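(* Let $0<\varepsilon<1$ and $q\in\mathbb{N}$. Let $G$ be a graph on $[n]$ with $m$ edges, with adjacency matrix $A$ and diagonal degree matrix $D$. For each edge $ij$ of $G$, let $\varphi_{ij} : [q]^2 \to \{0,1\}$ be a predicate that is not identically $0$ (with $\varphi_{ji}(\beta,\alpha)=\varphi_{ij}(\alpha,\beta)$), and let $M \in \{0,1\}^{nq\times nq}$ be the adjacency matrix of the label-extended graph, i.e. $M_{(i,\alpha),(j,\beta)} = 1$ iff $ij$ is an edge of $G$ and $\varphi_{ij}(\alpha,\beta)=1$. Let $E = D \otimes \mathrm{Id}_q$. Let $\Phi(x) = \sum_{ij \in E(G)} \varphi_{ij}(x_i,x_j)$ for $x\in[q]^n$ and $\mathrm{OPT} = \max_{x \in [q]^n} \Phi(x)$. Set $k = \mathrm{rank}_{\ge \varepsilon}(E^{-1/2} M E^{-1/2})$. Then there is an algorithm running in time $\widetilde{O}(n+m)\cdot (1/\varepsilon)^{O(k)} \cdot \mathrm{poly}(q)$ which finds an assignment $\widehat{x} \in [q]^n$ with $\Phi(\widehat{x}) \ge \mathrm{OPT} - O(\varepsilon q^2 m)$.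
   Context: For a square matrix $B$ with real eigenvalues, $\mathrm{rank}_{\ge \varepsilon}(B)$ is the number of eigenvalues of $B$ (counted with multiplicity) that are at least $\varepsilon$. $\widetilde{O}(\cdot)$ hides polylogarithmic factors and $O(\cdot)$ hides absolute constants. *)

theory Defs
  imports Complex_Main "HOL-Library.FuncSet" "Jordan_Normal_Form.Char_Poly"
begin

section \<open>Constraint satisfaction instances on graphs\<close>

text \<open>The vertex set $[n]$ is \<open>{..<n}\<close> and the label set $[q]$ is \<open>{..<q}\<close>.
  An undirected graph is given by its symmetric adjacency relation, so that every edge
  $ij$ occurs in it both as \<open>(i, j)\<close> and as \<open>(j, i)\<close>.\<close>

definition simple_graph :: "nat \<Rightarrow> (nat \<times> nat) set \<Rightarrow> bool" where
  "simple_graph n E \<longleftrightarrow> E \<subseteq> {..<n} \<times> {..<n} \<and> sym E \<and> irrefl E"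

definition edges :: "(nat \<times> nat) set \<Rightarrow> (nat \<times> nat) set" where
  "edges E = {(i, j) \<in> E. i < j}"

definition vertex_degree :: "(nat \<times> nat) set \<Rightarrow> nat \<Rightarrow> nat" where
  "vertex_degree E i = card {j. (i, j) \<in> E}"

definition edge_predicates ::
    "nat \<Rightarrow> (nat \<times> nat) set \<Rightarrow> (nat \<Rightarrow> nat \<Rightarrow> nat \<Rightarrow> nat \<Rightarrow> bool) \<Rightarrow> bool" where
  "edge_predicates q E \<phi> \<longleftrightarrow>
     (\<forall>(i, j) \<in> E.
        (\<exists>\<alpha><q. \<exists>\<beta><q. \<phi> i j \<alpha> \<beta>) \<and>
        (\<forall>\<alpha><q. \<forall>\<beta><q. \<phi> j i \<beta> \<alpha> = \<phi> i j \<alpha> \<beta>))"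

definition assignments :: "nat \<Rightarrow> nat \<Rightarrow> (nat \<Rightarrow> nat) set" where
  "assignments n q = ({..<n} \<rightarrow>\<^sub>E {..<q})"

definition csp_value ::
    "(nat \<times> nat) set \<Rightarrow> (nat \<Rightarrow> nat \<Rightarrow> nat \<Rightarrow> nat \<Rightarrow> bool) \<Rightarrow> (nat \<Rightarrow> nat) \<Rightarrow> nat" where
  "csp_value E \<phi> x = (\<Sum>(i, j) \<in> edges E. of_bool (\<phi> i j (x i) (x j)))"

definition csp_opt ::
    "nat \<Rightarrow> nat \<Rightarrow> (nat \<times> nat) set \<Rightarrow> (nat \<Rightarrow> nat \<Rightarrow> nat \<Rightarrow> nat \<Rightarrow> bool) \<Rightarrow> nat" where
  "csp_opt n q E \<phi> = Max (csp_value E \<phi> ` assignments n q)"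


section \<open>The normalised label-extended matrix and its threshold rank\<close>

text \<open>The index pair $(i,\alpha)$ is encoded as \<open>i * q + \<alpha>\<close>; this is also the ordering
  used by the Kronecker product below.\<close>

definition label_extended ::
    "nat \<Rightarrow> nat \<Rightarrow> (nat \<times> nat) set \<Rightarrow> (nat \<Rightarrow> nat \<Rightarrow> nat \<Rightarrow> nat \<Rightarrow> bool) \<Rightarrow> real mat" where
  "label_extended n q E \<phi> =
     mat (n * q) (n * q) (\<lambda>(a, b).
       of_bool ((a div q, b div q) \<in> E \<and> \<phi> (a div q) (b div q) (a mod q) (b mod q)))"

definition degree_mat :: "nat \<Rightarrow> (nat \<times> nat) set \<Rightarrow> real mat" where
  "degree_mat n E = mat n n (\<lambda>(i, j). if i = j then real (vertex_degree E i) else 0)"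

definition kronecker :: "real mat \<Rightarrow> real mat \<Rightarrow> real mat" where
  "kronecker A B =
     mat (dim_row A * dim_row B) (dim_col A * dim_col B) (\<lambda>(a, b).
       A $$ (a div dim_row B, b div dim_col B) * B $$ (a mod dim_row B, b mod dim_col B))"

text \<open>$X^{-1/2}$ for a diagonal matrix $X$ with nonnegative entries. As \<open>1 / sqrt 0 = 0\<close>,
  this is the pseudo-inverse square root when isolated vertices make $X$ singular.\<close>

definition diag_inv_sqrt :: "real mat \<Rightarrow> real mat" where
  "diag_inv_sqrt X =
     mat (dim_row X) (dim_col X) (\<lambda>(a, b). if a = b then 1 / sqrt (X $$ (a, a)) else 0)"

definition normalized_label_extended ::
    "nat \<Rightarrow> nat \<Rightarrow> (nat \<times> nat) set \<Rightarrow> (nat \<Rightarrow> nat \<Rightarrow> nat \<Rightarrow> nat \<Rightarrow> bool) \<Rightarrow> real mat" where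
  "normalized_label_extended n q E \<phi> =
     (let S = diag_inv_sqrt (kronecker (degree_mat n E) (1\<^sub>m q))
      in S * label_extended n q E \<phi> * S)"

definition rank_ge :: "real \<Rightarrow> real mat \<Rightarrow> nat" where
  "rank_ge \<epsilon> B = (\<Sum>r \<in> {r. eigenvalue B r \<and> \<epsilon> \<le> r}. Polynomial.order r (char_poly B))"


section \<open>Algorithms: a real RAM\<close>

text \<open>Algorithms are programs of a structured, deterministic real RAM with two unbounded
  memories, one holding natural numbers (also used as addresses) and one holding exact
  reals. All basic operations have unit cost. As usual, to exclude the unreasonable
  speed-ups known for uniform-cost machines, natural numbers can only be added and
  subtracted (truncating at zero), and reals cannot be rounded to integers: they can
  influence the control flow and the natural-number memory only through comparisons. The only
  constants are natural numbers, so no information can be hidden in a real constant.\<close>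

datatype nexp =
    NConst nat
  | NLoad nexp
  | NAdd nexp nexp
  | NSub nexp nexp

datatype rexp =
    RNat nexp
  | RLoad nexp
  | RAdd rexp rexp
  | RSub rexp rexp
  | RMul rexp rexp
  | RDiv rexp rexp

datatype test =
    NLess nexp nexp
  | RLess rexp rexp
  | TNot test
  | TAnd test test

datatype prog =
    Skip
  | NStore nexp nexp
  | RStore nexp rexp
  | Then prog prog
  | Cond test prog prog
  | Loop test prog

type_synonym state = "(nat \<Rightarrow> nat) \<times> (nat \<Rightarrow> real)"

fun nval :: "nexp \<Rightarrow> state \<Rightarrow> nat" where
  "nval (NConst k) s = k"
| "nval (NLoad a) s = fst s (nval a s)"
| "nval (NAdd a b) s = nval a s + nval b s"
| "nval (NSub a b) s = nval a s - nval b s"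

fun rval :: "rexp \<Rightarrow> state \<Rightarrow> real" where
  "rval (RNat a) s = real (nval a s)"
| "rval (RLoad a) s = snd s (nval a s)"
| "rval (RAdd a b) s = rval a s + rval b s"
| "rval (RSub a b) s = rval a s - rval b s"
| "rval (RMul a b) s = rval a s * rval b s"
| "rval (RDiv a b) s = rval a s / rval b s"

fun holds :: "test \<Rightarrow> state \<Rightarrow> bool" where
  "holds (NLess a b) s = (nval a s < nval b s)"
| "holds (RLess a b) s = (rval a s < rval b s)"
| "holds (TNot b) s = (\<not> holds b s)"
| "holds (TAnd b c) s = (holds b s \<and> holds c s)"

text \<open>\<open>exec P s t s'\<close>: started in \<open>s\<close>, the program \<open>P\<close> halts in \<open>s'\<close> after \<open>t\<close> steps.
  The number of operations performed by one step is bounded by the size of the expressions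
  occurring in \<open>P\<close>, which does not depend on the input.\<close>

inductive exec :: "prog \<Rightarrow> state \<Rightarrow> nat \<Rightarrow> state \<Rightarrow> bool" where
  Skip: "exec Skip s 1 s"
| NStore: "exec (NStore a e) s 1 ((fst s)(nval a s := nval e s), snd s)"
| RStore: "exec (RStore a e) s 1 (fst s, (snd s)(nval a s := rval e s))"
| Then: "exec P s t s' \<Longrightarrow> exec Q s' u s'' \<Longrightarrow> exec (Then P Q) s (t + u) s''"
| CondTrue: "holds b s \<Longrightarrow> exec P s t s' \<Longrightarrow> exec (Cond b P Q) s (t + 1) s'"
| CondFalse: "\<not> holds b s \<Longrightarrow> exec Q s t s' \<Longrightarrow> exec (Cond b P Q) s (t + 1) s'"
| LoopFalse: "\<not> holds b s \<Longrightarrow> exec (Loop b P) s 1 s"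
| LoopTrue: "holds b s \<Longrightarrow> exec P s t s' \<Longrightarrow> exec (Loop b P) s' u s'' \<Longrightarrow>
    exec (Loop b P) s (t + u + 1) s''"

lemma exec_deterministic:
  "exec P s t s' \<Longrightarrow> exec P s u s'' \<Longrightarrow> u = t \<and> s'' = s'"
proof (induction arbitrary: u s'' rule: exec.induct)
  case (Skip s)
  then show ?case by (cases rule: exec.cases) auto
next
  case (NStore a e s)
  then show ?case by (cases rule: exec.cases) auto
next
  case (RStore a e s)
  then show ?case by (cases rule: exec.cases) auto
next
  case (Then P s t s' Q v w)
  from Then.prems show ?case
    by (cases rule: exec.cases) (use Then.IH in blast)+
next
  case (CondTrue b s P t s' Q)
  from CondTrue.prems show ?case
    by (cases rule: exec.cases) (use CondTrue.IH CondTrue.hyps in blast)+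
next
  case (CondFalse b s Q t s' P)
  from CondFalse.prems show ?case
    by (cases rule: exec.cases) (use CondFalse.IH CondFalse.hyps in blast)+
next
  case (LoopFalse b s P)
  from LoopFalse.prems show ?case
    by (cases rule: exec.cases) (use LoopFalse.hyps in blast)+
next
  case (LoopTrue b s P t s' v w)
  from LoopTrue.prems show ?case
    by (cases rule: exec.cases) (use LoopTrue.IH LoopTrue.hyps in blast)+
qed


section \<open>Input and output conventions\<close>

definition edge_listing :: "(nat \<times> nat) set \<Rightarrow> (nat \<times> nat) list \<Rightarrow> bool" where
  "edge_listing E es \<longleftrightarrow> distinct es \<and> set es = edges E"

text \<open>The input lists \<open>n\<close>, \<open>m\<close>, \<open>q\<close>, then the endpoints of all edges in the (arbitrary) order
  of \<open>es\<close>, then for each edge the truth table of its predicate, row by row.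
  In the state the list is followed by zeros. The real memory holds
  \<open>\<epsilon>\<close> in cell 0 and zeros elsewhere. The rank \<open>k\<close> is not part of the input.\<close>

definition input_list ::
    "nat \<Rightarrow> nat \<Rightarrow> (nat \<times> nat) list \<Rightarrow> (nat \<Rightarrow> nat \<Rightarrow> nat \<Rightarrow> nat \<Rightarrow> bool) \<Rightarrow> nat list" where
  "input_list n q es \<phi> =
     [n, length es, q] @
     concat (map (\<lambda>(i, j). [i, j]) es) @
     concat (map (\<lambda>(i, j).
       concat (map (\<lambda>\<alpha>. map (\<lambda>\<beta>. of_bool (\<phi> i j \<alpha> \<beta>)) [0..<q]) [0..<q])) es)"

definition input_state ::
    "nat \<Rightarrow> nat \<Rightarrow> (nat \<times> nat) list \<Rightarrow> (nat \<Rightarrow> nat \<Rightarrow> nat \<Rightarrow> nat \<Rightarrow> bool) \<Rightarrow> real \<Rightarrow> state" where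
  "input_state n q es \<phi> \<epsilon> =
     ((\<lambda>a. if a < length (input_list n q es \<phi>) then input_list n q es \<phi> ! a else 0),
      (\<lambda>a. if a = 0 then \<epsilon> else 0))"

text \<open>The output is read off the first \<open>n\<close> cells of the natural-number memory.\<close>

definition output_assignment :: "nat \<Rightarrow> state \<Rightarrow> nat \<Rightarrow> nat" where
  "output_assignment n s = restrict (fst s) {..<n}"

end

(* Normalise M by powers of two e_i with deg i <= e_i^2 <= 4 deg i instead of sqrt (deg i); after scaling by
   K^2 and shifting by q this gives a natural-number matrix St, and vectors of the span of large eigenvalues
   dominate in St^T for a large power T. Gram-Schmidt on columns of St^T, always taking a pivot whose residual
   diagonal entry of St^(2T) is nearly maximal, therefore needs at most k pivots until the residual trace is
   small, and then the form of the normalised matrix is at most 2 eps on the orthogonal complement of the pivots.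
   Pivots are found by bisection on block traces, which are computed exactly with one packed vector per block:
   all diagonal entries are read off as one digit in a large base. For each guess of the projection of a solution
   to the span of the pivots, from a net of (1/eps)^O(k) points, Frank-Wolfe maximises the quadratic form minus
   a penalty that makes it almost concave, and the fractional solution is rounded one vertex at a time. *)
theory Submission imports Defs "HOL-Analysis.Function_Topology" "Jordan_Normal_Form.Schur_Decomposition"
begin

section \<open>Symmetric matrices as functions\<close>

text \<open>The machine shapes most choices: it has no square roots, no rounding and no
  multiplication of natural numbers. Hence Gram-Schmidt vectors are scaled by powers of two and have
  squared norms in [1, 4) instead of 1, digits are extracted by doubling and halving a modulus, and
  products such as \<open>l * d\<close> are accumulated in address tables. The rank k is not given,
  so a guess is raised from 0; it cannot pass k, since too many pivots would span a space on which
  \<open>St\<close>^T is large, and such a space has dimension at most k. Pivoting keeps the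
  triangular system of the pivots well conditioned up to (12 d)^J, and T is doubled until the gap
  ((q + 2 eps)/(q + eps))^(2T) swallows this loss; so T is at most of order q k log d / eps. The
  normalised matrix has eigenvalues in [-q, q], so the shift by q keeps negative eigenvalues from
  dominating high powers. The net is an l1-ball and not a box, which keeps a factor J^O(J) out of
  its size. If 4 eps q^2 >= 1, every assignment is within the error; otherwise k >= 1, and
  polynomials in 1/eps are absorbed by (1/eps)^O(k).\<close>

definition ip :: "nat => (nat => real) => (nat => real) => real" where
 "ip d f g = (\<Sum>r<d. f r * g r)"

definition mv :: "nat => (nat => nat => real) => (nat => real) => nat => real" where
 "mv d A f = (%r. \<Sum>c<d. A r c * f c)"

definition sym_fun :: "nat => (nat => nat => real) => bool" where
 "sym_fun d A \<longleftrightarrow> (\<forall>r<d. \<forall>c<d. A r c = A c r)"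

lemma ip_commute: "ip d f g = ip d g f"
 by (simp add: ip_def mult.commute)

lemma ip_add_left: "ip d (%r. f r + g r) h = ip d f h + ip d g h"
 by (simp add: ip_def distrib_right sum.distrib)

lemma ip_add_right: "ip d h (%r. f r + g r) = ip d h f + ip d h g"
 by (simp add: ip_def distrib_left sum.distrib)

lemma ip_diff_left: "ip d (%r. f r - g r) h = ip d f h - ip d g h"
 by (simp add: ip_def left_diff_distrib sum_subtractf)

lemma ip_diff_right: "ip d h (%r. f r - g r) = ip d h f - ip d h g"
 by (simp add: ip_def right_diff_distrib sum_subtractf)

lemma ip_scale_left: "ip d (%r. a * f r) h = a * ip d f h"
 by (simp add: ip_def sum_distrib_left mult.assoc)

lemma ip_scale_right: "ip d h (%r. a * f r) = a * ip d h f"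
 by (simp add: ip_def sum_distrib_left mult.left_commute)

lemma ip_sum_left: "ip d (%r. \<Sum>i\<in>I. f i r) h = (\<Sum>i\<in>I. ip d (f i) h)"
 unfolding ip_def sum_distrib_right by (rule sum.swap)

lemma ip_sum_right: "ip d h (%r. \<Sum>i\<in>I. f i r) = (\<Sum>i\<in>I. ip d h (f i))"
 unfolding ip_def sum_distrib_left by (rule sum.swap)

lemma ip_self_nonneg: "0 <= ip d f f"
 by (simp add: ip_def sum_nonneg)

lemma ip_self_zero_iff: "ip d f f = 0 \<longleftrightarrow> (\<forall>r<d. f r = 0)"
 by (auto simp: ip_def sum_nonneg_eq_0_iff)

text \<open>Functions stand for vectors of length \<open>d\<close>; their values from
  \<open>d\<close> on are arbitrary, because they will be contents of unbounded arrays. The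
  congruence rules discard that tail.\<close>

lemma ip_cong: "(!!r. r < d ==> f r = f' r) ==> (!!r. r < d ==> g r = g' r) ==> ip d f g = ip d f' g'"
 by (simp add: ip_def)

lemma mv_cong: "(!!r. r < d ==> f r = f' r) ==> mv d A f = mv d A f'"
 by (simp add: mv_def)

lemma mv_add: "mv d A (%r. f r + g r) = (%r. mv d A f r + mv d A g r)"
 by (simp add: mv_def distrib_left sum.distrib)


lemma mv_scale: "mv d A (%r. a * f r) = (%r. a * mv d A f r)"
 by (simp add: mv_def sum_distrib_left mult.left_commute)

lemma mv_sum: "mv d A (%r. \<Sum>i\<in>I. f i r) = (%r. \<Sum>i\<in>I. mv d A (f i) r)"
 unfolding mv_def sum_distrib_left by (rule ext) (rule sum.swap)

lemma ip_mv_swap: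
 assumes "sym_fun d A"
 shows "ip d f (mv d A g) = ip d (mv d A f) g"
proof -
 have "ip d f (mv d A g) = (\<Sum>r<d. \<Sum>c<d. A r c * f r * g c)"
  by (simp add: ip_def mv_def sum_distrib_left mult_ac)
 also have "... = (\<Sum>c<d. \<Sum>r<d. A r c * f r * g c)"
  by (rule sum.swap)
 also have "... = (\<Sum>c<d. \<Sum>r<d. A c r * f r * g c)"
  using assms by (intro sum.cong refl) (auto simp: sym_fun_def)
 also have "... = ip d (mv d A f) g"
  by (simp add: ip_def mv_def sum_distrib_right)
 finally show ?thesis .
qed

lemma cauchy_schwarz_ip: "(ip d f g)\<^sup>2 <= ip d f f * ip d g g"
proof (cases "ip d g g = 0")
 case True
 then have "\<forall>r<d. g r = 0" by (simp add: ip_self_zero_iff)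
 then have "ip d f g = 0" by (simp add: ip_def)
 then show ?thesis by (simp add: True)
next
 case False
 then have pos: "0 < ip d g g" using ip_self_nonneg[of d g] by simp
 define t where "t = ip d f g / ip d g g"
 have "0 <= ip d (%r. f r - t * g r) (%r. f r - t * g r)"
  by (rule ip_self_nonneg)
 also have "... = ip d f f - 2 * t * ip d f g + t\<^sup>2 * ip d g g"
  by (simp add: ip_diff_left ip_diff_right ip_scale_left ip_scale_right ip_commute[of d g f]
  power2_eq_square algebra_simps)
 also have "... = ip d f f - (ip d f g)\<^sup>2 / ip d g g"
  using pos by (simp add: t_def power2_eq_square field_simps)
 finally show ?thesis using pos by (simp add: field_simps)
qed

section \<open>Spectral theorem by successive maximisation of the Rayleigh quotient\<close>

text \<open>Gaussian elimination, one equation per induction step: if the last equation involves an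
  unknown \<open>p\<close>, solving for \<open>p\<close> and substituting (\<open>g\<close>) leaves
  one equation and one unknown fewer; if it involves none, it holds for free. It supplies a vector
  orthogonal to fewer than \<open>d\<close> given ones, and later a combination of vectors that
  misses all large eigenvectors.\<close>

lemma homogeneous_nontrivial_solution:
 fixes f :: "nat => 'a => real"
 assumes "finite J" "r < card J"
 shows "\<exists>c. (\<exists>j\<in>J. c j ~= 0) & (\<forall>i<r. (\<Sum>j\<in>J. c j * f i j) = 0)"
 using assms
proof (induction r arbitrary: J f)
 case 0
 then obtain j where "j \<in> J" by fastforce
 then show ?case by (intro exI[of _ "%_. 1"]) auto
next
 case (Suc r)
 show ?case
 proof (cases "\<forall>j\<in>J. f r j = 0")
  case True
  from Suc.IH[of J f] Suc.prems obtain c where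
  "\<exists>j\<in>J. c j ~= 0" "\<forall>i<r. (\<Sum>j\<in>J. c j * f i j) = 0" by auto
  with True show ?thesis by (intro exI[of _ c]) (auto simp: less_Suc_eq)
 next
  case False
  then obtain p where p: "p \<in> J" "f r p ~= 0" by blast
  define J' where "J' = J - {p}"
  have J': "finite J'" "p \<notin> J'" "J = insert p J'" "r < card J'"
  using p Suc.prems by (auto simp: J'_def card_Diff_singleton)
  define g where "g = (%i j. f i j - f r j / f r p * f i p)"
  from Suc.IH[OF J'(1,4), of g] obtain c where
  c: "\<exists>j\<in>J'. c j ~= 0" "\<forall>i<r. (\<Sum>j\<in>J'. c j * g i j) = 0" by auto
  define t where "t = - (\<Sum>j\<in>J'. c j * f r j) / f r p"
  define c' where "c' = c(p := t)"
  have eq: "(\<Sum>j\<in>J. c' j * f i j) = t * f i p + (\<Sum>j\<in>J'. c j * f i j)" for i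
  proof -
  have "(\<Sum>j\<in>J'. c' j * f i j) = (\<Sum>j\<in>J'. c j * f i j)"
  using J'(2) by (intro sum.cong) (auto simp: c'_def)
  then show ?thesis using J' by (simp add: c'_def)
  qed
  have "(\<Sum>j\<in>J. c' j * f i j) = 0" if "i < Suc r" for i
  proof (cases "i = r")
  case True
  then show ?thesis unfolding eq using p(2) by (simp add: t_def)
  next
  case False
  with that c(2) have "0 = (\<Sum>j\<in>J'. c j * g i j)" by simp
  also have "... = (\<Sum>j\<in>J'. c j * f i j) - (\<Sum>j\<in>J'. c j * f r j) / f r p * f i p"
  by (simp add: g_def right_diff_distrib sum_subtractf sum_divide_distrib sum_distrib_right mult.assoc)
  also have "... = (\<Sum>j\<in>J. c' j * f i j)" unfolding eq by (simp add: t_def)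
  finally show ?thesis by simp
  qed
  moreover have "\<exists>j\<in>J. c' j ~= 0" using c(1) J'(2,3) by (auto simp: c'_def)
  ultimately show ?thesis by blast
 qed
qed

text \<open>First-order optimality: for a nonzero \<open>a\<close> the linear term would win at
  \<open>t = s * a\<close> as soon as s |b| < 1.\<close>

lemma linear_coefficient_zero:
 fixes a b :: real
 assumes "!!t. t * a + t\<^sup>2 * b <= 0"
 shows "a = 0"
proof (rule ccontr)
 assume "a ~= 0"
 define s where "s = 1 / (2 * (\<bar>b\<bar> + 1))"
 have s: "0 < s" "s * \<bar>b\<bar> < 1" by (auto simp: s_def field_simps)
 have "(s * a) * a + (s * a)\<^sup>2 * b = s * a\<^sup>2 * (1 + s * b)"
  by (simp add: power2_eq_square algebra_simps)
 moreover have "0 < 1 + s * b" using s by (smt (verit) mult_minus_right mult_nonneg_nonneg)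
 ultimately show False using assms[of "s * a"] s \<open>a ~= 0\<close>
  by (smt (verit) mult_pos_pos zero_less_power2)
qed

text \<open>Existence by compactness of the unit sphere cut by the constraints; the cut contains a
  point because \<open>r < d\<close> homogeneous equations have a nontrivial solution. The
  inequality for arbitrary \<open>y\<close> follows by scaling \<open>y\<close> to the sphere
  (\<open>nz\<close>).\<close>

lemma constrained_rayleigh_maximizer:
 fixes A :: "nat => nat => real" and Q :: "nat => nat => real"
 assumes "r < d"
 shows "\<exists>x. ip d x x = 1 & (\<forall>i<r. ip d x (Q i) = 0) &
  (\<forall>y. (\<forall>i<r. ip d y (Q i) = 0) --> ip d y (mv d A y) <= ip d x (mv d A x) * ip d y y)"
proof -
 define C where "C = {x::nat => real. ip d x x = 1 & (\<forall>i<r. ip d x (Q i) = 0)}"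
 \<comment> \<open>Coordinates from \<open>d\<close> on are free in \<open>C\<close>, so
   \<open>C\<close> itself is not compact in the product topology. The box pins them to 0 and is
   compact by Tychonoff; no value of the form is lost, as these coordinates do not enter it.\<close>
 define Bx where "Bx = (PiE UNIV (%i. if i < d then {-1..1} else {0}) :: (nat => real) set)"
 have cc: "continuous_on UNIV (%x::nat => real. x i)" for i
  by (rule continuous_on_product_coordinates)
 have ci: "continuous_on UNIV (%x::nat => real. ip d x x)"
  unfolding ip_def by (intro continuous_intros cc)
 have ciq: "continuous_on UNIV (%x::nat => real. ip d x (Q i))" for i
  unfolding ip_def by (intro continuous_intros cc)
 have cq: "continuous_on UNIV (%x::nat => real. ip d x (mv d A x))"
  unfolding ip_def mv_def by (intro continuous_intros cc)
 have "closed C"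
 proof -
  have "C = {x. ip d x x = 1} \<inter> (\<Inter>i\<in>{..<r}. {x. ip d x (Q i) = 0})"
  by (auto simp: C_def)
  moreover have "closed {x. ip d x x = 1}"
  by (rule closed_Collect_eq[OF ci]) simp
  moreover have "closed {x. ip d x (Q i) = 0}" for i
  by (rule closed_Collect_eq[OF ciq]) simp
  ultimately show ?thesis by auto
 qed
 moreover have "compact Bx"
 proof -
  have "compactin (product_topology (%i::nat. euclidean) UNIV) Bx"
  unfolding Bx_def compactin_PiE by (auto simp: compactin_euclidean_iff)
  then show ?thesis by (simp add: euclidean_product_topology compactin_euclidean_iff)
 qed
 ultimately have comp: "compact (C \<inter> Bx)" by (simp add: closed_Int_compact)
 define nz where "nz = (%y::nat => real. %i. if i < d then y i / sqrt (ip d y y) else 0)"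
 have nz_ip: "ip d (nz y) g = ip d y g / sqrt (ip d y y)" for y g
  by (simp add: nz_def ip_def sum_divide_distrib)
 have nz_mem: "nz y \<in> C \<inter> Bx" if y: "\<forall>i<r. ip d y (Q i) = 0" and "ip d y y ~= 0" for y
 proof -
  have pos: "0 < ip d y y" using that ip_self_nonneg[of d y] by simp
  have one: "ip d (nz y) (nz y) = 1"
  unfolding nz_ip ip_commute[of d y "nz y"] using pos by (simp add: real_div_sqrt)
  have "(nz y i)\<^sup>2 <= 1" if "i < d" for i
  proof -
  have "(nz y i)\<^sup>2 <= ip d (nz y) (nz y)"
  unfolding ip_def power2_eq_square
  by (rule member_le_sum) (use that in auto)
  then show ?thesis using one by simp
  qed
  then have "nz y i \<in> {-1..1}" if "i < d" for i
  using that by (simp add: abs_square_le_1 abs_le_iff)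
  moreover have "nz y i = 0" if "\<not> i < d" for i using that by (simp add: nz_def)
  ultimately have "nz y \<in> Bx" by (auto simp: Bx_def)
  with one y show ?thesis by (auto simp: C_def nz_ip)
 qed
 obtain c where c: "\<exists>j\<in>{..<d}. c j ~= 0" "\<forall>i<r. (\<Sum>j\<in>{..<d}. c j * Q i j) = 0"
  using homogeneous_nontrivial_solution[of "{..<d}" r Q] assms by auto
 have "ip d c c ~= 0" using c(1) by (auto simp: ip_self_zero_iff)
 then have "nz c \<in> C \<inter> Bx" using c(2) by (intro nz_mem) (auto simp: ip_def)
 then obtain x where x: "x \<in> C \<inter> Bx"
  and mx: "\<forall>y\<in>C \<inter> Bx. ip d y (mv d A y) <= ip d x (mv d A x)"
  using continuous_attains_sup[OF comp _ continuous_on_subset[OF cq]] by blast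
 have "ip d y (mv d A y) <= ip d x (mv d A x) * ip d y y" if y: "\<forall>i<r. ip d y (Q i) = 0" for y
 proof (cases "ip d y y = 0")
  case True
  then have "\<forall>s<d. y s = 0" by (simp add: ip_self_zero_iff)
  then have "ip d y (mv d A y) = 0" by (simp add: ip_def)
  then show ?thesis using True by simp
 next
  case False
  then have pos: "0 < ip d y y" using ip_self_nonneg[of d y] by simp
  have "mv d A (nz y) = (%k. (1 / sqrt (ip d y y)) * mv d A y k)"
  unfolding mv_scale[symmetric] by (rule mv_cong) (simp add: nz_def)
  then have "ip d (nz y) (mv d A (nz y)) = ip d y (mv d A y) / ip d y y"
  using pos by (simp only: nz_ip ip_scale_right) simp
  with mx nz_mem[OF y False] have "ip d y (mv d A y) / ip d y y <= ip d x (mv d A x)" by force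
  then show ?thesis using pos by (simp add: field_simps)
 qed
 with x show ?thesis by (auto simp: C_def)
qed

text \<open>The next eigenvector is the constrained maximiser \<open>x\<close>. Its defect
  \<open>w\<close> = A x - lam x is orthogonal to every admissible \<open>y\<close> by first-order
  optimality, and \<open>w\<close> is itself admissible because A maps the span of the earlier
  eigenvectors into itself. So \<open>w\<close> is orthogonal to itself and vanishes.\<close>

lemma orthonormal_eigenvectors:
 assumes "sym_fun d A" "r <= d"
 shows "\<exists>Q l. (\<forall>i<r. \<forall>j<r. ip d (Q i) (Q j) = (if i = j then 1 else 0)) &
  (\<forall>i<r. \<forall>s<d. mv d A (Q i) s = l i * Q i s)"
 using assms(2)
proof (induction r)
 case 0
 then show ?case by simp
next
 case (Suc r)
 then obtain Q l where on: "\<forall>i<r. \<forall>j<r. ip d (Q i) (Q j) = (if i = j then 1 else 0)"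
  and ev: "\<forall>i<r. \<forall>s<d. mv d A (Q i) s = l i * Q i s" by auto
 obtain x where x: "ip d x x = 1" "\<forall>i<r. ip d x (Q i) = 0"
  and mx: "!!y. (\<forall>i<r. ip d y (Q i) = 0) ==> ip d y (mv d A y) <= ip d x (mv d A x) * ip d y y"
  using constrained_rayleigh_maximizer[of r d Q A] Suc.prems by auto
 define lam where "lam = ip d x (mv d A x)"
 define w where "w = (%s. mv d A x s - lam * x s)"
 have perp: "ip d y w = 0" if y: "\<forall>i<r. ip d y (Q i) = 0" for y
 proof -
  have "t * (2 * ip d y w) + t\<^sup>2 * (ip d y (mv d A y) - lam * ip d y y) <= 0" for t
  proof -
  have "ip d (%s. x s + t * y s) (Q i) = 0" if "i < r" for i
  using that x y by (simp add: ip_add_left ip_scale_left)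
  from mx[of "%s. x s + t * y s"] this
  have "ip d (%s. x s + t * y s) (mv d A (%s. x s + t * y s))
  <= lam * ip d (%s. x s + t * y s) (%s. x s + t * y s)" by (simp add: lam_def)
  moreover have "ip d x (mv d A y) = ip d y (mv d A x)"
  using ip_mv_swap[OF assms(1), of x y] by (simp add: ip_commute)
  moreover have "ip d (%s. x s + t * y s) (mv d A (%s. x s + t * y s)) =
  lam + t * (ip d x (mv d A y) + ip d y (mv d A x)) + t\<^sup>2 * ip d y (mv d A y)"
  unfolding mv_add mv_scale ip_add_left ip_add_right ip_scale_left ip_scale_right lam_def
  by (simp add: power2_eq_square ring_distribs)
  moreover have "ip d (%s. x s + t * y s) (%s. x s + t * y s) = 1 + 2 * t * ip d x y + t\<^sup>2 * ip d y y"
  unfolding ip_add_left ip_add_right ip_scale_left ip_scale_right x(1)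
  by (simp add: power2_eq_square ip_commute[of d y x])
  moreover have weq: "ip d y w = ip d y (mv d A x) - lam * ip d x y"
  unfolding w_def ip_diff_right ip_scale_right by (simp add: ip_commute)
  ultimately show ?thesis unfolding weq by (simp add: algebra_simps)
  qed
  then have "2 * ip d y w = 0" by (rule linear_coefficient_zero)
  then show ?thesis by simp
 qed
 have "\<forall>i<r. ip d w (Q i) = 0"
 proof (intro allI impI)
  fix i assume i: "i < r"
  have "ip d (mv d A x) (Q i) = ip d x (mv d A (Q i))" using ip_mv_swap[OF assms(1)] by simp
  also have "... = ip d x (%s. l i * Q i s)" using ev i by (intro ip_cong) auto
  also have "... = 0" using x i by (simp add: ip_scale_right)
  finally show "ip d w (Q i) = 0" using x i by (simp add: w_def ip_diff_left ip_scale_left)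
 qed
 then have "ip d w w = 0" by (rule perp)
 then have w0: "\<forall>s<d. mv d A x s = lam * x s" by (auto simp: ip_self_zero_iff w_def)
 define Q' where "Q' = Q(r := x)"
 define l' where "l' = l(r := lam)"
 have "ip d (Q' i) (Q' j) = (if i = j then 1 else 0)" if ij: "i < Suc r" "j < Suc r" for i j
 proof -
  consider "i < r" "j < r" | "i = r" "j = r" | "i = r" "j < r" | "i < r" "j = r"
  using ij unfolding less_Suc_eq by blast
  then show ?thesis
  proof cases
  case 4
  then show ?thesis using x ip_commute[of d "Q i" x] by (simp add: Q'_def)
  qed (use on x in \<open>auto simp: Q'_def\<close>)
 qed
 moreover have "mv d A (Q' i) s = l' i * Q' i s" if "i < Suc r" "s < d" for i s
  using that ev w0 by (cases "i = r") (auto simp: Q'_def l'_def)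
 ultimately show ?case by blast
qed

text \<open>The third property is completeness. It comes from orthonormality because a one-sided
  inverse of a square matrix is two-sided, so the columns of the matrix with rows \<open>Q i\<close>
  are orthonormal as well.\<close>

lemma spectral_decomposition:
 assumes "sym_fun d A"
 obtains Q l where
  "!!i j. i < d ==> j < d ==> ip d (Q i) (Q j) = (if i = j then 1 else 0)"
  "!!i s. i < d ==> s < d ==> mv d A (Q i) s = l i * Q i s"
  "!!r s. r < d ==> s < d ==> (\<Sum>i<d. Q i r * Q i s) = (if r = s then 1 else 0)"
proof -
 obtain Q l where on: "\<forall>i<d. \<forall>j<d. ip d (Q i) (Q j) = (if i = j then 1 else 0)"
  and ev: "\<forall>i<d. \<forall>s<d. mv d A (Q i) s = l i * Q i s"
  using orthonormal_eigenvectors[OF assms order_refl] by blast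
 define U where "U = mat d d (%(i, r). Q i r)"
 have U: "U \<in> carrier_mat d d" "transpose_mat U \<in> carrier_mat d d" by (auto simp: U_def)
 have "U * transpose_mat U = 1\<^sub>m d"
  using on by (intro eq_matI) (auto simp: U_def scalar_prod_def ip_def lessThan_atLeast0)
 then have "transpose_mat U * U = 1\<^sub>m d"
  by (rule mat_mult_left_right_inverse[OF U])
 then have "(\<Sum>i<d. Q i r * Q i s) = (if r = s then 1 else 0)" if "r < d" "s < d" for r s
 proof -
  have "(transpose_mat U * U) $$ (r, s) = (\<Sum>i<d. Q i r * Q i s)"
  using that by (simp add: U_def scalar_prod_def lessThan_atLeast0)
  then show ?thesis using \<open>transpose_mat U * U = 1\<^sub>m d\<close> that by simp
 qed
 with on ev show ?thesis using that by blast
qed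

lemma order_prod_linear:
 "Polynomial.order x (\<Prod>a\<leftarrow>es. [:- a, 1:]) = count_list es (x::real)"
proof (induction es)
 case Nil
 then show ?case by (simp add: order_1_eq_0)
next
 case (Cons a es)
 have nz: "(\<Prod>a\<leftarrow>es. [:- a, 1:]) ~= (0::real poly)"
  by (auto simp: prod_list_zero_iff)
 have "Polynomial.order x [:- a, 1:] = (if a = x then 1 else 0)"
  by (auto simp: order_0I order_linear')
 then show ?case
  using nz Cons.IH by (auto simp: order_mult simp del: mult_pCons_left)
qed

text \<open>\<open>rank_ge\<close> counts roots of the characteristic polynomial with algebraic
  multiplicity. The orthonormal eigenvectors make the matrix similar to a diagonal one, whose
  characteristic polynomial splits into the factors X - \<open>l i\<close>; so the multiplicity of a
  root is the number of indices with that eigenvalue.\<close>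

lemma rank_ge_spectral:
 assumes "sym_fun d A"
  and on: "!!i j. i < d ==> j < d ==> ip d (Q i) (Q j) = (if i = j then 1 else 0)"
  and ev: "!!i s. i < d ==> s < d ==> mv d A (Q i) s = l i * Q i s"
  and co: "!!r s. r < d ==> s < d ==> (\<Sum>i<d. Q i r * Q i s) = (if r = s then 1 else 0)"
 shows "rank_ge \<epsilon> (mat d d (%(r, c). A r c)) = card {i. i < d & \<epsilon> <= l i}"
proof -
 define M where "M = mat d d (%(r, c). A r c)"
 define P where "P = mat d d (%(r, i). Q i r)"
 define D where "D = mat d d (%(i, j). if i = j then l i else 0)"
 have car: "M \<in> carrier_mat d d" "P \<in> carrier_mat d d" "D \<in> carrier_mat d d"
  "transpose_mat P \<in> carrier_mat d d" by (auto simp: M_def P_def D_def)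
 have PP: "P * transpose_mat P = 1\<^sub>m d"
  using co by (intro eq_matI) (auto simp: P_def scalar_prod_def lessThan_atLeast0)
 have PP': "transpose_mat P * P = 1\<^sub>m d"
  by (rule mat_mult_left_right_inverse[OF car(2,4) PP])
 have "M * P = P * D"
 proof (rule eq_matI)
  fix s i assume "s < dim_row (P * D)" "i < dim_col (P * D)"
  then have si: "s < d" "i < d" by (auto simp: P_def D_def)
  have "(M * P) $$ (s, i) = mv d A (Q i) s"
  using si by (simp add: M_def P_def scalar_prod_def mv_def lessThan_atLeast0)
  also have "... = l i * Q i s" using ev si by simp
  also have "... = (P * D) $$ (s, i)"
  using si by (simp add: P_def D_def scalar_prod_def if_distrib[where f="%x. _ * x"] sum.delta cong: if_cong)
  finally show "(M * P) $$ (s, i) = (P * D) $$ (s, i)" .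
 qed (auto simp: M_def P_def D_def)
 then have "M * P * transpose_mat P = P * D * transpose_mat P" by simp
 then have "M = P * D * transpose_mat P"
  using PP car by (simp add: assoc_mult_mat[of M d d P d "transpose_mat P" d])
 then have "similar_mat_wit M D P (transpose_mat P)"
  using car PP PP' by (intro similar_mat_witI[of _ _ d]) auto
 then have sim: "similar_mat M D" unfolding similar_mat_def by blast
 have ut: "upper_triangular D" by (auto simp: D_def)
 have dm: "diag_mat D = map l [0..<d]" by (auto simp: diag_mat_def D_def)
 have cp: "char_poly M = (\<Prod>a\<leftarrow>map l [0..<d]. [:- a, 1:])"
  using char_poly_similar[OF sim] char_poly_upper_triangular[OF car(3) ut] dm by simp
 have ord: "Polynomial.order x (char_poly M) = card {i. i < d & l i = x}" for x
 proof -
  have "Polynomial.order x (char_poly M) = count_list (map l [0..<d]) x"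
  unfolding cp by (rule order_prod_linear)
  also have "... = card {i. i < d & l i = x}"
  by (auto simp: count_list_eq_length_filter length_filter_conv_card intro!: arg_cong[where f=card])
  finally show ?thesis .
 qed
 have evl: "eigenvalue M x \<longleftrightarrow> x \<in> l ` {..<d}" for x
 proof -
  have "char_poly M ~= 0" using degree_monic_char_poly[OF car(1)] by auto
  then have "eigenvalue M x \<longleftrightarrow> Polynomial.order x (char_poly M) ~= 0"
  using eigenvalue_root_char_poly[OF car(1)] order_root by blast
  also have "... \<longleftrightarrow> x \<in> l ` {..<d}" unfolding ord by (auto simp: card_eq_0_iff)
  finally show ?thesis .
 qed
 have fin: "finite {x. eigenvalue M x & \<epsilon> <= x}"
  unfolding evl by (rule finite_subset[of _ "l ` {..<d}"]) auto
 have "card {i. i < d & \<epsilon> <= l i} = card (\<Union>x\<in>{x. eigenvalue M x & \<epsilon> <= x}. {i. i < d & l i = x})"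
  unfolding evl by (rule arg_cong[where f=card]) auto
 also have "... = (\<Sum>x\<in>{x. eigenvalue M x & \<epsilon> <= x}. card {i. i < d & l i = x})"
  by (rule card_UN_disjoint[OF fin]) auto
 finally show ?thesis
  unfolding rank_ge_def ord M_def[symmetric] ..
qed

section \<open>Programs over working arrays\<close>

text \<open>The view of the memory in which programs are reasoned about: input cells, independent
  arrays of both kinds, and \<open>clk\<close>, a ghost counter of steps that occupies no memory
  cell.\<close>

record hst =
 bnd :: nat
 raw :: "nat => nat"
 NA :: "nat => nat => nat"
 RA :: "nat => nat => real"
 clk :: nat

abbreviation arrs :: nat where "arrs == 64"

text \<open>Entry \<open>i\<close> of array \<open>a\<close> sits at offset
  \<open>a + 64 * i\<close>: interleaving gives every array unbounded length while addresses need
  only a multiplication by a constant. Cell 0, where the input holds the number of vertices, becomes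
  the base pointer, so \<open>raw\<close> is visible at positive addresses only.\<close>

definition lay :: "hst => state" where
 "lay h = ((%a. if a = 0 then Suc (bnd h) else if a <= bnd h then raw h a
  else NA h ((a - Suc (bnd h)) mod arrs) ((a - Suc (bnd h)) div arrs)),
  (%a. RA h (a mod arrs) (a div arrs)))"

definition nset :: "nat => nat => nat => hst => hst" where
 "nset a i x h = h\<lparr>NA := (NA h)(a := (NA h a)(i := x))\<rparr>"

definition rset :: "nat => nat => real => hst => hst" where
 "rset a i x h = h\<lparr>RA := (RA h)(a := (RA h a)(i := x))\<rparr>"

definition tick :: "hst => hst" where
 "tick h = h\<lparr>clk := Suc (clk h)\<rparr>"

lemma hst_access [simp]:
 "NA (nset a i x h) b = (if b = a then (NA h a)(i := x) else NA h b)"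
 "RA (nset a i x h) = RA h" "bnd (nset a i x h) = bnd h" "raw (nset a i x h) = raw h"
 "clk (nset a i x h) = clk h"
 "RA (rset a i y h) b = (if b = a then (RA h a)(i := y) else RA h b)"
 "NA (rset a i y h) = NA h" "bnd (rset a i y h) = bnd h" "raw (rset a i y h) = raw h"
 "clk (rset a i y h) = clk h"
 "NA (tick h) = NA h" "RA (tick h) = RA h" "bnd (tick h) = bnd h" "raw (tick h) = raw h"
 "clk (tick h) = Suc (clk h)"
 by (auto simp: nset_def rset_def tick_def)

lemma lay_tick [simp]: "lay (tick h) = lay h"
 by (simp add: lay_def cong: if_cong)

text \<open>Multiplication of naturals is no machine operation; a constant factor unrolls into an
  expression of constant size.\<close>

primrec mulc :: "nat => nexp => nexp" where
 "mulc 0 e = NConst 0"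
| "mulc (Suc k) e = NAdd e (mulc k e)"

lemma nval_mulc [simp]: "nval (mulc k e) s = k * nval e s"
 by (induction k) auto

definition naddr :: "nat => nexp => nexp" where
 "naddr a i = NAdd (NLoad (NConst 0)) (NAdd (NConst a) (mulc arrs i))"

definition raddr :: "nat => nexp => nexp" where
 "raddr a i = NAdd (NConst a) (mulc arrs i)"

definition nld :: "nat => nexp => nexp" where "nld a i = NLoad (naddr a i)"
definition rld :: "nat => nexp => rexp" where "rld a i = RLoad (raddr a i)"
definition nst :: "nat => nexp => nexp => prog" where "nst a i e = NStore (naddr a i) e"
definition rst :: "nat => nexp => rexp => prog" where "rst a i e = RStore (raddr a i) e"
definition rawld :: "nexp => nexp" where "rawld e = NLoad e"

abbreviation nv :: "nat => nexp" where "nv a == nld a (NConst 0)"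
abbreviation rv :: "nat => rexp" where "rv a == rld a (NConst 0)"
abbreviation nset0 :: "nat => nexp => prog" where "nset0 a e == nst a (NConst 0) e"
abbreviation rset0 :: "nat => rexp => prog" where "rset0 a e == rst a (NConst 0) e"
abbreviation Rc :: "nat => rexp" where "Rc k == RNat (NConst k)"
abbreviation seq :: "prog => prog => prog" (infixr ";;" 60) where "P ;; Q == Then P Q"

lemma nval_naddr: "nval (naddr a i) (lay h) = Suc (bnd h) + (a + arrs * nval i (lay h))"
 unfolding naddr_def by (simp add: lay_def)

lemma nval_raddr: "nval (raddr a i) s = a + arrs * nval i s"
 unfolding raddr_def by simp

lemma nval_nld [simp]: "a < arrs ==> nval (nld a i) (lay h) = NA h a (nval i (lay h))"
proof -
 assume "a < arrs"
 then have "fst (lay h) (Suc (bnd h) + (a + arrs * n)) = NA h a n" for n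
  by (simp add: lay_def)
 then show ?thesis unfolding nld_def by (simp only: nval.simps nval_naddr)
qed

lemma rval_rld [simp]: "a < arrs ==> rval (rld a i) (lay h) = RA h a (nval i (lay h))"
proof -
 assume "a < arrs"
 then have "snd (lay h) (a + arrs * n) = RA h a n" for n
  by (simp add: lay_def)
 then show ?thesis unfolding rld_def by (simp only: rval.simps nval_raddr)
qed

lemma nval_rawld [simp]:
 "0 < nval e (lay h) ==> nval e (lay h) <= bnd h ==> nval (rawld e) (lay h) = raw h (nval e (lay h))"
 by (simp add: rawld_def) (simp add: lay_def)

lemma lay_nset:
 assumes "a < arrs"
 shows "lay (nset a i x h) = ((fst (lay h))(Suc (bnd h) + (a + arrs * i) := x), snd (lay h))"
proof -
 have key: "(b - Suc (bnd h)) mod arrs = a & (b - Suc (bnd h)) div arrs = i \<longleftrightarrow> b = Suc (bnd h) + (a + arrs * i)"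
  if "bnd h < b" for b
 proof -
  have "b - Suc (bnd h) = (b - Suc (bnd h)) mod arrs + arrs * ((b - Suc (bnd h)) div arrs)" by simp
  then show ?thesis using that assms by auto
 qed
 have "fst (lay (nset a i x h)) b = ((fst (lay h))(Suc (bnd h) + (a + arrs * i) := x)) b" for b
  using key[of b] by (cases "b = Suc (bnd h) + (a + arrs * i)") (auto simp: lay_def)
 moreover have "snd (lay (nset a i x h)) = snd (lay h)" by (simp add: lay_def)
 ultimately show ?thesis by (intro prod_eqI) (auto simp: fun_eq_iff)
qed

lemma lay_rset:
 assumes "a < arrs"
 shows "lay (rset a i x h) = (fst (lay h), (snd (lay h))(a + arrs * i := x))"
proof -
 have key: "b mod arrs = a & b div arrs = i \<longleftrightarrow> b = a + arrs * i" for b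
 proof -
  have "b = b mod arrs + arrs * (b div arrs)" by simp
  then show ?thesis using assms by auto
 qed
 have "snd (lay (rset a i x h)) b = ((snd (lay h))(a + arrs * i := x)) b" for b
  using key[of b] by (cases "b = a + arrs * i") (auto simp: lay_def)
 moreover have "fst (lay (rset a i x h)) = fst (lay h)" by (simp add: lay_def cong: if_cong)
 ultimately show ?thesis by (intro prod_eqI) (auto simp: fun_eq_iff)
qed

section \<open>Program logic: total correctness with a step clock\<close>

text \<open>A Hoare triple at one start state. Because \<open>clk\<close> has to advance by exactly
  the number of executed steps, every bound on \<open>clk\<close> in a postcondition is a bound on
  the running time.\<close>

definition ht :: "prog => hst => (hst => bool) => bool" where
 "ht P h Q \<longleftrightarrow> (\<exists>t h'. exec P (lay h) t (lay h') & clk h' = clk h + t & Q h')"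

lemma ht_mono: "ht P h Q ==> (!!h'. Q h' ==> R h') ==> ht P h R"
 unfolding ht_def by blast

lemma ht_skip: "Q (tick h) ==> ht Skip h Q"
 unfolding ht_def by (rule exI[of _ 1], rule exI[of _ "tick h"]) (auto intro: exec.Skip[unfolded One_nat_def])

lemma ht_nst:
 assumes "a < arrs" "Q (tick (nset a (nval i (lay h)) (nval e (lay h)) h))"
 shows "ht (nst a i e) h Q"
proof -
 have "exec (nst a i e) (lay h) 1 (lay (tick (nset a (nval i (lay h)) (nval e (lay h)) h)))"
  unfolding nst_def lay_tick lay_nset[OF assms(1)]
  using exec.NStore[of "naddr a i" e "lay h"] by (simp add: nval_naddr)
 with assms(2) show ?thesis unfolding ht_def by (intro exI conjI) auto
qed

lemma ht_rst:
 assumes "a < arrs" "Q (tick (rset a (nval i (lay h)) (rval e (lay h)) h))"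
 shows "ht (rst a i e) h Q"
proof -
 have "exec (rst a i e) (lay h) 1 (lay (tick (rset a (nval i (lay h)) (rval e (lay h)) h)))"
  unfolding rst_def lay_tick lay_rset[OF assms(1)]
  using exec.RStore[of "raddr a i" e "lay h"] by (simp add: nval_raddr)
 with assms(2) show ?thesis unfolding ht_def by (intro exI conjI) auto
qed

lemma ht_seq: "ht P h (%h'. ht P' h' Q) ==> ht (P ;; P') h Q"
proof -
 assume "ht P h (%h'. ht P' h' Q)"
 then obtain t h1 u h2 where "exec P (lay h) t (lay h1)" "clk h1 = clk h + t"
  "exec P' (lay h1) u (lay h2)" "clk h2 = clk h1 + u" "Q h2" unfolding ht_def by blast
 then show ?thesis unfolding ht_def
  by (intro exI[of _ "t + u"] exI[of _ h2]) (auto intro: exec.Then)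
qed

lemma ht_cond:
 assumes "holds b (lay h) ==> ht P (tick h) Q" "\<not> holds b (lay h) ==> ht P' (tick h) Q"
 shows "ht (Cond b P P') h Q"
proof (cases "holds b (lay h)")
 case True
 from assms(1)[OF this] obtain t h' where
  e: "exec P (lay h) t (lay h')" "clk h' = Suc (clk h) + t" "Q h'" unfolding ht_def by auto
 then show ?thesis unfolding ht_def
  by (intro exI[of _ "t + 1"] exI[of _ h']) (auto intro!: exec.CondTrue[unfolded One_nat_def add_Suc_right add_0_right] True)
next
 case False
 from assms(2)[OF this] obtain t h' where
  e: "exec P' (lay h) t (lay h')" "clk h' = Suc (clk h) + t" "Q h'" unfolding ht_def by auto
 then show ?thesis unfolding ht_def
  by (intro exI[of _ "t + 1"] exI[of _ h']) (auto intro!: exec.CondFalse[unfolded One_nat_def add_Suc_right add_0_right] False)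
qed

lemma ht_while:
 fixes \<mu> :: "hst => nat"
 assumes "I h"
  and step: "!!h. I h ==> holds b (lay h) ==> ht P (tick h) (%h'. I h' & \<mu> h' < \<mu> h)"
  and fin: "!!h. I h ==> \<not> holds b (lay h) ==> Q (tick h)"
 shows "ht (Loop b P) h Q"
 using assms(1)
proof (induction "\<mu> h" arbitrary: h rule: less_induct)
 case less
 show ?case
 proof (cases "holds b (lay h)")
  case True
  from step[OF less.prems this] obtain t h1 where
  1: "exec P (lay h) t (lay h1)" "clk h1 = Suc (clk h) + t" "I h1" "\<mu> h1 < \<mu> h"
  unfolding ht_def by auto
  from less.hyps[OF 1(4) 1(3)] obtain u h2 where
  2: "exec (Loop b P) (lay h1) u (lay h2)" "clk h2 = clk h1 + u" "Q h2"
  unfolding ht_def by auto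
  have "exec (Loop b P) (lay h) (t + u + 1) (lay h2)" by (rule exec.LoopTrue[OF True 1(1) 2(1)])
  then show ?thesis unfolding ht_def using 1 2 by (intro exI[of _ "t + u + 1"] exI[of _ h2]) auto
 next
  case False
  have "exec (Loop b P) (lay h) 1 (lay (tick h))" using exec.LoopFalse[OF False] by simp
  then show ?thesis unfolding ht_def using fin[OF less.prems False]
  by (intro exI[of _ 1] exI[of _ "tick h"]) auto
 qed
qed

definition for_loop :: "nat => nexp => prog => prog" where
 "for_loop v e P = nset0 v (NConst 0) ;; Loop (NLess (nv v) e) (P ;; nset0 v (NAdd (nv v) (NConst 1)))"

text \<open>The index of \<open>I\<close> is the counter at the loop head. The bound is an
  expression that is evaluated anew in each round, so the invariant has to fix its value; the body
  hands back the counter it was given, and the invariant is demanded after the increment.\<close>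

lemma ht_for:
 assumes v: "v < arrs"
  and init: "I 0 (tick (nset v 0 0 h))"
  and bound: "!!k h. k <= n ==> I k h ==> NA h v 0 = k ==> nval e (lay h) = n"
  and step: "!!k h. k < n ==> I k h ==> NA h v 0 = k ==>
  ht P (tick h) (%h'. NA h' v 0 = k & I (Suc k) (tick (nset v 0 (Suc k) h')))"
  and fin: "!!h. I n h ==> NA h v 0 = n ==> Q (tick h)"
 shows "ht (for_loop v e P) h Q"
proof -
 define J where "J = (%h. NA h v 0 <= n & I (NA h v 0) h)"
 show ?thesis unfolding for_loop_def
 proof (intro ht_seq ht_nst v)
  show "ht (Loop (NLess (nv v) e) (P ;; nset0 v (NAdd (nv v) (NConst 1))))
  (tick (nset v (nval (NConst 0) (lay h)) (nval (NConst 0) (lay h)) h)) Q"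
  proof (rule ht_while[where I = J and \<mu> = "%h. n - NA h v 0"])
  show "J (tick (nset v (nval (NConst 0) (lay h)) (nval (NConst 0) (lay h)) h))"
  using init by (simp add: J_def)
  next
  fix h assume J: "J h" and lt: "holds (NLess (nv v) e) (lay h)"
  define k where "k = NA h v 0"
  have "nval e (lay h) = n" using J bound[of "NA h v 0" h] by (simp add: J_def)
  then have k: "k < n" "I k h" using J lt v by (auto simp: J_def k_def)
  show "ht (P ;; nset0 v (NAdd (nv v) (NConst 1))) (tick h)
  (%h'. J h' & n - NA h' v 0 < n - NA h v 0)"
  by (intro ht_seq ht_mono[OF step[OF k k_def[symmetric]]] ht_nst v)
  (use k v in \<open>auto simp: J_def k_def\<close>)
  next
  fix h assume J: "J h" and nlt: "\<not> holds (NLess (nv v) e) (lay h)"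
  have "nval e (lay h) = n" using J bound[of "NA h v 0" h] by (simp add: J_def)
  then show "Q (tick h)" using J nlt v fin by (auto simp: J_def)
  qed
 qed
qed

text \<open>The frame part of all specifications: \<open>X\<close> and \<open>Y\<close> limit the
  arrays that a program may touch, and facts about all other arrays are carried over by
  \<open>sameN\<close> and \<open>sameR\<close>.\<close>

definition same :: "nat set => nat set => hst => hst => bool" where
 "same X Y h h' \<longleftrightarrow> bnd h' = bnd h & raw h' = raw h &
  (\<forall>a. a \<notin> X --> NA h' a = NA h a) & (\<forall>a. a \<notin> Y --> RA h' a = RA h a)"

lemma same_refl [simp]: "same X Y h h" by (simp add: same_def)

lemma sameN: "same X Y h h' ==> a \<notin> X ==> NA h' a = NA h a" by (simp add: same_def)
lemma sameR: "same X Y h h' ==> a \<notin> Y ==> RA h' a = RA h a" by (simp add: same_def)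
lemma samebnd: "same X Y h h' ==> bnd h' = bnd h" by (simp add: same_def)
lemma sameraw: "same X Y h h' ==> raw h' = raw h" by (simp add: same_def)

lemma same_trans: "same X Y h h' ==> same X Y h' h'' ==> same X Y h h''"
 by (simp add: same_def)

lemma same_weaken: "same X Y h h' ==> X \<subseteq> X' ==> Y \<subseteq> Y' ==> same X' Y' h h'"
 by (auto simp: same_def)

lemma same_trans': "same X Y h h' ==> same X' Y' h' h'' ==> X' \<subseteq> X ==> Y' \<subseteq> Y ==> same X Y h h''"
 using same_trans same_weaken by blast

lemma same_simps [simp]:
 "same X Y h (tick h') = same X Y h h'"
 "same X Y (tick h) h' = same X Y h h'"
 "a \<in> X ==> same X Y h (nset a i x h') = same X Y h h'"
 "a \<in> Y ==> same X Y h (rset a i y h') = same X Y h h'"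
 "a \<in> X ==> same X Y (nset a i x h) h' = same X Y h h'"
 "a \<in> Y ==> same X Y (rset a i y h) h' = same X Y h h'"
 by (auto simp: same_def)

definition vmap :: "nat => nexp => nat => nexp => rexp => prog" where
 "vmap v e dst b x = for_loop v e (rst dst (NAdd b (nv v)) x)"

text \<open>The evaluation of \<open>x\<close> may rely on the part of \<open>dst\<close> that has
  not been written yet. This admits updates in place, where \<open>x\<close> reads the very entry
  that is about to be overwritten.\<close>

lemma ht_vmap:
 assumes ar: "v < arrs" "dst < arrs"
  and val: "!!k h'. k <= n ==> same {v} {dst} h h' ==> NA h' v 0 = k ==>
  (!!j. \<not> (b0 <= j & j < b0 + k) ==> RA h' dst j = RA h dst j) ==>
  nval e (lay h') = n & nval b (lay h') = b0 & (k < n --> rval x (lay h') = f k)"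
  and post: "!!h'. same {v} {dst} h h' ==> clk h' = clk h + 3 * n + 2 ==>
  RA h' dst = (%j. if b0 <= j & j < b0 + n then f (j - b0) else RA h dst j) ==> Q h'"
 shows "ht (vmap v e dst b x) h Q"
 unfolding vmap_def
proof (rule ht_for[where n = n and I = "%k h'. same {v} {dst} h h' & clk h' = clk h + 3 * k + 1 &
  RA h' dst = (%j. if b0 <= j & j < b0 + k then f (j - b0) else RA h dst j)"], goal_cases)
 case (3 k h')
 have "nval e (lay h') = n & nval b (lay h') = b0 & (k < n --> rval x (lay h') = f k)"
  by (rule val) (use 3 in auto)
 then show ?case by simp
next
 case (4 k h')
 have "nval e (lay h') = n & nval b (lay h') = b0 & (k < n --> rval x (lay h') = f k)"
  by (rule val) (use 4 in auto)
 then have v: "nval b (lay h') = b0" "rval x (lay h') = f k" using 4 by auto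
 show ?case
  by (rule ht_rst[OF ar(2)]) (use 4 v ar in \<open>auto simp: fun_eq_iff\<close>)
next
 case (5 h')
 then show ?case using post[of "tick h'"] by auto
qed (use ar in auto)

definition vsum :: "nat => nexp => nat => rexp => prog" where
 "vsum v e acc x = rset0 acc (RNat (NConst 0)) ;; for_loop v e (rset0 acc (RAdd (rv acc) x))"

lemma ht_vsum:
 assumes ar: "v < arrs" "acc < arrs"
  and val: "!!k h'. k <= n ==> same {v} {acc} h h' ==> NA h' v 0 = k ==>
  nval e (lay h') = n & (k < n --> rval x (lay h') = f k)"
  and post: "!!h'. same {v} {acc} h h' ==> clk h' = clk h + 3 * n + 3 ==>
  RA h' acc 0 = (\<Sum>k<n. f k) ==> Q h'"
 shows "ht (vsum v e acc x) h Q"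
 unfolding vsum_def
proof (rule ht_seq, rule ht_rst[OF ar(2)], rule ht_for[where n = n and I = "%k h'. same {v} {acc} h h' &
  clk h' = clk h + 3 * k + 2 & RA h' acc 0 = (\<Sum>j<k. f j)"], goal_cases)
 case (3 k h')
 then show ?case using val[of k h'] by auto
next
 case (4 k h')
 have v: "rval x (lay h') = f k"
  using 4 val[of k h'] by auto
 show ?case
  by (rule ht_rst[OF ar(2)]) (use 4 v ar in \<open>auto\<close>)
next
 case (5 h')
 then show ?case using post[of "tick h'"] by auto
qed (use ar in auto)

text \<open>Array numbers. Those below 12 hold data that stay fixed once the instance has been read,
  which \<open>cst\<close> expresses by allowing changes from 12 on only. Names in v belong to the
  natural-number memory, names in x and y to the real one; those in x are used as single
  cells.\<close>

abbreviation (input) "vN == (0::nat)"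
abbreviation (input) "vM == (1::nat)"
abbreviation (input) "vQ == (2::nat)"
abbreviation (input) "vD == (3::nat)"
abbreviation (input) "vRb == (4::nat)"
abbreviation (input) "vHead == (5::nat)"
abbreviation (input) "vNxt == (6::nat)"
abbreviation (input) "vCol == (7::nat)"
abbreviation (input) "vCnt == (8::nat)"
abbreviation (input) "vLam == (10::nat)"
abbreviation (input) "vFW == (11::nat)"
abbreviation (input) "vR == (12::nat)"
abbreviation (input) "vP == (13::nat)"
abbreviation (input) "vR2 == (14::nat)"
abbreviation (input) "vT == (15::nat)"
abbreviation (input) "vT1 == (16::nat)"
abbreviation (input) "vLo == (17::nat)"
abbreviation (input) "vHi == (18::nat)"
abbreviation (input) "vLen == (19::nat)"
abbreviation (input) "vH == (20::nat)"
abbreviation (input) "vBlo == (21::nat)"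
abbreviation (input) "vJ == (22::nat)"
abbreviation (input) "vBB == (23::nat)"
abbreviation (input) "vBase == (24::nat)"
abbreviation (input) "vL == (25::nat)"
abbreviation (input) "vK0 == (26::nat)"
abbreviation (input) "vOk == (27::nat)"

abbreviation (input) "xEps == (0::nat)"
abbreviation (input) "xN == (1::nat)"
abbreviation (input) "xM == (2::nat)"
abbreviation (input) "xQ == (3::nat)"
abbreviation (input) "xLen == (4::nat)"
abbreviation (input) "yE == (5::nat)"
abbreviation (input) "yA == (6::nat)"
abbreviation (input) "xQK == (7::nat)"
abbreviation (input) "xK == (8::nat)"
abbreviation (input) "xKap == (9::nat)"
abbreviation (input) "yDeg == (10::nat)"
abbreviation (input) "xEta == (11::nat)"
abbreviation (input) "yY == (12::nat)"
abbreviation (input) "yU == (13::nat)"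
abbreviation (input) "yV == (14::nat)"
abbreviation (input) "yB == (15::nat)"
abbreviation (input) "yC == (16::nat)"
abbreviation (input) "yNrm == (17::nat)"
abbreviation (input) "yCs == (18::nat)"
abbreviation (input) "yXP == (19::nat)"
abbreviation (input) "xAcc == (20::nat)"
abbreviation (input) "xX == (21::nat)"
abbreviation (input) "xP0 == (22::nat)"
abbreviation (input) "xP == (23::nat)"
abbreviation (input) "xZ == (24::nat)"
abbreviation (input) "xZ1 == (25::nat)"
abbreviation (input) "xTr == (26::nat)"
abbreviation (input) "xTA == (27::nat)"
abbreviation (input) "xTB == (28::nat)"
abbreviation (input) "xF == (29::nat)"
abbreviation (input) "xRR == (30::nat)"
abbreviation (input) "xBB == (31::nat)"
abbreviation (input) "xXX == (32::nat)"
abbreviation (input) "xCoef == (33::nat)"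
abbreviation (input) "xNr == (34::nat)"
abbreviation (input) "xS == (35::nat)"

section \<open>Sparse matrix-vector products over linked rows\<close>

text \<open>Linked lists with 0 as null pointer, so list cells are numbered from 1.\<close>

primrec chain :: "(nat => nat) => nat => nat list => bool" where
 "chain nx p [] \<longleftrightarrow> p = 0"
| "chain nx p (x # xs) \<longleftrightarrow> p = x & x ~= 0 & chain nx (nx x) xs"

definition rowdot :: "nexp => nat => prog" where
 "rowdot r src =
  rset0 xAcc (Rc 0) ;; nset0 vP (nld vHead r) ;;
  Loop (NLess (NConst 0) (nv vP))
  (rset0 xAcc (RAdd (rv xAcc) (rld src (nld vCol (nv vP)))) ;;
  nset0 vP (nld vNxt (nv vP)))"

lemma ht_rowdot:
 assumes ch: "chain (NA h vNxt) (NA h vHead r0) ps"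
  and r: "nval r (lay (tick (rset xAcc 0 0 h))) = r0" and src: "src < arrs" "src ~= xAcc"
  and post: "!!h'. same {vP} {xAcc} h h' ==> clk h' = clk h + 3 * length ps + 3 ==>
  RA h' xAcc 0 = (\<Sum>p\<leftarrow>ps. RA h src (NA h vCol p)) ==> Q h'"
 shows "ht (rowdot r src) h Q"
 unfolding rowdot_def
proof (intro ht_seq ht_rst ht_nst, goal_cases)
 case 3
 define s where "s = (\<Sum>p\<leftarrow>ps. RA h src (NA h vCol p))"
 show ?case
 proof (rule ht_while[where I = "%h'. same {vP} {xAcc} h h' &
  (\<exists>xs. chain (NA h vNxt) (NA h' vP 0) xs & length xs <= length ps &
  clk h' + 3 * length xs = clk h + 3 * length ps + 2 &
  RA h' xAcc 0 + (\<Sum>p\<leftarrow>xs. RA h src (NA h vCol p)) = s)"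
  and \<mu> = "%h'. clk h + 3 * length ps + 2 - clk h'"], goal_cases)
  case 1
  then show ?case using ch r by (auto simp: s_def intro!: exI[of _ ps])
 next
  case (2 h')
  then have S: "same {vP} {xAcc} h h'" and p0: "0 < NA h' vP 0" by auto
  from 2 p0 obtain x xs where xs: "chain (NA h vNxt) (NA h' vP 0) (x # xs)"
  "length (x # xs) <= length ps" "clk h' + 3 * length (x # xs) = clk h + 3 * length ps + 2"
  "RA h' xAcc 0 + (\<Sum>p\<leftarrow>x # xs. RA h src (NA h vCol p)) = s"
  by (metis chain.simps(1) list.exhaust less_numeral_extra(3))
  show ?case
  by (intro ht_seq ht_rst ht_nst)
  (use S xs src in \<open>auto simp: sameN[OF S] sameR[OF S] intro!: exI[of _ xs]\<close>)
 next
  case (3 h')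
  then obtain xs where xs: "chain (NA h vNxt) (NA h' vP 0) xs"
  "clk h' + 3 * length xs = clk h + 3 * length ps + 2"
  "RA h' xAcc 0 + (\<Sum>p\<leftarrow>xs. RA h src (NA h vCol p)) = s" and "NA h' vP 0 = 0" by auto
  then have "xs = []" by (cases xs) auto
  then show ?case using xs 3 by (intro post) (auto simp: s_def)
 qed
qed auto

text \<open>Entries from \<open>d\<close> on are passed through, so that iterates of
  \<open>sop\<close> describe whole array contents and equalities between arrays hold
  everywhere.\<close>

definition sop :: "nat => (nat => nat => real) => (nat => real) => nat => real" where
 "sop d A f = (%r. if r < d then mv d A f r else f r)"

definition shifted :: "(nat => real) => (nat => nat => real) => real => nat => nat => real" where
 "shifted a M s = (%r c. a r * M r c * a c + (if r = c then s else 0))"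

lemma mv_shifted:
 assumes "r < d"
 shows "mv d (shifted a M s) f r = a r * mv d M (%c. a c * f c) r + s * f r"
proof -
 have "mv d (shifted a M s) f r = (\<Sum>c<d. a r * (M r c * (a c * f c)) + (if r = c then s * f c else 0))"
  unfolding mv_def shifted_def by (intro sum.cong refl) (auto simp: algebra_simps)
 also have "... = a r * mv d M (%c. a c * f c) r + s * f r"
  using assms by (simp add: sum.distrib mv_def sum_distrib_left)
 finally show ?thesis .
qed

text \<open>Rows are stored without coefficients: a product with a vector is a plain sum over the
  listed columns (\<open>rowsM\<close>), which suits a 0/1 matrix. \<open>nnz\<close> governs the
  cost of one product.\<close>

locale machine =
 fixes h0 :: hst and n q d nnz :: nat and M :: "nat => nat => real" and rows :: "nat => nat list"
 assumes cN: "NA h0 vN 0 = n" and cQ: "NA h0 vQ 0 = q" and cD: "NA h0 vD 0 = d"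
  and cRb: "!!i. i < n ==> NA h0 vRb i = i * q" and dnq: "d = n * q"
  and ch: "!!r. r < d ==> chain (NA h0 vNxt) (NA h0 vHead r) (rows r)"
  and rowsM: "!!r f. r < d ==> (\<Sum>p\<leftarrow>rows r. f (NA h0 vCol p)) = mv d M f r"
  and nnz: "(\<Sum>r<d. length (rows r)) <= nnz"
begin

definition cst :: "hst => bool" where "cst h \<longleftrightarrow> same {12..} {12..} h0 h"

definition tM :: nat where "tM = 3 * nnz + 16 * d + 16"

lemma cstN: "cst h ==> a < 12 ==> NA h a = NA h0 a"
 by (auto simp: cst_def same_def)
lemma cstR: "cst h ==> a < 12 ==> RA h a = RA h0 a"
 by (auto simp: cst_def same_def)

lemma cst_same: "cst h ==> same X Y h h' ==> X \<subseteq> {12..} ==> Y \<subseteq> {12..} ==> cst h'"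
 unfolding cst_def by (rule same_trans')

lemma cst_simps [simp]:
 "cst (tick h) = cst h"
 "12 <= a ==> cst (nset a i x h) = cst h"
 "12 <= a ==> cst (rset a i y h) = cst h"
 by (auto simp: cst_def)

lemma cst_D: "cst h ==> NA h vD 0 = d" by (simp add: cstN cD)
lemma cst_N: "cst h ==> NA h vN 0 = n" by (simp add: cstN cN)
lemma cst_Q: "cst h ==> NA h vQ 0 = q" by (simp add: cstN cQ)

lemma ht_rowdot':
 assumes c: "cst h" and r: "nval r (lay (tick (rset xAcc 0 0 h))) = r0" "r0 < d"
  and src: "src < arrs" "src ~= xAcc"
  and post: "!!h'. same {vP} {xAcc} h h' ==> clk h' = clk h + 3 * length (rows r0) + 3 ==>
  RA h' xAcc 0 = mv d M (RA h src) r0 ==> Q h'"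
 shows "ht (rowdot r src) h Q"
 by (rule ht_rowdot[of h r0 "rows r0"])
  (use c r src post rowsM[OF r(2), of "RA h src"] ch[OF r(2)] in \<open>auto simp: cstN\<close>)

definition matvec :: "nat => nat => prog" where
 "matvec dst src = for_loop vR (nv vD) (rowdot (nv vR) src ;; rst dst (nv vR) (rv xAcc))"

lemma ht_matvec:
 assumes c: "cst h" and ar: "dst < arrs" "12 <= dst" "dst ~= xAcc" "src < arrs" "src ~= xAcc" "src ~= dst"
  and post: "!!h'. same {vP, vR} {xAcc, dst} h h' ==> clk h' <= clk h + 3 * nnz + 6 * d + 2 ==>
  RA h' dst = (%r. if r < d then mv d M (RA h src) r else RA h dst r) ==> Q h'"
 shows "ht (matvec dst src) h Q"
 unfolding matvec_def
proof (rule ht_for[where n = d and I = "%k h'. same {vP, vR} {xAcc, dst} h h' &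
  clk h' = clk h + 3 * (\<Sum>r<k. length (rows r)) + 6 * k + 1 &
  RA h' dst = (%r. if r < k then mv d M (RA h src) r else RA h dst r)"], goal_cases)
 case (3 k h')
 then have S: "same {vP, vR} {xAcc, dst} h h'" by simp
 have "cst h'" by (rule cst_same[OF c S]) (use ar in auto)
 then show ?case by (simp add: cst_D)
next
 case (4 k h')
 then have S: "same {vP, vR} {xAcc, dst} h h'" by simp
 have c': "cst h'" by (rule cst_same[OF c S]) (use ar in auto)
 have src': "RA h' src = RA h src" using sameR[OF S] ar by simp
 show ?case
 proof (rule ht_seq, rule ht_rowdot'[where ?r0.0 = k], goal_cases)
  case (6 h2)
  show ?case
  proof (rule ht_rst, goal_cases)
  case 2
  have "same {vP, vR} {xAcc, dst} h h2"
  by (rule same_trans'[OF S]) (use 6 in auto)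
  then show ?case using 6 4 ar src' by (auto simp: fun_eq_iff sameN[OF 6(1)] sameR[OF 6(1)])
  qed (use ar in auto)
 qed (use 4 c' ar in auto)
next
 case (5 h')
 then show ?case using nnz by (intro post) auto
qed (use ar in auto)

end

section \<open>Exact traces by packing\<close>

text \<open>Remainder of \<open>xZ\<close> modulo \<open>xP0\<close> without rounding: the modulus
  is doubled until it exceeds \<open>xZ\<close> and then halved back down, being subtracted whenever
  it fits. The cost is logarithmic in the quotient, hence the parameter \<open>w\<close> of the
  specification.\<close>

definition modred :: prog where
 "modred = rset0 xP (rv xP0) ;;
  Loop (TNot (RLess (rv xZ) (rv xP))) (rset0 xP (RAdd (rv xP) (rv xP))) ;;
  Loop (RLess (rv xP0) (rv xP))
  (rset0 xP (RDiv (rv xP) (Rc 2)) ;;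
  Cond (RLess (rv xZ) (rv xP)) Skip (rset0 xZ (RSub (rv xZ) (rv xP))))"

lemma ht_modred:
 assumes P0: "0 < RA h xP0 0" and Z: "0 <= RA h xZ 0" "RA h xZ 0 < RA h xP0 0 * 2 ^ w"
  and post: "!!h' N. same {} {xP, xZ} h h' ==> clk h' <= clk h + 6 * w + 3 ==>
  RA h' xZ 0 = RA h xZ 0 - real (N::nat) * RA h xP0 0 ==> 0 <= RA h' xZ 0 ==>
  RA h' xZ 0 < RA h xP0 0 ==> Q h'"
 shows "ht modred h Q"
proof -
 define P where "P = RA h xP0 0"
 define I1 where "I1 = (%h'. same {} {xP} h h' &
  (\<exists>j\<le>w. RA h' xP 0 = P * 2 ^ j & clk h' = clk h + 2 * j + 1))"
 define I2 where "I2 = (%h'. same {} {xP, xZ} h h' &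
  (\<exists>j N. RA h' xP 0 = P * 2 ^ j & clk h' + 4 * j <= clk h + 6 * w + 2 &
  0 <= RA h' xZ 0 & RA h' xZ 0 < P * 2 ^ j & RA h' xZ 0 = RA h xZ 0 - real (N::nat) * P))"
 have I2I: "I2 h'" if "same {} {xP, xZ} h h'" "RA h' xP 0 = P * 2 ^ j" "clk h' + 4 * j <= clk h + 6 * w + 2"
  "0 <= RA h' xZ 0" "RA h' xZ 0 < P * 2 ^ j" "RA h' xZ 0 = RA h xZ 0 - real (N::nat) * P" for h' j N
  unfolding I2_def using that by blast
 show ?thesis unfolding modred_def
 proof (intro ht_seq ht_rst, goal_cases)
  case 2
  show ?case
  proof (rule ht_while[where I = I1 and \<mu> = "%h'. clk h + 2 * w + 2 - clk h'"], goal_cases)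
  case 1
  then show ?case by (auto simp: I1_def P_def)
  next
  case (2 h')
  then obtain j where S: "same {} {xP} h h'" and j: "j <= w" "RA h' xP 0 = P * 2 ^ j"
  "clk h' = clk h + 2 * j + 1" by (auto simp: I1_def)
  have "P * 2 ^ j < P * 2 ^ w"
  using 2(2) Z j sameR[OF S, of xZ] by (auto simp: P_def)
  then have "j < w" using P0 by (simp add: P_def)
  then show ?case using S j
  by (intro ht_rst) (auto simp: I1_def intro!: exI[of _ "Suc j"])
  next
  case (3 h1)
  then obtain j where S: "same {} {xP} h h1" and j: "j <= w" "RA h1 xP 0 = P * 2 ^ j"
  "clk h1 = clk h + 2 * j + 1" by (auto simp: I1_def)
  show ?case
  proof (rule ht_while[where I = I2 and \<mu> = "%h'. clk h + 6 * w + 4 - clk h'"], goal_cases)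
  case 1
  have "same {} {xP, xZ} h h1" by (rule same_weaken[OF S]) auto
  moreover have "RA h xZ 0 < P * 2 ^ j" using 3(2) j sameR[OF S, of xZ] by simp
  then have "\<exists>j N. RA (tick h1) xP 0 = P * 2 ^ j & clk (tick h1) + 4 * j <= clk h + 6 * w + 2 &
  0 <= RA (tick h1) xZ 0 & RA (tick h1) xZ 0 < P * 2 ^ j &
  RA (tick h1) xZ 0 = RA h xZ 0 - real (N::nat) * P"
  using j Z sameR[OF S, of xZ] by (intro exI[of _ j] exI[of _ "0::nat"]) simp
  ultimately show ?case unfolding I2_def by simp
  next
  case (2 h')
  then have "I2 h'" by simp
  then obtain j N where S: "same {} {xP, xZ} h h'" and jN: "RA h' xP 0 = P * 2 ^ j"
  "clk h' + 4 * j <= clk h + 6 * w + 2" "0 <= RA h' xZ 0" "RA h' xZ 0 < P * 2 ^ j"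
  "RA h' xZ 0 = RA h xZ 0 - real (N::nat) * P" unfolding I2_def by blast
  have "P < P * 2 ^ j" using 2(2) jN sameR[OF S, of xP0] by (simp add: P_def)
  then have "j ~= 0" by (intro notI) simp
  then obtain i where i: "j = Suc i" by (cases j) auto
  show ?case
  proof (intro ht_seq ht_rst ht_cond, goal_cases)
  case 2
  then show ?case using S jN i
  by (intro ht_skip conjI I2I[of _ i N]) auto
  next
  case 4
  then show ?case using S jN i
  by (intro conjI I2I[of _ i "N + 2 ^ i"]) (auto simp: algebra_simps)
  qed auto
  next
  case (3 h')
  then have "I2 h'" by simp
  then obtain j N where S: "same {} {xP, xZ} h h'" and jN: "RA h' xP 0 = P * 2 ^ j"
  "clk h' + 4 * j <= clk h + 6 * w + 2" "0 <= RA h' xZ 0" "RA h' xZ 0 < P * 2 ^ j"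
  "RA h' xZ 0 = RA h xZ 0 - real (N::nat) * P" unfolding I2_def by blast
  have "\<not> P < P * 2 ^ j" using 3(2) jN(1) sameR[OF S, of xP0] by (simp add: P_def)
  then have "P * 2 ^ j <= P * 1" by linarith
  moreover have "0 < P" using P0 by (simp add: P_def)
  ultimately have "(2::real) ^ j <= 1" by (simp only: mult_le_cancel_left_pos)
  then have "\<not> 1 < (2::real) ^ j" by simp
  then have "j = 0" using one_less_power[of "2::real" j] by auto
  then show ?case using S jN by (intro post[of _ N]) (auto simp: P_def)
  qed
  qed
 qed auto
qed

text \<open>With \<open>b\<close> the indicator of a block, the weights X^j for columns and X^(d-i)
  for rows send entry (i, j) to exponent d + j - i: all diagonal entries meet at exponent d, those
  above the diagonal land higher and those below it lower. As X exceeds the sum of all entries,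
  nothing is carried into the digit at d or out of it, so the block trace \<open>c\<close> is that
  digit and follows from the remainders modulo X^(d+1) and X^d. One vector thus replaces one product
  per diagonal entry.\<close>

lemma packed_digit:
 fixes Wn :: "nat => nat => nat" and b :: "nat => nat" and X d :: nat
 assumes X: "(\<Sum>i<d. \<Sum>j<d. Wn i j) < X" and b: "!!i. b i <= 1"
 defines "Z == (\<Sum>i<d. \<Sum>j<d. b i * (Wn i j * (b j * X ^ j)) * X ^ (d - i))"
  and "c == (\<Sum>i<d. b i * Wn i i)"
 obtains Hi Lo where "Z = Hi * X ^ Suc d + c * X ^ d + Lo" "Lo < X ^ d"
  "c * X ^ d + Lo < X ^ Suc d" "Z < X ^ (2 * d + 1)"
proof -
 have X0: "0 < X" using X by linarith
 define t where "t = (%i j. b i * (Wn i j * b j))"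
 have tW: "t i j <= Wn i j" for i j
  using mult_le_mono[OF b[of i] mult_le_mono2[OF b[of j], of "Wn i j"]] by (simp add: t_def)
 define Hi where "Hi = (\<Sum>i<d. \<Sum>j<d. if i < j then t i j * X ^ (j - i - 1) else 0)"
 define Lo where "Lo = (\<Sum>i<d. \<Sum>j<d. if j < i then t i j * X ^ (d - (i - j)) else 0)"
 define L where "L = (\<Sum>i<d. \<Sum>j<d. if j < i then t i j else 0)"
 have c: "c = (\<Sum>i<d. \<Sum>j<d. if j = i then t i j else 0)"
 proof -
  have "b i * Wn i i = t i i" for i using b[of i] by (cases "b i") (auto simp: t_def)
  then show ?thesis by (simp add: c_def sum.delta')
 qed
 have tm: "b i * (Wn i j * (b j * X ^ j)) * X ^ (d - i) =
  (if i < j then t i j * X ^ (j - i - 1) else 0) * X ^ Suc d + (if j = i then t i j else 0) * X ^ d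
  + (if j < i then t i j * X ^ (d - (i - j)) else 0)" if "i < d" for i j
 proof -
  have e: "b i * (Wn i j * (b j * X ^ j)) * X ^ (d - i) = t i j * X ^ (j + (d - i))"
  by (simp add: t_def power_add)
  consider "i < j" | "j = i" | "j < i" by linarith
  then show ?thesis
  proof cases
  case 1
  then have "j + (d - i) = (j - i - 1) + Suc d" using that by simp
  then show ?thesis unfolding e using 1 by (simp only: power_add) simp
  next
  case 2
  then show ?thesis unfolding e using that by simp
  next
  case 3
  then have "j + (d - i) = d - (i - j)" using that by simp
  then show ?thesis unfolding e using 3 by simp
  qed
 qed
 have Z: "Z = Hi * X ^ Suc d + c * X ^ d + Lo"
  unfolding Z_def c Hi_def Lo_def sum_distrib_right sum.distrib[symmetric]
  using tm by (intro sum.cong refl) auto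
 have cL: "c + L < X"
 proof -
  have "c + L <= (\<Sum>i<d. \<Sum>j<d. Wn i j)"
  unfolding c L_def sum.distrib[symmetric] by (intro sum_mono) (auto intro: tW)
  with X show ?thesis by simp
 qed
 \<comment> \<open>Entries below the diagonal have exponent at most d - 1; the factor X on the left
   avoids a subtraction in the exponent.\<close>
 have Lo: "Lo * X <= L * X ^ d"
  unfolding Lo_def L_def sum_distrib_right
 proof (intro sum_mono)
  fix i j assume "i \<in> {..<d}" "j \<in> {..<d}"
  then show "(if j < i then t i j * X ^ (d - (i - j)) else 0) * X <= (if j < i then t i j else 0) * X ^ d"
  proof (cases "j < i")
  case True
  have "X ^ (d - (i - j)) * X = X ^ Suc (d - (i - j))" by simp
  also have "... <= X ^ d" using True X0 \<open>i \<in> {..<d}\<close> by (intro power_increasing) auto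
  finally show ?thesis using True by (simp add: mult.assoc)
  qed auto
 qed
 have Lod: "Lo < X ^ d & Lo <= L * X ^ d"
 proof (cases "L = 0")
  case True
  then have "Lo = 0" using Lo X0 by simp
  then show ?thesis using X0 by simp
 next
  case False
  have "Lo * X <= L * X ^ d" by (rule Lo)
  also have "... < X * X ^ d" using cL X0 by simp
  finally have "Lo < X ^ d" by (simp add: mult.commute)
  moreover have "X ^ d <= L * X ^ d" using False by simp
  ultimately show ?thesis by linarith
 qed
 have cLo: "c * X ^ d + Lo < X ^ Suc d"
 proof -
  have "c * X ^ d + Lo <= (c + L) * X ^ d" using Lod by (simp add: add_mult_distrib)
  also have "... < X ^ Suc d" using cL X0 by simp
  finally show ?thesis .
 qed
 have "Z <= (\<Sum>i<d. \<Sum>j<d. Wn i j) * X ^ (2 * d)"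
  unfolding Z_def sum_distrib_right
 proof (intro sum_mono)
  fix i j assume "i \<in> {..<d}" "j \<in> {..<d}"
  have "b i * (Wn i j * (b j * X ^ j)) * X ^ (d - i) = t i j * X ^ (j + (d - i))"
  by (simp add: t_def power_add)
  also have "... <= Wn i j * X ^ (2 * d)"
  using X0 \<open>j \<in> {..<d}\<close> by (intro mult_le_mono tW power_increasing) auto
  finally show "b i * (Wn i j * (b j * X ^ j)) * X ^ (d - i) <= Wn i j * X ^ (2 * d)" .
 qed
 also have "... < X ^ (2 * d + 1)" using X X0 by simp
 finally show ?thesis using Z Lod cLo that by blast
qed

context machine
begin

text \<open>With the later values K/e for \<open>yA\<close> and q K^2 for \<open>xQK\<close>, this
  is K^2 times the sum of the normalised matrix and q: its entries are natural numbers and its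
  eigenvalues are nonnegative.\<close>

definition St :: "nat => nat => real" where "St = shifted (RA h0 yA) M (RA h0 xQK 0)"

definition applyS :: prog where
 "applyS = vmap vR (nv vD) yU (NConst 0) (RMul (rld yA (nv vR)) (rld yY (nv vR))) ;;
  matvec yV yU ;;
  vmap vR (nv vD) yY (NConst 0)
  (RAdd (RMul (rld yA (nv vR)) (rld yV (nv vR))) (RMul (rv xQK) (rld yY (nv vR))))"

lemma ht_applyS:
 assumes c: "cst h"
  and post: "!!h'. same {vP, vR} {xAcc, yU, yV, yY} h h' ==> clk h' <= clk h + tM ==>
  RA h' yY = sop d St (RA h yY) ==> Q h'"
 shows "ht applyS h Q"
 unfolding applyS_def
proof (rule ht_seq, rule ht_vmap[where n = d and ?b0.0 = 0 and f = "%r. RA h0 yA r * RA h yY r"], goal_cases)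
 case (3 k h1)
 have c1: "cst h1" by (rule cst_same[OF c 3(2)]) auto
 show ?case using 3(3) sameR[OF 3(2), of yY] by (simp add: cst_D[OF c1] cstR[OF c1])
next
 case (4 h1)
 note h1 = this
 have c1: "cst h1" by (rule cst_same[OF c h1(1)]) auto
 show ?case
 proof (rule ht_seq, rule ht_matvec[OF c1], goal_cases)
  case (7 h2)
  note h2 = this
  have c2: "cst h2" by (rule cst_same[OF c1 h2(1)]) auto
  have mvU: "mv d M (RA h1 yU) = mv d M (%r. RA h0 yA r * RA h yY r)"
  unfolding mv_def using h1(3) by simp
  show ?case
  proof (rule ht_vmap[where n = d and ?b0.0 = 0 and f = "%r. RA h0 yA r * RA h2 yV r + RA h0 xQK 0 * RA h2 yY r"], goal_cases)
  case (3 k h3)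
  have c3: "cst h3" by (rule cst_same[OF c2 3(2)]) auto
  show ?case using 3(3) 3(4)[of k] sameR[OF 3(2), of yV] by (simp add: cst_D[OF c3] cstR[OF c3])
  next
  case (4 h3)
  have S: "same {vP, vR} {xAcc, yU, yV, yY} h h3"
  by (rule same_trans[OF same_trans[OF same_weaken[OF h1(1)] same_weaken[OF h2(1)]] same_weaken[OF 4(1)]]) auto
  have "RA h2 yY = RA h yY" using sameR[OF h1(1), of yY] sameR[OF h2(1), of yY] by simp
  then have "RA h3 yY = sop d St (RA h yY)"
  unfolding 4(3) h2(3) mvU sop_def by (auto simp: fun_eq_iff St_def mv_shifted)
  then show ?case using S 4(2) h2(2) h1(2) by (intro post) (auto simp: tM_def)
  qed auto
 qed auto
qed auto

definition applyT :: prog where "applyT = for_loop vT1 (nv vT) applyS"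

lemma ht_applyT:
 assumes c: "cst h" and T: "NA h vT 0 = T"
  and post: "!!h'. same {vP, vR, vT1} {xAcc, yU, yV, yY} h h' ==> clk h' <= clk h + T * (tM + 2) + 2 ==>
  RA h' yY = (sop d St ^^ T) (RA h yY) ==> Q h'"
 shows "ht applyT h Q"
 unfolding applyT_def
proof (rule ht_for[where n = T and I = "%k h'. same {vP, vR, vT1} {xAcc, yU, yV, yY} h h' &
  clk h' <= clk h + k * (tM + 2) + 1 & RA h' yY = (sop d St ^^ k) (RA h yY)"], goal_cases)
 case (3 k h')
 then show ?case using T sameN[of "{vP, vR, vT1}" "{xAcc, yU, yV, yY}" h h' vT] by simp
next
 case (4 k h')
 then have S: "same {vP, vR, vT1} {xAcc, yU, yV, yY} h h'" by simp
 have c': "cst (tick h')" using cst_same[OF c S] by simp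
 show ?case
 proof (rule ht_applyS[OF c'], goal_cases)
  case (1 h2)
  have "same {vP, vR, vT1} {xAcc, yU, yV, yY} h h2"
  by (rule same_trans'[OF S, of "{vP, vR}" "{xAcc, yU, yV, yY}"]) (use 1 in auto)
  then show ?case using 1 4 sameN[OF 1(1), of vT1] by auto
 qed
next
 case (5 h')
 then show ?case by (intro post) auto
qed (use c T in auto)

end

text \<open>A run with a fixed exponent T. \<open>Wn\<close> is the matrix \<open>St\<close>^(2T)
  over the natural numbers, \<open>Xn\<close> the packing base, and \<open>wx\<close> bounds the
  number of bits of \<open>Xn\<close>, on which the cost of the remainders depends.\<close>

locale attempt = machine +
 fixes T wx Xn :: nat and Wn :: "nat => nat => nat"
 assumes W: "!!f i. i < d ==> (sop d St ^^ T) ((sop d St ^^ T) f) i = (\<Sum>j<d. real (Wn i j) * f j)"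
  and Xn: "(\<Sum>i<d. \<Sum>j<d. Wn i j) < Xn" and wx: "Xn <= 2 ^ wx"
begin

definition acfg :: "hst => bool" where
 "acfg h \<longleftrightarrow> cst h & NA h vT 0 = T & (\<forall>i\<le>Suc d. RA h yXP i = real Xn ^ i)"

lemma acfg_cst: "acfg h ==> cst h" by (simp add: acfg_def)
lemma acfg_T: "acfg h ==> NA h vT 0 = T" by (simp add: acfg_def)
lemma acfg_XP: "acfg h ==> i <= Suc d ==> RA h yXP i = real Xn ^ i" by (simp add: acfg_def)

lemma acfg_same: "acfg h ==> same X Y h h' ==> X \<subseteq> {12..} - {vT} ==> Y \<subseteq> {12..} - {yXP} ==> acfg h'"
proof -
 assume a: "acfg h" "same X Y h h'" "X \<subseteq> {12..} - {vT}" "Y \<subseteq> {12..} - {yXP}"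
 then have "cst h'" using cst_same[of h X Y h'] by (auto simp: acfg_def)
 moreover have "NA h' vT = NA h vT" "RA h' yXP = RA h yXP"
  using a by (auto intro!: sameN[of X Y h h'] sameR[of X Y h h'])
 ultimately show "acfg h'" using a by (simp add: acfg_def)
qed

lemma acfg_simps [simp]:
 "acfg (tick h) = acfg h"
 "12 <= a ==> a ~= vT ==> acfg (nset a i x h) = acfg h"
 "12 <= a ==> a ~= yXP ==> acfg (rset a i y h) = acfg h"
 by (auto simp: acfg_def)

text \<open>A block trace of the residual of \<open>St\<close>^(2T), when \<open>C\<close> is the
  diagonal of the part that the pivots found so far account for.\<close>

definition bsum :: "(nat => real) => nat => nat => real" where
 "bsum C lo hi = (\<Sum>i<d. of_bool (lo <= i & i < hi) * (real (Wn i i) - C i))"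

definition tTr :: nat where "tTr = (2 * T + 2) * (tM + 2) + 6 * wx * (d + 1)"

text \<open>An indicator by arithmetic: truncated subtraction makes 1 - (lo - r) equal to 1 exactly
  if lo <= r and to 0 otherwise, and similarly at the upper end.\<close>

definition indic :: rexp where
 "indic = RMul (RNat (NSub (NConst 1) (NSub (nv vLo) (nv vR))))
  (RNat (NSub (NConst 1) (NSub (NAdd (nv vR) (NConst 1)) (nv vHi))))"

lemma rval_indic [simp]:
 "rval indic (lay h) = of_bool (NA h vLo 0 <= NA h vR 0 & NA h vR 0 < NA h vHi 0)"
 unfolding indic_def by auto

definition trace :: prog where
 "trace =
  vmap vR (nv vD) yY (NConst 0) (RMul indic (rld yXP (nv vR))) ;;
  applyT ;; applyT ;;
  vsum vR (nv vD) xZ (RMul (RMul indic (rld yY (nv vR))) (rld yXP (NSub (nv vD) (nv vR)))) ;;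
  rset0 xP0 (rld yXP (NAdd (nv vD) (NConst 1))) ;; modred ;;
  rset0 xZ1 (rv xZ) ;;
  rset0 xP0 (rld yXP (nv vD)) ;; modred ;;
  rset0 xZ1 (RDiv (RSub (rv xZ1) (rv xZ)) (rld yXP (nv vD))) ;;
  vsum vR (nv vD) xZ (RMul indic (rld yCs (nv vR))) ;;
  rset0 xTr (RSub (rv xZ1) (rv xZ))"

text \<open>Identifies the multiple that \<open>modred\<close> has removed, which its specification
  leaves open, with the one known from \<open>packed_digit\<close>.\<close>

lemma multiple_remainder_unique:
 fixes P r x :: real
 assumes "x = real a * P + r" "0 <= r" "r < P" "0 <= x - real N * P" "x - real N * P < P"
 shows "N = a"
proof (rule ccontr)
 assume "N ~= a"
 then consider "N + 1 <= a" | "a + 1 <= N" by linarith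
 then show False
 proof cases
  case 1
  then have "(real N + 1) * P <= real a * P" using assms by (intro mult_right_mono) auto
  then show False using assms by (simp add: algebra_simps)
 next
  case 2
  then have "(real a + 1) * P <= real N * P" using assms by (intro mult_right_mono) auto
  then show False using assms by (simp add: algebra_simps)
 qed
qed

lemma ht_trace:
 assumes a: "acfg h" and lo: "NA h vLo 0 = lo" and hi: "NA h vHi 0 = hi" and C: "RA h yCs = C"
  and post: "!!h'. same {vP, vR, vT1} {xAcc, yU, yV, yY, xZ, xZ1, xP, xP0, xTr} h h' ==>
  clk h' <= clk h + tTr ==> RA h' xTr 0 = bsum C lo hi ==> Q h'"
 shows "ht trace h Q"
 unfolding trace_def
proof -
 let ?X = "{vP, vR, vT1}" and ?Y = "{xAcc, yU, yV, yY, xZ, xZ1, xP, xP0, xTr}"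
 define b where "b = (%i. if lo <= i & i < hi then 1 else (0::nat))"
 have ind: "of_bool (lo <= i & i < hi) = real (b i)" for i by (simp add: b_def)
 define Z where "Z = (\<Sum>i<d. \<Sum>j<d. b i * (Wn i j * (b j * Xn ^ j)) * Xn ^ (d - i))"
 define c where "c = (\<Sum>i<d. b i * Wn i i)"
 obtain Hi Lo where HL: "Z = Hi * Xn ^ Suc d + c * Xn ^ d + Lo" "Lo < Xn ^ d"
  "c * Xn ^ d + Lo < Xn ^ Suc d" "Z < Xn ^ (2 * d + 1)"
  unfolding Z_def c_def by (rule packed_digit[OF Xn, of b]) (auto simp: b_def)
 have X0: "0 < Xn" using Xn by linarith
 have pw: "real Xn ^ k <= 2 ^ (wx * k)" for k
 proof -
  have "real Xn <= 2 ^ wx" using wx of_nat_mono[OF wx, where 'a=real] by simp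
  then have "real Xn ^ k <= (2 ^ wx) ^ k" by (intro power_mono) auto
  then show ?thesis by (simp add: power_mult)
 qed
 show "ht (vmap vR (nv vD) yY (NConst 0) (RMul indic (rld yXP (nv vR))) ;;
  applyT ;; applyT ;;
  vsum vR (nv vD) xZ (RMul (RMul indic (rld yY (nv vR))) (rld yXP (NSub (nv vD) (nv vR)))) ;;
  rset0 xP0 (rld yXP (NAdd (nv vD) (NConst 1))) ;; modred ;;
  rset0 xZ1 (rv xZ) ;;
  rset0 xP0 (rld yXP (nv vD)) ;; modred ;;
  rset0 xZ1 (RDiv (RSub (rv xZ1) (rv xZ)) (rld yXP (nv vD))) ;;
  vsum vR (nv vD) xZ (RMul indic (rld yCs (nv vR))) ;;
  rset0 xTr (RSub (rv xZ1) (rv xZ))) h Q"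
 proof (rule ht_seq, rule ht_vmap[where n = d and ?b0.0 = 0 and f = "%r. real (b r) * real Xn ^ r"], goal_cases)
  case (3 k h1)
  have a1: "acfg h1" by (rule acfg_same[OF a 3(2)]) auto
  show ?case using 3(1,3) lo hi sameN[OF 3(2), of vLo] sameN[OF 3(2), of vHi]
  by (auto simp: cst_D[OF acfg_cst[OF a1]] acfg_XP[OF a1] b_def)
 next
  case (4 h1)
  note h1 = 4
  have a1: "acfg h1" by (rule acfg_same[OF a h1(1)]) auto
  show ?case
  proof (rule ht_seq, rule ht_applyT[OF acfg_cst[OF a1] acfg_T[OF a1]], goal_cases)
  case (1 h2)
  note h2 = 1
  have a2: "acfg h2" by (rule acfg_same[OF a1 h2(1)]) auto
  show ?case
  proof (rule ht_seq, rule ht_applyT[OF acfg_cst[OF a2] acfg_T[OF a2]], goal_cases)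
  case (1 h3)
  note h3 = 1
  have a3: "acfg h3" by (rule acfg_same[OF a2 h3(1)]) auto
  have S3: "same ?X ?Y h h3"
  by (rule same_trans[OF same_trans[OF same_weaken[OF h1(1)] same_weaken[OF h2(1)]] same_weaken[OF h3(1)]]) auto
  have Y3: "RA h3 yY i = (\<Sum>j<d. real (Wn i j) * (real (b j) * real Xn ^ j))" if "i < d" for i
  unfolding h3(3) h2(3) W[OF that] using h1(3) by simp
  show ?case
  proof (rule ht_seq, rule ht_vsum[where n = d and f =
  "%i. real (b i) * (\<Sum>j<d. real (Wn i j) * (real (b j) * real Xn ^ j)) * real Xn ^ (d - i)"], goal_cases)
  case (3 k h4)
  have a4: "acfg h4" by (rule acfg_same[OF a3 3(2)]) auto
  have S4: "same ?X ?Y h h4" by (rule same_trans[OF S3 same_weaken[OF 3(2)]]) auto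
  show ?case using 3(1,3) lo hi Y3[of k] sameN[OF S4, of vLo] sameN[OF S4, of vHi] sameR[OF 3(2), of yY]
  by (auto simp: cst_D[OF acfg_cst[OF a4]] acfg_XP[OF a4] ind[symmetric])
  next
  case (4 h4)
  note h4 = 4
  have a4: "acfg h4" by (rule acfg_same[OF a3 h4(1)]) auto
  have S4: "same ?X ?Y h h4" by (rule same_trans[OF S3 same_weaken[OF h4(1)]]) auto
  have Z4: "RA h4 xZ 0 = real Z"
  unfolding h4(3) Z_def by (simp add: sum_distrib_left sum_distrib_right mult.assoc)
  have k4: "clk h4 <= clk h + 2 * (T * (tM + 2)) + 6 * d + 9" using h1(2) h2(2) h3(2) h4(2) by simp
  show ?case
  proof (intro ht_seq ht_rst, goal_cases)
  case 2
  define h5 where "h5 = tick (rset xP0 (nval (NConst 0) (lay h4)) (rval (rld yXP (NAdd (nv vD) (NConst 1))) (lay h4)) h4)"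
  have h5: "RA h5 xP0 0 = real Xn ^ Suc d" "RA h5 xZ 0 = real Z" "same ?X ?Y h h5" "acfg h5"
  "clk h5 = Suc (clk h4)"
  using S4 a4 Z4 by (auto simp: h5_def cst_D[OF acfg_cst[OF a4]] acfg_XP[OF a4])
  show ?case unfolding h5_def[symmetric]
  proof (rule ht_modred[where w = "wx * d"], goal_cases)
  case 3
  have "real Z < real Xn ^ (2 * d + 1)" using HL(4) by (metis of_nat_less_iff of_nat_power)
  also have "... = real Xn ^ Suc d * real Xn ^ d" by (simp add: mult_2 power_add)
  also have "... <= real Xn ^ Suc d * 2 ^ (wx * d)" using pw[of d] by (intro mult_left_mono) auto
  finally show ?case unfolding h5 .
  next
  case (4 h6 N)
  note h6 = this
  have "N = Hi"
  proof (rule multiple_remainder_unique)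
  show "real Z = real Hi * real Xn ^ Suc d + (real c * real Xn ^ d + real Lo)" unfolding HL(1) by simp
  have "real (c * Xn ^ d + Lo) < real (Xn ^ Suc d)" using HL(3) by (rule less_imp_of_nat_less)
  then show "real c * real Xn ^ d + real Lo < real Xn ^ Suc d" by simp
  qed (use h6 h5 in auto)
  then have Z6: "RA h6 xZ 0 = real c * real Xn ^ d + real Lo"
  unfolding h6(3) h5 HL(1) by simp
  have a6: "acfg h6" by (rule acfg_same[OF h5(4) h6(1)]) auto
  have S6: "same ?X ?Y h h6" by (rule same_trans[OF h5(3) same_weaken[OF h6(1)]]) auto
  show ?case
  proof (intro ht_seq ht_rst, goal_cases)
  case 3
  define h7 where "h7 = tick (rset xZ1 (nval (NConst 0) (lay h6)) (rval (rv xZ) (lay h6)) h6)"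
  define h8 where "h8 = tick (rset xP0 (nval (NConst 0) (lay h7)) (rval (rld yXP (nv vD)) (lay h7)) h7)"
  have h8: "RA h8 xP0 0 = real Xn ^ d" "RA h8 xZ 0 = real c * real Xn ^ d + real Lo"
  "RA h8 xZ1 0 = real c * real Xn ^ d + real Lo" "same ?X ?Y h h8" "acfg h8"
  "clk h8 = clk h6 + 2"
  using S6 a6 Z6 by (auto simp: h8_def h7_def cst_D[OF acfg_cst[OF a6]] acfg_XP[OF a6])
  show ?case unfolding h7_def[symmetric] h8_def[symmetric]
  proof (rule ht_modred[where w = "wx"], goal_cases)
  case 3
  have "real (c * Xn ^ d + Lo) < real (Xn ^ Suc d)" using HL(3) by (rule less_imp_of_nat_less)
  also have "... = real Xn ^ d * real Xn ^ 1" by simp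
  also have "... <= real Xn ^ d * 2 ^ (wx * 1)" by (intro mult_left_mono pw) auto
  finally show ?case unfolding h8 by simp
  next
  case (4 h9 N')
  note h9 = this
  have "N' = c"
  proof (rule multiple_remainder_unique)
  have "real Lo < real (Xn ^ d)" using HL(2) by (rule less_imp_of_nat_less)
  then show "real Lo < real Xn ^ d" by simp
  qed (use h9 h8 in auto)
  then have Z9: "RA h9 xZ 0 = real Lo" unfolding h9(3) h8 by simp
  have a9: "acfg h9" by (rule acfg_same[OF h8(5) h9(1)]) auto
  have S9: "same ?X ?Y h h9" by (rule same_trans[OF h8(4) same_weaken[OF h9(1)]]) auto
  define hA where "hA = tick (rset xZ1 (nval (NConst 0) (lay h9))
  (rval (RDiv (RSub (rv xZ1) (rv xZ)) (rld yXP (nv vD))) (lay h9)) h9)"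
  have hA: "RA hA xZ1 0 = real c" "same ?X ?Y h hA" "acfg hA" "clk hA = Suc (clk h9)"
  using S9 a9 Z9 h8(3) X0 sameR[OF h9(1), of xZ1]
  by (auto simp: hA_def cst_D[OF acfg_cst[OF a9]] acfg_XP[OF a9])
  show ?case
  proof (intro ht_seq ht_rst, goal_cases)
  case 2
  show ?case unfolding hA_def[symmetric]
  proof (rule ht_vsum[where n = d and f = "%i. real (b i) * C i"], goal_cases)
  case (3 k hB)
  have aB: "acfg hB" by (rule acfg_same[OF hA(3) 3(2)]) auto
  have SB: "same ?X ?Y h hB" by (rule same_trans[OF hA(2) same_weaken[OF 3(2)]]) auto
  show ?case using 3(1,3) lo hi C sameN[OF SB, of vLo] sameN[OF SB, of vHi] sameR[OF SB, of yCs]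
  by (auto simp: cst_D[OF acfg_cst[OF aB]] ind[symmetric])
  next
  case (4 hB)
  note hB = this
  show ?case
  proof (rule ht_rst, goal_cases)
  case 2
  have SB: "same ?X ?Y h hB" by (rule same_trans[OF hA(2) same_weaken[OF hB(1)]]) auto
  have r: "real c - (\<Sum>i<d. real (b i) * C i) = bsum C lo hi"
  unfolding bsum_def c_def ind by (simp add: algebra_simps sum_subtractf)
  show ?case
  proof (rule post)
  show "RA (tick (rset xTr (nval (NConst 0) (lay hB)) (rval (RSub (rv xZ1) (rv xZ)) (lay hB)) hB)) xTr 0 = bsum C lo hi"
  using hA(1) hB(3) r sameR[OF hB(1), of xZ1] by simp
  show "clk (tick (rset xTr (nval (NConst 0) (lay hB)) (rval (RSub (rv xZ1) (rv xZ)) (lay hB)) hB)) <= clk h + tTr"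
  using k4 h5(5) h6(2) h8(6) h9(2) hA(4) hB(2) by (simp add: tTr_def tM_def algebra_simps)
  qed (use SB in simp)
  qed simp
  qed auto
  qed auto
  qed (use h8 X0 in auto)
  qed auto
  qed (use h5 X0 in auto)
  qed auto
  qed auto
  qed
  qed
 qed auto
qed

end

section \<open>Choice of a pivot by bisection\<close>

context attempt
begin

text \<open>The block starts with a power of two at least \<open>d\<close> and is halved until one
  index is left. A natural number cannot be halved by the machine, so the half length
  \<open>vH\<close> is recovered by doubling from 1.\<close>

definition select :: prog where
 "select =
  nset0 vLen (NConst 1) ;; Loop (NLess (nv vLen) (nv vD)) (nset0 vLen (NAdd (nv vLen) (nv vLen))) ;;
  nset0 vBlo (NConst 0) ;;
  Loop (NLess (NConst 1) (nv vLen))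
  (nset0 vH (NConst 1) ;;
  Loop (NLess (NAdd (nv vH) (nv vH)) (nv vLen)) (nset0 vH (NAdd (nv vH) (nv vH))) ;;
  nset0 vLo (nv vBlo) ;; nset0 vHi (NAdd (nv vBlo) (nv vH)) ;; trace ;; rset0 xTA (rv xTr) ;;
  nset0 vLo (NAdd (nv vBlo) (nv vH)) ;; nset0 vHi (NAdd (NAdd (nv vBlo) (nv vH)) (nv vH)) ;; trace ;;
  rset0 xTB (rv xTr) ;;
  Cond (RLess (rv xTA) (rv xTB)) (nset0 vBlo (NAdd (nv vBlo) (nv vH))) Skip ;;
  nset0 vLen (nv vH))"

lemma bsum_split: "bsum C lo (lo + a + b) = bsum C lo (lo + a) + bsum C (lo + a) (lo + a + b)"
 unfolding bsum_def sum.distrib[symmetric] by (intro sum.cong refl) auto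

lemma bsum_singleton: "bsum C p (Suc p) = (if p < d then real (Wn p p) - C p else 0)"
proof -
 have "bsum C p (Suc p) = (\<Sum>i<d. if i = p then real (Wn i i) - C i else 0)"
  unfolding bsum_def by (intro sum.cong refl) auto
 then show ?thesis by simp
qed

lemma bsum_beyond: "d <= hi ==> bsum C 0 hi = bsum C 0 d"
 unfolding bsum_def by (intro sum.cong refl) auto

lemma ht_double_to:
 assumes v: "v < arrs" and e: "!!h'. same {v} {} h h' ==> nval e (lay h') = m"
  and h1: "NA h v 0 = 1" and lg: "m <= 2 ^ lg"
  and post: "!!h' j. same {v} {} h h' ==> clk h' <= clk h + 2 * lg + 1 ==> NA h' v 0 = 2 ^ j ==> m <= 2 ^ j ==>
  j = 0 \<or> 2 ^ j < 2 * m ==> Q h'"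
 shows "ht (Loop (NLess (nv v) e) (nset0 v (NAdd (nv v) (nv v)))) h Q"
proof (rule ht_while[where I = "%h'. same {v} {} h h' & (\<exists>j. NA h' v 0 = 2 ^ j & clk h' = clk h + 2 * j &
  j <= lg & (j = 0 \<or> 2 ^ j < 2 * m))" and \<mu> = "%h'. clk h + 2 * lg + 1 - clk h'"], goal_cases)
 case 1
 then show ?case using h1 by auto
next
 case (2 h')
 then obtain j where j: "NA h' v 0 = 2 ^ j" "clk h' = clk h + 2 * j" "j <= lg" and S: "same {v} {} h h'" by auto
 have lt: "2 ^ j < m" using 2(2) v j e[OF S] by simp
 with lg have "(2::nat) ^ j < 2 ^ lg" by linarith
 then have jl: "j < lg" by simp
 show ?case
  by (rule ht_nst) (use v j S lt jl in \<open>auto intro!: exI[of _ "Suc j"]\<close>)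
next
 case (3 h')
 then obtain j where j: "NA h' v 0 = 2 ^ j" "clk h' = clk h + 2 * j" "j <= lg" and S: "same {v} {} h h'"
  and jj: "j = 0 \<or> 2 ^ j < 2 * m" by auto
 have "m <= 2 ^ j" using 3(2) v j e[OF S] by simp
 then show ?case using S j jj by (intro post[of _ j]) auto
qed

abbreviation "selN == {vP, vR, vT1, vLen, vBlo, vH, vLo, vHi}"
abbreviation "selR == {xAcc, yU, yV, yY, xZ, xZ1, xP, xP0, xTr, xTA, xTB}"

text \<open>The larger of two numbers is at least half their sum, whatever their signs.\<close>

lemma ht_select_step:
 assumes a: "acfg h" and C: "RA h yCs = C" and len: "NA h vLen 0 = 2 ^ Suc j" and lo: "NA h vBlo 0 = lo"
  and post: "!!h'. same selN selR h h' ==> clk h' <= clk h + 2 * tTr + 2 * j + 12 ==> NA h' vLen 0 = 2 ^ j ==>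
  bsum C lo (lo + 2 ^ Suc j) <= 2 * bsum C (NA h' vBlo 0) (NA h' vBlo 0 + 2 ^ j) ==> Q h'"
 shows "ht (nset0 vH (NConst 1) ;;
  Loop (NLess (NAdd (nv vH) (nv vH)) (nv vLen)) (nset0 vH (NAdd (nv vH) (nv vH))) ;;
  nset0 vLo (nv vBlo) ;; nset0 vHi (NAdd (nv vBlo) (nv vH)) ;; trace ;; rset0 xTA (rv xTr) ;;
  nset0 vLo (NAdd (nv vBlo) (nv vH)) ;; nset0 vHi (NAdd (NAdd (nv vBlo) (nv vH)) (nv vH)) ;; trace ;;
  rset0 xTB (rv xTr) ;;
  Cond (RLess (rv xTA) (rv xTB)) (nset0 vBlo (NAdd (nv vBlo) (nv vH))) Skip ;;
  nset0 vLen (nv vH)) h Q"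
proof (intro ht_seq ht_nst, goal_cases)
 case 2
 show ?case
 proof (rule ht_while[where I = "%h'. same selN selR h h' & NA h' vLen 0 = 2 ^ Suc j & NA h' vBlo 0 = lo &
  RA h' yCs = C & (\<exists>i\<le>j. NA h' vH 0 = 2 ^ i & clk h' = clk h + 2 * i + 1)" and \<mu> = "%h'. clk h + 2 * j + 2 - clk h'"],
  goal_cases)
  case 1
  then show ?case using C len lo by auto
 next
  case (2 h')
  then obtain i where i: "i <= j" "NA h' vH 0 = 2 ^ i" "clk h' = clk h + 2 * i + 1" by auto
  have "(2::nat) ^ Suc i < 2 ^ Suc j" using 2(2) i(2) 2(1) by (simp add: mult_2)
  then have "i < j" using power_less_imp_less_exp[of "2::nat" "Suc i" "Suc j"] by simp
  then have "Suc i <= j" by simp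
  then show ?case using 2 i by (intro ht_nst) (auto intro!: exI[of _ "Suc i"])
 next
  case (3 h1)
  then obtain i where i: "i <= j" "NA h1 vH 0 = 2 ^ i" "clk h1 = clk h + 2 * i + 1" by auto
  have "\<not> (2::nat) ^ Suc i < 2 ^ Suc j" using 3(2) i(2) 3(1) by (simp add: mult_2)
  then have "i = j" using i by simp
  with i 3 have h1: "same selN selR h h1" "NA h1 vBlo 0 = lo" "RA h1 yCs = C" "NA h1 vH 0 = 2 ^ j"
  "clk h1 = clk h + 2 * j + 1" by auto
  have a1: "acfg h1" by (rule acfg_same[OF a h1(1)]) auto
  show ?case
  proof (intro ht_seq ht_nst, goal_cases)
  case 3
  show ?case
  proof (rule ht_trace[where lo = lo and hi = "lo + 2 ^ j" and C = C], goal_cases)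
  case (5 h2)
  note h2 = this
  have S2: "same selN selR h h2"
  by (rule same_trans[OF h1(1)], rule same_weaken[of "{vP, vR, vT1, vLo, vHi}" "{xAcc, yU, yV, yY, xZ, xZ1, xP, xP0, xTr}"])
  (use h2(1) in \<open>auto simp: same_def\<close>)
  have a2: "acfg h2" by (rule acfg_same[OF a S2]) auto
  have v2: "NA h2 vBlo 0 = lo" "NA h2 vH 0 = 2 ^ j" "RA h2 yCs = C"
  using h1 h2 sameN[OF h2(1), of vBlo] sameN[OF h2(1), of vH] sameR[OF h2(1), of yCs] by auto
  show ?case
  proof (intro ht_seq ht_rst ht_nst, goal_cases)
  case 4
  show ?case
  proof (rule ht_trace[where lo = "lo + 2 ^ j" and hi = "lo + 2 ^ j + 2 ^ j" and C = C], goal_cases)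
  case (5 h3)
  note h3 = this
  have S3: "same selN selR h h3"
  by (rule same_trans[OF S2], rule same_weaken[of "{vP, vR, vT1, vLo, vHi}" "{xAcc, yU, yV, yY, xZ, xZ1, xP, xP0, xTr, xTA}"])
  (use h3(1) in \<open>auto simp: same_def\<close>)
  have v3: "NA h3 vBlo 0 = lo" "NA h3 vH 0 = 2 ^ j" "RA h3 xTA 0 = bsum C lo (lo + 2 ^ j)"
  using v2 h2(3) sameN[OF h3(1), of vBlo] sameN[OF h3(1), of vH] sameR[OF h3(1), of xTA] by auto
  have sp: "bsum C lo (lo + 2 ^ Suc j) = bsum C lo (lo + 2 ^ j) + bsum C (lo + 2 ^ j) (lo + 2 ^ j + 2 ^ j)"
  using bsum_split[of C lo "2 ^ j" "2 ^ j"] by (simp add: mult_2 add.assoc)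
  have k: "clk h3 <= clk h + 2 * tTr + 2 * j + 7" using h1(5) h2(2) h3(2) by simp
  show ?case
  proof (intro ht_seq ht_rst ht_cond ht_nst ht_skip, goal_cases)
  case 4
  show ?case
  by (rule post) (use S3 v3 h3(3) k sp 4(1) in auto)
  next
  case 6
  show ?case
  by (rule post) (use S3 v3 h3(3) k sp 6(1) in auto)
  qed auto
  qed (use a2 v2 in auto)
  qed auto
  qed (use a1 h1 in auto)
  qed auto
 qed
qed auto

text \<open>Each halving loses at most a factor 2 and 2^J <= 2 d for the number J of halvings, so
  the last index carries at least the share 1/(2d) of the residual trace. The alternative
  \<open>bsum C 0 d <= 0\<close> is for a negative final value, where 2^J may not be replaced by 2
  d.\<close>

lemma ht_select:
 assumes a: "acfg h" and C: "RA h yCs = C" and lg: "d <= 2 ^ lg" and d: "0 < d"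
  and post: "!!h'. same selN selR h h' ==> clk h' <= clk h + (lg + 1) * (2 * tTr + 2 * lg + 20) ==>
  bsum C 0 d <= 2 * real d * bsum C (NA h' vBlo 0) (Suc (NA h' vBlo 0)) \<or> bsum C 0 d <= 0 ==> Q h'"
 shows "ht select h Q"
 unfolding select_def
proof (intro ht_seq ht_nst, goal_cases)
 case 2
 define h1 where "h1 = tick (nset vLen (nval (NConst 0) (lay h)) (nval (NConst 1) (lay h)) h)"
 show ?case unfolding h1_def[symmetric]
 proof (rule ht_double_to[where m = d and lg = lg], goal_cases)
  case (2 h')
  have "acfg h'" by (rule acfg_same[OF _ 2]) (use a in \<open>auto simp: h1_def\<close>)
  then show ?case by (simp add: cst_D acfg_cst)
 next
  case (5 h2 J)
  note h2 = this
  have S2: "same selN selR h h2"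
  by (rule same_trans[OF _ same_weaken[OF h2(1)]]) (auto simp: h1_def)
  have C2: "RA h2 yCs = C" using sameR[OF S2, of yCs] C by simp
  have Jl: "J <= lg"
  proof (cases "J = 0")
  case False
  then have "(2::nat) ^ J < 2 * 2 ^ lg" using h2(5) lg by linarith
  then show ?thesis using power_less_imp_less_exp[of "2::nat" J "Suc lg"] by simp
  qed simp
  have J2: "2 ^ J <= 2 * d" using h2(5) d by auto
  define B where "B = 2 * tTr + 2 * lg + 14"
  have k2: "clk h2 <= clk h + 2 * lg + 2" using h2(2) by (simp add: h1_def)
  show ?case
  proof (intro ht_nst ht_seq, goal_cases)
  case 2
  show ?case
  proof (rule ht_while[where I = "%h'. same selN selR h h' & RA h' yCs = C & (\<exists>j\<le>J. NA h' vLen 0 = 2 ^ j &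
  clk h' + j * B <= clk h + 2 * lg + 3 + J * B &
  2 ^ j * bsum C 0 d <= 2 ^ J * bsum C (NA h' vBlo 0) (NA h' vBlo 0 + 2 ^ j) &
  (j = J --> NA h' vBlo 0 = 0))"
  and \<mu> = "%h'. NA h' vLen 0"], goal_cases)
  case 1
  show ?case using S2 C2 h2(3) k2 bsum_beyond[OF h2(4), of C] by auto
  next
  case (2 h')
  then obtain j where S: "same selN selR h h'" and C': "RA h' yCs = C" and j: "j <= J" "NA h' vLen 0 = 2 ^ j"
  "clk h' + j * B <= clk h + 2 * lg + 3 + J * B"
  "2 ^ j * bsum C 0 d <= 2 ^ J * bsum C (NA h' vBlo 0) (NA h' vBlo 0 + 2 ^ j)" by blast
  have "j ~= 0" using 2(2) j(2) by (intro notI) simp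
  then obtain i where i: "j = Suc i" by (cases j) auto
  have a': "acfg (tick h')" using acfg_same[OF a S] by auto
  show ?case
  proof (rule ht_select_step[OF a', where C = C and j = i and lo = "NA h' vBlo 0"], goal_cases)
  case (4 h3)
  have S3: "same selN selR h h3" by (rule same_trans[OF S]) (use 4(1) in simp)
  have C3: "RA h3 yCs = C" using sameR[OF S3, of yCs] C by simp
  have "clk h3 + i * B <= clk h + 2 * lg + 3 + J * B"
  using 4(2) j(3) i j(1) Jl by (simp add: B_def)
  moreover have "2 ^ i * bsum C 0 d <= 2 ^ J * bsum C (NA h3 vBlo 0) (NA h3 vBlo 0 + 2 ^ i)"
  proof -
  have "2 * (2 ^ i * bsum C 0 d) <= 2 ^ J * bsum C (NA h' vBlo 0) (NA h' vBlo 0 + 2 ^ Suc i)"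
  using j(4) by (simp add: i)
  also have "... <= 2 ^ J * (2 * bsum C (NA h3 vBlo 0) (NA h3 vBlo 0 + 2 ^ i))"
  using 4(4) by (intro mult_left_mono) auto
  finally show ?thesis by simp
  qed
  ultimately show ?case using S3 C3 4(3) i j by auto
  qed (use j i C' in auto)
  next
  case (3 h')
  then obtain j where S: "same selN selR h h'" and j: "j <= J" "NA h' vLen 0 = 2 ^ j"
  "clk h' + j * B <= clk h + 2 * lg + 3 + J * B"
  "2 ^ j * bsum C 0 d <= 2 ^ J * bsum C (NA h' vBlo 0) (NA h' vBlo 0 + 2 ^ j)" by blast
  have "\<not> (1::nat) < 2 ^ j" using 3(2) j(2) by simp
  then have j0: "j = 0" using one_less_power[of "2::nat" j] by auto
  have "J * B <= lg * B" using Jl by simp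
  then have kk: "clk (tick h') <= clk h + (lg + 1) * (2 * tTr + 2 * lg + 20)"
  using j(3) j0 by (simp add: B_def algebra_simps)
  define s where "s = bsum C (NA h' vBlo 0) (Suc (NA h' vBlo 0))"
  have le: "bsum C 0 d <= 2 ^ J * s" using j(4) j0 by (simp add: s_def)
  show ?case
  proof (rule post)
  show "bsum C 0 d <= 2 * real d * bsum C (NA (tick h') vBlo 0) (Suc (NA (tick h') vBlo 0)) \<or> bsum C 0 d <= 0"
  proof (cases "0 <= s")
  case True
  have "(2::real) ^ J <= 2 * real d" using J2 by (metis of_nat_le_iff of_nat_mult of_nat_numeral of_nat_power)
  then have "2 ^ J * s <= 2 * real d * s" using True by (intro mult_right_mono)
  then show ?thesis using le by (simp add: s_def)
  next
  case False
  then have "2 ^ J * s <= 0" by (intro mult_nonneg_nonpos) auto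
  then show ?thesis using le by simp
  qed
  qed (use S kk in auto)
  qed
  qed auto
 qed (use lg in \<open>auto simp: h1_def\<close>)
qed auto

end

section \<open>Pivoted Gram-Schmidt\<close>

context attempt
begin

abbreviation AT :: "(nat => real) => nat => real" where "AT f == (sop d St ^^ T) f"

lemma sop_pow_cong:
 "(!!r. r < d ==> f r = g r) ==> r < d ==> (sop d St ^^ k) f r = (sop d St ^^ k) g r"
proof (induction k arbitrary: r)
 case (Suc k)
 then have "mv d St ((sop d St ^^ k) f) = mv d St ((sop d St ^^ k) g)"
  unfolding mv_def by simp
 moreover have "(sop d St ^^ Suc k) f r = mv d St ((sop d St ^^ k) f) r" for f
  using Suc.prems by (simp add: sop_def[of d St "(sop d St ^^ k) f"])
 ultimately show ?case by simp
qed simp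

text \<open>Vectors are stored one behind the other; the offsets \<open>l * d\<close> are tabulated
  in \<open>vBB\<close>, as no product can be formed in an address.\<close>

definition gst :: "hst => nat => (nat => nat => real) => (nat => nat => real) => (nat => real) => bool" where
 "gst h J b c nrm \<longleftrightarrow> NA h vJ 0 = J & NA h vBase 0 = J * d & (\<forall>l<J. NA h vBB l = l * d) &
  (\<forall>l<J. \<forall>r<d. RA h yB (l * d + r) = b l r) & (\<forall>l<J. \<forall>r<d. RA h yC (l * d + r) = c l r) &
  (\<forall>l<J. RA h yNrm l = nrm l)"

lemma gst_same: "gst h J b c nrm ==> same X Y h h' ==> X \<inter> {vJ, vBase, vBB} = {} ==> Y \<inter> {yB, yC, yNrm} = {} ==>
  gst h' J b c nrm"
proof -
 assume a: "gst h J b c nrm" "same X Y h h'" "X \<inter> {vJ, vBase, vBB} = {}" "Y \<inter> {yB, yC, yNrm} = {}"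
 have "NA h' vJ = NA h vJ" "NA h' vBase = NA h vBase" "NA h' vBB = NA h vBB"
  "RA h' yB = RA h yB" "RA h' yC = RA h yC" "RA h' yNrm = RA h yNrm"
  using a by (auto intro!: sameN[of X Y h h'] sameR[of X Y h h'])
 then show ?thesis using a(1) by (simp add: gst_def)
qed

text \<open>In place of a square root: a power of two s with s^2 <= nr < 4 s^2, so that division by
  s brings a squared norm into [1, 4). For nr < 4 the loop stops at 1.\<close>

definition scale_loop :: prog where
 "scale_loop = rset0 xS (Rc 1) ;;
 Loop (TNot (RLess (rv xNr) (RMul (RMul (rv xS) (rv xS)) (Rc 4)))) (rset0 xS (RAdd (rv xS) (rv xS)))"

lemma ht_scale_loop:
 assumes nr: "RA h xNr 0 = nr" "nr <= 2 ^ w"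
  and post: "!!h' s. same {} {xS} h h' ==> clk h' <= clk h + 2 * w + 2 ==> RA h' xS 0 = s ==> 1 <= s ==>
  s = 1 \<or> s * s <= nr ==> nr < 4 * (s * s) ==> Q h'"
 shows "ht scale_loop h Q"
 unfolding scale_loop_def
proof (intro ht_seq ht_rst, goal_cases)
 case 2
 have I: "same {} {xS} h h' & (\<exists>j\<le>w. RA h' xS 0 = 2 ^ j & clk h' = clk h + 1 + 2 * j & (j = 0 \<or> 4 ^ j <= nr))
  ==> \<exists>j\<le>w. same {} {xS} h h' & RA h' xS 0 = 2 ^ j & clk h' = clk h + 1 + 2 * j & (j = 0 \<or> 4 ^ j <= nr) & RA h' xNr 0 = nr"
  for h' using nr sameR[of "{}" "{xS}" h h' xNr] by auto
 have sq: "(2::real) ^ j * 2 ^ j = 4 ^ j" for j by (simp add: power_mult_distrib[symmetric])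
 show ?case
 proof (rule ht_while[where I = "%h'. same {} {xS} h h' & (\<exists>j\<le>w. RA h' xS 0 = 2 ^ j &
  clk h' = clk h + 1 + 2 * j & (j = 0 \<or> 4 ^ j <= nr))" and \<mu> = "%h'. clk h + 2 * w + 2 - clk h'"], goal_cases)
  case 1
  then show ?case by auto
 next
  case (2 h')
  from I[OF 2(1)] obtain j where j: "j <= w" "same {} {xS} h h'" "RA h' xS 0 = 2 ^ j" "clk h' = clk h + 1 + 2 * j"
  "RA h' xNr 0 = nr" by blast
  have le: "4 ^ Suc j <= nr" using 2(2) j(3,5) by (simp add: sq mult.commute)
  have "(2::real) ^ Suc (Suc (2 * j)) = 4 ^ Suc j" by (simp add: power_mult)
  then have "(2::real) ^ Suc (Suc (2 * j)) <= 2 ^ w" using le nr(2) by linarith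
  then have "Suc (Suc (2 * j)) <= w" by (rule power_le_imp_le_exp[rotated]) simp
  then show ?case using j le by (intro ht_rst) (auto intro!: exI[of _ "Suc j"])
 next
  case (3 h')
  from I[OF 3(1)] obtain j where j: "j <= w" "same {} {xS} h h'" "RA h' xS 0 = 2 ^ j" "clk h' = clk h + 1 + 2 * j"
  "j = 0 \<or> 4 ^ j <= nr" "RA h' xNr 0 = nr" by blast
  show ?case
  by (rule post[of _ "2 ^ j"]) (use j 3(2) in \<open>auto simp: sq mult.commute\<close>)
 qed
qed auto

text \<open>With each \<open>b\<close> its image \<open>c\<close> under \<open>St\<close>^T is kept.
  By symmetry the coefficient of column p of \<open>St\<close>^T along \<open>b\<close> is entry p
  of \<open>c\<close>, up to the division by \<open>nrm\<close>; so later columns are orthogonalised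
  without inner products, and c^2/nrm, entry by entry, is what the diagonal \<open>yCs\<close>
  gains.\<close>

definition gram_step :: prog where
 "gram_step =
  nset0 vLo (nv vBlo) ;; nset0 vHi (NAdd (nv vBlo) (NConst 1)) ;;
  vmap vR (nv vD) yY (NConst 0) indic ;; applyT ;;
  for_loop vL (nv vJ)
  (rset0 xCoef (RDiv (rld yC (NAdd (nld vBB (nv vL)) (nv vBlo))) (rld yNrm (nv vL))) ;;
  vmap vR (nv vD) yY (NConst 0)
  (RSub (rld yY (nv vR)) (RMul (rv xCoef) (rld yB (NAdd (nld vBB (nv vL)) (nv vR)))))) ;;
  vsum vR (nv vD) xNr (RMul (rld yY (nv vR)) (rld yY (nv vR))) ;;
  scale_loop ;;
  vmap vR (nv vD) yY (NConst 0) (RDiv (rld yY (nv vR)) (rv xS)) ;;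
  vmap vR (nv vD) yB (nv vBase) (rld yY (nv vR)) ;;
  applyT ;;
  vmap vR (nv vD) yC (nv vBase) (rld yY (nv vR)) ;;
  rst yNrm (nv vJ) (RDiv (rv xNr) (RMul (rv xS) (rv xS))) ;;
  vmap vR (nv vD) yCs (NConst 0)
  (RAdd (rld yCs (nv vR)) (RDiv (RMul (rld yY (nv vR)) (rld yY (nv vR))) (rld yNrm (nv vJ)))) ;;
  nst vBB (nv vJ) (nv vBase) ;; nset0 vBase (NAdd (nv vBase) (nv vD)) ;; nset0 vJ (NAdd (nv vJ) (NConst 1))"

definition tGS :: "nat => nat" where
 "tGS J = (2 * T + 2) * (tM + 2) + (J + 8) * (3 * d + 6) + 2 * wx + 30"

abbreviation "gsN == {vP, vR, vT1, vLo, vHi, vL, vBB, vBase, vJ}"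
abbreviation "gsR == {xAcc, yU, yV, yY, xCoef, xNr, xS, yB, yC, yNrm, yCs}"

definition residual :: "nat => (nat => nat => real) => (nat => nat => real) => (nat => real) => nat => nat => real" where
 "residual J b c nrm p = (%r. AT (%r. of_bool (r = p)) r - (\<Sum>l<J. c l p / nrm l * b l r))"


lemma index_block_less: "l < J ==> r < d ==> l * d + r < J * d"
proof -
 assume "l < J" "r < d"
 then have "l * d + r < Suc l * d" "Suc l * d <= J * d" by (simp, intro mult_le_mono1, simp)
 then show ?thesis by linarith
qed

lemma ht_gram_step:
 assumes a: "acfg h" and g: "gst h J b c nrm" and C: "RA h yCs = C" and p: "NA h vBlo 0 = p" "p < d"
  and nr: "ip d (residual J b c nrm p) (residual J b c nrm p) = nr" "nr <= 2 ^ wx"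
  and post: "!!h' s C' b' c' nrm'. same gsN gsR h h' ==> clk h' <= clk h + tGS J ==>
  1 <= s ==> s = 1 \<or> s * s <= nr ==> nr < 4 * (s * s) ==>
  b' = (%r. residual J b c nrm p r / s) ==> c' = AT b' ==> nrm' = nr / (s * s) ==>
  gst h' (Suc J) (b(J := b')) (c(J := c')) (nrm(J := nrm')) ==>
  RA h' yCs = C' ==> (!!r. r < d ==> C' r = C r + c' r * c' r / nrm') ==> Q h'"
 shows "ht gram_step h Q"
 unfolding gram_step_def
proof (intro ht_seq ht_nst, goal_cases)
 case 3
 define e where "e = (%r. of_bool (r = p) :: real)"
 define h1 where "h1 = tick (nset vHi (nval (NConst 0) (lay (tick (nset vLo (nval (NConst 0) (lay h)) (nval (nv vBlo) (lay h)) h))))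
  (nval (NAdd (nv vBlo) (NConst 1)) (lay (tick (nset vLo (nval (NConst 0) (lay h)) (nval (nv vBlo) (lay h)) h))))
  (tick (nset vLo (nval (NConst 0) (lay h)) (nval (nv vBlo) (lay h)) h)))"
 have h1: "same gsN gsR h h1" "acfg h1" "NA h1 vLo 0 = p" "NA h1 vHi 0 = Suc p" "clk h1 = clk h + 2"
  using a p by (auto simp: h1_def)
 show ?case unfolding h1_def[symmetric]
 proof (rule ht_vmap[where n = d and ?b0.0 = 0 and f = e], goal_cases)
  case (3 k h2)
  have a2: "acfg h2" by (rule acfg_same[OF h1(2) 3(2)]) auto
  show ?case using 3(3) h1(3,4) sameN[OF 3(2), of vLo] sameN[OF 3(2), of vHi]
  by (auto simp: cst_D[OF acfg_cst[OF a2]] e_def)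
 next
  case (4 h2)
  note h2 = 4
  have a2: "acfg h2" by (rule acfg_same[OF h1(2) h2(1)]) auto
  have S2: "same gsN gsR h h2" by (rule same_trans[OF h1(1) same_weaken[OF h2(1)]]) auto
  show ?case
  proof (rule ht_seq, rule ht_applyT[OF acfg_cst[OF a2] acfg_T[OF a2]], goal_cases)
  case (1 h3)
  note h3 = 1
  have a3: "acfg h3" by (rule acfg_same[OF a2 h3(1)]) auto
  have S3: "same gsN gsR h h3" by (rule same_trans[OF S2 same_weaken[OF h3(1)]]) auto
  have g3: "gst h3 J b c nrm"
  by (rule gst_same[OF gst_same[OF gst_same[OF g, of "{vLo, vHi}" "{}" h1] h2(1)] h3(1)]) (auto simp: h1_def)
  have Y3: "RA h3 yY r = AT e r" if "r < d" for r
  unfolding h3(3) by (rule sop_pow_cong) (use h2(3) that in auto)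
  define u where "u = (%k r. AT e r - (\<Sum>l<k. c l p / nrm l * b l r))"
  have uJ: "residual J b c nrm p = u J" by (simp add: residual_def u_def e_def)
  have p3: "NA h3 vBlo 0 = p" using sameN[OF S3, of vBlo] p by simp
  show ?case
  proof (rule ht_seq, rule ht_for[where n = J and I = "%k h'. same {vL, vR} {xCoef, yY} h3 h' &
  clk h' <= clk h3 + k * (3 * d + 5) + 1 & (\<forall>r<d. RA h' yY r = u k r)"], goal_cases)
  case 2
  then show ?case using Y3 by (auto simp: u_def)
  next
  case (3 k h')
  then show ?case using g3 sameN[of "{vL, vR}" "{xCoef, yY}" h3 h' vJ] by (simp add: gst_def)
  next
  case (4 k h')
  then have S: "same {vL, vR} {xCoef, yY} h3 h'" by simp
  have a': "acfg h'" by (rule acfg_same[OF a3 S]) auto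
  have g': "gst h' J b c nrm" by (rule gst_same[OF g3 S]) auto
  have p': "NA h' vBlo 0 = p" using sameN[OF S, of vBlo] p3 by simp
  have coef: "RA h' yC (NA h' vBB k + p) / RA h' yNrm k = c k p / nrm k"
  using g' 4(1) p(2) by (simp add: gst_def)
  show ?case
  proof (intro ht_seq ht_rst, goal_cases)
  case 2
  show ?case
  proof (rule ht_vmap[where n = d and ?b0.0 = 0 and f = "%r. u k r - c k p / nrm k * b k r"], goal_cases)
  case (3 i h4)
  have a4: "acfg h4" by (rule acfg_same[OF _ 3(2)]) (use a' in auto)
  show ?case using 3(3) 3(4)[of i] 4 g' p' coef sameN[OF 3(2), of vL] sameN[OF 3(2), of vBB]
  sameR[OF 3(2), of yB] sameR[OF 3(2), of xCoef]
  by (auto simp: cst_D[OF acfg_cst[OF a4]] gst_def)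
  next
  case (4 h4)
  have "same {vL, vR} {xCoef, yY} h3 h4"
  by (rule same_trans[OF S]) (use 4(1) in \<open>auto simp: same_def\<close>)
  then show ?case using \<open>k < J\<close> \<open>NA h' vL 0 = k\<close> 4 sameN[OF 4(1), of vL] \<open>same _ _ h3 h' & _\<close>
  by (auto simp: u_def algebra_simps)
  qed auto
  qed auto
  next
  case (5 h4)
  note h4 = 5
  define h5 where "h5 = tick h4"
  have S45: "same {vL, vR} {xCoef, yY} h3 h5" using h4 by (simp add: h5_def)
  have a5: "acfg h5" by (rule acfg_same[OF a3 S45]) auto
  have g5: "gst h5 J b c nrm" by (rule gst_same[OF g3 S45]) auto
  have S5: "same gsN gsR h h5" by (rule same_trans[OF S3 same_weaken[OF S45]]) auto
  have Y5: "RA h5 yY r = u J r" if "r < d" for r using h4 that by (simp add: h5_def)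
  have k5: "clk h5 <= clk h + 3 * d + T * (tM + 2) + J * (3 * d + 5) + 8"
  using h1(5) h2(2) h3(2) h4 by (simp add: h5_def)
  show ?case unfolding h5_def[symmetric]
  proof (rule ht_seq, rule ht_vsum[where n = d and f = "%r. u J r * u J r"], goal_cases)
  case (3 k h6)
  have a6: "acfg h6" by (rule acfg_same[OF a5 3(2)]) auto
  show ?case using 3(3) Y5[of k] sameR[OF 3(2), of yY]
  by (auto simp: cst_D[OF acfg_cst[OF a6]])
  next
  case (4 h6)
  note h6 = this
  have a6: "acfg h6" by (rule acfg_same[OF a5 h6(1)]) auto
  have g6: "gst h6 J b c nrm" by (rule gst_same[OF g5 h6(1)]) auto
  have S6: "same gsN gsR h h6" by (rule same_trans[OF S5 same_weaken[OF h6(1)]]) auto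
  have nr6: "RA h6 xNr 0 = nr" using h6(3) nr(1) by (simp add: uJ ip_def)
  show ?case
  proof (rule ht_seq, rule ht_scale_loop[OF nr6 nr(2)], goal_cases)
  case (1 h7 s)
  note h7 = this
  have a7: "acfg h7" by (rule acfg_same[OF a6 h7(1)]) auto
  have g7: "gst h7 J b c nrm" by (rule gst_same[OF g6 h7(1)]) auto
  have S7: "same gsN gsR h h7" by (rule same_trans[OF S6 same_weaken[OF h7(1)]]) auto
  have Y7: "RA h7 yY r = u J r" if "r < d" for r
  using Y5[OF that] sameR[OF h6(1), of yY] sameR[OF h7(1), of yY] by simp
  have nr7: "RA h7 xNr 0 = nr" using nr6 sameR[OF h7(1), of xNr] by simp
  define b' where "b' = (%r. u J r / s)"
  show ?case
  proof (rule ht_seq, rule ht_vmap[where n = d and ?b0.0 = 0 and f = b'], goal_cases)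
  case (3 k h8)
  have a8: "acfg h8" by (rule acfg_same[OF a7 3(2)]) auto
  show ?case using 3(3) 3(4)[of k] Y7[of k] h7(3) sameR[OF 3(2), of xS]
  by (auto simp: cst_D[OF acfg_cst[OF a8]] b'_def)
  next
  case (4 h8)
  note h8 = this
  have a8: "acfg h8" by (rule acfg_same[OF a7 h8(1)]) auto
  have g8: "gst h8 J b c nrm" by (rule gst_same[OF g7 h8(1)]) auto
  have S8: "same gsN gsR h h8" by (rule same_trans[OF S7 same_weaken[OF h8(1)]]) auto
  show ?case
  proof (rule ht_seq, rule ht_vmap[where n = d and ?b0.0 = "J * d" and f = b'], goal_cases)
  case (3 k h9)
  have a9: "acfg h9" by (rule acfg_same[OF a8 3(2)]) auto
  show ?case using 3(3) h8(3) g8 sameR[OF 3(2), of yY] sameN[OF 3(2), of vBase]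
  by (auto simp: cst_D[OF acfg_cst[OF a9]] gst_def)
  next
  case (4 h9)
  note h9 = this
  have a9: "acfg h9" by (rule acfg_same[OF a8 h9(1)]) auto
  have S9: "same gsN gsR h h9" by (rule same_trans[OF S8 same_weaken[OF h9(1)]]) auto
  show ?case
  proof (rule ht_seq, rule ht_applyT[OF acfg_cst[OF a9] acfg_T[OF a9]], goal_cases)
  case (1 hA)
  note hA = this
  have aA: "acfg hA" by (rule acfg_same[OF a9 hA(1)]) auto
  have SA: "same gsN gsR h hA" by (rule same_trans[OF S9 same_weaken[OF hA(1)]]) auto
  have YA: "RA hA yY r = AT b' r" if "r < d" for r
  unfolding hA(3) by (rule sop_pow_cong) (use h8(3) sameR[OF h9(1), of yY] that in auto)
  have BaA: "NA hA vBase 0 = J * d"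
  using g8 sameN[OF h9(1), of vBase] sameN[OF hA(1), of vBase] by (simp add: gst_def)
  show ?case
  proof (rule ht_seq, rule ht_vmap[where n = d and ?b0.0 = "J * d" and f = "AT b'"], goal_cases)
  case (3 k hB)
  have aB: "acfg hB" by (rule acfg_same[OF aA 3(2)]) auto
  show ?case using 3(3) YA[of k] BaA sameR[OF 3(2), of yY] sameN[OF 3(2), of vBase]
  by (auto simp: cst_D[OF acfg_cst[OF aB]])
  next
  case (4 hB)
  note hB = this
  have aB: "acfg hB" by (rule acfg_same[OF aA hB(1)]) auto
  have SB: "same gsN gsR h hB" by (rule same_trans[OF SA same_weaken[OF hB(1)]]) auto
  have S8B: "same {vP, vR, vT1} {yB, xAcc, yU, yV, yY, yC} h8 hB"
  by (rule same_trans[OF same_trans[OF same_weaken[OF h9(1)] same_weaken[OF hA(1)]] same_weaken[OF hB(1)]]) auto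
  have vB: "NA hB vJ 0 = J" "NA hB vBase 0 = J * d" "!!l. l < J ==> NA hB vBB l = l * d"
  "!!l. l < J ==> RA hB yNrm l = nrm l" "RA hB xNr 0 = nr" "RA hB xS 0 = s"
  using g8 nr7 h7(3) sameR[OF h8(1), of xNr] sameR[OF h8(1), of xS]
  sameN[OF S8B, of vJ] sameN[OF S8B, of vBase] sameN[OF S8B, of vBB] sameR[OF S8B, of yNrm]
  sameR[OF S8B, of xNr] sameR[OF S8B, of xS] by (auto simp: gst_def)
  have BB: "RA hB yB = (%j. if J * d <= j & j < J * d + d then b' (j - J * d) else RA h8 yB j)"
  using h9(3) sameR[OF hA(1), of yB] sameR[OF hB(1), of yB] by simp
  have CB: "RA hB yC = (%j. if J * d <= j & j < J * d + d then AT b' (j - J * d) else RA h8 yC j)"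
  using hB(3) sameR[OF h9(1), of yC] sameR[OF hA(1), of yC] by (simp cong: if_cong)
  have YB: "RA hB yY r = AT b' r" if "r < d" for r using YA[OF that] sameR[OF hB(1), of yY] by simp
  have CsB: "RA hB yCs = C" using C sameR[OF S8B, of yCs] sameR[OF h8(1), of yCs] sameR[OF h7(1), of yCs]
  sameR[OF h6(1), of yCs] sameR[OF S45, of yCs] sameR[OF h3(1), of yCs] sameR[OF h2(1), of yCs]
  by (simp add: h1_def)
  have bB: "RA hB yB (l * d + r) = (b(J := b')) l r" if "l < Suc J" "r < d" for l r
  proof (cases "l = J")
  case False
  then have "l < J" using that by simp
  from index_block_less[OF this that(2)] g8 this that(2) False show ?thesis
  unfolding BB by (auto simp: gst_def)
  qed (use that BB in simp)
  have cB: "RA hB yC (l * d + r) = (c(J := AT b')) l r" if "l < Suc J" "r < d" for l r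
  proof (cases "l = J")
  case False
  then have "l < J" using that by simp
  from index_block_less[OF this that(2)] g8 this that(2) False show ?thesis
  unfolding CB by (auto simp: gst_def)
  qed (use that CB in simp)
  define hC where "hC = tick (rset yNrm (nval (nv vJ) (lay hB)) (rval (RDiv (rv xNr) (RMul (rv xS) (rv xS))) (lay hB)) hB)"
  have hC: "same gsN gsR h hC" "acfg hC" "clk hC = Suc (clk hB)" "RA hC yNrm = (RA hB yNrm)(J := nr / (s * s))"
  using SB aB vB by (auto simp: hC_def)
  have kC: "clk hC <= clk h + 2 * (T * (tM + 2)) + (J + 5) * (3 * d + 5) + 2 * wx + 10"
  using k5 h6(2) h7(2) h8(2) h9(2) hA(2) hB(2) hC(3) by (simp add: algebra_simps)
  show ?case
  proof (intro ht_seq ht_rst, goal_cases)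
  case 2
  show ?case unfolding hC_def[symmetric]
  proof (rule ht_vmap[where n = d and ?b0.0 = 0 and f = "%r. C r + AT b' r * AT b' r / (nr / (s * s))"], goal_cases)
  case (3 k hD)
  have aD: "acfg hD" by (rule acfg_same[OF hC(2) 3(2)]) auto
  show ?case using 3(3) 3(4)[of k] CsB YB[of k] vB(1) hC(4) sameR[OF 3(2), of yY] sameR[OF 3(2), of yNrm] sameN[OF 3(2), of vJ]
  by (auto simp: cst_D[OF acfg_cst[OF aD]]) (auto simp: hC_def)
  next
  case (4 hD)
  note hD = this
  have aD: "acfg hD" by (rule acfg_same[OF hC(2) hD(1)]) auto
  have SD: "same gsN gsR h hD" by (rule same_trans[OF hC(1) same_weaken[OF hD(1)]]) auto
  have eqD: "NA hD vJ = NA hB vJ" "NA hD vBase = NA hB vBase" "NA hD vBB = NA hB vBB"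
  "RA hD yB = RA hB yB" "RA hD yC = RA hB yC" "RA hD yNrm = (RA hB yNrm)(J := nr / (s * s))"
  using sameN[OF hD(1), of vJ] sameN[OF hD(1), of vBase] sameN[OF hD(1), of vBB]
  sameR[OF hD(1), of yB] sameR[OF hD(1), of yC] sameR[OF hD(1), of yNrm] hC(4)
  by (auto simp: hC_def)
  show ?case
  proof (intro ht_seq ht_nst, goal_cases)
  case 4
  show ?case
  proof (rule post[of _ s b' "AT b'" "nr / (s * s)" "RA hD yCs"], goal_cases)
  case 1
  show ?case using SD by simp
  next
  case 2
  show ?case using hD(2) kC by (simp add: tGS_def algebra_simps)
  next
  case 9
  have D: "NA hD vD 0 = d" using cst_D[OF acfg_cst[OF aD]] .
  show ?case unfolding gst_def using eqD vB bB cB D by (auto simp: less_Suc_eq)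
  next
  case (11 r)
  then show ?case using hD(3) by simp
  qed (use h7 in \<open>auto simp: b'_def uJ\<close>)
  qed auto
  qed auto
  qed auto
  qed auto
  qed
  qed auto
  qed auto
  qed
  qed auto
  qed auto
  qed
 qed auto
qed auto

end

section \<open>Linear algebra of the pivots\<close>

lemma sop_less: "r < d ==> sop d A f r = mv d A f r"
 by (simp add: sop_def)

lemma sop_add: "sop d A (%r. f r + g r) = (%r. sop d A f r + sop d A g r)"
 by (auto simp: sop_def mv_add fun_eq_iff)

lemma sop_scale: "sop d A (%r. a * f r) = (%r. a * sop d A f r)"
 by (auto simp: sop_def mv_scale fun_eq_iff)

lemma sop_pow_add: "(sop d A ^^ k) (%r. f r + g r) = (%r. (sop d A ^^ k) f r + (sop d A ^^ k) g r)"
 by (induction k) (simp_all add: sop_add)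

lemma sop_pow_scale: "(sop d A ^^ k) (%r. a * f r) = (%r. a * (sop d A ^^ k) f r)"
 by (induction k) (simp_all add: sop_scale)

lemma sop_pow_zero: "(sop d A ^^ k) (%r. 0) = (%r. 0)"
 using sop_pow_scale[where a = 0 and f = "%r. 0" and d = d and A = A and k = k] by simp

lemma sop_pow_sum: "(sop d A ^^ k) (%r. \<Sum>i\<in>I. f i r) = (%r. \<Sum>i\<in>I. (sop d A ^^ k) (f i) r)"
proof (induction I rule: infinite_finite_induct)
 case (insert i I)
 then show ?case by (simp add: sop_pow_add)
qed (auto simp: sop_pow_zero)

lemma sop_pow_sym:
 assumes "sym_fun d A"
 shows "ip d ((sop d A ^^ k) f) g = ip d f ((sop d A ^^ k) g)"
proof (induction k arbitrary: f g)
 case (Suc k)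
 have s: "ip d (sop d A f) g = ip d (mv d A f) g" "ip d f (sop d A g) = ip d f (mv d A g)" for f g
  by (auto intro!: ip_cong simp: sop_less)
 have "ip d ((sop d A ^^ Suc k) f) g = ip d (mv d A ((sop d A ^^ k) f)) g" by (simp add: s)
 also have "... = ip d ((sop d A ^^ k) f) (mv d A g)" using ip_mv_swap[OF assms] by simp
 also have "... = ip d ((sop d A ^^ k) f) (sop d A g)" by (simp add: s)
 also have "... = ip d f ((sop d A ^^ k) (sop d A g))" by (rule Suc)
 finally show ?case by (simp add: funpow_swap1)
qed simp

lemma ip_unit: "p < d ==> ip d f (%r. of_bool (r = p)) = f p"
 by (simp add: ip_def)

text \<open>A unit upper triangular system is solved from the last unknown upwards. If S is the
  l1-norm of the unknowns found so far, one more unknown turns S + eta into at most (2 + beta)(S +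
  eta); carrying the extra eta through the induction makes the recursion purely
  multiplicative.\<close>

lemma back_substitution_bound:
 fixes x y :: "nat => real"
 assumes eq: "!!l. l < J ==> x l + (\<Sum>j\<in>{l<..<J}. x j * L l j) = y l"
  and L: "!!l j. l < j ==> j < J ==> \<bar>L l j\<bar> <= \<beta>" and y: "!!l. l < J ==> \<bar>y l\<bar> <= \<eta>"
  and pos: "0 <= \<beta>" "0 <= \<eta>"
 shows "(\<Sum>l<J. \<bar>x l\<bar>) <= \<eta> * (2 + \<beta>) ^ J"
proof -
 have "(\<Sum>j\<in>{J - t..<J}. \<bar>x j\<bar>) + \<eta> <= \<eta> * (2 + \<beta>) ^ t" if "t <= J" for t
  using that
 proof (induction t)
  case (Suc t)
  define l where "l = J - Suc t"
  have l: "l < J" "J - t = Suc l" using Suc.prems by (auto simp: l_def)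
  define S where "S = (\<Sum>j\<in>{Suc l..<J}. \<bar>x j\<bar>)"
  have IH: "S + \<eta> <= \<eta> * (2 + \<beta>) ^ t" using Suc l by (simp add: S_def)
  have S0: "0 <= S" by (simp add: S_def sum_nonneg)
  have iv: "{l<..<J} = {Suc l..<J}" by auto
  have "\<bar>\<Sum>j\<in>{l<..<J}. x j * L l j\<bar> <= (\<Sum>j\<in>{l<..<J}. \<bar>x j\<bar> * \<beta>)"
  by (rule order_trans[OF sum_abs]) (auto intro!: sum_mono mult_left_mono L simp: abs_mult)
  also have "... = \<beta> * S" by (simp add: S_def iv sum_distrib_left mult.commute)
  finally have "\<bar>x l\<bar> <= \<eta> + \<beta> * S" using eq[OF l(1)] y[OF l(1)] by linarith
  moreover have "(\<Sum>j\<in>{l..<J}. \<bar>x j\<bar>) = \<bar>x l\<bar> + S"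
  using l(1) by (simp add: S_def sum.atLeast_Suc_lessThan)
  ultimately have "(\<Sum>j\<in>{l..<J}. \<bar>x j\<bar>) + \<eta> <= 2 * \<eta> + \<beta> * S + S" by simp
  also have "... <= (2 + \<beta>) * (S + \<eta>)" using S0 pos by (simp add: algebra_simps)
  also have "... <= (2 + \<beta>) * (\<eta> * (2 + \<beta>) ^ t)" using IH pos by (intro mult_left_mono) auto
  finally show ?case by (simp add: l_def mult_ac)
 qed (use pos in simp)
 from this[of J] pos show ?thesis by (simp add: atLeast0LessThan)
qed

lemma sum_delta_const: "l < J ==> (\<Sum>l'<J. if l' = l then x else 0) = (x::real)" for l J :: nat
 using sum.delta[of "{..<J}" l "%_. x"] by simp

lemma orthogonal_sum_norm:
 fixes J :: nat
 assumes "!!l l'. l < J ==> l' < J ==> l ~= l' ==> ip d (b l) (b l') = 0"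
 shows "ip d (%r. \<Sum>l<J. a l * b l r) (%r. \<Sum>l<J. a l * b l r) = (\<Sum>l<J. (a l)\<^sup>2 * ip d (b l) (b l))"
proof -
 have "ip d (%r. \<Sum>l<J. a l * b l r) (%r. \<Sum>l<J. a l * b l r)
  = (\<Sum>l<J. \<Sum>l'<J. a l * (a l' * ip d (b l) (b l')))"
  by (simp only: ip_sum_left ip_sum_right ip_scale_left ip_scale_right sum_distrib_left)
 also have "... = (\<Sum>l<J. \<Sum>l'<J. if l' = l then (a l)\<^sup>2 * ip d (b l) (b l) else 0)"
  using assms by (intro sum.cong refl) (auto simp: power2_eq_square)
 also have "... = (\<Sum>l<J. (a l)\<^sup>2 * ip d (b l) (b l))"
  by (intro sum.cong refl sum_delta_const) simp
 finally show ?thesis .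
qed

text \<open>Pythagoras for the projection onto the span of an orthogonal system that need not be
  normalised.\<close>

lemma orthogonal_residual_norm:
 fixes a :: "nat => real" and J :: nat
 assumes orth: "!!l l'. l < J ==> l' < J ==> l ~= l' ==> ip d (b l) (b l') = 0"
  and nz: "!!l. l < J ==> ip d (b l) (b l) ~= 0"
 defines "u == (%r. a r - (\<Sum>l<J. ip d (b l) a / ip d (b l) (b l) * b l r))"
 shows "l < J ==> ip d u (b l) = 0"
  and "ip d u u = ip d a a - (\<Sum>l<J. (ip d (b l) a)\<^sup>2 / ip d (b l) (b l))"
proof -
 have o: "ip d u (b l) = 0" if l: "l < J" for l
 proof -
  have "ip d u (b l) = ip d a (b l) - (\<Sum>l'<J. ip d (b l') a / ip d (b l') (b l') * ip d (b l') (b l))"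
  unfolding u_def by (simp only: ip_diff_left ip_sum_left ip_scale_left)
  also have "(\<Sum>l'<J. ip d (b l') a / ip d (b l') (b l') * ip d (b l') (b l)) = (\<Sum>l'<J. if l' = l then ip d (b l) a else 0)"
  using orth nz l by (intro sum.cong refl) auto
  also have "(\<Sum>l'<J. if l' = l then ip d (b l) a else 0) = ip d (b l) a" by (rule sum_delta_const[OF l])
  finally show ?thesis using ip_commute[of d a "b l"] by linarith
 qed
 then show "l < J ==> ip d u (b l) = 0" .
 have "ip d u u = ip d u a - (\<Sum>l<J. ip d (b l) a / ip d (b l) (b l) * ip d u (b l))"
  by (subst (2) u_def) (simp only: ip_diff_right ip_sum_right ip_scale_right)
 also have "... = ip d u a" using o by simp
 also have "... = ip d a a - (\<Sum>l<J. ip d (b l) a / ip d (b l) (b l) * ip d (b l) a)"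
  unfolding u_def by (simp only: ip_diff_left ip_sum_left ip_scale_left)
 finally show "ip d u u = ip d a a - (\<Sum>l<J. (ip d (b l) a)\<^sup>2 / ip d (b l) (b l))"
  by (simp add: power2_eq_square)
qed

locale attempt_sym = attempt +
 fixes B :: real
 assumes symM: "sym_fun d M" and B: "2 * real d <= B" and d0: "0 < d"
begin

lemma sym_St: "sym_fun d St"
 using symM by (auto simp: sym_fun_def St_def shifted_def)

lemma AT_sym: "ip d (AT f) g = ip d f (AT g)"
 by (rule sop_pow_sym[OF sym_St])

abbreviation ue :: "nat => nat => real" where "ue p == (%r. of_bool (r = p))"

text \<open>The diagonal of \<open>St\<close>^(2T) consists of the squared norms of the columns of
  \<open>St\<close>^T. Hence residual traces are sums of squared residual norms, and a large
  residual diagonal entry means a column far from the span of the pivots.\<close>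

lemma W_diag: "p < d ==> real (Wn p p) = ip d (AT (ue p)) (AT (ue p))"
proof -
 assume p: "p < d"
 have "ip d (AT (ue p)) (AT (ue p)) = ip d (AT (AT (ue p))) (ue p)" by (simp add: AT_sym)
 also have "... = AT (AT (ue p)) p" using p by (simp add: ip_unit)
 also have "... = real (Wn p p)" using W[OF p, of "ue p"] p by simp
 finally show ?thesis by simp
qed

definition csum :: "(nat => nat => real) => (nat => real) => nat => nat => real" where
 "csum c nrm l = (%r. \<Sum>l'<l. (c l' r)\<^sup>2 / nrm l')"

definition ortho :: "nat => (nat => nat => real) => (nat => nat => real) => (nat => real) => bool" where
 "ortho J b c nrm \<longleftrightarrow> (\<forall>l<J. 1 <= nrm l & nrm l < 4 & nrm l = ip d (b l) (b l) &
  (\<forall>r<d. c l r = AT (b l) r) & (\<forall>l'<J. l ~= l' --> ip d (b l) (b l') = 0))"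

text \<open>The history that the rank bound needs: the pivot columns are triangular in the
  \<open>b\<close>, and at the time of choice the residual trace was above \<open>B\<close> but at
  most 2 d times the squared residual norm s^2 nrm of the chosen column.\<close>

definition pivoted :: "nat => (nat => nat => real) => (nat => nat => real) => (nat => real) => (nat => nat) => (nat => real) => bool" where
 "pivoted J b c nrm p s \<longleftrightarrow> (\<forall>l<J. p l < d & 1 <= s l &
  (\<forall>r<d. AT (ue (p l)) r = s l * b l r + (\<Sum>l'<l. c l' (p l) / nrm l' * b l' r)) &
  B < bsum (csum c nrm l) 0 d & bsum (csum c nrm l) 0 d <= 2 * real d * ((s l)\<^sup>2 * nrm l))"

definition gs_inv :: "nat => (nat => nat => real) => (nat => nat => real) => (nat => real) => (nat => real) => bool" where
 "gs_inv J b c nrm C \<longleftrightarrow> ortho J b c nrm & (\<exists>p s. pivoted J b c nrm p s) & (\<forall>r<d. C r = csum c nrm J r)"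

lemma gs_inv_0: "(!!r. r < d ==> C r = 0) ==> gs_inv 0 b c nrm C"
 by (simp add: gs_inv_def ortho_def pivoted_def csum_def)

lemma ortho_mono: "ortho J b c nrm ==> l <= J ==> ortho l b c nrm"
 unfolding ortho_def by (meson less_le_trans)

lemma ortho_coef: "ortho J b c nrm ==> l < J ==> p < d ==> c l p = ip d (b l) (AT (ue p))"
proof -
 assume "ortho J b c nrm" "l < J" "p < d"
 then have "c l p = AT (b l) p" by (simp add: ortho_def)
 also have "... = ip d (AT (b l)) (ue p)" using \<open>p < d\<close> by (simp add: ip_unit)
 finally show ?thesis by (simp add: AT_sym)
qed

lemma residual_facts:
 assumes o: "ortho J b c nrm" and p: "p < d"
 shows "l < J ==> ip d (residual J b c nrm p) (b l) = 0"
  and "ip d (residual J b c nrm p) (residual J b c nrm p) = real (Wn p p) - csum c nrm J p"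
proof -
 have r: "residual J b c nrm p = (%r. AT (ue p) r - (\<Sum>l<J. ip d (b l) (AT (ue p)) / ip d (b l) (b l) * b l r))"
  unfolding residual_def using o ortho_coef[OF o _ p] by (auto simp: fun_eq_iff ortho_def intro!: sum.cong)
 have orth: "!!l l'. l < J ==> l' < J ==> l ~= l' ==> ip d (b l) (b l') = 0"
  and nz: "!!l. l < J ==> ip d (b l) (b l) ~= 0"
  using o by (auto simp: ortho_def)
 show "l < J ==> ip d (residual J b c nrm p) (b l) = 0"
  unfolding r by (rule orthogonal_residual_norm(1)[OF orth nz])
 have "csum c nrm J p = (\<Sum>l<J. (ip d (b l) (AT (ue p)))\<^sup>2 / ip d (b l) (b l))"
  unfolding csum_def using o ortho_coef[OF o _ p] by (auto simp: ortho_def intro!: sum.cong)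
 then show "ip d (residual J b c nrm p) (residual J b c nrm p) = real (Wn p p) - csum c nrm J p"
  unfolding r W_diag[OF p] using orthogonal_residual_norm(2)[OF orth nz, where a = "AT (ue p)"] by simp
qed

lemma bsum_ge_term:
 assumes o: "ortho J b c nrm" and p: "p < d"
 shows "real (Wn p p) - csum c nrm J p <= bsum (csum c nrm J) 0 d"
proof -
 have "real (Wn p p) - csum c nrm J p <= (\<Sum>i<d. real (Wn i i) - csum c nrm J i)"
  by (rule member_le_sum)
  (use p residual_facts(2)[OF o] ip_self_nonneg in \<open>auto simp: residual_facts(2)[OF o, symmetric] ip_self_nonneg simp del: of_nat_le_iff\<close>)
 then show ?thesis by (simp add: bsum_def)
qed

lemma bsum_cong: "(!!r. r < d ==> C r = C' r) ==> bsum C lo hi = bsum C' lo hi"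
 by (simp add: bsum_def)

text \<open>Limits the doublings in \<open>scale_loop\<close> in terms of \<open>wx\<close>: squared
  residual norms are at most diagonal entries of \<open>St\<close>^(2T).\<close>

lemma residual_le_Xn:
 assumes o: "ortho J b c nrm" and p: "p < d"
 shows "ip d (residual J b c nrm p) (residual J b c nrm p) <= 2 ^ wx"
proof -
 have "0 <= csum c nrm J p"
 proof -
  have "0 <= nrm l" if "l < J" for l
  using o that unfolding ortho_def by (meson order_trans zero_le_one)
  then show ?thesis unfolding csum_def by (intro sum_nonneg divide_nonneg_nonneg) auto
 qed
 moreover have "Wn p p <= (\<Sum>j<d. Wn p j)"
  by (rule member_le_sum[of p "{..<d}" "%j. Wn p j"]) (use p in auto)
 moreover have "... <= (\<Sum>i<d. \<Sum>j<d. Wn i j)"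
  by (rule member_le_sum[of p "{..<d}" "%i. \<Sum>j<d. Wn i j"]) (use p in auto)
 ultimately have "0 <= csum c nrm J p" "Wn p p <= (\<Sum>i<d. \<Sum>j<d. Wn i j)" by auto
 moreover have "real Xn <= 2 ^ wx" using of_nat_mono[OF wx, where 'a = real] by simp
 moreover have "real (Wn p p) <= real Xn" using calculation(2) Xn by simp
 ultimately show ?thesis unfolding residual_facts(2)[OF o p] by linarith
qed

lemma gs_inv_step:
 assumes g: "gs_inv J b c nrm C" and big: "B < bsum C 0 d" and p: "bsum C 0 d <= 2 * real d * bsum C p (Suc p)"
  and nr: "nr = ip d (residual J b c nrm p) (residual J b c nrm p)"
  and s: "1 <= s" "s = 1 \<or> s * s <= nr" "nr < 4 * (s * s)"
  and b': "b' = (%r. residual J b c nrm p r / s)" and c': "c' = AT b'" and nrm': "nrm' = nr / (s * s)"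
  and C': "!!r. r < d ==> C' r = C r + c' r * c' r / nrm'"
 shows "p < d" "gs_inv (Suc J) (b(J := b')) (c(J := c')) (nrm(J := nrm')) C'"
proof -
 have o: "ortho J b c nrm" and C: "!!r. r < d ==> C r = csum c nrm J r" using g by (auto simp: gs_inv_def)
 obtain pv sv where pv: "pivoted J b c nrm pv sv" using g by (auto simp: gs_inv_def)
 have bp: "0 < bsum C p (Suc p)"
 proof (rule ccontr)
  assume "\<not> ?thesis"
  then have "2 * real d * bsum C p (Suc p) <= 0" by (intro mult_nonneg_nonpos) auto
  then show False using big p B d0 by linarith
 qed
 then show pd: "p < d" by (simp add: bsum_singleton split: if_splits)
 have nrC: "nr = bsum C p (Suc p)" using residual_facts(2)[OF o pd] pd C by (simp add: nr bsum_singleton)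
 \<comment> \<open>Here the condition \<open>2 * real d <= B\<close> enters: the squared residual
   norm of the pivot exceeds 1, so a scaling factor of at least 1 can bring it into [1, 4).\<close>
 have "2 * real d * 1 < 2 * real d * nr" using B big p unfolding nrC by linarith
 then have nr1: "1 < nr" using d0 by simp
 have n1: "1 <= nrm'" "nrm' < 4" using s nr1 by (auto simp: nrm' field_simps)
 have ipb: "ip d b' b' = nrm'" using s(1) unfolding b' nrm' nr
  by (simp add: ip_def sum_divide_distrib)
 have orb: "ip d b' (b l) = 0" "ip d (b l) b' = 0" if "l < J" for l
  using residual_facts(1)[OF o pd that] by (auto simp: b' ip_commute[of d "b l"], auto simp: ip_def sum_divide_distrib[symmetric])
 have o': "ortho (Suc J) (b(J := b')) (c(J := c')) (nrm(J := nrm'))"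
  unfolding ortho_def using o n1 ipb orb by (auto simp: ortho_def less_Suc_eq c')
 have cs: "csum (c(J := c')) (nrm(J := nrm')) l = csum c nrm l" if "l <= J" for l
  unfolding csum_def using that by (intro ext sum.cong) auto
 have "pivoted (Suc J) (b(J := b')) (c(J := c')) (nrm(J := nrm')) (pv(J := p)) (sv(J := s))"
  unfolding pivoted_def
 proof (intro allI impI)
  fix l assume l: "l < Suc J"
  have sm: "(\<Sum>l'<l. (c(J := c')) l' i / (nrm(J := nrm')) l' * (b(J := b')) l' r) = (\<Sum>l'<l. c l' i / nrm l' * b l' r)" for i r
  using l by (intro sum.cong) auto
  show "(pv(J := p)) l < d & 1 <= (sv(J := s)) l &
  (\<forall>r<d. AT (ue ((pv(J := p)) l)) r = (sv(J := s)) l * (b(J := b')) l r +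
  (\<Sum>l'<l. (c(J := c')) l' ((pv(J := p)) l) / (nrm(J := nrm')) l' * (b(J := b')) l' r)) &
  B < bsum (csum (c(J := c')) (nrm(J := nrm')) l) 0 d &
  bsum (csum (c(J := c')) (nrm(J := nrm')) l) 0 d <= 2 * real d * (((sv(J := s)) l)\<^sup>2 * (nrm(J := nrm')) l)"
  proof (cases "l = J")
  case True
  have "bsum (csum c nrm J) 0 d = bsum C 0 d" using C by (intro bsum_cong) auto
  moreover have "s\<^sup>2 * nrm' = nr" using s(1) by (simp add: nrm' power2_eq_square)
  moreover have "s * b' r = residual J b c nrm p r" for r using s(1) by (simp add: b')
  ultimately show ?thesis unfolding sm unfolding True
  using pd s(1) big p nrC by (simp add: cs residual_def)
  next
  case False
  then have "l < J" using l by simp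
  then show ?thesis unfolding sm using False pv cs[of l] by (simp add: pivoted_def)
  qed
 qed
 moreover have "C' r = csum (c(J := c')) (nrm(J := nrm')) (Suc J) r" if "r < d" for r
  using C'[OF that] C[OF that] cs[of J] by (simp add: csum_def power2_eq_square)
 ultimately show "gs_inv (Suc J) (b(J := b')) (c(J := c')) (nrm(J := nrm')) C'"
  using o' unfolding gs_inv_def by blast
qed

text \<open>Entry i of \<open>St\<close>^T v is the inner product of v with column i and, as v is
  orthogonal to the pivots, with the residual of column i. Cauchy-Schwarz and summation over i bound
  the squared norm by |v|^2 times the residual trace, which has dropped to \<open>B\<close>.\<close>

lemma orthogonal_complement_bound:
 assumes g: "gs_inv J b c nrm C" and le: "bsum C 0 d <= B" and v: "!!l. l < J ==> ip d v (b l) = 0"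
 shows "ip d (AT v) (AT v) <= B * ip d v v"
proof -
 have o: "ortho J b c nrm" and C: "!!r. r < d ==> C r = csum c nrm J r" using g by (auto simp: gs_inv_def)
 have "ip d (AT v) (AT v) = (\<Sum>i<d. (AT v i)\<^sup>2)" by (simp add: ip_def power2_eq_square)
 also have "... <= (\<Sum>i<d. ip d v v * (real (Wn i i) - C i))"
 proof (rule sum_mono)
  fix i assume "i \<in> {..<d}"
  then have i: "i < d" by simp
  have "AT v i = ip d v (AT (ue i))" using i AT_sym[of v "ue i"] by (simp add: ip_unit)
  also have "... = ip d v (residual J b c nrm i) + (\<Sum>l<J. c l i / nrm l * ip d v (b l))"
  unfolding residual_def by (simp only: ip_diff_right ip_sum_right ip_scale_right diff_add_cancel)
  also have "... = ip d v (residual J b c nrm i)" using v by simp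
  finally have "(AT v i)\<^sup>2 <= ip d v v * ip d (residual J b c nrm i) (residual J b c nrm i)"
  using cauchy_schwarz_ip by simp
  then show "(AT v i)\<^sup>2 <= ip d v v * (real (Wn i i) - C i)"
  using residual_facts(2)[OF o i] C[OF i] by simp
 qed
 also have "... = ip d v v * bsum C 0 d" by (simp add: bsum_def sum_distrib_left)
 also have "... <= B * ip d v v" using mult_right_mono[OF le ip_self_nonneg[of d v]] by (simp add: mult.commute)
 finally show ?thesis .
qed

text \<open>\<open>St\<close>^T stretches every combination of the chosen unit vectors. In the basis
  \<open>b\<close> the image has coefficients s_l y_l, where y arises from x by a unit triangular
  matrix \<open>L\<close>. Since pivots were nearly maximal, the entries of \<open>L\<close> are at
  most sqrt(2d), and back substitution recovers x from y at a loss of (2 + sqrt(2d))^J; y itself is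
  controlled because s_l^2 nrm_l is at least B/(2d).\<close>

lemma pivots_lower_bound:
 assumes o: "ortho J b c nrm" and pv: "pivoted J b c nrm p s"
 defines "v == %x r. \<Sum>j<J. x j * ue (p j) r"
 shows "(\<Sum>j<J. \<bar>x j\<bar>)\<^sup>2 <= (12 * real d) ^ J * (2 * real d / B) * ip d (AT (v x)) (AT (v x))"
  and "ip d (v x) (v x) <= (\<Sum>j<J. \<bar>x j\<bar>)\<^sup>2"
proof -
 have B0: "0 < B" using B d0 by (smt (verit) of_nat_0_less_iff)
 define L where "L = (%l j. c l (p j) / nrm l / s l)"
 define y where "y = (%l. x l + (\<Sum>j\<in>{l<..<J}. x j * L l j))"
 have s1: "1 <= s l" "p l < d" if "l < J" for l using pv that by (auto simp: pivoted_def)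
 have n1: "1 <= nrm l" if "l < J" for l using o that by (auto simp: ortho_def)
 have "AT (v x) r = (\<Sum>l<J. (s l * y l) * b l r)" if "r < d" for r
 proof -
  have "AT (v x) r = (\<Sum>j<J. x j * AT (ue (p j)) r)"
  unfolding v_def by (simp only: sop_pow_sum sop_pow_scale)
  also have "... = (\<Sum>j<J. x j * (s j * b j r + (\<Sum>l<j. c l (p j) / nrm l * b l r)))"
  using pv that by (intro sum.cong refl) (auto simp: pivoted_def)
  also have "... = (\<Sum>j<J. x j * s j * b j r) + (\<Sum>j<J. \<Sum>l<j. x j * (c l (p j) / nrm l * b l r))"
  by (simp add: distrib_left sum.distrib sum_distrib_left mult.assoc)
  \<comment> \<open>The sums over the triangle l < j are exchanged to collect the coefficient of
    each \<open>b l\<close>.\<close>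
  also have "(\<Sum>j<J. \<Sum>l<j. x j * (c l (p j) / nrm l * b l r))
  = (\<Sum>l<J. \<Sum>j\<in>{l<..<J}. x j * (c l (p j) / nrm l * b l r))"
  proof -
  have "(\<Sum>j<J. \<Sum>l<j. x j * (c l (p j) / nrm l * b l r)) = (\<Sum>j<J. \<Sum>l\<in>{l\<in>{..<J}. l < j}. x j * (c l (p j) / nrm l * b l r))"
  by (intro sum.cong refl) auto
  also have "... = (\<Sum>l<J. \<Sum>j\<in>{j\<in>{..<J}. l < j}. x j * (c l (p j) / nrm l * b l r))"
  by (rule sum.swap_restrict) auto
  also have "... = (\<Sum>l<J. \<Sum>j\<in>{l<..<J}. x j * (c l (p j) / nrm l * b l r))"
  by (intro sum.cong refl) auto
  finally show ?thesis .
  qed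
  also have "(\<Sum>j<J. x j * s j * b j r) + ... = (\<Sum>l<J. (s l * y l) * b l r)"
  unfolding sum.distrib[symmetric]
  proof (intro sum.cong refl)
  fix l assume "l \<in> {..<J}"
  then have "s l ~= 0" using s1(1)[of l] by auto
  then show "x l * s l * b l r + (\<Sum>j\<in>{l<..<J}. x j * (c l (p j) / nrm l * b l r)) = s l * y l * b l r"
  by (simp add: y_def L_def distrib_left distrib_right sum_distrib_left sum_distrib_right) (simp add: mult_ac)
  qed
  finally show ?thesis .
 qed
 then have "ip d (AT (v x)) (AT (v x)) = ip d (%r. \<Sum>l<J. (s l * y l) * b l r) (%r. \<Sum>l<J. (s l * y l) * b l r)"
  by (intro ip_cong) auto
 also have "... = (\<Sum>l<J. (s l * y l)\<^sup>2 * ip d (b l) (b l))"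
  by (rule orthogonal_sum_norm) (use o in \<open>auto simp: ortho_def\<close>)
 finally have E: "ip d (AT (v x)) (AT (v x)) = (\<Sum>l<J. (s l * y l)\<^sup>2 * ip d (b l) (b l))" .
 define E where "E = ip d (AT (v x)) (AT (v x))"
 define \<eta> where "\<eta> = sqrt (2 * real d / B * E)"
 have E0: "0 <= E" by (simp add: E_def ip_self_nonneg)
 have yb: "\<bar>y l\<bar> <= \<eta>" if l: "l < J" for l
 proof -
  have "(s l * y l)\<^sup>2 * ip d (b l) (b l) <= E" unfolding E_def E
  by (rule member_le_sum[of l "{..<J}" "%l. (s l * y l)\<^sup>2 * ip d (b l) (b l)"]) (use l in \<open>auto intro!: mult_nonneg_nonneg ip_self_nonneg\<close>)
  then have "(y l)\<^sup>2 * ((s l)\<^sup>2 * nrm l) <= E" using o l by (simp add: ortho_def power_mult_distrib mult_ac)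
  moreover have "B <= 2 * real d * ((s l)\<^sup>2 * nrm l)" using pv l unfolding pivoted_def by (smt (verit))
  then have "(y l)\<^sup>2 * B <= (y l)\<^sup>2 * (2 * real d * ((s l)\<^sup>2 * nrm l))" by (intro mult_left_mono) auto
  ultimately have "(y l)\<^sup>2 * B <= 2 * real d * E"
  using mult_left_mono[of "(y l)\<^sup>2 * ((s l)\<^sup>2 * nrm l)" E "2 * real d"] by (simp add: mult_ac)
  then have "(y l)\<^sup>2 <= 2 * real d / B * E" using B0 by (simp add: field_simps)
  then show ?thesis unfolding \<eta>_def by (metis real_sqrt_abs real_sqrt_le_mono)
 qed
 have Lb: "\<bar>L l j\<bar> <= sqrt (2 * real d)" if lj: "l < j" "j < J" for l j
 proof -
  have l: "l < J" using lj by simp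
  have pj: "p j < d" using s1 lj by simp
  \<comment> \<open>The residual of column \<open>p j\<close> after l + 1 directions has nonnegative
    squared norm. So its part along \<open>b l\<close> is at most its residual before step l, and
    that is one term of the residual trace from which pivot l was chosen.\<close>
  have "0 <= real (Wn (p j) (p j)) - csum c nrm (Suc l) (p j)"
  unfolding residual_facts(2)[OF ortho_mono[OF o, of "Suc l"] pj, symmetric, OF Suc_leI[OF l]] by (rule ip_self_nonneg)
  then have "(c l (p j))\<^sup>2 / nrm l <= real (Wn (p j) (p j)) - csum c nrm l (p j)" by (simp add: csum_def)
  also have "... <= bsum (csum c nrm l) 0 d"
  by (rule bsum_ge_term[OF ortho_mono[OF o] pj]) (use l in simp)
  also have "... <= 2 * real d * ((s l)\<^sup>2 * nrm l)" using pv l by (simp add: pivoted_def)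
  finally have le: "(c l (p j))\<^sup>2 / nrm l <= 2 * real d * ((s l)\<^sup>2 * nrm l)" .
  have "(L l j)\<^sup>2 = (c l (p j))\<^sup>2 / nrm l / ((s l)\<^sup>2 * nrm l)"
  by (simp add: L_def power_divide power2_eq_square)
  also have "... <= 2 * real d" using le s1(1)[OF l] n1[OF l] by (subst pos_divide_le_eq) auto
  finally show ?thesis by (metis real_sqrt_abs real_sqrt_le_mono)
 qed
 have \<eta>0: "0 <= \<eta>" using E0 B0 by (simp add: \<eta>_def)
 have "(\<Sum>j<J. \<bar>x j\<bar>) <= \<eta> * (2 + sqrt (2 * real d)) ^ J"
  by (rule back_substitution_bound[where L = L and y = y]) (use Lb yb \<eta>0 in \<open>auto simp: y_def\<close>)
 then have "(\<Sum>j<J. \<bar>x j\<bar>)\<^sup>2 <= (\<eta> * (2 + sqrt (2 * real d)) ^ J)\<^sup>2"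
  by (intro power_mono sum_nonneg) auto
 also have "... = (2 * real d / B * E) * ((2 + sqrt (2 * real d))\<^sup>2) ^ J"
  using E0 B0 by (simp add: \<eta>_def power_mult_distrib power_mult[symmetric] mult.commute)
 also have "... <= (2 * real d / B * E) * (12 * real d) ^ J"
 proof (intro mult_left_mono power_mono)
  \<comment> \<open>Bounds the cross term 4 sqrt(2d) by 4 + 2 d; then 8 + 4 d <= 12 d as d >=
    1.\<close>
  have "0 <= (2 - sqrt (2 * real d))\<^sup>2" by simp
  moreover have "(sqrt (2 * real d))\<^sup>2 = 2 * real d" by simp
  ultimately have "(2 + sqrt (2 * real d))\<^sup>2 <= 8 + 4 * real d" by (simp add: power2_eq_square algebra_simps)
  also have "... <= 12 * real d" using d0 by simp
  finally show "(2 + sqrt (2 * real d))\<^sup>2 <= 12 * real d" .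
 qed (use E0 B0 in auto)
 finally show "(\<Sum>j<J. \<bar>x j\<bar>)\<^sup>2 <= (12 * real d) ^ J * (2 * real d / B) * ip d (AT (v x)) (AT (v x))"
  by (simp add: E_def mult_ac)
 have "ip d (v x) (v x) = (\<Sum>j<J. \<Sum>j'<J. x j * (x j' * ip d (ue (p j)) (ue (p j'))))"
  unfolding v_def by (simp only: ip_sum_left ip_sum_right ip_scale_left ip_scale_right sum_distrib_left)
 also have "... <= (\<Sum>j<J. \<Sum>j'<J. \<bar>x j\<bar> * \<bar>x j'\<bar>)"
 proof (intro sum_mono)
  fix j j' assume "j \<in> {..<J}" "j' \<in> {..<J}"
  then have "ip d (ue (p j)) (ue (p j')) = of_bool (p j' = p j)" using s1(2)[of j'] by (simp add: ip_unit)
  then have "\<bar>x j * (x j' * ip d (ue (p j)) (ue (p j')))\<bar> <= \<bar>x j\<bar> * \<bar>x j'\<bar>" by (simp add: abs_mult)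
  then show "x j * (x j' * ip d (ue (p j)) (ue (p j'))) <= \<bar>x j\<bar> * \<bar>x j'\<bar>" by linarith
 qed
 also have "... = (\<Sum>j<J. \<bar>x j\<bar>)\<^sup>2" by (simp add: power2_eq_square sum_product)
 finally show "ip d (v x) (v x) <= (\<Sum>j<J. \<bar>x j\<bar>)\<^sup>2" .
qed

end

section \<open>The pivoting loop\<close>

context attempt_sym
begin

abbreviation "pvN == {vP, vR, vT1, vLen, vBlo, vH, vLo, vHi, vL, vBB, vBase, vJ}"
abbreviation "pvR == {xAcc, yU, yV, yY, xZ, xZ1, xP, xP0, xTr, xTA, xTB, xCoef, xNr, xS, yB, yC, yNrm, yCs}"

text \<open>The loop also stops once it has taken one pivot more than the guess \<open>vK0\<close>:
  if the residual trace is still large by then, the guess is refuted.\<close>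

definition pivots :: prog where
 "pivots = nset0 vJ (NConst 0) ;; nset0 vBase (NConst 0) ;;
  vmap vR (nv vD) yCs (NConst 0) (Rc 0) ;; nset0 vLo (NConst 0) ;; nset0 vHi (nv vD) ;; trace ;;
  Loop (TAnd (RLess (rv xBB) (rv xTr)) (NLess (nv vJ) (NAdd (nv vK0) (NConst 1))))
  (select ;; gram_step ;; nset0 vLo (NConst 0) ;; nset0 vHi (nv vD) ;; trace)"

definition tIter :: "nat => nat => nat" where
 "tIter k0 lg = (lg + 1) * (2 * tTr + 2 * lg + 20) + tGS (Suc k0) + tTr + 5"

definition pinv :: "hst => nat => nat => nat => hst => nat => (nat => nat => real) => (nat => nat => real) => (nat => real) => (nat => real) => bool" where
 "pinv h k0 lg t h' J b c nrm C \<longleftrightarrow> same pvN pvR h h' & gst h' J b c nrm & RA h' yCs = C & gs_inv J b c nrm C &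
  J <= Suc k0 & RA h' xTr 0 = bsum C 0 d & clk h' <= clk h + t + J * tIter k0 lg"

lemma ht_pivots:
 assumes a: "acfg h" and B': "RA h xBB 0 = B" and k0: "NA h vK0 0 = k0" and lg: "d <= 2 ^ lg"
  and post: "!!h' J b c nrm C. pinv h k0 lg (3 * d + tTr + 7) h' J b c nrm C ==> bsum C 0 d <= B \<or> J = Suc k0 ==> Q h'"
 shows "ht pivots h Q"
 unfolding pivots_def
proof (intro ht_seq ht_nst, goal_cases)
 case 3
 define h1 where "h1 = tick (nset vBase (nval (NConst 0) (lay (tick (nset vJ (nval (NConst 0) (lay h)) (nval (NConst 0) (lay h)) h))))
  (nval (NConst 0) (lay (tick (nset vJ (nval (NConst 0) (lay h)) (nval (NConst 0) (lay h)) h))))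
  (tick (nset vJ (nval (NConst 0) (lay h)) (nval (NConst 0) (lay h)) h)))"
 have h1: "same pvN pvR h h1" "acfg h1" "NA h1 vJ 0 = 0" "NA h1 vBase 0 = 0" "clk h1 = clk h + 2"
  using a by (auto simp: h1_def)
 show ?case unfolding h1_def[symmetric]
 proof (rule ht_vmap[where n = d and ?b0.0 = 0 and f = "%r. 0"], goal_cases)
  case (3 k h2)
  have a2: "acfg h2" by (rule acfg_same[OF h1(2) 3(2)]) auto
  show ?case by (simp add: cst_D[OF acfg_cst[OF a2]])
 next
  case (4 h2)
  note h2 = 4
  have a2: "acfg h2" by (rule acfg_same[OF h1(2) h2(1)]) auto
  have S2: "same pvN pvR h h2" by (rule same_trans[OF h1(1) same_weaken[OF h2(1)]]) auto
  define C0 where "C0 = RA h2 yCs"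
  have v2: "NA h2 vJ 0 = 0" "NA h2 vBase 0 = 0" using h1 sameN[OF h2(1), of vJ] sameN[OF h2(1), of vBase] by auto
  show ?case
  proof (intro ht_seq ht_nst, goal_cases)
  case 3
  show ?case
  proof (rule ht_trace[where lo = 0 and hi = d and C = C0], goal_cases)
  case (5 h3)
  note h3 = 5
  define b where "b = (%l r. RA h3 yB (l * d + r))"
  define c where "c = (%l r. RA h3 yC (l * d + r))"
  have S3: "same pvN pvR h h3"
  by (rule same_trans[OF S2], rule same_weaken[of "{vP, vR, vT1, vLo, vHi}" "{xAcc, yU, yV, yY, xZ, xZ1, xP, xP0, xTr}"])
  (use h3(1) in \<open>auto simp: same_def\<close>)
  have P0: "pinv h k0 lg (3 * d + tTr + 6) h3 0 b c (RA h3 yNrm) C0"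
  proof -
  have "gst h3 0 b c (RA h3 yNrm)"
  using v2 sameN[OF h3(1), of vJ] sameN[OF h3(1), of vBase] by (simp add: gst_def)
  moreover have "gs_inv 0 b c (RA h3 yNrm) C0" by (rule gs_inv_0) (simp add: C0_def h2(3))
  moreover have "RA h3 yCs = C0" using sameR[OF h3(1), of yCs] by (simp add: C0_def)
  ultimately show ?thesis using S3 h3 h2 h1 by (simp add: pinv_def)
  qed
  show ?case
  proof (rule ht_while[where I = "%h'. \<exists>J b c nrm C. pinv h k0 lg (3 * d + tTr + 6) h' J b c nrm C"
  and \<mu> = "%h'. Suc k0 - NA h' vJ 0"], goal_cases)
  case 1
  then show ?case using P0 by blast
  next
  case (2 h4)
  then obtain J b c nrm C where I: "pinv h k0 lg (3 * d + tTr + 6) h4 J b c nrm C" by blast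
  then have S4: "same pvN pvR h h4" and g4: "gst h4 J b c nrm" and C4: "RA h4 yCs = C"
  and gi: "gs_inv J b c nrm C" and Tr4: "RA h4 xTr 0 = bsum C 0 d"
  and k4: "clk h4 <= clk h + (3 * d + tTr + 6) + J * tIter k0 lg" by (auto simp: pinv_def)
  have J4: "NA h4 vJ 0 = J" using g4 by (simp add: gst_def)
  have big: "B < bsum C 0 d" and Jk: "J < Suc k0"
  using 2(2) Tr4 B' J4 k0 sameR[OF S4, of xBB] sameN[OF S4, of vK0] by auto
  have a4: "acfg (tick h4)" using acfg_same[OF a S4] by simp
  show ?case
  proof (rule ht_seq, rule ht_select[OF a4 _ lg d0, where C = C], goal_cases)
  case (2 h5)
  note h5 = this
  have a5: "acfg h5" by (rule acfg_same[OF a4 h5(1)]) auto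
  have g5: "gst h5 J b c nrm" by (rule gst_same[OF _ h5(1)]) (use g4 in \<open>auto simp: gst_def\<close>)
  have S5: "same pvN pvR h h5" by (rule same_trans[OF S4 same_weaken[of selN selR]]) (use h5(1) in auto)
  have C5: "RA h5 yCs = C" using sameR[OF h5(1), of yCs] C4 by simp
  define p where "p = NA h5 vBlo 0"
  have "0 <= B" using B by linarith
  then have p: "bsum C 0 d <= 2 * real d * bsum C p (Suc p)" using h5(3) big unfolding p_def by linarith
  have o: "ortho J b c nrm" using gi by (simp add: gs_inv_def)
  have pd: "p < d"
  proof (rule ccontr)
  assume "\<not> p < d"
  then have "bsum C p (Suc p) = 0" by (simp add: bsum_singleton)
  then show False using p big \<open>0 <= B\<close> by simp
  qed
  show ?case
  proof (rule ht_seq, rule ht_gram_step[OF a5 g5 C5 p_def[symmetric] pd refl residual_le_Xn[OF o pd]], goal_cases)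
  case (1 h6 s C' b' c' nrm')
  note h6 = this
  have gi6: "gs_inv (Suc J) (b(J := b')) (c(J := c')) (nrm(J := nrm')) C'"
  by (rule gs_inv_step(2)[OF gi big p refl h6(3-8) h6(11)])
  have a6: "acfg h6" by (rule acfg_same[OF a5 h6(1)]) auto
  have S6: "same pvN pvR h h6" by (rule same_trans[OF S5 same_weaken[OF h6(1)]]) auto
  show ?case
  proof (intro ht_seq ht_nst, goal_cases)
  case 3
  show ?case
  proof (rule ht_trace[where lo = 0 and hi = d and C = C'], goal_cases)
  case (5 h7)
  note h7 = this
  have S7: "same pvN pvR h h7"
  by (rule same_trans[OF S6], rule same_weaken[of "{vP, vR, vT1, vLo, vHi}" "{xAcc, yU, yV, yY, xZ, xZ1, xP, xP0, xTr}"])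
  (use h7(1) in \<open>auto simp: same_def\<close>)
  have g7: "gst h7 (Suc J) (b(J := b')) (c(J := c')) (nrm(J := nrm'))"
  by (rule gst_same[OF _ h7(1)]) (use h6(9) in \<open>auto simp: gst_def\<close>)
  have C7: "RA h7 yCs = C'" using sameR[OF h7(1), of yCs] h6(10) by simp
  have "(J + 8) * (3 * d + 6) <= (Suc k0 + 8) * (3 * d + 6)" using Jk by (intro mult_le_mono1) simp
  then have tg: "tGS J <= tGS (Suc k0)" by (simp add: tGS_def)
  have "clk h7 <= clk h + (3 * d + tTr + 6) + Suc J * tIter k0 lg"
  using h7(2) h6(2) h5(2) k4 tg by (simp add: tIter_def)
  then have "pinv h k0 lg (3 * d + tTr + 6) h7 (Suc J) (b(J := b')) (c(J := c')) (nrm(J := nrm')) C'"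
  unfolding pinv_def using S7 g7 C7 gi6 h7(3) Jk by auto
  then have "\<exists>J b c nrm C. pinv h k0 lg (3 * d + tTr + 6) h7 J b c nrm C" by blast
  moreover have "NA h7 vJ 0 = Suc J" using g7 by (simp add: gst_def)
  ultimately show ?case using Jk J4 by simp
  qed (use a6 h6(10) in \<open>auto simp: cst_D acfg_cst\<close>)
  qed auto
  qed
  qed (use C4 in simp)
  next
  case (3 h4)
  then obtain J b c nrm C where I: "pinv h k0 lg (3 * d + tTr + 6) h4 J b c nrm C" by blast
  then have S4: "same pvN pvR h h4" and g4: "gst h4 J b c nrm" and Tr4: "RA h4 xTr 0 = bsum C 0 d"
  and Jk: "J <= Suc k0" by (auto simp: pinv_def)
  have J4: "NA h4 vJ 0 = J" using g4 by (simp add: gst_def)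
  have "bsum C 0 d <= B \<or> J = Suc k0"
  using 3(2) Tr4 B' J4 k0 sameR[OF S4, of xBB] sameN[OF S4, of vK0] Jk by auto
  moreover have "pinv h k0 lg (3 * d + tTr + 7) (tick h4) J b c nrm C"
  using I by (auto simp: pinv_def gst_def)
  ultimately show ?case using post by blast
  qed
  qed (use a2 in \<open>auto simp: C0_def cst_D acfg_cst\<close>)
  qed auto
 qed auto
qed auto

end

section \<open>Integer powers, thresholds and the choice of T\<close>

text \<open>Matrix powers over the natural numbers; packing is exact only for natural
  entries.\<close>

primrec Wp :: "nat => (nat => nat => nat) => nat => nat => nat => nat" where
 "Wp d S 0 i j = of_bool (i = j)"
| "Wp d S (Suc k) i j = (\<Sum>c<d. S i c * Wp d S k c j)"

lemma sop_pow_Wp: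
 assumes "!!r c. r < d ==> c < d ==> A r c = real (S r c)"
 shows "i < d ==> (sop d A ^^ k) f i = (\<Sum>j<d. real (Wp d S k i j) * f j)"
proof (induction k arbitrary: i)
 case (Suc k)
 have "(sop d A ^^ Suc k) f i = mv d A ((sop d A ^^ k) f) i"
  using Suc.prems by (simp add: sop_less)
 also have "... = (\<Sum>c<d. \<Sum>j<d. real (S i c * Wp d S k c j) * f j)"
  unfolding mv_def using Suc assms by (intro sum.cong refl) (simp add: sum_distrib_left mult.assoc)
 also have "... = (\<Sum>j<d. real (Wp d S (Suc k) i j) * f j)"
  by (subst sum.swap) (simp add: sum_distrib_right)
 finally show ?case .
qed simp

lemma Wp_row_sum:
 assumes "!!r. r < d ==> (\<Sum>c<d. S r c) <= s"
 shows "i < d ==> (\<Sum>j<d. Wp d S k i j) <= s ^ k"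
proof (induction k arbitrary: i)
 case (Suc k)
 have "(\<Sum>j<d. Wp d S (Suc k) i j) = (\<Sum>c<d. S i c * (\<Sum>j<d. Wp d S k c j))"
  unfolding Wp.simps by (subst sum.swap) (simp add: sum_distrib_left)
 also have "... <= (\<Sum>c<d. S i c * s ^ k)"
  using Suc by (intro sum_mono mult_le_mono2) simp
 also have "... = (\<Sum>c<d. S i c) * s ^ k" by (simp add: sum_distrib_right)
 also have "... <= s * s ^ k" using assms[OF Suc.prems] by (rule mult_le_mono1)
 finally show ?case by simp
qed simp

locale engine = machine +
 fixes aN :: "nat => nat" and Mn :: "nat => nat => nat" and K w1 :: nat and eps :: real
 assumes aN: "!!r. r < d ==> RA h0 yA r = real (aN r)" and aK: "!!r. r < d ==> aN r <= K"
  and Mn: "!!r c. r < d ==> c < d ==> M r c = real (Mn r c)" and Mn1: "!!r c. r < d ==> c < d ==> Mn r c <= 1"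
  and cEps: "RA h0 xEps 0 = eps" and eps: "0 < eps" and cQr: "RA h0 xQ 0 = real q" and q0: "0 < q" and n0: "0 < n"
  and cK: "RA h0 xK 0 = real K" and K1: "1 <= K" and cQK: "RA h0 xQK 0 = real (q * K\<^sup>2)"
  and sM: "sym_fun d M"
  and w1: "K\<^sup>2 * (d + q) <= 2 ^ w1" "d + 1 <= 2 ^ w1"
begin

definition Sn :: "nat => nat => nat" where
 "Sn r c = aN r * Mn r c * aN c + (if r = c then q * K\<^sup>2 else 0)"

lemma St_Sn: "r < d ==> c < d ==> St r c = real (Sn r c)"
 by (simp add: St_def shifted_def Sn_def aN Mn cQK)

lemma Sn_row: "r < d ==> (\<Sum>c<d. Sn r c) <= K\<^sup>2 * (d + q)"
proof -
 assume r: "r < d"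
 have "(\<Sum>c<d. Sn r c) = (\<Sum>c<d. aN r * Mn r c * aN c) + q * K\<^sup>2"
  using r by (simp add: Sn_def sum.distrib)
 also have "(\<Sum>c<d. aN r * Mn r c * aN c) <= (\<Sum>c<d. K\<^sup>2)"
 proof (rule sum_mono)
  fix c assume "c \<in> {..<d}"
  then have "aN r * Mn r c * aN c <= K * 1 * K" using r aK Mn1 by (intro mult_le_mono) auto
  then show "aN r * Mn r c * aN c <= K\<^sup>2" by (simp add: power2_eq_square)
 qed
 finally show ?thesis by (simp add: algebra_simps)
qed

lemma d0: "0 < d" using q0 n0 by (simp add: dnq)

text \<open>\<open>Bof\<close> and \<open>thof\<close> are the 2T-th powers of K^2 (q + 2 eps) and
  K^2 (q + eps), the levels of \<open>St\<close> that correspond to 2 eps and eps in the normalised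
  matrix. Pivoting stops at the upper level, while the rank counts from the lower one on; their
  ratio \<open>rho ^ (2 * T)\<close> is the room for all losses of the pivoting. \<open>Xof\<close>
  exceeds the sum of all entries of \<open>St\<close>^(2T).\<close>

definition Xof :: "nat => nat" where "Xof T = (K\<^sup>2 * (d + q)) ^ (2 * T) * (d + 1)"
definition Bof :: "nat => real" where "Bof T = (real (K\<^sup>2) * (real q + 2 * eps)) ^ (2 * T)"
definition thof :: "nat => real" where "thof T = (real (K\<^sup>2) * (real q + eps)) ^ (2 * T)"
definition rho :: real where "rho = (real q + 2 * eps) / (real q + eps)"

lemma rho1: "1 < rho" using eps q0 by (simp add: rho_def)

lemma Bof_rho: "Bof T = thof T * rho ^ (2 * T)"
proof -
 have "real (K\<^sup>2) * (real q + 2 * eps) = real (K\<^sup>2) * (real q + eps) * rho"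
  using eps q0 by (simp add: rho_def add_pos_pos less_imp_neq[THEN not_sym])
 then show ?thesis unfolding Bof_def thof_def by (simp only: power_mult_distrib)
qed

lemma thof1: "1 <= thof T"
proof -
 have "1 * 1 <= real (K\<^sup>2) * (real q + eps)" using K1 q0 eps by (intro mult_mono) auto
 then show ?thesis unfolding thof_def by (intro one_le_power) simp
qed

text \<open>Row sums of \<open>St\<close>^(2T) are at most the 2T-th power of K^2 (d + q), a number
  of at most \<open>w1\<close> bits, and the factor d + 1 adds another \<open>w1\<close> bits. The
  lower bound on \<open>rho ^ (2 * T)\<close> makes the threshold \<open>Bof T\<close> at least 2
  d.\<close>

lemma attempt_sym_intro:
 assumes T: "T <= Tm" and F: "2 * real d <= rho ^ (2 * T)"
 shows "attempt_sym h0 n q d nnz M rows T ((2 * Tm + 1) * w1) (Xof T) (Wp d Sn (2 * T)) (Bof T)"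
proof unfold_locales
 fix f :: "nat => real" and i assume i: "i < d"
 show "(sop d St ^^ T) ((sop d St ^^ T) f) i = (\<Sum>j<d. real (Wp d Sn (2 * T) i j) * f j)"
  using sop_pow_Wp[of d St Sn i "2 * T" f] St_Sn i by (simp add: mult_2 funpow_add)
next
 have "(\<Sum>i<d. \<Sum>j<d. Wp d Sn (2 * T) i j) <= (\<Sum>i<d. (K\<^sup>2 * (d + q)) ^ (2 * T))"
  using Sn_row by (intro sum_mono Wp_row_sum) auto
 also have "... = d * (K\<^sup>2 * (d + q)) ^ (2 * T)" by simp
 also have "... < (d + 1) * (K\<^sup>2 * (d + q)) ^ (2 * T)" using K1 q0 by simp
 finally show "(\<Sum>i<d. \<Sum>j<d. Wp d Sn (2 * T) i j) < Xof T" by (simp add: Xof_def mult.commute)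
next
 have "(K\<^sup>2 * (d + q)) ^ (2 * T) <= (2 ^ w1) ^ (2 * T)" using w1 by (intro power_mono) auto
 also have "... <= (2 ^ w1) ^ (2 * Tm)" using T by (intro power_increasing) auto
 finally have "Xof T <= (2 ^ w1) ^ (2 * Tm) * 2 ^ w1" unfolding Xof_def using w1 by (intro mult_le_mono)
 then show "Xof T <= 2 ^ ((2 * Tm + 1) * w1)" by (simp add: power_mult[symmetric] power_add[symmetric] algebra_simps)
next
 show "sym_fun d M" by (rule sM)
 have "1 * rho ^ (2 * T) <= Bof T" unfolding Bof_rho using thof1[of T] rho1 by (intro mult_right_mono) auto
 then show "2 * real d <= Bof T" using F by linarith
 show "0 < d" by (rule d0)
qed

text \<open>T runs through powers of two, so that all powers needed follow by squaring;
  \<open>power_form_bound\<close> relies on this form of T as well. The start T = 1 belongs to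
  exponent 2, hence the squarings before the loop.\<close>

definition find_T :: prog where
 "find_T = nset0 vT (NConst 1) ;;
  rset0 xRR (RDiv (RAdd (rv xQ) (RMul (Rc 2) (rv xEps))) (RAdd (rv xQ) (rv xEps))) ;;
  rset0 xRR (RMul (rv xRR) (rv xRR)) ;;
  rset0 xBB (RMul (RMul (rv xK) (rv xK)) (RAdd (rv xQ) (RMul (Rc 2) (rv xEps)))) ;;
  rset0 xBB (RMul (rv xBB) (rv xBB)) ;;
  rset0 xXX (RMul (RMul (rv xK) (rv xK)) (RNat (NAdd (nv vD) (nv vQ)))) ;;
  rset0 xXX (RMul (rv xXX) (rv xXX)) ;;
  Loop (RLess (rv xRR) (rv xF))
  (nset0 vT (NAdd (nv vT) (nv vT)) ;; rset0 xRR (RMul (rv xRR) (rv xRR)) ;;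
  rset0 xBB (RMul (rv xBB) (rv xBB)) ;; rset0 xXX (RMul (rv xXX) (rv xXX))) ;;
  rset0 xX (RMul (rv xXX) (RNat (NAdd (nv vD) (NConst 1)))) ;;
  rst yXP (NConst 0) (Rc 1) ;;
  for_loop vR (NAdd (nv vD) (NConst 1))
  (rst yXP (NAdd (nv vR) (NConst 1)) (RMul (rld yXP (nv vR)) (rv xX)))"

abbreviation "ftR == {xRR, xBB, xXX, xX, yXP}"

lemma ht_find_T:
 assumes c: "cst h" and F: "RA h xF 0 = F" "F <= rho ^ (2 * 2 ^ jm)"
  and post: "!!h' j. same {vT, vR} ftR h h' ==> clk h' <= clk h + 5 * jm + 3 * d + 15 ==> j <= jm ==>
  NA h' vT 0 = 2 ^ j ==> RA h' xBB 0 = Bof (2 ^ j) ==> F <= rho ^ (2 * 2 ^ j) ==>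
  (!!i. i <= Suc d ==> RA h' yXP i = real (Xof (2 ^ j)) ^ i) ==> Q h'"
 shows "ht find_T h Q"
proof -
 define I where "I = (%j h'. same {vT} {xRR, xBB, xXX} h h' & j <= jm & NA h' vT 0 = 2 ^ j & RA h' xBB 0 = Bof (2 ^ j) &
  RA h' xRR 0 = rho ^ (2 * 2 ^ j) & RA h' xXX 0 = real (K\<^sup>2 * (d + q)) ^ (2 * 2 ^ j) & clk h' = clk h + 7 + 5 * j)"
 have c0: "RA h xQ 0 = real q" "RA h xEps 0 = eps" "RA h xK 0 = real K" "NA h vD 0 = d" "NA h vQ 0 = q"
  using c by (auto simp: cstR cQr cEps cK cst_D cst_Q)
 have dbl: "x ^ (2 * 2 ^ Suc j) = x ^ (2 * 2 ^ j) * x ^ (2 * 2 ^ j)" for x :: real and j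
  by (simp add: power_add[symmetric] mult_2)
 have I0: "I 0 h'" if "same {vT} {xRR, xBB, xXX} h h'" "NA h' vT 0 = 1" "clk h' = clk h + 7"
  "RA h' xRR 0 = ((real q + 2 * eps) / (real q + eps)) * ((real q + 2 * eps) / (real q + eps))"
  "RA h' xBB 0 = (real K * real K * (real q + 2 * eps)) * (real K * real K * (real q + 2 * eps))"
  "RA h' xXX 0 = (real K * real K * real (d + q)) * (real K * real K * real (d + q))" for h'
  using that by (simp add: I_def Bof_def rho_def power2_eq_square)
 show ?thesis unfolding find_T_def
 proof (intro ht_seq ht_nst ht_rst, goal_cases)
  case 8
  show ?case
  proof (rule ht_while[where I = "%h'. \<exists>j. I j h'" and \<mu> = "%h'. clk h + 8 + 5 * jm - clk h'"], goal_cases)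
  case 1
  show ?case by (rule exI[of _ 0], rule I0) (auto simp: c0)
  next
  case (2 h')
  then obtain j where j: "I j h'" by blast
  have xF': "RA h' xF 0 = F" using j F sameR[of "{vT}" "{xRR, xBB, xXX}" h h' xF] by (simp add: I_def)
  have "rho ^ (2 * 2 ^ j) < rho ^ (2 * 2 ^ jm)" using 2(2) j xF' F(2) by (simp add: I_def)
  then have "2 * 2 ^ j < (2 * 2 ^ jm :: nat)" by (rule power_less_imp_less_exp[OF rho1])
  then have jl: "j < jm" by simp
  have dB: "Bof (2 ^ Suc j) = Bof (2 ^ j) * Bof (2 ^ j)" unfolding Bof_def by (rule dbl)
  show ?case
  proof (intro ht_seq ht_nst ht_rst conjI, goal_cases)
  case 5
  have "I (Suc j) h''" if "same {vT} {xRR, xBB, xXX} h h''" "NA h'' vT 0 = 2 ^ j + 2 ^ j"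
  "RA h'' xBB 0 = Bof (2 ^ j) * Bof (2 ^ j)" "RA h'' xRR 0 = rho ^ (2 * 2 ^ j) * rho ^ (2 * 2 ^ j)"
  "RA h'' xXX 0 = real (K\<^sup>2 * (d + q)) ^ (2 * 2 ^ j) * real (K\<^sup>2 * (d + q)) ^ (2 * 2 ^ j)"
  "clk h'' = clk h + 7 + 5 * j + 5" for h''
  proof -
  show ?thesis unfolding I_def dbl dB using that jl by auto
  qed
  then show ?case by (rule exI) (use j jl in \<open>auto simp: I_def\<close>)
  next
  case 6
  then show ?case using j jl by (auto simp: I_def)
  qed auto
  next
  case (3 h1)
  then obtain j where j: "I j h1" by blast
  have S1: "same {vT, vR} ftR h h1" using j same_weaken[of "{vT}" "{xRR, xBB, xXX}" h h1] by (auto simp: I_def)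
  have xF': "RA h1 xF 0 = F" using F sameR[OF S1, of xF] by simp
  have Fj: "F <= rho ^ (2 * 2 ^ j)" using 3(2) j xF' by (simp add: I_def)
  have c1: "cst h1" by (rule cst_same[OF c S1]) auto
  show ?case
  proof (intro ht_seq ht_rst, goal_cases)
  case 3
  show ?case
  proof (rule ht_for[where n = "d + 1" and I = "%k h'. same {vT, vR} ftR h h' & NA h' vT 0 = 2 ^ j &
  RA h' xBB 0 = Bof (2 ^ j) & RA h' xX 0 = real (Xof (2 ^ j)) & (\<forall>i\<le>k. RA h' yXP i = real (Xof (2 ^ j)) ^ i) &
  clk h' = clk h + 11 + 5 * j + 3 * k"], goal_cases)
  case 2
  then show ?case using S1 j cst_D[OF c1] by (auto simp: I_def Xof_def distrib_left)
  next
  case (3 k h')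
  then have "cst h'" using cst_same[OF c, of "{vT, vR}" ftR] by auto
  then show ?case by (simp add: cst_D)
  next
  case (4 k h')
  then show ?case by (intro ht_rst) (auto simp: le_Suc_eq)
  next
  case (5 h')
  then show ?case using j Fj by (intro post[of _ j]) (auto simp: I_def)
  qed simp
  qed auto
  qed
 qed auto
qed

end

section \<open>Search for the number of pivots\<close>

context engine
begin

definition combo :: "nat => (nat => nat => real) => (nat => real) => nat => real" where
 "combo m V x = (%r. \<Sum>l<m. x l * V l r)"

text \<open>What the rank bound uses about the pivots: on the span of \<open>V\<close>, the power
  \<open>St\<close>^T stretches at least as eigenvalues K^2 (q + eps) would. Strict positivity
  excludes a vanishing combination with nonzero coefficients, so the span has full dimension
  m.\<close>

definition dominating :: "nat => (nat => nat => real) => nat => bool" where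
 "dominating m V T \<longleftrightarrow> 0 < T & (\<forall>x. (\<exists>l<m. x l ~= 0) -->
  (let v = combo m V x; w = (sop d St ^^ T) v in 0 < ip d w w & thof T * ip d v v <= ip d w w))"

text \<open>Cauchy-Schwarz gives <v, A^(2^i) v>^2 <= |v|^2 <v, A^(2^(i+1)) v>. If the Rayleigh
  quotient of v exceeded L, this would carry the excess through all doublings up to exponent
  2^(j+1), against the assumption. So a bound for a high power of \<open>St\<close> comes back to
  \<open>St\<close> itself.\<close>

lemma power_form_bound:
 assumes s: "sym_fun d A" and L: "0 < L"
  and le: "ip d ((sop d A ^^ 2 ^ j) v) ((sop d A ^^ 2 ^ j) v) <= L ^ (2 * 2 ^ j) * ip d v v"
 shows "ip d v (mv d A v) <= L * ip d v v"
proof (rule ccontr)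
 assume n: "\<not> ?thesis"
 define f where "f = (%i. ip d v ((sop d A ^^ 2 ^ i) v))"
 have f0: "f 0 = ip d v (mv d A v)" unfolding f_def by (auto intro!: ip_cong simp: sop_less)
 have v0: "0 < ip d v v"
 proof (rule ccontr)
  assume "\<not> 0 < ip d v v"
  then have z: "ip d v v = 0" using ip_self_nonneg[of d v] by simp
  then have "\<forall>r<d. v r = 0" by (simp add: ip_self_zero_iff)
  then have "ip d v (mv d A v) = 0" by (simp add: ip_def)
  with n z show False by simp
 qed
 have nrm: "ip d ((sop d A ^^ 2 ^ i) v) ((sop d A ^^ 2 ^ i) v) = f (Suc i)" for i
  unfolding f_def sop_pow_sym[OF s] by (simp add: mult_2 funpow_add)
 have gt: "L ^ 2 ^ i * ip d v v < f i" for i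
 proof (induction i)
  case 0
  then show ?case using n f0 by simp
 next
  case (Suc i)
  have "(L ^ 2 ^ i * ip d v v)\<^sup>2 < (f i)\<^sup>2"
  using Suc L v0 by (intro power_strict_mono) auto
  also have "... <= ip d v v * f (Suc i)"
  using cauchy_schwarz_ip[of d v "(sop d A ^^ 2 ^ i) v"] nrm[of i] by (simp add: f_def)
  moreover have "L ^ 2 ^ Suc i = L ^ 2 ^ i * L ^ 2 ^ i" by (simp add: mult_2 power_add)
  ultimately have "ip d v v * (L ^ 2 ^ Suc i * ip d v v) < ip d v v * f (Suc i)"
  by (simp add: power2_eq_square mult_ac)
  then show ?case using v0 by simp
 qed
 show False using gt[of "Suc j"] le nrm[of j] by simp
qed

text \<open>Programs are defined inside locales but mention none of their parameters, so
  \<open>attempt_sym.pivots\<close> is one fixed program. The gap demanded for guess k0 is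
  \<open>xF\<close> = (24 d)^(k0 + 2).\<close>

definition search :: prog where
 "search = nset0 vK0 (NConst 0) ;;
  rset0 xF (RMul (RMul (Rc 24) (RNat (nv vD))) (RMul (Rc 24) (RNat (nv vD)))) ;;
  nset0 vOk (NConst 0) ;;
  Loop (NLess (nv vOk) (NConst 1))
  (find_T ;; attempt_sym.pivots ;;
  Cond (RLess (rv xBB) (rv xTr))
  (nset0 vK0 (NAdd (nv vK0) (NConst 1)) ;; rset0 xF (RMul (rv xF) (RMul (Rc 24) (RNat (nv vD)))))
  (nset0 vOk (NConst 1)))"

definition basis_found :: "hst => nat => (nat => nat => real) => (nat => real) => bool" where
 "basis_found h J b nrm \<longleftrightarrow> NA h vJ 0 = J & (\<forall>l<J. NA h vBB l = l * d) &
  (\<forall>l<J. \<forall>r<d. RA h yB (l * d + r) = b l r) & (\<forall>l<J. RA h yNrm l = nrm l) &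
  (\<forall>l<J. 1 <= nrm l & nrm l < 4 & nrm l = ip d (b l) (b l) & (\<forall>l'<J. l ~= l' --> ip d (b l) (b l') = 0)) &
  (\<forall>v. (\<forall>l<J. ip d v (b l) = 0) --> ip d v (mv d St v) <= real (K\<^sup>2) * (real q + 2 * eps) * ip d v v)"

definition tTrM :: "nat => nat" where
 "tTrM jm = (2 * 2 ^ jm + 2) * (tM + 2) + 6 * ((2 * 2 ^ jm + 1) * w1) * (d + 1)"
definition tIterM :: "nat => nat => nat => nat" where
 "tIterM jm k lg = (lg + 1) * (2 * tTrM jm + 2 * lg + 20) +
  ((2 * 2 ^ jm + 2) * (tM + 2) + (Suc k + 8) * (3 * d + 6) + 2 * ((2 * 2 ^ jm + 1) * w1) + 30) + tTrM jm + 5"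
definition tAttM :: "nat => nat => nat => nat" where
 "tAttM jm k lg = 5 * jm + 6 * d + 30 + tTrM jm + (k + 1) * tIterM jm k lg"

abbreviation "srN == {vP, vR, vT, vT1, vLen, vBlo, vH, vLo, vHi, vL, vBB, vBase, vJ, vK0, vOk}"
abbreviation "srR == {xAcc, yU, yV, yY, xZ, xZ1, xP, xP0, xTr, xTA, xTB, xCoef, xNr, xS, yB, yC, yNrm, yCs,
 xRR, xBB, xXX, xX, yXP, xF}"

text \<open>Both outcomes are informative. If the residual trace is still large, k0 + 1 pivots were
  taken; they span a dominating space, so k0 + 1 <= \<open>kk\<close>. Otherwise the residual bound
  holds on the complement and \<open>power_form_bound\<close> turns it into the bound of
  \<open>basis_found\<close>.\<close>

lemma ht_attempt:
 assumes c: "cst h" and F: "RA h xF 0 = (24 * real d) ^ (k0 + 2)" and k0: "NA h vK0 0 = k0" "k0 <= kk"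
  and jm: "(24 * real d) ^ (kk + 2) <= rho ^ (2 * 2 ^ jm)" and lg: "d <= 2 ^ lg"
  and hk: "!!m V T. dominating m V T ==> m <= kk"
  and post: "!!h'. same srN srR h h' ==> NA h' vK0 = NA h vK0 ==> NA h' vOk = NA h vOk ==> RA h' xF = RA h xF ==>
  clk h' <= clk h + tAttM jm kk lg ==>
  RA h' xBB 0 < RA h' xTr 0 ==> Suc k0 <= kk ==> Q h'"
  and post': "!!h' J b nrm. same srN srR h h' ==> NA h' vK0 = NA h vK0 ==> NA h' vOk = NA h vOk ==> RA h' xF = RA h xF ==>
  clk h' <= clk h + tAttM jm kk lg ==>
  \<not> RA h' xBB 0 < RA h' xTr 0 ==> J <= kk ==> basis_found h' J b nrm ==> Q h'"
 shows "ht (find_T ;; attempt_sym.pivots) h Q"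
proof (rule ht_seq, rule ht_find_T[OF c F, where jm = jm], goal_cases)
 case 1
 have "(24 * real d) ^ (k0 + 2) <= (24 * real d) ^ (kk + 2)"
  using d0 k0 by (intro power_increasing) auto
 with jm show ?case by linarith
next
 case (2 h1 j)
 note h1 = this
 define T where "T = (2::nat) ^ j"
 have Tm: "T <= 2 ^ jm" using h1(3) by (simp add: T_def)
 have F2: "2 * real d <= (24 * real d) ^ (k0 + 2)"
 proof -
  have "2 * real d <= (24 * real d) ^ 1" by simp
  also have "... <= (24 * real d) ^ (k0 + 2)" using d0 by (intro power_increasing) auto
  finally show ?thesis .
 qed
 define wx where "wx = (2 * 2 ^ jm + 1) * w1"
 define Wn where "Wn = Wp d Sn (2 * T)"
 interpret at: attempt_sym h0 n q d nnz M rows T wx "Xof T" Wn "Bof T"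
  unfolding wx_def Wn_def
  by (rule attempt_sym_intro[OF Tm]) (use order_trans[OF F2 h1(6)] in \<open>simp only: T_def\<close>)
 have c1: "cst h1" by (rule cst_same[OF c h1(1)]) auto
 have a1: "at.acfg h1" unfolding at.acfg_def using c1 h1(4,7) by (simp add: T_def)
 have B1: "RA h1 xBB 0 = Bof T" using h1(5) by (simp add: T_def)
 have k1: "NA h1 vK0 0 = k0" using k0 sameN[OF h1(1), of vK0] by simp
 show "ht attempt_sym.pivots h1 Q"
 proof (rule at.ht_pivots[OF a1 B1 k1 lg], goal_cases)
  case (1 h2 J b c' nrm C)
  then have S2: "same at.pvN at.pvR h1 h2" and g: "at.gst h2 J b c' nrm" and gi: "at.gs_inv J b c' nrm C"
  and Jk: "J <= Suc k0" and Tr: "RA h2 xTr 0 = at.bsum C 0 d"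
  and k2: "clk h2 <= clk h1 + (3 * d + at.tTr + 7) + J * at.tIter k0 lg" by (auto simp: at.pinv_def)
  obtain p s where pv: "at.pivoted J b c' nrm p s" and o: "at.ortho J b c' nrm" using gi by (auto simp: at.gs_inv_def)
  have "dominating J (%l. at.ue (p l)) T"
  unfolding dominating_def Let_def
  proof (rule conjI; (intro allI impI)?)
  show "0 < T" by (simp add: T_def)
  next
  fix x :: "nat => real" assume "\<exists>l<J. x l ~= 0"
  then obtain l where l: "l < J" "x l ~= 0" by blast
  define v where "v = combo J (%l. at.ue (p l)) x"
  define E where "E = ip d (at.AT v) (at.AT v)"
  have "\<bar>x l\<bar> <= (\<Sum>j<J. \<bar>x j\<bar>)" by (rule member_le_sum) (use l in auto)
  then have S0: "0 < (\<Sum>j<J. \<bar>x j\<bar>)" using l by simp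
  have th0: "0 < thof T" using thof1[of T] by linarith
  have Fr: "(24 * real d) ^ (k0 + 2) <= rho ^ (2 * T)" using h1(6) by (simp add: T_def)
  have B0: "0 < Bof T" unfolding Bof_rho using th0 rho1 by simp
  \<comment> \<open>The loss (12 d)^J 2 d of \<open>pivots_lower_bound\<close> with J <= k0 + 1 fits
    below (24 d)^(k0 + 2); this is where base and exponent of \<open>xF\<close> come from.\<close>
  have "(12 * real d) ^ J * (2 * real d) <= (24 * real d) ^ Suc k0 * (24 * real d)"
  proof (intro mult_mono)
  have "(12 * real d) ^ J <= (24 * real d) ^ J" by (intro power_mono) auto
  also have "... <= (24 * real d) ^ Suc k0" using d0 Jk by (intro power_increasing) auto
  finally show "(12 * real d) ^ J <= (24 * real d) ^ Suc k0" .
  qed auto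
  also have "... = (24 * real d) ^ (k0 + 2)" by simp
  finally have "(12 * real d) ^ J * (2 * real d) <= rho ^ (2 * T)" using Fr by linarith
  then have "thof T * ((12 * real d) ^ J * (2 * real d)) <= Bof T"
  unfolding Bof_rho using th0 by (intro mult_left_mono) auto
  then have cf: "thof T * ((12 * real d) ^ J * (2 * real d / Bof T)) <= 1" using B0 by (simp add: field_simps)
  have E0: "0 <= E" by (simp add: E_def ip_self_nonneg)
  have "(\<Sum>j<J. \<bar>x j\<bar>)\<^sup>2 <= (12 * real d) ^ J * (2 * real d / Bof T) * E"
  using at.pivots_lower_bound(1)[OF o pv, of x] by (simp add: E_def v_def combo_def)
  then have "thof T * (\<Sum>j<J. \<bar>x j\<bar>)\<^sup>2 <= thof T * ((12 * real d) ^ J * (2 * real d / Bof T) * E)"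
  using th0 by (intro mult_left_mono) auto
  also have "... = (thof T * ((12 * real d) ^ J * (2 * real d / Bof T))) * E" by simp
  also have "... <= 1 * E" using cf E0 by (rule mult_right_mono)
  finally have le: "thof T * (\<Sum>j<J. \<bar>x j\<bar>)\<^sup>2 <= E" by simp
  have "thof T * ip d v v <= thof T * (\<Sum>j<J. \<bar>x j\<bar>)\<^sup>2"
  using at.pivots_lower_bound(2)[OF o pv, of x] th0 by (intro mult_left_mono) (auto simp: v_def combo_def)
  moreover have "0 < thof T * (\<Sum>j<J. \<bar>x j\<bar>)\<^sup>2" using th0 S0 by simp
  ultimately show "0 < ip d (at.AT v) (at.AT v) & thof T * ip d v v <= ip d (at.AT v) (at.AT v)"
  using le by (simp add: E_def)
  qed
  then have Jkk: "J <= kk" by (rule hk)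
  have S: "same srN srR h h2"
  by (rule same_trans[OF same_weaken[OF h1(1)] same_weaken[OF S2]]) auto
  have fr: "NA h2 vK0 = NA h vK0" "NA h2 vOk = NA h vOk" "RA h2 xF = RA h xF"
  using sameN[OF h1(1), of vK0] sameN[OF S2, of vK0] sameN[OF h1(1), of vOk] sameN[OF S2, of vOk]
  sameR[OF h1(1), of xF] sameR[OF S2, of xF] by auto
  have BB2: "RA h2 xBB 0 = Bof T" using B1 sameR[OF S2, of xBB] by simp
  have tr: "at.tTr <= tTrM jm" unfolding at.tTr_def tTrM_def wx_def[symmetric] using Tm by (intro add_mono mult_le_mono) auto
  have "(2 * T + 2) * (tM + 2) <= (2 * 2 ^ jm + 2) * (tM + 2)" using Tm by (intro mult_le_mono) auto
  moreover have "(Suc k0 + 8) * (3 * d + 6) <= (Suc kk + 8) * (3 * d + 6)" using k0(2) by (intro mult_le_mono) auto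
  moreover have "(lg + 1) * (2 * at.tTr + 2 * lg + 20) <= (lg + 1) * (2 * tTrM jm + 2 * lg + 20)"
  using tr by (intro mult_le_mono) auto
  ultimately have ti: "at.tIter k0 lg <= tIterM jm kk lg"
  unfolding at.tIter_def at.tGS_def tIterM_def wx_def[symmetric] using tr by linarith
  have "J * at.tIter k0 lg <= (kk + 1) * tIterM jm kk lg" using ti Jkk by (intro mult_le_mono) auto
  then have kt: "clk h2 <= clk h + tAttM jm kk lg" using k2 h1(2) tr by (simp add: tAttM_def)
  show ?case
  proof (cases "RA h2 xBB 0 < RA h2 xTr 0")
  case True
  then have "J = Suc k0" using 1(2) Tr BB2 by auto
  then show ?thesis using True S fr kt Jkk by (intro post) auto
  next
  case False
  then have le: "at.bsum C 0 d <= Bof T" using Tr BB2 by simp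
  have "basis_found h2 J b nrm"
  proof -
  have "ip d v (mv d St v) <= real (K\<^sup>2) * (real q + 2 * eps) * ip d v v" if v: "\<forall>l<J. ip d v (b l) = 0" for v
  proof (rule power_form_bound[OF at.sym_St, where j = j])
  show "0 < real (K\<^sup>2) * (real q + 2 * eps)" using K1 eps by (intro mult_pos_pos add_nonneg_pos) auto
  show "ip d ((sop d St ^^ 2 ^ j) v) ((sop d St ^^ 2 ^ j) v) <= (real (K\<^sup>2) * (real q + 2 * eps)) ^ (2 * 2 ^ j) * ip d v v"
  using at.orthogonal_complement_bound[OF gi le, of v] v by (simp add: T_def Bof_def)
  qed
  then show ?thesis using g o by (auto simp: basis_found_def at.gst_def at.ortho_def)
  qed
  then show ?thesis using False S fr kt Jkk by (intro post') auto
  qed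
 qed
qed

text \<open>A failed attempt proves that the next guess is still at most \<open>kk\<close>, so at
  most \<open>kk\<close> + 1 attempts are made.\<close>

lemma ht_search:
 assumes c: "cst h"
  and jm: "(24 * real d) ^ (kk + 2) <= rho ^ (2 * 2 ^ jm)" and lg: "d <= 2 ^ lg"
  and hk: "!!m V T. dominating m V T ==> m <= kk"
  and post: "!!h' J b nrm. same srN srR h h' ==> clk h' <= clk h + (kk + 1) * (tAttM jm kk lg + 5) + 5 ==>
  J <= kk ==> basis_found h' J b nrm ==> Q h'"
 shows "ht search h Q"
 unfolding search_def
proof (intro ht_seq ht_nst ht_rst, goal_cases)
 case 4
 define tA where "tA = tAttM jm kk lg + 5"
 define I where "I = (%h'. same srN srR h h' &
  ((\<exists>k0\<le>kk. NA h' vK0 0 = k0 & NA h' vOk 0 = 0 & RA h' xF 0 = (24 * real d) ^ (k0 + 2) & clk h' <= clk h + 3 + k0 * tA) \<or>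
  (NA h' vOk 0 = 1 & clk h' <= clk h + 3 + (kk + 1) * tA & (\<exists>J b nrm. J <= kk & basis_found h' J b nrm))))"
 have found_simps: "basis_found (tick h') J b nrm = basis_found h' J b nrm"
  "basis_found (nset vOk i x h') J b nrm = basis_found h' J b nrm" for h' J b nrm i x
  by (simp_all add: basis_found_def)
 show ?case
 proof (rule ht_while[where I = I and \<mu> = "%h'. if NA h' vOk 0 = 0 then Suc kk - NA h' vK0 0 else 0"], goal_cases)
  case 1
  then show ?case using c by (auto simp: I_def cst_D power2_eq_square)
 next
  case (2 h1)
  have S1: "same srN srR h h1" using 2 by (simp add: I_def)
  obtain k0 where k0: "k0 <= kk" "NA h1 vK0 0 = k0" "NA h1 vOk 0 = 0" "RA h1 xF 0 = (24 * real d) ^ (k0 + 2)"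
  "clk h1 <= clk h + 3 + k0 * tA" using 2 by (auto simp: I_def)
  have c1: "cst (tick h1)" using cst_same[OF c S1] by auto
  \<comment> \<open>Sequencing associates to the right, so its first two components are regrouped
    before \<open>ht_attempt\<close> applies; the step counts agree.\<close>
  have split: "ht (find_T ;; attempt_sym.pivots ;; P) h' Q" if "ht (find_T ;; attempt_sym.pivots) h' (%h2. ht P h2 Q)" for h' P Q
  proof -
  from that obtain t hh u h2 where e: "exec (find_T ;; attempt_sym.pivots) (lay h') t (lay hh)" "clk hh = clk h' + t"
  "exec P (lay hh) u (lay h2)" "clk h2 = clk hh + u" "Q h2" unfolding ht_def by blast
  from e(1) obtain t1 s1 t2 where "exec find_T (lay h') t1 s1" "exec attempt_sym.pivots s1 t2 (lay hh)" "t = t1 + t2"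
  by (cases rule: exec.cases) auto
  then have "exec (find_T ;; attempt_sym.pivots ;; P) (lay h') (t1 + (t2 + u)) (lay h2)"
  using e(3) by (intro exec.Then) auto
  then show ?thesis unfolding ht_def using e \<open>t = t1 + t2\<close> by (intro exI[of _ "t1 + (t2 + u)"] exI[of _ h2]) auto
  qed
  show ?case
  proof (rule split, rule ht_attempt[OF c1 _ _ k0(1) jm lg], goal_cases)
  case (4 h2)
  have S2: "same srN srR h h2" by (rule same_trans[OF S1]) (use 4(1) in simp)
  have c2: "cst h2" by (rule cst_same[OF c S2]) auto
  have "clk h2 + 4 <= clk h + 3 + Suc k0 * tA" using 4(5) k0(5) by (simp add: tA_def)
  then show ?case using 4 S2 k0 c2
  by (intro ht_cond ht_seq ht_nst ht_rst) (auto simp: I_def cst_D)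
  next
  case (5 h2 J b nrm)
  have S2: "same srN srR h h2" by (rule same_trans[OF S1]) (use 5(1) in simp)
  have "k0 * tA + tA <= (kk + 1) * tA" using k0(1) by simp
  moreover have "clk h2 + 4 <= clk h + 3 + k0 * tA + tA" using 5(5) k0(5) by (simp add: tA_def)
  ultimately have "clk h2 + 4 <= clk h + 3 + (kk + 1) * tA" by linarith
  moreover have "\<exists>J b nrm. J <= kk & basis_found (tick (nset vOk 0 (Suc 0) (tick h2))) J b nrm"
  using 5(7,8) by (intro exI[of _ J] exI[of _ b] exI[of _ nrm]) (simp add: found_simps)
  ultimately show ?case using 5(6) S2 k0
  by (intro ht_cond ht_seq ht_nst ht_rst) (auto simp: I_def)
  qed (use k0 hk in auto)
 next
  case (3 h1)
  then obtain J b nrm where "J <= kk" "basis_found h1 J b nrm" "same srN srR h h1" "clk h1 <= clk h + 3 + (kk + 1) * tA"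
  by (auto simp: I_def)
  then show ?case by (intro post[of _ J b nrm]) (auto simp: found_simps tA_def)
 qed
qed auto

end

section \<open>Frank-Wolfe and rounding\<close>

lemma sum_blocks: "(\<Sum>r<n * q. F r) = (\<Sum>i<n. \<Sum>\<alpha><q. F (i * q + \<alpha>))" for F :: "nat => real"
proof -
 have e: "sum F {i * q..<i * q + q} = (\<Sum>\<alpha><q. F (i * q + \<alpha>))" for i
  using sum.shift_bounds_nat_ivl[of F 0 "i * q" q] by (simp add: atLeast0LessThan add.commute)
 show ?thesis unfolding e[symmetric] by (simp add: sum.nat_group)
qed

lemma block_div_mod: "\<alpha> < q ==> (i * q + \<alpha>) div q = i & (i * q + \<alpha>) mod q = \<alpha>" for q i \<alpha> :: nat
 by auto

lemma block_less: "i < n ==> \<alpha> < q ==> i * q + \<alpha> < n * q" for q i \<alpha> n :: nat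
proof -
 assume "i < n" "\<alpha> < q"
 then have "i * q + \<alpha> < Suc i * q" "Suc i * q <= n * q" by (simp, intro mult_le_mono1, simp)
 then show ?thesis by linarith
qed

text \<open>The 0/1 vector of an assignment, with one block of q entries per vertex of the graph;
  \<open>fractional\<close> below is the product of simplices that these vectors span.\<close>

definition label_vec :: "nat => (nat => nat) => nat => real" where
 "label_vec q x r = of_bool (r mod q = x (r div q))"

definition fractional :: "nat => nat => (nat => real) => bool" where
 "fractional n q z \<longleftrightarrow> (\<forall>r<n * q. 0 <= z r) & (\<forall>i<n. (\<Sum>\<alpha><q. z (i * q + \<alpha>)) = 1)"

definition argmax_labels :: "nat => nat => (nat => real) => (nat => nat) => bool" where
 "argmax_labels n q g x \<longleftrightarrow> (\<forall>i<n. x i < q & (\<forall>\<alpha><q. g (i * q + \<alpha>) <= g (i * q + x i)))"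

lemma label_vec_sum: "x i < q ==> (\<Sum>\<alpha><q. F \<alpha> * label_vec q x (i * q + \<alpha>)) = F (x i)"
proof -
 assume x: "x i < q"
 have "(\<Sum>\<alpha><q. F \<alpha> * label_vec q x (i * q + \<alpha>)) = (\<Sum>\<alpha><q. if \<alpha> = x i then F \<alpha> else 0)"
  by (intro sum.cong refl) (auto simp: label_vec_def block_div_mod)
 then show ?thesis using x by simp
qed

lemma fractional_label_vec: "(!!i. i < n ==> x i < q) ==> fractional n q (label_vec q x)"
 unfolding fractional_def using label_vec_sum[of x _ q "%_. 1"] by (auto simp: label_vec_def)

lemma fractional_mix:
 assumes "fractional n q z" "fractional n q w" "0 <= \<eta>" "\<eta> <= 1"
 shows "fractional n q (%r. (1 - \<eta>) * z r + \<eta> * w r)"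
 using assms unfolding fractional_def
 by (auto simp: sum.distrib sum_distrib_left[symmetric])

lemma fractional_le_1: "fractional n q z ==> 0 < q ==> r < n * q ==> z r <= 1"
proof -
 assume f: "fractional n q z" and q: "0 < q" and r: "r < n * q"
 define i where "i = r div q"
 have i: "i < n" using r q by (simp add: i_def less_mult_imp_div_less)
 have "z (i * q + r mod q) <= (\<Sum>\<alpha><q. z (i * q + \<alpha>))"
  by (rule member_le_sum[of "r mod q" "{..<q}" "%\<alpha>. z (i * q + \<alpha>)"])
  (use f q i block_less in \<open>auto simp: fractional_def\<close>)
 then show ?thesis using f i by (simp add: fractional_def i_def)
qed

lemma fractional_weighted_sum:
 "fractional n q z ==> (\<Sum>r<n * q. c (r div q) * z r) = (\<Sum>i<n. c i)"
 unfolding sum_blocks fractional_def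
 by (intro sum.cong refl) (auto simp: block_div_mod sum_distrib_left[symmetric])

text \<open>A linear function on a product of simplices splits over the blocks, and in each block it
  is an average of its values at the labels.\<close>

lemma argmax_linear:
 assumes "argmax_labels n q g x" "fractional n q z"
 shows "ip (n * q) g z <= ip (n * q) g (label_vec q x)"
 unfolding ip_def sum_blocks
proof (rule sum_mono)
 fix i assume "i \<in> {..<n}"
 then have i: "i < n" by simp
 have "(\<Sum>\<alpha><q. g (i * q + \<alpha>) * z (i * q + \<alpha>)) <= (\<Sum>\<alpha><q. g (i * q + x i) * z (i * q + \<alpha>))"
  using assms i block_less[OF i] unfolding argmax_labels_def fractional_def
  by (intro sum_mono mult_right_mono) auto
 also have "... = g (i * q + x i)" using assms(2) i by (simp add: sum_distrib_left[symmetric] fractional_def)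
 also have "... = (\<Sum>\<alpha><q. g (i * q + \<alpha>) * label_vec q x (i * q + \<alpha>))"
  using assms(1) i by (subst label_vec_sum) (auto simp: argmax_labels_def)
 finally show "(\<Sum>\<alpha><q. g (i * q + \<alpha>) * z (i * q + \<alpha>)) <= (\<Sum>\<alpha><q. g (i * q + \<alpha>) * label_vec q x (i * q + \<alpha>))" .
qed

definition scaled :: "(nat => nat => real) => (nat => real) => nat => nat => real" where
 "scaled M e = (%r c. M r c / (e r * e c))"

text \<open>For each entry, |v_r v_c|/(e_r e_c) is at most the mean of (v_r/e_r)^2 and (v_c/e_c)^2;
  by symmetry both halves give the same sum, and the row sums turn it into q |v|^2. So the
  normalised matrix has its spectrum in [-q, q].\<close>

lemma weighted_form_bound:
 assumes sM: "sym_fun d M" and Mnn: "!!r c. r < d ==> c < d ==> 0 <= M r c"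
  and rows: "!!r. r < d ==> (\<Sum>c<d. M r c) <= q * (e r)\<^sup>2" and q: "0 <= q"
 shows "\<bar>ip d v (mv d (scaled M e) v)\<bar> <= q * ip d v v"
proof -
 have "\<bar>ip d v (mv d (scaled M e) v)\<bar> <= (\<Sum>r<d. \<Sum>c<d. \<bar>v r * (scaled M e r c * v c)\<bar>)"
  unfolding ip_def mv_def sum_distrib_left by (rule order_trans[OF sum_abs]) (intro sum_mono sum_abs)
 also have "... <= (\<Sum>r<d. \<Sum>c<d. M r c * ((v r / e r)\<^sup>2 / 2) + M c r * ((v c / e c)\<^sup>2 / 2))"
 proof (intro sum_mono)
  fix r c assume "r \<in> {..<d}" "c \<in> {..<d}"
  then have rc: "0 <= M r c" "M c r = M r c" using Mnn sM by (auto simp: sym_fun_def)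
  have "\<bar>v r * (scaled M e r c * v c)\<bar> = M r c * (\<bar>v r / e r\<bar> * \<bar>v c / e c\<bar>)"
  using rc(1) by (simp add: scaled_def abs_mult)
  also have "... <= M r c * ((v r / e r)\<^sup>2 / 2 + (v c / e c)\<^sup>2 / 2)"
  proof (rule mult_left_mono[OF _ rc(1)])
  have "0 <= (\<bar>v r / e r\<bar> - \<bar>v c / e c\<bar>)\<^sup>2" by simp
  then show "\<bar>v r / e r\<bar> * \<bar>v c / e c\<bar> <= (v r / e r)\<^sup>2 / 2 + (v c / e c)\<^sup>2 / 2"
  by (simp only: power2_diff power2_abs)
  qed
  finally show "\<bar>v r * (scaled M e r c * v c)\<bar> <= M r c * ((v r / e r)\<^sup>2 / 2) + M c r * ((v c / e c)\<^sup>2 / 2)"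
  using rc(2) by (simp add: distrib_left)
 qed
 also have "... = 2 * (\<Sum>r<d. \<Sum>c<d. M r c * ((v r / e r)\<^sup>2 / 2))"
  by (simp only: sum.distrib) (subst (2) sum.swap, simp)
 also have "... = (\<Sum>r<d. (\<Sum>c<d. M r c) * (v r / e r)\<^sup>2)"
  by (simp only: sum_distrib_left sum_distrib_right) (simp add: mult.commute)
 also have "... <= (\<Sum>r<d. q * (v r * v r))"
 proof (rule sum_mono)
  fix r assume "r \<in> {..<d}"
  then have "(\<Sum>c<d. M r c) * (v r / e r)\<^sup>2 <= q * (e r)\<^sup>2 * (v r / e r)\<^sup>2"
  using rows by (intro mult_right_mono) auto
  also have "... <= q * (v r * v r)" using q by (cases "e r = 0") (auto simp: power2_eq_square)
  finally show "(\<Sum>c<d. M r c) * (v r / e r)\<^sup>2 <= q * (v r * v r)" .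
 qed
 also have "... = q * ip d v v" by (simp add: ip_def sum_distrib_left)
 finally show ?thesis .
qed

section \<open>Frank-Wolfe for the penalised quadratic form\<close>

locale frank_wolfe =
 fixes n q d J :: nat and M :: "nat => nat => real" and ev :: "nat => real" and e :: "nat => real"
  and b :: "nat => nat => real" and nrm :: "nat => real" and \<epsilon> \<kappa> :: real
 assumes dnq: "d = n * q" and q0: "0 < q" and sM: "sym_fun d M"
  and Mnn: "!!r c. r < d ==> c < d ==> 0 <= M r c"
  and rows: "!!r. r < d ==> (\<Sum>c<d. M r c) <= real q * (e r)\<^sup>2"
  and ev: "!!r. r < d ==> e r = ev (r div q)" and eps: "0 < \<epsilon>" "\<epsilon> < 1"
  and kap: "\<kappa> = real q + (real q)\<^sup>2 / \<epsilon>"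
  and basis: "!!l. l < J ==> 1 <= nrm l & nrm l < 4 & nrm l = ip d (b l) (b l)"
  and orth: "!!l l'. l < J ==> l' < J ==> l ~= l' ==> ip d (b l) (b l') = 0"
  and perp: "!!v. (!!l. l < J ==> ip d v (b l) = 0) ==> ip d v (mv d (scaled M e) v) <= 2 * \<epsilon> * ip d v v"
begin

text \<open>Everything is measured in the coordinates e_r z_r, in which \<open>M\<close> becomes
  \<open>scaled M e\<close>: \<open>tc l\<close> is the coefficient along \<open>b l\<close> and
  \<open>Nz\<close> the squared norm. \<open>grad\<close> is half the gradient of
  \<open>gob\<close>. \<open>Se\<close> is the natural scale of the errors; for the graph it lies
  between m and 8 m.\<close>

definition tc :: "nat => (nat => real) => real" where
 "tc l z = ip d (b l) (%r. e r * z r) / nrm l"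
definition obj :: "(nat => real) => real" where "obj z = ip d z (mv d M z)"
definition Nz :: "(nat => real) => real" where "Nz z = ip d (%r. e r * z r) (%r. e r * z r)"
definition pen :: "(nat => real) => (nat => real) => real" where
 "pen \<gamma> z = (\<Sum>l<J. nrm l * (tc l z - \<gamma> l)\<^sup>2)"
definition gob :: "(nat => real) => (nat => real) => real" where "gob \<gamma> z = obj z - \<kappa> * pen \<gamma> z"
definition grad :: "(nat => real) => (nat => real) => nat => real" where
 "grad \<gamma> z r = mv d M z r - (\<Sum>l<J. \<kappa> * (tc l z - \<gamma> l) * (e r * b l r))"
definition Se :: real where "Se = (\<Sum>i<n. (ev i)\<^sup>2)"

lemma nrm_pos: "l < J ==> 0 < nrm l" using basis[of l] by linarith
lemma kap_pos: "0 < \<kappa>" "real q <= \<kappa>" "1 <= \<kappa>"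
proof -
 have "0 <= (real q)\<^sup>2 / \<epsilon>" using eps by simp
 then show "0 < \<kappa>" "real q <= \<kappa>" "1 <= \<kappa>" using q0 by (auto simp: kap)
qed

lemma nz: "l < J ==> ip d (b l) (b l) ~= 0"
 using basis[of l] by auto

lemma bessel: "(\<Sum>l<J. nrm l * (tc l z)\<^sup>2) <= Nz z"
proof -
 define y where "y = (%r. e r * z r)"
 have "0 <= ip d y y - (\<Sum>l<J. (ip d (b l) y)\<^sup>2 / ip d (b l) (b l))"
  using ip_self_nonneg[of d "%r. y r - (\<Sum>l<J. ip d (b l) y / ip d (b l) (b l) * b l r)"]
  orthogonal_residual_norm(2)[OF orth nz, where a = y] by simp
 also have "(\<Sum>l<J. (ip d (b l) y)\<^sup>2 / ip d (b l) (b l)) = (\<Sum>l<J. nrm l * (tc l z)\<^sup>2)"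
  using basis nrm_pos by (intro sum.cong refl) (auto simp: tc_def y_def power2_eq_square)
 finally show ?thesis by (simp add: Nz_def y_def)
qed

lemma zero_row: "r < d ==> c < d ==> e r = 0 ==> M r c = 0"
proof -
 assume a: "r < d" "c < d" "e r = 0"
 have "M r c <= (\<Sum>c<d. M r c)" by (rule member_le_sum) (use a Mnn in auto)
 then show ?thesis using rows[OF a(1)] a Mnn[OF a(1,2)] by simp
qed

lemma obj_scaled: "obj z = ip d (%r. e r * z r) (mv d (scaled M e) (%r. e r * z r))"
proof -
 have "M r c = e r * e c * scaled M e r c" if "r < d" "c < d" for r c
  using zero_row[OF that] zero_row[OF that(2,1)] sM that
  by (cases "e r = 0"; cases "e c = 0") (auto simp: scaled_def sym_fun_def)
 then show ?thesis unfolding obj_def ip_def mv_def sum_distrib_left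
  by (intro sum.cong refl) (simp add: mult_ac)
qed

lemma obj_abs: "\<bar>obj z\<bar> <= real q * Nz z"
 unfolding obj_scaled Nz_def by (rule weighted_form_bound[OF sM Mnn rows]) auto

text \<open>Split (e_r z_r) into u in the span of the \<open>b l\<close> and v orthogonal to it. The
  form is at most q |u|^2 on u and 2 eps |v|^2 on v, and the mixed term is at most (q^2/eps) |u|^2 +
  eps |v|^2. The constant \<open>\<kappa>\<close> = q + q^2/eps collects the coefficients of |u|^2,
  so subtracting the penalty leaves a curvature of at most 3 eps: \<open>gob\<close> is almost
  concave.\<close>

lemma obj_le: "obj z <= \<kappa> * (\<Sum>l<J. nrm l * (tc l z)\<^sup>2) + 3 * \<epsilon> * Nz z"
proof -
 define y where "y = (%r. e r * z r)"
 define u where "u = (%r. \<Sum>l<J. tc l z * b l r)"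
 define v where "v = (%r. y r - u r)"
 define H where "H = (%f g. ip d f (mv d (scaled M e) g))"
 have ue: "u r = (\<Sum>l<J. ip d (b l) y / ip d (b l) (b l) * b l r)" for r
  unfolding u_def tc_def y_def using basis by (intro sum.cong refl) auto
 have vb: "ip d v (b l) = 0" if "l < J" for l
  unfolding v_def ue by (rule orthogonal_residual_norm(1)[OF orth nz that])
 have uu: "ip d u u = (\<Sum>l<J. nrm l * (tc l z)\<^sup>2)"
  unfolding u_def using orthogonal_sum_norm[OF orth, where a = "%l. tc l z"] basis by (simp add: mult.commute)
 have vv: "ip d v v = ip d y y - ip d u u"
 proof -
  have "ip d v v = ip d y y - (\<Sum>l<J. (ip d (b l) y)\<^sup>2 / ip d (b l) (b l))"
  unfolding v_def ue by (rule orthogonal_residual_norm(2)[OF orth nz])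
  also have "(\<Sum>l<J. (ip d (b l) y)\<^sup>2 / ip d (b l) (b l)) = (\<Sum>l<J. nrm l * (tc l z)\<^sup>2)"
  using basis nrm_pos by (intro sum.cong refl) (auto simp: tc_def y_def power2_eq_square)
  finally show ?thesis using uu by simp
 qed
 have sH: "sym_fun d (scaled M e)" using sM by (auto simp: sym_fun_def scaled_def mult.commute)
 have Hs: "H f g = H g f" for f g
  using ip_mv_swap[OF sH, of f g] by (simp add: H_def ip_commute)
 have Hb: "\<bar>H f f\<bar> <= real q * ip d f f" for f
  unfolding H_def by (rule weighted_form_bound[OF sM Mnn rows]) auto
 have y: "y = (%r. u r + v r)" by (simp add: v_def)
 have Hy: "H y y = H u u + 2 * H u v + H v v"
  unfolding y H_def mv_add ip_add_left ip_add_right using Hs[of u v] by (simp add: H_def)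
 \<comment> \<open>Polarisation of the mixed term with weights s and 1/s; s^2 = q/eps turns q s^2
   into q^2/eps and q/s^2 into eps.\<close>
 define s where "s = sqrt (real q / \<epsilon>)"
 have s: "0 < s" "s\<^sup>2 = real q / \<epsilon>" using q0 eps by (auto simp: s_def)
 define f1 where "f1 = (%r. s * u r + (1 / s) * v r)"
 define f2 where "f2 = (%r. s * u r + (- 1 / s) * v r)"
 have ex: "H (%r. s * u r + t * v r) (%r. s * u r + t * v r) = s\<^sup>2 * H u u + 2 * (s * t) * H u v + t\<^sup>2 * H v v" for t
  unfolding H_def mv_add mv_scale ip_add_left ip_add_right ip_scale_left ip_scale_right
  using Hs[of u v] by (simp add: H_def power2_eq_square algebra_simps)
 have ei: "ip d (%r. s * u r + t * v r) (%r. s * u r + t * v r) = s\<^sup>2 * ip d u u + 2 * (s * t) * ip d u v + t\<^sup>2 * ip d v v" for t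
  unfolding ip_add_left ip_add_right ip_scale_left ip_scale_right
  using ip_commute[of d u v] by (simp add: power2_eq_square algebra_simps)
 have "4 * H u v = H f1 f1 - H f2 f2" unfolding f1_def f2_def ex using s(1) by (simp add: power2_eq_square)
 also have "... <= real q * ip d f1 f1 + real q * ip d f2 f2" using Hb[of f1] Hb[of f2] by linarith
 also have "... = 2 * (real q * s\<^sup>2 * ip d u u + real q / s\<^sup>2 * ip d v v)"
  unfolding f1_def f2_def ei using s(1) by (simp add: power2_eq_square field_simps)
 also have "... = 2 * ((real q)\<^sup>2 / \<epsilon> * ip d u u + \<epsilon> * ip d v v)"
  unfolding s(2) using q0 by (simp add: power2_eq_square)
 finally have "2 * H u v <= (real q)\<^sup>2 / \<epsilon> * ip d u u + \<epsilon> * ip d v v" by simp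
 moreover have "H u u <= real q * ip d u u" using Hb[of u] by linarith
 moreover have "H v v <= 2 * \<epsilon> * ip d v v" unfolding H_def using vb by (rule perp)
 ultimately have "H y y <= \<kappa> * ip d u u + 3 * \<epsilon> * ip d v v"
  unfolding Hy kap by (simp add: algebra_simps)
 also have "3 * \<epsilon> * ip d v v <= 3 * \<epsilon> * ip d y y"
  using eps ip_self_nonneg[of d u] by (intro mult_left_mono) (auto simp: vv)
 finally show ?thesis unfolding uu by (simp add: obj_scaled H_def y_def Nz_def)
qed

lemma tc_add: "tc l (%r. z r + w r) = tc l z + tc l w"
proof -
 have "(%r. e r * (z r + w r)) = (%r. e r * z r + e r * w r)" by (simp add: distrib_left)
 then show ?thesis by (simp only: tc_def ip_add_right add_divide_distrib)
qed

lemma tc_scale: "tc l (%r. a * z r) = a * tc l z"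
proof -
 have "(%r. e r * (a * z r)) = (%r. a * (e r * z r))" by (simp add: mult_ac)
 then show ?thesis by (simp only: tc_def ip_scale_right times_divide_eq_right)
qed

lemma ip_grad: "ip d (grad \<gamma> z) w = ip d (mv d M z) w - \<kappa> * (\<Sum>l<J. nrm l * (tc l z - \<gamma> l) * tc l w)"
proof -
 have "ip d (grad \<gamma> z) w = ip d (mv d M z) w - (\<Sum>l<J. \<kappa> * (tc l z - \<gamma> l) * ip d (%r. e r * b l r) w)"
  unfolding grad_def ip_diff_left ip_sum_left by (simp only: ip_scale_left)
 also have "(\<Sum>l<J. \<kappa> * (tc l z - \<gamma> l) * ip d (%r. e r * b l r) w) = \<kappa> * (\<Sum>l<J. nrm l * (tc l z - \<gamma> l) * tc l w)"
  unfolding sum_distrib_left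
 proof (intro sum.cong refl)
  fix l assume "l \<in> {..<J}"
  then have "nrm l ~= 0" using nrm_pos[of l] by auto
  moreover have "ip d (%r. e r * b l r) w = ip d (b l) (%r. e r * w r)" by (simp add: ip_def mult_ac)
  ultimately show "\<kappa> * (tc l z - \<gamma> l) * ip d (%r. e r * b l r) w = \<kappa> * (nrm l * (tc l z - \<gamma> l) * tc l w)"
  by (simp add: tc_def)
 qed
 finally show ?thesis .
qed

text \<open>Exact because \<open>gob\<close> is quadratic; the second-order coefficient does not
  involve \<open>\<gamma>\<close>, so \<open>obj_le\<close> controls it for every guess.\<close>

lemma gob_expand:
 "gob \<gamma> (%r. z r + a * w r) = gob \<gamma> z + 2 * a * ip d (grad \<gamma> z) w + a\<^sup>2 * (obj w - \<kappa> * (\<Sum>l<J. nrm l * (tc l w)\<^sup>2))"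
proof -
 have o: "obj (%r. z r + a * w r) = obj z + 2 * a * ip d (mv d M z) w + a\<^sup>2 * obj w"
  unfolding obj_def mv_add mv_scale ip_add_left ip_add_right ip_scale_left ip_scale_right
  using ip_mv_swap[OF sM, of z w] ip_commute[of d w "mv d M z"] by (simp add: power2_eq_square algebra_simps)
 have p: "pen \<gamma> (%r. z r + a * w r) = pen \<gamma> z + 2 * a * (\<Sum>l<J. nrm l * (tc l z - \<gamma> l) * tc l w)
  + a\<^sup>2 * (\<Sum>l<J. nrm l * (tc l w)\<^sup>2)"
  unfolding pen_def tc_add tc_scale sum_distrib_left sum.distrib[symmetric]
  by (intro sum.cong refl) (simp add: power2_eq_square algebra_simps)
 show ?thesis unfolding gob_def o p ip_grad by (simp add: algebra_simps)
qed

text \<open>Entries lie in [0, 1], so (w - z)^2 <= w + z entrywise, and each block of w and of z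
  sums to 1.\<close>

lemma Nz_fractional_diff:
 assumes "fractional n q z" "fractional n q w"
 shows "Nz (%r. w r - z r) <= 2 * Se"
proof -
 have "Nz (%r. w r - z r) <= (\<Sum>r<n * q. (ev (r div q))\<^sup>2 * w r + (ev (r div q))\<^sup>2 * z r)"
  unfolding Nz_def ip_def unfolding dnq
 proof (rule sum_mono)
  fix r assume "r \<in> {..<n * q}"
  then have r: "r < n * q" by simp
  have b: "0 <= z r" "z r <= 1" "0 <= w r" "w r <= 1"
  using assms fractional_le_1[OF _ q0 r] r by (auto simp: fractional_def)
  have "(w r - z r) * (w r - z r) <= w r + z r"
  proof -
  have "\<bar>w r - z r\<bar> * \<bar>w r - z r\<bar> <= (w r + z r) * 1" using b by (intro mult_mono) auto
  then show ?thesis by simp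
  qed
  then have "(ev (r div q))\<^sup>2 * ((w r - z r) * (w r - z r)) <= (ev (r div q))\<^sup>2 * (w r + z r)"
  by (intro mult_left_mono) auto
  then show "e r * (w r - z r) * (e r * (w r - z r)) <= (ev (r div q))\<^sup>2 * w r + (ev (r div q))\<^sup>2 * z r"
  using ev[of r] r dnq by (simp add: power2_eq_square algebra_simps)
 qed
 also have "... = 2 * Se"
  unfolding sum.distrib
  using fractional_weighted_sum[OF assms(1), of "%i. (ev i)\<^sup>2"] fractional_weighted_sum[OF assms(2), of "%i. (ev i)\<^sup>2"]
  by (simp add: Se_def)
 finally show ?thesis .
qed

lemma Nz_fractional: "fractional n q z ==> Nz z <= Se"
proof -
 assume f: "fractional n q z"
 have "Nz z <= (\<Sum>r<n * q. (ev (r div q))\<^sup>2 * z r)"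
  unfolding Nz_def ip_def unfolding dnq
 proof (rule sum_mono)
  fix r assume "r \<in> {..<n * q}"
  then have r: "r < n * q" by simp
  have b: "0 <= z r" "z r <= 1" using f fractional_le_1[OF f q0 r] r by (auto simp: fractional_def)
  then have "(ev (r div q))\<^sup>2 * (z r * z r) <= (ev (r div q))\<^sup>2 * (z r * 1)" by (intro mult_left_mono) auto
  then show "e r * z r * (e r * z r) <= (ev (r div q))\<^sup>2 * z r"
  using ev[of r] r dnq by (simp add: power2_eq_square algebra_simps)
 qed
 then show ?thesis using fractional_weighted_sum[OF f, of "%i. (ev i)\<^sup>2"] by (simp add: Se_def)
qed

lemma Se_nonneg: "0 <= Se" by (simp add: Se_def sum_nonneg)

text \<open>With this step size the second-order loss of a step, eta^2 (q + kappa) 2 Se, equals eta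
  times 2 eps Se. Together with 6 eps Se from the imperfect concavity this is the 8 eps Se that
  \<open>fw_inv\<close> sets aside; the rest of the gap contracts geometrically from 11 kappa
  Se.\<close>

definition \<eta> :: real where "\<eta> = \<epsilon> / (real q + \<kappa>)"
definition fw_inv :: "(nat => real) => (nat => real) => nat => (nat => real) => bool" where
 "fw_inv \<gamma> zs t z \<longleftrightarrow> fractional n q z & gob \<gamma> zs - 8 * \<epsilon> * Se - gob \<gamma> z <= (1 - \<eta>) ^ t * (11 * \<kappa> * Se)"

lemma eta: "0 < \<eta>" "\<eta> <= 1" "\<eta> * (real q + \<kappa>) = \<epsilon>"
proof -
 have "0 < real q + \<kappa>" "1 <= real q + \<kappa>" using kap_pos q0 by auto
 then show "0 < \<eta>" "\<eta> <= 1" "\<eta> * (real q + \<kappa>) = \<epsilon>" using eps by (auto simp: \<eta>_def field_simps)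
qed

text \<open>Almost-concavity bounds the gap to \<open>zs\<close> by 2 <grad, zs - z> + 6 eps Se, the
  vertex of the best labels is at least as good as \<open>zs\<close> in the linear term, and a step
  of length eta towards it realises the share eta of the gap, up to the second-order loss.\<close>

lemma fw_step:
 assumes I: "fw_inv \<gamma> zs t z" and zs: "fractional n q zs" and am: "argmax_labels n q (grad \<gamma> z) x"
 shows "fw_inv \<gamma> zs (Suc t) (%r. (1 - \<eta>) * z r + \<eta> * label_vec q x r)"
proof -
 define w where "w = label_vec q x"
 have z: "fractional n q z" using I by (simp add: fw_inv_def)
 have w: "fractional n q w" unfolding w_def using am by (intro fractional_label_vec) (auto simp: argmax_labels_def)
 define D where "D = (%r. zs r - z r)"
 have "ip d (grad \<gamma> z) zs <= ip d (grad \<gamma> z) w"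
  using argmax_linear[OF am zs] by (simp add: dnq w_def)
 then have lin: "ip d (grad \<gamma> z) D <= ip d (grad \<gamma> z) (%r. w r - z r)" by (simp add: D_def ip_diff_right)
 have "gob \<gamma> zs = gob \<gamma> (%r. z r + 1 * D r)" by (simp add: D_def)
 also have "... = gob \<gamma> z + 2 * ip d (grad \<gamma> z) D + (obj D - \<kappa> * (\<Sum>l<J. nrm l * (tc l D)\<^sup>2))"
  unfolding gob_expand by simp
 also have "obj D - \<kappa> * (\<Sum>l<J. nrm l * (tc l D)\<^sup>2) <= 3 * \<epsilon> * Nz D" using obj_le[of D] by simp
 also have "3 * \<epsilon> * Nz D <= 3 * \<epsilon> * (2 * Se)"
  using Nz_fractional_diff[OF z zs] eps by (intro mult_left_mono) (auto simp: D_def)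
 finally have up: "gob \<gamma> zs - gob \<gamma> z - 6 * \<epsilon> * Se <= 2 * ip d (grad \<gamma> z) (%r. w r - z r)" using lin by simp
 define W where "W = (%r. w r - z r)"
 have NW: "Nz W <= 2 * Se" unfolding W_def by (rule Nz_fractional_diff[OF z w])
 have "\<kappa> * (\<Sum>l<J. nrm l * (tc l W)\<^sup>2) <= \<kappa> * Nz W" using bessel kap_pos by (intro mult_left_mono) auto
 then have "- ((real q + \<kappa>) * Nz W) <= obj W - \<kappa> * (\<Sum>l<J. nrm l * (tc l W)\<^sup>2)"
  using obj_abs[of W] by (simp add: algebra_simps abs_le_iff)
 moreover have "(real q + \<kappa>) * Nz W <= (real q + \<kappa>) * (2 * Se)" using NW kap_pos by (intro mult_left_mono) auto
 ultimately have q2: "- ((real q + \<kappa>) * (2 * Se)) <= obj W - \<kappa> * (\<Sum>l<J. nrm l * (tc l W)\<^sup>2)" by linarith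
 have "gob \<gamma> (%r. z r + \<eta> * W r) = gob \<gamma> z + \<eta> * (2 * ip d (grad \<gamma> z) W) + \<eta>\<^sup>2 * (obj W - \<kappa> * (\<Sum>l<J. nrm l * (tc l W)\<^sup>2))"
  unfolding gob_expand by simp
 moreover have "\<eta> * (gob \<gamma> zs - gob \<gamma> z - 6 * \<epsilon> * Se) <= \<eta> * (2 * ip d (grad \<gamma> z) W)"
  using up eta by (intro mult_left_mono) (auto simp: W_def)
 moreover have "\<eta>\<^sup>2 * (- ((real q + \<kappa>) * (2 * Se))) <= \<eta>\<^sup>2 * (obj W - \<kappa> * (\<Sum>l<J. nrm l * (tc l W)\<^sup>2))"
  using q2 by (intro mult_left_mono) auto
 moreover have "\<eta>\<^sup>2 * (- ((real q + \<kappa>) * (2 * Se))) = - (\<eta> * (2 * \<epsilon> * Se))"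
 proof -
  have "\<eta>\<^sup>2 * (- ((real q + \<kappa>) * (2 * Se))) = - (\<eta> * ((\<eta> * (real q + \<kappa>)) * (2 * Se)))" by (simp add: power2_eq_square)
  then show ?thesis unfolding eta(3) by simp
 qed
 ultimately have low: "gob \<gamma> z + \<eta> * (gob \<gamma> zs - gob \<gamma> z - 6 * \<epsilon> * Se) - \<eta> * (2 * \<epsilon> * Se) <= gob \<gamma> (%r. z r + \<eta> * W r)"
  by linarith
 have eq: "(%r. z r + \<eta> * W r) = (%r. (1 - \<eta>) * z r + \<eta> * w r)" by (auto simp: W_def algebra_simps)
 have "gob \<gamma> zs - 8 * \<epsilon> * Se - gob \<gamma> (%r. z r + \<eta> * W r) <= (1 - \<eta>) * (gob \<gamma> zs - 8 * \<epsilon> * Se - gob \<gamma> z)"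
  using low by (simp add: algebra_simps)
 also have "... <= (1 - \<eta>) * ((1 - \<eta>) ^ t * (11 * \<kappa> * Se))"
  using I eta by (intro mult_left_mono) (auto simp: fw_inv_def)
 finally show ?thesis unfolding fw_inv_def eq[symmetric] using fractional_mix[OF z w, of \<eta>] eta
  by (simp add: eq w_def)
qed

lemma obj_nonneg: "(!!r. r < d ==> 0 <= z r) ==> 0 <= obj z"
 unfolding obj_def ip_def mv_def using Mnn by (auto intro!: sum_nonneg mult_nonneg_nonneg)

lemma pen_nonneg: "0 <= pen \<gamma> z"
 unfolding pen_def by (intro sum_nonneg mult_nonneg_nonneg) (auto dest: nrm_pos)

text \<open>The constant 11 is made of gob zs <= kappa Se, obj z >= 0 and kappa pen z <= 6 kappa Se
  + 4 Se <= 10 kappa Se; the last holds because z and \<open>zs\<close> have squared norm at most Se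
  and the guess is close to \<open>zs\<close>.\<close>

lemma fw_start:
 assumes zs: "fractional n q zs" and z: "fractional n q z" and near: "\<kappa> * pen \<gamma> zs <= Se"
 shows "fw_inv \<gamma> zs 0 z"
proof -
 have sq: "(x - y)\<^sup>2 <= 2 * x\<^sup>2 + 2 * y\<^sup>2" for x y :: real
  using zero_le_power2[of "x + y"] by (simp add: power2_eq_square algebra_simps)
 have "pen \<gamma> z <= (\<Sum>l<J. 2 * (nrm l * (tc l z)\<^sup>2) + 4 * (nrm l * (tc l zs)\<^sup>2) + 4 * (nrm l * (tc l zs - \<gamma> l)\<^sup>2))"
  unfolding pen_def
 proof (rule sum_mono)
  fix l assume "l \<in> {..<J}"
  then have n: "0 <= nrm l" using nrm_pos[of l] by simp
  have "(tc l z - \<gamma> l)\<^sup>2 <= 2 * (tc l z)\<^sup>2 + 4 * (tc l zs)\<^sup>2 + 4 * (tc l zs - \<gamma> l)\<^sup>2"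
  using sq[of "tc l z" "\<gamma> l"] sq[of "tc l zs" "tc l zs - \<gamma> l"] by simp
  from mult_left_mono[OF this n]
  show "nrm l * (tc l z - \<gamma> l)\<^sup>2 <= 2 * (nrm l * (tc l z)\<^sup>2) + 4 * (nrm l * (tc l zs)\<^sup>2) + 4 * (nrm l * (tc l zs - \<gamma> l)\<^sup>2)"
  by (simp add: algebra_simps)
 qed
 also have "... = 2 * (\<Sum>l<J. nrm l * (tc l z)\<^sup>2) + 4 * (\<Sum>l<J. nrm l * (tc l zs)\<^sup>2) + 4 * pen \<gamma> zs"
  unfolding pen_def by (simp add: sum.distrib sum_distrib_left)
 also have "... <= 2 * Se + 4 * Se + 4 * pen \<gamma> zs"
  using bessel[of z] bessel[of zs] Nz_fractional[OF z] Nz_fractional[OF zs] by linarith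
 finally have "\<kappa> * pen \<gamma> z <= \<kappa> * (6 * Se + 4 * pen \<gamma> zs)" using kap_pos by (intro mult_left_mono) auto
 then have pz: "\<kappa> * pen \<gamma> z <= 6 * \<kappa> * Se + 4 * Se" using near by (simp add: algebra_simps)
 have "obj zs <= real q * Nz zs" using obj_abs[of zs] by simp
 also have "... <= \<kappa> * Se" using Nz_fractional[OF zs] kap_pos Se_nonneg by (intro mult_mono) (auto simp: Nz_def ip_self_nonneg)
 finally have "obj zs <= \<kappa> * Se" .
 moreover have "0 <= obj z" using z by (intro obj_nonneg) (auto simp: fractional_def dnq)
 moreover have "0 <= \<kappa> * pen \<gamma> zs" using pen_nonneg kap_pos by simp
 moreover have "0 <= \<epsilon> * Se" using eps Se_nonneg by simp
 moreover have "1 * Se <= \<kappa> * Se" using kap_pos Se_nonneg by (intro mult_right_mono) auto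
 ultimately show ?thesis unfolding fw_inv_def gob_def using z pz by (simp add: algebra_simps)
qed

text \<open>Bernoulli and (1 - eta)(1 + eta) <= 1 give (1 - eta)^t (1 + t eta) <= 1, so t of order
  kappa/(eps eta) suffices. The loss 10 eps Se consists of 8 from the invariant, 1 from the
  remaining gap and 1 from the penalty of \<open>zs\<close>.\<close>

lemma fw_final:
 assumes I: "fw_inv \<gamma> zs t z" and t: "11 * \<kappa> * (real q + \<kappa>) / \<epsilon>\<^sup>2 <= real t" and near: "\<kappa> * pen \<gamma> zs <= \<epsilon> * Se"
 shows "obj zs - 10 * \<epsilon> * Se <= obj z"
proof -
 have "(1 - \<eta>) ^ t * (1 + real t * \<eta>) <= (1 - \<eta>) ^ t * (1 + \<eta>) ^ t"
  using eta Bernoulli_inequality[of \<eta> t] by (intro mult_left_mono) auto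
 also have "... = (1 - \<eta>\<^sup>2) ^ t" by (simp add: power_mult_distrib[symmetric] power2_eq_square algebra_simps)
 also have "... <= 1" using eta by (intro power_le_one) (auto simp: abs_square_le_1 power_le_one)
 finally have P: "(1 - \<eta>) ^ t * (1 + real t * \<eta>) <= 1" .
 have "11 * \<kappa> / \<epsilon> = 11 * \<kappa> * (real q + \<kappa>) / \<epsilon>\<^sup>2 * \<eta>"
  using eps kap_pos q0 by (simp add: \<eta>_def power2_eq_square add_pos_pos less_imp_neq[THEN not_sym])
 also have "... <= real t * \<eta>" using t eta by (intro mult_right_mono) auto
 finally have tl: "11 * \<kappa> / \<epsilon> <= 1 + real t * \<eta>" by simp
 have "(1 - \<eta>) ^ t * (11 * \<kappa> / \<epsilon>) <= (1 - \<eta>) ^ t * (1 + real t * \<eta>)"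
  using tl eta by (intro mult_left_mono) auto
 then have "(1 - \<eta>) ^ t * (11 * \<kappa> / \<epsilon>) <= 1" using P by linarith
 then have "(1 - \<eta>) ^ t * (11 * \<kappa>) <= \<epsilon>" using eps by (simp add: field_simps)
 then have "(1 - \<eta>) ^ t * (11 * \<kappa>) * Se <= \<epsilon> * Se" using Se_nonneg by (intro mult_right_mono) auto
 moreover have "gob \<gamma> zs - 8 * \<epsilon> * Se - gob \<gamma> z <= (1 - \<eta>) ^ t * (11 * \<kappa> * Se)" using I by (simp add: fw_inv_def)
 moreover have "0 <= \<kappa> * pen \<gamma> z" using pen_nonneg kap_pos by simp
 ultimately show ?thesis unfolding gob_def using near by (simp add: algebra_simps)
qed

text \<open>By \<open>noself\<close> there are no entries within a block, so with all other blocks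
  fixed the objective is affine in this one; the best label is at least as good as the average over
  the block.\<close>

lemma round_step:
 assumes z: "fractional n q z" and i: "i < n" and x: "x < q"
  and mx: "!!\<alpha>. \<alpha> < q ==> mv d M z (i * q + \<alpha>) <= mv d M z (i * q + x)"
  and noself: "!!\<alpha> \<beta>. \<alpha> < q ==> \<beta> < q ==> M (i * q + \<alpha>) (i * q + \<beta>) = 0"
  and z': "!!r. r < d ==> z' r = (if r div q = i then of_bool (r = i * q + x) else z r)"
 shows "fractional n q z'" "obj z <= obj z'"
proof -
 have zb: "z' (j * q + \<alpha>) = (if j = i then of_bool (\<alpha> = x) else z (j * q + \<alpha>))" if "j < n" "\<alpha> < q" for j \<alpha>
  using z'[of "j * q + \<alpha>"] block_less[OF that] that by (auto simp: dnq block_div_mod)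
 have s1: "(\<Sum>\<alpha><q. of_bool (\<alpha> = x)) = (1::real)" using x by simp
 show "fractional n q z'" unfolding fractional_def
 proof (intro conjI allI impI)
  fix r assume "r < n * q"
  then show "0 <= z' r" using z'[of r] z by (auto simp: dnq fractional_def)
 next
  fix j assume j: "j < n"
  show "(\<Sum>\<alpha><q. z' (j * q + \<alpha>)) = 1"
  using zb[OF j] z j s1 by (cases "j = i") (auto simp: fractional_def)
 qed
 define w where "w = (%r. z' r - z r)"
 have wb: "w (j * q + \<alpha>) = (if j = i then of_bool (\<alpha> = x) - z (i * q + \<alpha>) else 0)" if "j < n" "\<alpha> < q" for j \<alpha>
  using zb[OF that] by (auto simp: w_def)
 have Dw: "ip d g w = (\<Sum>\<alpha><q. g (i * q + \<alpha>) * (of_bool (\<alpha> = x) - z (i * q + \<alpha>)))" for g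
 proof -
  have "ip d g w = (\<Sum>j<n. if j = i then (\<Sum>\<alpha><q. g (j * q + \<alpha>) * (of_bool (\<alpha> = x) - z (i * q + \<alpha>))) else 0)"
  unfolding ip_def dnq sum_blocks by (intro sum.cong refl) (auto simp: wb)
  then show ?thesis using i by simp
 qed
 have "mv d M w (i * q + \<alpha>) = 0" if a: "\<alpha> < q" for \<alpha>
 proof -
  have "mv d M w (i * q + \<alpha>) = (\<Sum>j<n. \<Sum>\<beta><q. M (i * q + \<alpha>) (j * q + \<beta>) * w (j * q + \<beta>))"
  unfolding mv_def dnq sum_blocks ..
  also have "... = (\<Sum>j<n. \<Sum>\<beta><q. 0)"
  using noself[OF a] by (intro sum.cong refl) (auto simp: wb)
  finally show ?thesis by simp
 qed
 then have ow: "obj w = 0" unfolding obj_def ip_commute[of d w] Dw by simp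
 have "(\<Sum>\<alpha><q. mv d M z (i * q + \<alpha>) * z (i * q + \<alpha>)) <= (\<Sum>\<alpha><q. mv d M z (i * q + x) * z (i * q + \<alpha>))"
  using mx z block_less[OF i] by (intro sum_mono mult_right_mono) (auto simp: fractional_def)
 also have "... = mv d M z (i * q + x)" using z i by (simp add: sum_distrib_left[symmetric] fractional_def)
 finally have lin: "0 <= ip d (mv d M z) w" unfolding Dw using x by (simp add: right_diff_distrib sum_subtractf)
 have "obj z' = obj (%r. z r + w r)" by (simp add: w_def)
 also have "... = obj z + 2 * ip d (mv d M z) w + obj w"
  unfolding obj_def mv_add ip_add_left ip_add_right
  using ip_mv_swap[OF sM, of z w] ip_commute[of d w "mv d M z"] by simp
 finally show "obj z <= obj z'" using lin ow by simp
qed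

end

section \<open>Programs for Frank-Wolfe, rounding and evaluation\<close>

abbreviation (input) "xDel == (36::nat)"
abbreviation (input) "yGam == (37::nat)"
abbreviation (input) "xTt == (38::nat)"
abbreviation (input) "yZ == (39::nat)"
abbreviation (input) "yG == (40::nat)"
abbreviation (input) "xVal == (41::nat)"
abbreviation (input) "xBest == (42::nat)"
abbreviation (input) "vI == (28::nat)"
abbreviation (input) "vA == (29::nat)"
abbreviation (input) "vBi == (30::nat)"
abbreviation (input) "vFt == (31::nat)"
abbreviation (input) "vS == (32::nat)"
abbreviation (input) "vTot == (33::nat)"
abbreviation (input) "vFin == (34::nat)"
abbreviation (input) "vPos == (35::nat)"
abbreviation (input) "vG == (36::nat)"
abbreviation (input) "vLab == (37::nat)"
abbreviation (input) "vBest == (38::nat)"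

text \<open>\<open>TF\<close> is the number of steps that \<open>fw_final\<close> demands, and the
  bound on \<open>lam\<close> is the radius per pivot at which the net reaches the coordinates of
  all fractional points. \<open>Sm\<close> lets the input value m stand in for
  \<open>Se\<close>.\<close>

locale solver = engine +
 fixes e ev :: "nat => real" and lam TF m :: nat and kap :: real
 assumes cE: "!!r. r < d ==> RA h0 yE r = e r" and ev: "!!r. r < d ==> e r = ev (r div q)"
  and aE: "!!r. r < d ==> real (aN r) = real K / e r"
  and rows': "!!r. r < d ==> (\<Sum>c<d. M r c) <= real q * (e r)\<^sup>2"
  and noself: "!!i \<alpha> \<beta>. i < n ==> \<alpha> < q ==> \<beta> < q ==> M (i * q + \<alpha>) (i * q + \<beta>) = 0"
  and kap: "kap = real q + (real q)\<^sup>2 / eps" and eps1: "eps < 1"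
  and cKap: "RA h0 xKap 0 = kap" and cEta: "RA h0 xEta 0 = eps / (real q + kap)"
  and cFW: "NA h0 vFW 0 = TF" and TF: "11 * kap * (real q + kap) / eps\<^sup>2 <= real TF"
  and cLam: "NA h0 vLam 0 = lam" and lam: "1 + sqrt (128 * kap / eps) <= real lam"
  and cM: "RA h0 xM 0 = real m" and m1: "1 <= m" and Sm: "real m <= (\<Sum>i<n. (ev i)\<^sup>2)" "(\<Sum>i<n. (ev i)\<^sup>2) <= 8 * real m"

locale net_search = solver +
 fixes J :: nat and b :: "nat => nat => real" and nrm :: "nat => real"
 assumes basis': "!!l. l < J ==> 1 <= nrm l & nrm l < 4 & nrm l = ip d (b l) (b l)"
  and orth': "!!l l'. l < J ==> l' < J ==> l ~= l' ==> ip d (b l) (b l') = 0"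
  and St_perp: "!!v. (!!l. l < J ==> ip d v (b l) = 0) ==> ip d v (mv d St v) <= real (K\<^sup>2) * (real q + 2 * eps) * ip d v v"
begin

text \<open>With weights K/e the integral scaling and the shift become a factor K^2 and a summand q;
  so the bound found for \<open>St\<close> on the complement is the bound 2 eps for the normalised
  form.\<close>

lemma St_scaled: "ip d v (mv d St v) = real (K\<^sup>2) * (ip d v (mv d (scaled M e) v) + real q * ip d v v)"
proof -
 have "mv d St v r = real (K\<^sup>2) * mv d (scaled M e) v r + real (K\<^sup>2) * (real q * v r)" if r: "r < d" for r
 proof -
  have "mv d St v r = (\<Sum>c<d. RA h0 yA r * (M r c * (RA h0 yA c * v c))) + real (K\<^sup>2) * (real q * v r)"
  unfolding St_def mv_shifted[OF r] cQK by (simp add: mv_def sum_distrib_left mult_ac)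
  also have "(\<Sum>c<d. RA h0 yA r * (M r c * (RA h0 yA c * v c))) = real (K\<^sup>2) * mv d (scaled M e) v r"
  unfolding mv_def sum_distrib_left using r
  by (intro sum.cong refl) (simp add: aN aE scaled_def power2_eq_square)
  finally show ?thesis .
 qed
 then have "ip d v (mv d St v) = ip d v (%r. real (K\<^sup>2) * mv d (scaled M e) v r + real (K\<^sup>2) * (real q * v r))"
  by (intro ip_cong) auto
 also have "... = real (K\<^sup>2) * (ip d v (mv d (scaled M e) v) + real q * ip d v v)"
  unfolding ip_add_right ip_scale_right by (simp add: algebra_simps)
 finally show ?thesis .
qed

sublocale frank_wolfe n q d J M ev e b nrm eps kap
proof
 show "d = n * q" "0 < q" "sym_fun d M" "0 < eps" "eps < 1" "kap = real q + (real q)\<^sup>2 / eps"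
  using dnq q0 sM eps eps1 kap by auto
 show "0 <= M r c" if "r < d" "c < d" for r c using Mn[OF that] by simp
 show "ip d v (mv d (scaled M e) v) <= 2 * eps * ip d v v" if "!!l. l < J ==> ip d v (b l) = 0" for v
 proof -
  have "real (K\<^sup>2) * (ip d v (mv d (scaled M e) v) + real q * ip d v v) <= real (K\<^sup>2) * ((real q + 2 * eps) * ip d v v)"
  using St_perp[OF that] unfolding St_scaled by (simp add: mult.assoc)
  then have "ip d v (mv d (scaled M e) v) + real q * ip d v v <= (real q + 2 * eps) * ip d v v"
  using K1 by (subst (asm) mult_le_cancel_left_pos) auto
  then show ?thesis by (simp add: algebra_simps)
 qed
 show "1 <= nrm l & nrm l < 4 & nrm l = ip d (b l) (b l)" if "l < J" for l by (rule basis'[OF that])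
 show "ip d (b l) (b l') = 0" if "l < J" "l' < J" "l ~= l'" for l l' by (rule orth'[OF that])
 show "e r = ev (r div q)" if "r < d" for r by (rule ev[OF that])
 show "(\<Sum>c<d. M r c) <= real q * (e r)\<^sup>2" if "r < d" for r by (rule rows'[OF that])
qed

definition bst :: "hst => bool" where
 "bst h \<longleftrightarrow> cst h & NA h vJ 0 = J & (\<forall>l<J. NA h vBB l = l * d) &
  (\<forall>l<J. \<forall>r<d. RA h yB (l * d + r) = b l r) & (\<forall>l<J. RA h yNrm l = nrm l)"

lemma bst_cst: "bst h ==> cst h" by (simp add: bst_def)

lemma bst_same: "bst h ==> same X Y h h' ==> X \<subseteq> {12..} - {vJ, vBB} ==> Y \<subseteq> {12..} - {yB, yNrm} ==> bst h'"
proof -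
 assume a: "bst h" "same X Y h h'" "X \<subseteq> {12..} - {vJ, vBB}" "Y \<subseteq> {12..} - {yB, yNrm}"
 then have "cst h'" using cst_same[of h X Y h'] by (auto simp: bst_def)
 moreover have "NA h' vJ = NA h vJ" "NA h' vBB = NA h vBB" "RA h' yB = RA h yB" "RA h' yNrm = RA h yNrm"
  using a by (auto intro!: sameN[of X Y h h'] sameR[of X Y h h'])
 ultimately show "bst h'" using a(1) by (simp add: bst_def)
qed

lemma bst_simps [simp]:
 "bst (tick h) = bst h"
 "12 <= a ==> a \<notin> {vJ, vBB} ==> bst (nset a i x h) = bst h"
 "12 <= a ==> a \<notin> {yB, yNrm} ==> bst (rset a i y h) = bst h"
 by (auto simp: bst_def)

lemma cst_Rb: "cst h ==> i < n ==> NA h vRb i = i * q" by (simp add: cstN cRb)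
lemma cst_E: "cst h ==> r < d ==> RA h yE r = e r" by (simp add: cstR cE)

lemma blk_less: "i < n ==> \<alpha> < q ==> i * q + \<alpha> < d" unfolding dnq by (rule block_less)

definition gradient :: prog where
 "gradient = matvec yG yZ ;;
  for_loop vL (nv vJ)
  (vsum vR (nv vD) xTt (RMul (rld yB (NAdd (nld vBB (nv vL)) (nv vR))) (RMul (rld yE (nv vR)) (rld yZ (nv vR)))) ;;
  rset0 xTt (RMul (rv xKap) (RSub (RDiv (rv xTt) (rld yNrm (nv vL))) (rld yGam (nv vL)))) ;;
  vmap vR (nv vD) yG (NConst 0)
  (RSub (rld yG (nv vR)) (RMul (rv xTt) (RMul (rld yE (nv vR)) (rld yB (NAdd (nld vBB (nv vL)) (nv vR)))))))"

lemma ht_gradient: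
 assumes s: "bst h"
  and post: "!!h'. same {vP, vR, vL} {xAcc, xTt, yG} h h' ==> clk h' <= clk h + 3 * nnz + 6 * d + J * (6 * d + 9) + 4 ==>
  (!!r. r < d ==> RA h' yG r = grad (RA h yGam) (RA h yZ) r) ==> Q h'"
 shows "ht gradient h Q"
 unfolding gradient_def
proof (rule ht_seq, rule ht_matvec[OF bst_cst[OF s]], goal_cases)
 case (7 h1)
 note h1 = this
 define \<gamma> where "\<gamma> = RA h yGam"
 define z where "z = RA h yZ"
 have s1: "bst h1" by (rule bst_same[OF s h1(1)]) auto
 have S1: "same {vP, vR, vL} {xAcc, xTt, yG} h h1" by (rule same_weaken[OF h1(1)]) auto
 define pg where "pg = (%k r. mv d M z r - (\<Sum>l<k. kap * (tc l z - \<gamma> l) * (e r * b l r)))"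
 show ?case
 proof (rule ht_for[where n = J and I = "%k h'. same {vP, vR, vL} {xAcc, xTt, yG} h h' &
  clk h' <= clk h1 + k * (6 * d + 9) + 1 & (\<forall>r<d. RA h' yG r = pg k r)"], goal_cases)
  case 2
  then show ?case using S1 h1(3) by (simp add: pg_def z_def)
 next
  case (3 k h')
  then have "bst h'" using bst_same[OF s, of "{vP, vR, vL}" "{xAcc, xTt, yG}" h'] by auto
  then show ?case by (simp add: bst_def)
 next
  case (4 k h2)
  then have S2: "same {vP, vR, vL} {xAcc, xTt, yG} h h2" by simp
  have s2: "bst (tick h2)" using bst_same[OF s S2] by auto
  have zg: "RA h2 yZ = z" "RA h2 yGam = \<gamma>" using sameR[OF S2, of yZ] sameR[OF S2, of yGam] by (auto simp: z_def \<gamma>_def)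
  show ?case
  proof (rule ht_seq, rule ht_vsum[where n = d and f = "%r. b k r * (e r * z r)"], goal_cases)
  case (3 r h3)
  have s3: "bst h3" by (rule bst_same[OF s2 3(2)]) auto
  show ?case using 3(3) zg s3 4(1,3) sameN[OF 3(2), of vL] sameR[OF 3(2), of yZ]
  by (auto simp: cst_D[OF bst_cst[OF s3]] cst_E[OF bst_cst[OF s3]] bst_def)
  next
  case (4 h3)
  note h3 = this
  have s3: "bst h3" by (rule bst_same[OF s2 h3(1)]) auto
  have L3: "NA h3 vL 0 = k" using \<open>NA h2 vL 0 = k\<close> sameN[OF h3(1), of vL] by simp
  have S3: "same {vP, vR, vL} {xAcc, xTt, yG} h h3"
  by (rule same_trans[OF S2]) (use h3(1) in \<open>auto simp: same_def\<close>)
  define t where "t = kap * (tc k z - \<gamma> k)"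
  define h4 where "h4 = tick (rset xTt (nval (NConst 0) (lay h3))
  (rval (RMul (rv xKap) (RSub (RDiv (rv xTt) (rld yNrm (nv vL))) (rld yGam (nv vL)))) (lay h3)) h3)"
  have h4: "bst h4" "same {vP, vR, vL} {xAcc, xTt, yG} h h4" "NA h4 vL 0 = k" "clk h4 = Suc (clk h3)"
  "RA h4 yG = RA h2 yG" using s3 S3 L3 sameR[OF h3(1), of yG] by (auto simp: h4_def)
  have "RA h3 xKap 0 = kap" using s3 cstR[of h3 xKap] cKap by (simp add: bst_def)
  then have t4: "RA h4 xTt 0 = t"
  using h3(3) L3 s3 \<open>k < J\<close> zg sameR[OF h3(1), of yGam]
  by (simp add: h4_def t_def bst_def tc_def ip_def)
  show ?case
  proof (intro ht_seq ht_rst, goal_cases)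
  case 2
  show ?case unfolding h4_def[symmetric]
  proof (rule ht_vmap[where n = d and ?b0.0 = 0 and f = "%r. pg k r - t * (e r * b k r)"], goal_cases)
  case (3 r h5)
  have s5: "bst h5" by (rule bst_same[OF h4(1) 3(2)]) auto
  show ?case using 3(3) 3(4)[of r] s5 4(1) h4(3,5) t4 sameN[OF 3(2), of vL] sameR[OF 3(2), of xTt] \<open>k < J\<close>
  \<open>same _ _ h h2 & _\<close>
  by (auto simp: cst_D[OF bst_cst[OF s5]] cst_E[OF bst_cst[OF s5]] bst_def)
  next
  case (4 h5)
  have "same {vP, vR, vL} {xAcc, xTt, yG} h h5"
  by (rule same_trans[OF h4(2)]) (use 4(1) in \<open>auto simp: same_def\<close>)
  moreover have "\<forall>r<d. RA h5 yG r = pg (Suc k) r" using 4(3) by (simp add: pg_def t_def)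
  ultimately show ?case using 4(2) h4(3,4) h3(2) \<open>same _ _ h h2 & _\<close> sameN[OF 4(1), of vL] by auto
  qed auto
  qed auto
  qed auto
 next
  case (5 h')
  then show ?case using h1(2) by (intro post) (auto simp: pg_def grad_def z_def \<gamma>_def)
 qed auto
qed auto

definition argmax :: prog where
 "argmax = nset0 vBi (nld vRb (nv vI)) ;;
  for_loop vA (nv vQ)
  (Cond (RLess (rld yG (nv vBi)) (rld yG (NAdd (nld vRb (nv vI)) (nv vA))))
  (nset0 vBi (NAdd (nld vRb (nv vI)) (nv vA))) Skip)"

lemma ht_argmax:
 assumes c: "cst h" and i: "NA h vI 0 = i" "i < n"
  and post: "!!h' x. same {vBi, vA} {} h h' ==> clk h' <= clk h + 4 * q + 3 ==> x < q ==>
  NA h' vBi 0 = i * q + x ==> (!!\<alpha>. \<alpha> < q ==> RA h yG (i * q + \<alpha>) <= RA h yG (i * q + x)) ==> Q h'"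
 shows "ht argmax h Q"
 unfolding argmax_def
proof (intro ht_seq ht_nst, goal_cases)
 case 2
 show ?case
 proof (rule ht_for[where n = q and I = "%k h'. same {vBi, vA} {} h h' & clk h' <= clk h + 4 * k + 2 &
  (\<exists>x<q. NA h' vBi 0 = i * q + x & (\<forall>\<alpha><k. RA h yG (i * q + \<alpha>) <= RA h yG (i * q + x)))"], goal_cases)
  case 2
  then show ?case using c i q0 by (auto simp: cst_Rb)
 next
  case (3 k h')
  then have "cst h'" using cst_same[OF c, of "{vBi, vA}" "{}"] by auto
  then show ?case by (simp add: cst_Q)
 next
  case (4 k h')
  then have S: "same {vBi, vA} {} h h'" by simp
  have c': "cst h'" by (rule cst_same[OF c S]) auto
  obtain x where x: "x < q" "NA h' vBi 0 = i * q + x" "\<forall>\<alpha><k. RA h yG (i * q + \<alpha>) <= RA h yG (i * q + x)" using 4 by auto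
  have i': "NA h' vI 0 = i" "RA h' yG = RA h yG" using i sameN[OF S, of vI] sameR[OF S, of yG] by auto
  show ?case
  proof (rule ht_cond, goal_cases)
  case 1
  then have "RA h yG (i * q + x) < RA h yG (i * q + k)" using x i' i 4 by (simp add: cst_Rb[OF c'])
  then have "\<forall>\<alpha><Suc k. RA h yG (i * q + \<alpha>) <= RA h yG (i * q + k)" using x(3) by (auto simp: less_Suc_eq intro: order.trans less_imp_le)
  then show ?case using 4 S i' i
  by (intro ht_nst) (auto simp: cst_Rb[OF c'] intro!: exI[of _ k])
  next
  case 2
  then have "\<not> RA h yG (i * q + x) < RA h yG (i * q + k)" using x i' i 4 by (simp add: cst_Rb[OF c'])
  then have "\<forall>\<alpha><Suc k. RA h yG (i * q + \<alpha>) <= RA h yG (i * q + x)" using x(3) by (auto simp: less_Suc_eq)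
  then show ?case using 4 S x(1,2)
  by (intro ht_skip) (auto intro!: exI[of _ x])
  qed
 next
  case (5 h')
  then obtain x where "x < q" "NA h' vBi 0 = i * q + x" "\<forall>\<alpha><q. RA h yG (i * q + \<alpha>) <= RA h yG (i * q + x)" by auto
  then show ?case using 5 by (intro post[of _ x]) auto
 qed simp
qed simp

text \<open>The vertex towards which the step goes is never stored: the old point is shrunk by 1 -
  eta, then eta is added at the best label of each block.\<close>

definition fw_prog :: prog where
 "fw_prog = gradient ;;
  vmap vR (nv vD) yZ (NConst 0) (RMul (RSub (Rc 1) (rv xEta)) (rld yZ (nv vR))) ;;
  for_loop vI (nv vN) (argmax ;; rst yZ (nv vBi) (RAdd (rld yZ (nv vBi)) (rv xEta)))"

abbreviation "fwN == {vP, vR, vL, vI, vA, vBi}"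
abbreviation "fwR == {xAcc, xTt, yG, yZ}"

definition tFWs :: nat where "tFWs = 3 * nnz + 9 * d + J * (6 * d + 9) + n * (4 * q + 6) + 20"

lemma ht_fw_prog:
 assumes s: "bst h"
  and post: "!!h' x. same fwN fwR h h' ==> clk h' <= clk h + tFWs ==>
  argmax_labels n q (grad (RA h yGam) (RA h yZ)) x ==>
  (!!r. r < d ==> RA h' yZ r = (1 - \<eta>) * RA h yZ r + \<eta> * label_vec q x r) ==> Q h'"
 shows "ht fw_prog h Q"
 unfolding fw_prog_def
proof (rule ht_seq, rule ht_gradient[OF s], goal_cases)
 case (1 h1)
 note h1 = 1
 define z where "z = RA h yZ"
 define g where "g = grad (RA h yGam) z"
 have s1: "bst h1" by (rule bst_same[OF s h1(1)]) auto
 have S1: "same fwN fwR h h1" by (rule same_weaken[OF h1(1)]) auto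
 have z1: "RA h1 yZ = z" using sameR[OF h1(1), of yZ] by (simp add: z_def)
 have eta_c: "RA h' xEta 0 = \<eta>" if "bst h'" for h' using that cstR[of h' xEta] cEta by (simp add: bst_def \<eta>_def)
 show ?case
 proof (rule ht_seq, rule ht_vmap[where n = d and ?b0.0 = 0 and f = "%r. (1 - \<eta>) * z r"], goal_cases)
  case (3 k h2)
  have s2: "bst h2" by (rule bst_same[OF s1 3(2)]) auto
  show ?case using 3(3) 3(4)[of k] z1 eta_c[OF s2] by (simp add: cst_D[OF bst_cst[OF s2]])
 next
  case (4 h2)
  note h2 = this
  have s2: "bst h2" by (rule bst_same[OF s1 h2(1)]) auto
  have S2: "same fwN fwR h h2" by (rule same_trans[OF S1 same_weaken[OF h2(1)]]) auto
  have g2: "RA h2 yG r = g r" if "r < d" for r using h1(3)[OF that] sameR[OF h2(1), of yG] by (simp add: g_def z_def)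
  show ?case
  proof (rule ht_for[where n = n and I = "%k h'. same {vI, vA, vBi} {yZ} h2 h' &
  clk h' <= clk h2 + k * (4 * q + 6) + 1 &
  (\<exists>x. (\<forall>i<k. x i < q & (\<forall>\<alpha><q. g (i * q + \<alpha>) <= g (i * q + x i))) &
  (\<forall>r<d. RA h' yZ r = (1 - \<eta>) * z r + (if r div q < k then \<eta> * label_vec q x r else 0)))"], goal_cases)
  case 2
  then show ?case using h2(3) by auto
  next
  case (3 k h')
  then have "cst h'" using cst_same[OF bst_cst[OF s2], of "{vI, vA, vBi}" "{yZ}"] by auto
  then show ?case by (simp add: cst_N)
  next
  case (4 k h3)
  then have S3: "same {vI, vA, vBi} {yZ} h2 h3" by simp
  have s3: "bst h3" by (rule bst_same[OF s2 S3]) auto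
  obtain x where x: "\<forall>i<k. x i < q & (\<forall>\<alpha><q. g (i * q + \<alpha>) <= g (i * q + x i))"
  "\<forall>r<d. RA h3 yZ r = (1 - \<eta>) * z r + (if r div q < k then \<eta> * label_vec q x r else 0)" using 4 by blast
  have c3: "cst (tick h3)" using bst_cst[OF s3] by simp
  show ?case
  proof (rule ht_seq, rule ht_argmax[OF c3, where i = k], goal_cases)
  case (3 h4 y)
  note h4 = 3
  have S4: "same {vI, vA, vBi} {yZ} h2 h4" by (rule same_trans[OF S3]) (use h4(1) in \<open>auto simp: same_def\<close>)
  have s4: "bst h4" by (rule bst_same[OF s2 S4]) auto
  have z4: "RA h4 yZ = RA h3 yZ" using sameR[OF h4(1), of yZ] by simp
  have gy: "g (k * q + \<alpha>) <= g (k * q + y)" if "\<alpha> < q" for \<alpha>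
  using h4(5)[OF that] g2[OF blk_less[OF 4(1) that]] g2[OF blk_less[OF 4(1) h4(3)]] sameR[OF S3, of yG] by simp
  define x' where "x' = x(k := y)"
  have "\<exists>x. (\<forall>i<Suc k. x i < q & (\<forall>\<alpha><q. g (i * q + \<alpha>) <= g (i * q + x i))) &
  (\<forall>r<d. ((RA h4 yZ)(k * q + y := RA h4 yZ (k * q + y) + \<eta>)) r = (1 - \<eta>) * z r + (if r div q < Suc k then \<eta> * label_vec q x r else 0))"
  proof (intro exI[of _ x'] conjI allI impI, goal_cases)
  case (3 r)
  have rr: "r = k * q + y \<longleftrightarrow> r div q = k & r mod q = y" using h4(3) by (auto simp: div_mult_mod_eq)
  show ?case using x(2) 3 z4 rr
  by (cases "r div q = k") (auto simp: x'_def label_vec_def)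
  qed (use x(1) gy h4(3) in \<open>auto simp: x'_def less_Suc_eq\<close>)
  then show ?case
  using S4 h4 4 eta_c[OF s4] sameN[OF h4(1), of vI] by (intro ht_rst) auto
  qed (use 4 in auto)
  next
  case (5 h3)
  then obtain x where x: "\<forall>i<n. x i < q & (\<forall>\<alpha><q. g (i * q + \<alpha>) <= g (i * q + x i))"
  "\<forall>r<d. RA h3 yZ r = (1 - \<eta>) * z r + (if r div q < n then \<eta> * label_vec q x r else 0)" by blast
  have "r div q < n" if "r < d" for r using that by (simp add: dnq less_mult_imp_div_less)
  then have xz: "RA h3 yZ r = (1 - \<eta>) * z r + \<eta> * label_vec q x r" if "r < d" for r using x(2) that by simp
  have S3: "same fwN fwR h h3" by (rule same_trans[OF S2 same_weaken[of "{vI, vA, vBi}" "{yZ}"]]) (use 5 in auto)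
  show ?case
  by (rule post[of _ x])
  (use S3 5 h1(2) h2(2) x(1) xz in \<open>auto simp: tFWs_def argmax_labels_def g_def z_def\<close>)
  qed auto
 qed auto
qed

end

context frank_wolfe
begin

lemma obj_cong:
 assumes "!!r. r < d ==> z r = z' r"
 shows "obj z = obj z'"
proof -
 have "mv d M z = mv d M z'" by (rule mv_cong) (rule assms)
 then show ?thesis unfolding obj_def ip_def using assms by simp
qed

lemma tc_cong:
 assumes "!!r. r < d ==> z r = z' r"
 shows "tc l z = tc l z'"
 unfolding tc_def ip_def using assms by simp

lemma fractional_cong: "(!!r. r < d ==> z r = z' r) ==> fractional n q z = fractional n q z'"
 unfolding fractional_def using block_less[of _ n _ q] by (auto simp: dnq)

lemma fw_inv_cong: "(!!r. r < d ==> z r = z' r) ==> fw_inv \<gamma> zs t z = fw_inv \<gamma> zs t z'"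
 unfolding fw_inv_def gob_def pen_def using obj_cong[of z z'] tc_cong[of z z'] fractional_cong[of z z'] by simp

end

context net_search
begin

text \<open>The guesses that are good for \<open>zs\<close>: their penalty at \<open>zs\<close>
  stays within the error that \<open>fw_final\<close> tolerates.\<close>

definition near :: "(nat => real) => (nat => real) => bool" where
 "near \<gamma> zs \<longleftrightarrow> fractional n q zs & kap * pen \<gamma> zs <= eps * Se"

definition fw_loop :: prog where
 "fw_loop = vmap vR (nv vD) yZ (NConst 0) (Rc 0) ;;
  for_loop vI (nv vN) (rst yZ (nld vRb (nv vI)) (Rc 1)) ;;
  for_loop vFt (nv vFW) fw_prog"

abbreviation "flN == {vP, vR, vL, vI, vA, vBi, vFt}"

definition tFW :: nat where "tFW = TF * (tFWs + 2) + 3 * d + 3 * n + 10"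

lemma ht_fw_loop:
 assumes s: "bst h"
  and post: "!!h'. same flN fwR h h' ==> clk h' <= clk h + tFW ==> fractional n q (RA h' yZ) ==>
  (!!zs. near (RA h yGam) zs ==> obj zs - 10 * eps * Se <= obj (RA h' yZ)) ==> Q h'"
 shows "ht fw_loop h Q"
 unfolding fw_loop_def
proof (rule ht_seq, rule ht_vmap[where n = d and ?b0.0 = 0 and f = "%r. 0"], goal_cases)
 case (3 k h1)
 have "bst h1" by (rule bst_same[OF s 3(2)]) auto
 then show ?case by (simp add: cst_D bst_cst)
next
 case (4 h1)
 note h1 = this
 have s1: "bst h1" by (rule bst_same[OF s h1(1)]) auto
 show ?case
 proof (rule ht_seq, rule ht_for[where n = n and I = "%k h'. same {vI} {yZ} h1 h' & clk h' = clk h1 + 3 * k + 1 &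
  (\<forall>r<d. RA h' yZ r = (if r div q < k then label_vec q (%_. 0) r else 0))"], goal_cases)
  case 2
  then show ?case using h1(3) by auto
 next
  case (3 k h')
  then have "cst h'" using cst_same[OF bst_cst[OF s1], of "{vI}" "{yZ}"] by auto
  then show ?case by (simp add: cst_N)
 next
  case (4 k h')
  then have "cst h'" using cst_same[OF bst_cst[OF s1], of "{vI}" "{yZ}"] by auto
  then have rb: "NA h' vRb k = k * q" using 4(1) by (simp add: cst_Rb)
  have rr: "r = k * q \<longleftrightarrow> r div q = k & r mod q = 0" for r using q0 by (auto simp: div_mult_mod_eq)
  show ?case
  proof (rule ht_rst, goal_cases)
  case 2
  have "((RA h' yZ)(k * q := 1)) r = (if r div q < Suc k then label_vec q (%_. 0) r else 0)" if "r < d" for r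
  using 4(2) that rr[of r] by (cases "r div q = k") (auto simp: label_vec_def)
  then show ?case using 4 rb by auto
  qed simp
 next
  case (5 h2)
  have z2: "RA h2 yZ r = label_vec q (%_. 0) r" if "r < d" for r
  using 5 that by (simp add: dnq less_mult_imp_div_less)
  have f0: "fractional n q (RA h2 yZ)"
  using fractional_label_vec[of n "%_. 0" q] q0 fractional_cong[of "RA h2 yZ" "label_vec q (%_. 0)"] z2 by auto
  have S2: "same flN fwR h h2" by (rule same_trans[OF same_weaken[OF h1(1)] same_weaken[of "{vI}" "{yZ}"]]) (use 5 in auto)
  define \<gamma> where "\<gamma> = RA h yGam"
  have st: "fw_inv \<gamma> zs 0 (RA h2 yZ)" if "near \<gamma> zs" for zs
  proof (rule fw_start)
  have "eps * Se <= 1 * Se" using eps1 Se_nonneg by (intro mult_right_mono) auto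
  then show "kap * pen \<gamma> zs <= Se" using that by (simp add: near_def)
  qed (use that f0 in \<open>auto simp: near_def\<close>)
  show ?case
  proof (rule ht_for[where n = TF and I = "%k h'. same flN fwR h h' & clk h' <= clk h2 + 2 + k * (tFWs + 2) &
  fractional n q (RA h' yZ) & (\<forall>zs. near \<gamma> zs --> fw_inv \<gamma> zs k (RA h' yZ))"], goal_cases)
  case 2
  then show ?case using S2 f0 st by auto
  next
  case (3 k h')
  then have "bst h'" using bst_same[OF s, of flN fwR h'] by auto
  then show ?case using cFW by (simp add: cstN bst_def)
  next
  case (4 k h3)
  then have S3: "same flN fwR h h3" by simp
  have s3: "bst (tick h3)" using bst_same[OF s S3] by auto
  have g3: "RA h3 yGam = \<gamma>" using sameR[OF S3, of yGam] by (simp add: \<gamma>_def)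
  show ?case
  proof (rule ht_fw_prog[OF s3], goal_cases)
  case (1 h4 x)
  define w where "w = (%r. (1 - \<eta>) * RA h3 yZ r + \<eta> * label_vec q x r)"
  have w: "RA h4 yZ r = w r" if "r < d" for r using 1(4)[OF that] by (simp add: w_def)
  have S4: "same flN fwR h h4" by (rule same_trans[OF S3 same_weaken[of fwN fwR]]) (use 1(1) in auto)
  have "fractional n q w" unfolding w_def
  by (rule fractional_mix) (use 4(2) 1(3) eta in \<open>auto simp: argmax_labels_def intro!: fractional_label_vec\<close>)
  then have "fractional n q (RA h4 yZ)" using fractional_cong[of "RA h4 yZ" w] w by simp
  moreover have "fw_inv \<gamma> zs (Suc k) (RA h4 yZ)" if nr: "near \<gamma> zs" for zs
  proof -
  have "fw_inv \<gamma> zs (Suc k) w" unfolding w_def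
  by (rule fw_step) (use 4(2) 1(3) nr g3 in \<open>auto simp: near_def\<close>)
  then show ?thesis using fw_inv_cong[of "RA h4 yZ" w] w by simp
  qed
  ultimately show ?case using S4 4 1(2) sameN[OF 1(1), of vFt] by auto
  qed
  next
  case (5 h3)
  show ?case
  proof (rule post, goal_cases)
  case (4 zs)
  then have nr: "near \<gamma> zs" by (simp add: \<gamma>_def)
  have "obj zs - 10 * eps * Se <= obj (RA h3 yZ)"
  by (rule fw_final[of \<gamma> zs TF]) (use 5 nr TF in \<open>auto simp: near_def\<close>)
  then show ?case by simp
  qed (use 5 h1(2) \<open>same {vI} {yZ} h1 h2 & _\<close> in \<open>auto simp: tFW_def\<close>)
  qed auto
 qed auto
qed auto

text \<open>Each round evaluates only the q rows of the current vertex, so all rounds together cost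
  one pass over the matrix; \<open>plen\<close> keeps that account.\<close>

definition round_prog :: prog where
 "round_prog = for_loop vI (nv vN)
  (for_loop vA (nv vQ)
  (rowdot (NAdd (nld vRb (nv vI)) (nv vA)) yZ ;; rst yG (NAdd (nld vRb (nv vI)) (nv vA)) (rv xAcc)) ;;
  argmax ;; vmap vA (nv vQ) yZ (nld vRb (nv vI)) (Rc 0) ;; rst yZ (nv vBi) (Rc 1) ;;
  nst vLab (nv vI) (NSub (nv vBi) (nld vRb (nv vI))))"

abbreviation "roN == {vP, vI, vA, vBi, vLab}"
abbreviation "roR == {xAcc, yG, yZ}"

definition plen :: "nat => nat" where "plen r = (\<Sum>r'<r. length (rows r'))"

lemma ht_round:
 assumes s: "cst h" and f: "fractional n q (RA h yZ)"
  and post: "!!h'. same roN roR h h' ==> clk h' <= clk h + 3 * nnz + n * (13 * q + 14) + 2 ==>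
  (!!i. i < n ==> NA h' vLab i < q) ==>
  (!!r. r < d ==> RA h' yZ r = label_vec q (NA h' vLab) r) ==> obj (RA h yZ) <= obj (RA h' yZ) ==> Q h'"
 shows "ht round_prog h Q"
 unfolding round_prog_def
proof (rule ht_for[where n = n and I = "%k h'. same roN roR h h' & clk h' <= clk h + 3 * plen (k * q) + k * (13 * q + 14) + 1 &
  fractional n q (RA h' yZ) & obj (RA h yZ) <= obj (RA h' yZ) & (\<forall>i<k. NA h' vLab i < q) &
  (\<forall>r<d. r div q < k --> RA h' yZ r = label_vec q (NA h' vLab) r)"], goal_cases)
 case 2
 then show ?case using f by (simp add: plen_def)
next
 case (3 k h')
 then have "cst h'" using cst_same[OF s, of roN roR] by auto
 then show ?case by (simp add: cst_N)
next
 case (4 k h1)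
 note h1 = this
 then have S1: "same roN roR h h1" by simp
 have c1: "cst h1" by (rule cst_same[OF s S1]) auto
 define z where "z = RA h1 yZ"
 have rb1: "NA h1 vRb k = k * q" using c1 h1(1) by (simp add: cst_Rb)
 show ?case
 proof (rule ht_seq, rule ht_for[where n = q and I = "%a h'. same {vP, vA} {xAcc, yG} h1 h' &
  clk h' + 3 * plen (k * q) <= clk h1 + 3 * plen (k * q + a) + 6 * a + 2 &
  (\<forall>\<alpha><a. RA h' yG (k * q + \<alpha>) = mv d M z (k * q + \<alpha>))"], goal_cases)
  case (3 a h')
  then have "cst h'" using cst_same[OF c1, of "{vP, vA}" "{xAcc, yG}"] by auto
  then show ?case by (simp add: cst_Q)
 next
  case (4 a h2)
  then have S2: "same {vP, vA} {xAcc, yG} h1 h2" by simp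
  have c2: "cst (tick h2)" using cst_same[OF c1 S2] by auto
  have v2: "NA h2 vI 0 = k" "NA h2 vRb k = k * q" "NA h2 vA 0 = a" "RA h2 yZ = z"
  using h1 4 rb1 sameN[OF S2, of vI] sameN[OF S2, of vRb] sameR[OF S2, of yZ] by (auto simp: z_def)
  have lt: "k * q + a < d" by (rule blk_less[OF h1(1) 4(1)])
  show ?case
  proof (rule ht_seq, rule ht_rowdot'[OF c2 _ lt], goal_cases)
  case (4 h3)
  note h3 = this
  have S3: "same {vP, vA} {xAcc, yG} h1 h3" by (rule same_trans[OF S2]) (use h3(1) in \<open>auto simp: same_def\<close>)
  have v3: "NA h3 vI 0 = k" "NA h3 vRb k = k * q" "NA h3 vA 0 = a" "RA h3 yG = RA h2 yG"
  using v2 sameN[OF h3(1), of vI] sameN[OF h3(1), of vRb] sameN[OF h3(1), of vA] sameR[OF h3(1), of yG] by auto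
  show ?case
  proof (rule ht_rst, goal_cases)
  case 2
  then show ?case using S3 v3 v2 h3 \<open>same _ _ h1 h2 & _\<close> by (auto simp: less_Suc_eq plen_def)
  qed simp
  qed (use v2 in auto)
 next
  case (5 h2)
  then have S2: "same {vP, vA} {xAcc, yG} h1 h2" by simp
  have c2: "cst (tick h2)" using cst_same[OF c1 S2] by auto
  have I2: "NA (tick h2) vI 0 = k" using h1 sameN[OF S2, of vI] by simp
  have k2: "clk h2 + 3 * plen (k * q) <= clk h1 + 3 * plen (Suc k * q) + 6 * q + 2" using 5 by (simp add: add.commute)
  show ?case
  proof (rule ht_seq, rule ht_argmax[OF c2 I2 h1(1)], goal_cases)
  case (1 h3 x)
  note h3 = this
  have S3: "same roN roR h1 h3"
  by (rule same_trans[OF same_weaken[OF S2] same_weaken[of "{vBi, vA}" "{}"]]) (use h3(1) in auto)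
  have c3: "cst h3" by (rule cst_same[OF c1 S3]) auto
  have v3: "NA h3 vI 0 = k" "NA h3 vRb k = k * q" "RA h3 yZ = z" "NA h3 vLab = NA h1 vLab"
  using I2 rb1 sameN[OF h3(1), of vI] sameN[OF h3(1), of vRb] sameN[OF h3(1), of vLab] sameR[OF h3(1), of yZ]
  sameN[OF S2, of vRb] sameN[OF S2, of vLab] sameR[OF S2, of yZ] by (auto simp: z_def)
  have mx: "mv d M z (k * q + \<alpha>) <= mv d M z (k * q + x)" if "\<alpha> < q" for \<alpha>
  using h3(5)[OF that] 5 that h3(3) by simp
  show ?case
  proof (rule ht_seq, rule ht_vmap[where n = q and ?b0.0 = "k * q" and f = "%_. 0"], goal_cases)
  case (3 a h4)
  have "cst h4" by (rule cst_same[OF c3 3(2)]) auto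
  then show ?case using v3 sameN[OF 3(2), of vI] sameN[OF 3(2), of vRb] by (simp add: cst_Q)
  next
  case (4 h4)
  note h4 = this
  define z' where "z' = (RA h4 yZ)(k * q + x := 1)"
  have "z' r = (if r div q = k then of_bool (r = k * q + x) else z r)" for r
  proof -
  have "k * q <= r & r < k * q + q \<longleftrightarrow> r div q = k"
  proof
  assume a: "k * q <= r & r < k * q + q"
  then obtain t where "r = k * q + t" "t < q" by (metis add_less_cancel_left le_Suc_ex)
  then show "r div q = k" by simp
  next
  assume "r div q = k"
  then have "r = k * q + r mod q" using div_mult_mod_eq[of r q] by simp
  then show "k * q <= r & r < k * q + q" using q0 by (metis le_add1 mod_less_divisor nat_add_left_cancel_less)
  qed
  moreover have "k * q + x = r ==> r div q = k" using h3(3) by auto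
  ultimately show ?thesis unfolding z'_def h4(3) v3 by auto
  qed
  note z' = this
  have rd: "fractional n q z'" "obj z <= obj z'"
  using round_step[of z k x z'] h1 h3(3) mx noself[OF h1(1)] z' by (auto simp: z_def)
  have S4: "same roN roR h1 h4" by (rule same_trans[OF S3 same_weaken[OF h4(1)]]) auto
  have v4: "NA h4 vI 0 = k" "NA h4 vRb k = k * q" "NA h4 vBi 0 = k * q + x" "NA h4 vLab = NA h1 vLab"
  using v3 h3(4) sameN[OF h4(1), of vI] sameN[OF h4(1), of vRb] sameN[OF h4(1), of vBi] sameN[OF h4(1), of vLab] by auto
  have lab: "z' r = label_vec q ((NA h1 vLab)(k := x)) r" if "r < d" "r div q < Suc k" for r
  proof (cases "r div q = k")
  case True
  have "r = k * q + r mod q" using True div_mult_mod_eq[of r q] by simp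
  then show ?thesis using z'[of r] True by (simp add: label_vec_def)
  next
  case False
  then show ?thesis using z'[of r] h1(2) that by (auto simp: label_vec_def z_def)
  qed
  have Sh: "same roN roR h h4" by (rule same_trans[OF S1 S4])
  have kk: "clk h4 + 4 <= clk h + 3 * plen (Suc k * q) + Suc k * (13 * q + 14) + 1"
  using h4(2) h3(2) k2 h1(2) by simp
  show ?case
  by (intro ht_seq ht_rst ht_nst)
  (use Sh v4 rd lab kk h1(2) h3(3) in \<open>auto simp: z'_def[symmetric] z_def less_Suc_eq simp del: mult_Suc\<close>)
  qed auto
  qed
 qed (use h1 in auto)
next
 case (5 h')
 have "r div q < n" if "r < d" for r using that by (simp add: dnq less_mult_imp_div_less)
 moreover have "plen (n * q) <= nnz" using nnz by (simp add: plen_def dnq)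
 ultimately show ?case using 5 by (intro post) auto
qed auto

definition bestok :: "hst => bool" where
 "bestok h \<longleftrightarrow> (\<forall>i<n. NA h vBest i < q) & RA h xBest 0 <= obj (label_vec q (NA h vBest))"

definition process :: prog where
 "process =
  vmap vL (nv vJ) yGam (NConst 0) (RMul (rv xDel) (RSub (RNat (nld vG (nv vL))) (RNat (nld vG (NAdd (nv vJ) (nv vL)))))) ;;
  fw_loop ;; round_prog ;;
  matvec yG yZ ;; vsum vR (nv vD) xVal (RMul (rld yZ (nv vR)) (rld yG (nv vR))) ;;
  Cond (RLess (rv xBest) (rv xVal))
  (rset0 xBest (rv xVal) ;; for_loop vI (nv vN) (nst vBest (nv vI) (nld vLab (nv vI)))) Skip"

text \<open>The natural-number memory has no signs: a net coordinate is the difference of two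
  naturals, which is why net points have 2 J entries.\<close>

definition gam :: "real => (nat => nat) => nat => real" where
 "gam \<delta> g l = \<delta> * (real (g l) - real (g (J + l)))"

abbreviation "prN == {vP, vR, vL, vI, vA, vBi, vFt, vLab, vBest}"
abbreviation "prR == {xAcc, xTt, yG, yZ, yGam, xVal, xBest}"

definition tProc :: nat where
 "tProc = tFW + 6 * nnz + n * (13 * q + 17) + 9 * d + 3 * J + 20"

lemma near_cong: "(!!l. l < J ==> \<gamma> l = \<gamma>' l) ==> near \<gamma> zs = near \<gamma>' zs"
 by (simp add: near_def pen_def)

lemma ht_process:
 assumes s: "bst h" and ok: "bestok h"
  and post: "!!h'. same prN prR h h' ==> clk h' <= clk h + tProc ==> bestok h' ==> RA h xBest 0 <= RA h' xBest 0 ==>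
  (!!zs. near (gam (RA h xDel 0) (NA h vG)) zs ==> obj zs - 10 * eps * Se <= RA h' xBest 0) ==> Q h'"
 shows "ht process h Q"
 unfolding process_def
proof (rule ht_seq, rule ht_vmap[where n = J and ?b0.0 = 0 and f = "gam (RA h xDel 0) (NA h vG)"], goal_cases)
 case (3 k h1)
 have "bst h1" by (rule bst_same[OF s 3(2)]) auto
 then show ?case using 3(3) sameN[OF 3(2), of vG] sameR[OF 3(2), of xDel] by (simp add: bst_def gam_def)
next
 case (4 h1)
 note h1 = this
 have s1: "bst h1" by (rule bst_same[OF s h1(1)]) auto
 have g1: "near (RA h1 yGam) zs = near (gam (RA h xDel 0) (NA h vG)) zs" for zs
  by (rule near_cong) (simp add: h1(3))
 show ?case
 proof (rule ht_seq, rule ht_fw_loop[OF s1], goal_cases)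
  case (1 h2)
  note h2 = this
  have s2: "bst h2" by (rule bst_same[OF s1 h2(1)]) auto
  show ?case
  proof (rule ht_seq, rule ht_round[OF bst_cst[OF s2] h2(3)], goal_cases)
  case (1 h3)
  note h3 = this
  have s3: "bst h3" by (rule bst_same[OF s2 h3(1)]) auto
  show ?case
  proof (rule ht_seq, rule ht_matvec[OF bst_cst[OF s3]], goal_cases)
  case (7 h4)
  note h4 = this
  have s4: "bst h4" by (rule bst_same[OF s3 h4(1)]) auto
  have z4: "RA h4 yZ = RA h3 yZ" using sameR[OF h4(1), of yZ] by simp
  show ?case
  proof (rule ht_seq, rule ht_vsum[where n = d and f = "%r. RA h3 yZ r * mv d M (RA h3 yZ) r"], goal_cases)
  case (3 k h5)
  have "bst h5" by (rule bst_same[OF s4 3(2)]) auto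
  then show ?case using 3(3) h4(3) z4 sameR[OF 3(2), of yZ] sameR[OF 3(2), of yG] by (auto simp: cst_D bst_cst)
  next
  case (4 h5)
  note h5 = this
  have s5: "bst h5" by (rule bst_same[OF s4 h5(1)]) auto
  have val: "RA h5 xVal 0 = obj (RA h3 yZ)" using h5(3) by (simp add: obj_def ip_def)
  have S5: "same prN prR h h5"
  by (rule same_trans[OF same_weaken[OF h1(1)] same_trans[OF same_weaken[OF h2(1)] same_trans[OF same_weaken[OF h3(1)]
  same_trans[OF same_weaken[OF h4(1)] same_weaken[OF h5(1)]]]]]) auto
  have lab: "NA h5 vLab = NA h3 vLab" "RA h5 xBest = RA h xBest" "NA h5 vBest = NA h vBest"
  using sameN[OF h4(1), of vLab] sameN[OF h5(1), of vLab]
  sameR[OF h1(1), of xBest] sameR[OF h2(1), of xBest] sameR[OF h3(1), of xBest] sameR[OF h4(1), of xBest] sameR[OF h5(1), of xBest]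
  sameN[OF h1(1), of vBest] sameN[OF h2(1), of vBest] sameN[OF h3(1), of vBest] sameN[OF h4(1), of vBest] sameN[OF h5(1), of vBest]
  by auto
  have objl: "obj (RA h3 yZ) = obj (label_vec q (NA h3 vLab))" using h3(4) by (rule obj_cong)
  have good: "obj zs - 10 * eps * Se <= obj (RA h3 yZ)" if "near (gam (RA h xDel 0) (NA h vG)) zs" for zs
  using h2(4)[of zs] g1 that h3(5) by simp
  have k5: "clk h5 + 3 * n + 6 <= clk h + tProc"
  using h1(2) h2(2) h3(2) h4(2) h5(2) by (simp add: tProc_def algebra_simps)
  show ?case
  proof (intro ht_cond ht_seq ht_rst, goal_cases)
  case 2
  define h6 where "h6 = tick (rset xBest (nval (NConst 0) (lay (tick h5))) (rval (rv xVal) (lay (tick h5))) (tick h5))"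
  have h6: "RA h6 xBest 0 = obj (RA h3 yZ)" "same prN prR h h6" "bst h6" "NA h6 vLab = NA h3 vLab" "clk h6 = clk h5 + 2"
  using val S5 s5 lab by (auto simp: h6_def)
  show ?case unfolding h6_def[symmetric]
  proof (rule ht_for[where n = n and I = "%k h'. same {vI, vBest} {} h6 h' & clk h' = clk h6 + 3 * k + 1 &
  (\<forall>i<k. NA h' vBest i = NA h3 vLab i)"], goal_cases)
  case (3 k h')
  then have "bst h'" using bst_same[OF h6(3), of "{vI, vBest}" "{}"] by auto
  then show ?case by (simp add: cst_N bst_cst)
  next
  case (4 k h')
  then show ?case using h6(4) sameN[of "{vI, vBest}" "{}" h6 h' vLab]
  by (intro ht_nst) (auto simp: less_Suc_eq)
  next
  case (5 h')
  then have S6: "same {vI, vBest} {} h6 h'" by simp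
  have "obj (label_vec q (NA h' vBest)) = obj (label_vec q (NA h3 vLab))"
  using 5 by (intro obj_cong) (auto simp: label_vec_def dnq less_mult_imp_div_less)
  then have "bestok h'" using 5 h3(3) h6(1) objl sameR[OF S6, of xBest] by (auto simp: bestok_def)
  moreover have "same prN prR h h'" by (rule same_trans[OF h6(2) same_weaken[OF S6]]) auto
  ultimately show ?case
  using 5 h6 k5 good 2 lab val sameR[OF S6, of xBest]
  by (intro post) (auto simp: bestok_def)
  qed auto
  next
  case 3
  then have "obj (RA h3 yZ) <= RA h xBest 0" using val lab by simp
  then have "obj zs - 10 * eps * Se <= RA h xBest 0" if "near (gam (RA h xDel 0) (NA h vG)) zs" for zs
  using good[OF that] by linarith
  then show ?case using S5 k5 ok lab
  by (intro ht_skip post) (auto simp: bestok_def)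
  qed auto
  qed auto
  qed auto
  qed
 qed
qed auto

end

section \<open>The net\<close>

definition simplex_points :: "nat => nat => (nat => nat) set" where
 "simplex_points D S = {g. (\<forall>l\<ge>D. g l = 0) & (\<Sum>l<D. g l) <= S}"

text \<open>The highest differing position decides, so a successor is found by working upwards from
  position 0, as on an odometer whose digits share the budget S.\<close>

definition colex_less :: "nat => (nat => nat) => (nat => nat) => bool" where
 "colex_less D g h \<longleftrightarrow> (\<exists>j<D. g j < h j & (\<forall>i. j < i --> i < D --> g i = h i))"

lemma colex_less_irrefl: "\<not> colex_less D g g"
 by (simp add: colex_less_def)

lemma colex_less_trans: "colex_less D f g ==> colex_less D g h ==> colex_less D f h"
proof -
 assume "colex_less D f g" "colex_less D g h"
 then obtain i j where i: "i < D" "f i < g i" "\<forall>k. i < k --> k < D --> f k = g k"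
  and j: "j < D" "g j < h j" "\<forall>k. j < k --> k < D --> g k = h k" by (auto simp: colex_less_def)
 show ?thesis unfolding colex_less_def
  by (rule exI[of _ "max i j"]) (use i j in \<open>cases i j rule: linorder_cases; auto simp: max_def\<close>)
qed

lemma simplex_points_eqI:
 "g \<in> simplex_points D S ==> h \<in> simplex_points D S ==> (!!l. l < D ==> g l = h l) ==> g = h"
 unfolding simplex_points_def by (intro ext) (metis (mono_tags, lifting) linorder_not_less mem_Collect_eq)

lemma colex_next_small:
 assumes h: "h \<in> simplex_points D S" and g: "g \<in> simplex_points D S" and lt: "(\<Sum>l<D. g l) < S" and D: "0 < D"
 defines "g' == g(0 := Suc (g 0))"
 shows "g' \<in> simplex_points D S" "colex_less D g g'" "colex_less D g h ==> h = g' \<or> colex_less D g' h"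
proof -
 have "(\<Sum>l<D. g' l) = Suc (\<Sum>l<D. g l)"
  using D by (simp add: g'_def lessThan_Suc_eq_insert_0 sum.remove[of "{..<D}" 0])
 then show m: "g' \<in> simplex_points D S" using g lt D by (auto simp: simplex_points_def g'_def)
 show "colex_less D g g'" unfolding colex_less_def using D by (intro exI[of _ 0]) (auto simp: g'_def)
 show "h = g' \<or> colex_less D g' h" if "colex_less D g h"
 proof -
  from that obtain j where j: "j < D" "g j < h j" "\<forall>k. j < k --> k < D --> g k = h k" by (auto simp: colex_less_def)
  show ?thesis
  proof (cases "j = 0 & h 0 = Suc (g 0)")
  case True
  have "h = g'" by (rule simplex_points_eqI[OF h m]) (use j True in \<open>auto simp: g'_def\<close>)
  then show ?thesis ..
  next
  case False
  then have "colex_less D g' h" unfolding colex_less_def using j by (intro exI[of _ j]) (auto simp: g'_def)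
  then show ?thesis ..
  qed
 qed
qed

text \<open>If the deciding position j were at most p, then h would be at least g everywhere and
  larger at j, so its sum would exceed the budget that g already exhausts.\<close>

lemma colex_above_zero_prefix:
 assumes h: "h \<in> simplex_points D S" and full: "\<not> (\<Sum>l<D. g l) < S" and z: "!!l. l < p ==> g l = 0"
  and j: "j < D" "g j < h j" "\<forall>k. j < k --> k < D --> g k = h k"
 shows "p < j"
proof (rule ccontr)
 assume "\<not> p < j"
 then have "\<forall>l\<in>{..<D}. g l <= h l" using z j by (metis less_or_eq_imp_le linorder_less_linear lessThan_iff not_less zero_le less_le_trans)
 then have "(\<Sum>l<D. g l) < (\<Sum>l<D. h l)" using j by (intro sum_strict_mono_ex1) auto
 then show False using h full by (simp add: simplex_points_def)
qed

text \<open>With the budget spent, larger points are decided above the lowest nonzero position p.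
  The least of them clears p and raises p + 1; clearing frees at least the one unit that the raise
  takes.\<close>

lemma colex_next_carry:
 assumes h: "h \<in> simplex_points D S" and g: "g \<in> simplex_points D S" and full: "\<not> (\<Sum>l<D. g l) < S"
  and z: "!!l. l < p ==> g l = 0" and p: "0 < g p" "Suc p < D"
 defines "g' == g(p := 0, Suc p := Suc (g (Suc p)))"
 shows "g' \<in> simplex_points D S" "colex_less D g g'" "colex_less D g h ==> h = g' \<or> colex_less D g' h"
  "(\<Sum>l<D. g' l) = (\<Sum>l<D. g l) - g p + 1"
proof -
 have e: "(\<Sum>l<D. f l) = f p + (f (Suc p) + (\<Sum>l\<in>{..<D} - {p} - {Suc p}. f l))" for f :: "nat => nat"
  using p by (subst sum.remove[of _ p], simp, simp, subst sum.remove[of _ "Suc p"]) auto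
 have "(\<Sum>l\<in>{..<D} - {p} - {Suc p}. g' l) = (\<Sum>l\<in>{..<D} - {p} - {Suc p}. g l)"
  by (intro sum.cong) (auto simp: g'_def)
 then show s: "(\<Sum>l<D. g' l) = (\<Sum>l<D. g l) - g p + 1" unfolding e[of g'] e[of g] by (simp add: g'_def)
 have "g p <= (\<Sum>l<D. g l)" by (simp add: e[of g])
 then show m: "g' \<in> simplex_points D S" using g s p by (auto simp: simplex_points_def g'_def)
 show "colex_less D g g'" unfolding colex_less_def using p by (intro exI[of _ "Suc p"]) (auto simp: g'_def)
 show "h = g' \<or> colex_less D g' h" if "colex_less D g h"
 proof -
  from that obtain j where j: "j < D" "g j < h j" "\<forall>k. j < k --> k < D --> g k = h k" by (auto simp: colex_less_def)
  have pj: "p < j" by (rule colex_above_zero_prefix[OF h full z j])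
  show ?thesis
  proof (cases "j = Suc p & h j = Suc (g j)")
  case False
  then have "colex_less D g' h" unfolding colex_less_def using j pj by (intro exI[of _ j]) (auto simp: g'_def)
  then show ?thesis ..
  next
  case True
  show ?thesis
  proof (cases "\<forall>l\<le>p. h l = 0")
  case True
  have "h l = g' l" if "l < D" for l
  proof -
  consider "l <= p" | "l = Suc p" | "Suc p < l" by linarith
  then show ?thesis
  by cases (use j \<open>j = Suc p & _\<close> True z[of l] that in \<open>auto simp: g'_def\<close>)
  qed
  then have "h = g'" by (rule simplex_points_eqI[OF h m])
  then show ?thesis ..
  next
  case False
  \<comment> \<open>From p + 1 on, h agrees with the candidate, which is zero at 0..p; so the
    highest nonzero entry of h among these positions decides.\<close>
  define i where "i = Max {l. l <= p & h l ~= 0}"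
  have "i \<in> {l. l <= p & h l ~= 0}" unfolding i_def by (rule Max_in) (use False in auto)
  then have i: "i <= p" "h i ~= 0" by auto
  have top: "h l = 0" if "i < l" "l <= p" for l
  proof (rule ccontr)
  assume "h l ~= 0"
  then have "l <= i" unfolding i_def using that by (intro Max_ge) auto
  then show False using that by simp
  qed
  have "g' k = h k" if "i < k" "k < D" for k
  proof -
  consider "k <= p" | "k = Suc p" | "Suc p < k" by linarith
  then show ?thesis
  proof cases
  case 1
  then show ?thesis using top[OF that(1)] z[of k] by (cases "k = p") (auto simp: g'_def)
  next
  case 2
  then show ?thesis using \<open>j = Suc p & _\<close> by (auto simp: g'_def)
  next
  case 3
  then show ?thesis using j that \<open>j = Suc p & _\<close> by (simp add: g'_def)
  qed
  qed
  moreover have "g' i = 0" using i z[of i] by (cases "i = p") (auto simp: g'_def)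
  ultimately have "colex_less D g' h" unfolding colex_less_def using i p by (intro exI[of _ i]) auto
  then show ?thesis ..
  qed
  qed
 qed
qed

lemma simplex_points_card:
 "finite (simplex_points D S)" "card (simplex_points D S) <= (S + D) choose D"
proof -
 define L where "L = {l::nat list. size l = Suc D & sum_list l = S}"
 define f where "f = (%g. map g [0..<D] @ [S - (\<Sum>l<D. g l)])"
 have cardL: "card L = (S + D) choose S" unfolding L_def by (subst card_length_sum_list) simp
 have "(S + D) choose S > 0" by simp
 then have finL: "finite L" using cardL by (metis card.infinite less_numeral_extra(3))
 have sub: "f ` simplex_points D S \<subseteq> L"
  by (auto simp: f_def L_def simplex_points_def interv_sum_list_conv_sum_set_nat atLeast0LessThan)
 have inj: "inj_on f (simplex_points D S)"
 proof (rule inj_onI)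
  fix g h assume gh: "g \<in> simplex_points D S" "h \<in> simplex_points D S" "f g = f h"
  then have "map g [0..<D] = map h [0..<D]" by (simp add: f_def)
  then show "g = h" by (intro simplex_points_eqI[OF gh(1,2)]) auto
 qed
 show "finite (simplex_points D S)" using finite_imageD[OF finite_subset[OF sub finL] inj] .
 have "card (simplex_points D S) = card (f ` simplex_points D S)" by (rule card_image[OF inj, symmetric])
 also have "... <= card L" by (rule card_mono[OF finL sub])
 also have "... = (S + D) choose D" unfolding cardL using binomial_symmetric[of S "S + D"] by simp
 finally show "card (simplex_points D S) <= (S + D) choose D" .
qed

text \<open>D^D/D! is one term of the series of exp(D), and e <= 3.\<close>

lemma power_le_exp_fact: "real D ^ D <= 3 ^ D * fact D"
proof -
 have s: "(%n. inverse (fact n) * real D ^ n) sums exp (real D)"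
  using exp_converges[of "real D"] by simp
 have "inverse (fact D) * real D ^ D <= exp (real D)"
  using sum_le_suminf[OF sums_summable[OF s], of "{D}"] sums_unique[OF s] by simp
 also have "... = exp 1 ^ D" by (simp add: exp_of_nat_mult[symmetric])
 also have "... <= 3 ^ D" using exp_le by (intro power_mono) auto
 finally show ?thesis by (simp add: field_simps)
qed

text \<open>The factorial in the binomial coefficient cancels D^D up to 3^D for D = 2 J, so the size
  is a power with exponent 2 J of a base of order lam, independent of J. A box of the required side
  would leave a factor J^O(J).\<close>

lemma simplex_points_card_le:
 "real (card (simplex_points (2 * J) (J * lam))) <= (3 * (real lam + 2)) ^ (2 * J)"
proof -
 define D where "D = 2 * J"
 have "real (card (simplex_points D (J * lam))) * fact D <= real ((J * lam + D) choose D) * fact D"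
  using simplex_points_card(2)[of D "J * lam"] by (intro mult_right_mono) auto
 also have "... = real (((J * lam + D) choose D) * fact D)" by simp
 also have "... <= real ((J * lam + D) ^ D)"
  using binomial_fact_pow[of "J * lam + D" D] by (simp only: of_nat_le_iff)
 also have "... <= real ((D * (lam + 2)) ^ D)"
  unfolding of_nat_le_iff by (intro power_mono) (auto simp: D_def algebra_simps)
 also have "... = real D ^ D * (real lam + 2) ^ D"
  by (simp only: of_nat_power of_nat_mult of_nat_add of_nat_numeral power_mult_distrib)
 also have "... <= (3 ^ D * fact D) * (real lam + 2) ^ D"
  using power_le_exp_fact by (intro mult_right_mono) auto
 also have "... = (3 * (real lam + 2)) ^ D * fact D"
  by (simp only: power_mult_distrib mult_ac)
 finally have "real (card (simplex_points D (J * lam))) <= (3 * (real lam + 2)) ^ D"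
  by (subst (asm) mult_le_cancel_right_pos) auto
 then show ?thesis by (simp only: D_def)
qed

section \<open>Enumeration of the net\<close>

context net_search
begin

definition next_prog :: prog where
 "next_prog =
  Cond (NLess (nv vTot) (nv vS))
  (nst vG (NConst 0) (NAdd (nld vG (NConst 0)) (NConst 1)) ;; nset0 vTot (NAdd (nv vTot) (NConst 1)))
  (nset0 vPos (NConst 0) ;;
  Loop (TAnd (NLess (nv vPos) (NAdd (nv vJ) (nv vJ))) (NLess (nld vG (nv vPos)) (NConst 1)))
  (nset0 vPos (NAdd (nv vPos) (NConst 1))) ;;
  Cond (NLess (NAdd (nv vPos) (NConst 1)) (NAdd (nv vJ) (nv vJ)))
  (nset0 vTot (NAdd (NSub (nv vTot) (nld vG (nv vPos))) (NConst 1)) ;;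
  nst vG (nv vPos) (NConst 0) ;;
  nst vG (NAdd (nv vPos) (NConst 1)) (NAdd (nld vG (NAdd (nv vPos) (NConst 1))) (NConst 1)))
  (nset0 vFin (NConst 1)))"

definition net_state :: "hst => nat => (nat => nat) => bool" where
 "net_state h S g \<longleftrightarrow> bst h & NA h vS 0 = S & (\<forall>l<2 * J. NA h vG l = g l) & g \<in> simplex_points (2 * J) S &
  NA h vTot 0 = (\<Sum>l<2 * J. g l)"

abbreviation "nxN == {vG, vTot, vPos, vFin}"

text \<open>For J = 0 there is no coordinate to raise; the budget 0 then makes the first test fail,
  and the end is reported.\<close>

lemma ht_next_prog:
 assumes s: "net_state h S g" and S: "J = 0 ==> S = 0" and fin: "NA h vFin 0 = 0"
  and post: "!!h'. same nxN {} h h' ==> clk h' <= clk h + 4 * J + 8 ==>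
  (NA h' vFin 0 = 0 & (\<exists>g'. net_state h' S g' & colex_less (2 * J) g g' &
  (\<forall>f\<in>simplex_points (2 * J) S. colex_less (2 * J) g f --> f = g' \<or> colex_less (2 * J) g' f))) \<or>
  (NA h' vFin 0 = 1 & (\<forall>f\<in>simplex_points (2 * J) S. \<not> colex_less (2 * J) g f)) ==> Q h'"
 shows "ht next_prog h Q"
 unfolding next_prog_def
proof (rule ht_cond, goal_cases)
 case 1
 have gm: "g \<in> simplex_points (2 * J) S" and tot: "NA h vTot 0 = (\<Sum>l<2 * J. g l)"
  and gl: "!!l. l < 2 * J ==> NA h vG l = g l" using s by (auto simp: net_state_def)
 have lt: "(\<Sum>l<2 * J. g l) < S" using 1 s by (simp add: net_state_def)
 then have J: "0 < J" using S by (cases "J = 0") auto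
 note nx = colex_next_small[OF _ gm lt]
 define g' where "g' = g(0 := Suc (g 0))"
 have sum': "(\<Sum>l<2 * J. g' l) = Suc (\<Sum>l<2 * J. g l)"
  using J by (simp add: g'_def sum.remove[of "{..<2 * J}" 0])
 show ?case
 proof (intro ht_seq ht_nst, goal_cases)
  case 3
  have n: "net_state (tick (nset vTot 0 (Suc (NA h vTot 0)) (tick (nset vG 0 (Suc (NA h vG 0)) (tick h))))) S g'"
  using s gl J sum' tot nx(1)[OF gm] by (auto simp: net_state_def g'_def)
  have J2: "0 < 2 * J" using J by simp
  have "\<forall>f\<in>simplex_points (2 * J) S. colex_less (2 * J) g f --> f = g' \<or> colex_less (2 * J) g' f"
  unfolding g'_def using nx(3)[OF _ J2] by blast
  moreover have "colex_less (2 * J) g g'" unfolding g'_def by (rule nx(2)[OF gm J2])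
  ultimately have "\<exists>g'. net_state (tick (nset vTot 0 (Suc (NA h vTot 0)) (tick (nset vG 0 (Suc (NA h vG 0)) (tick h))))) S g' &
  colex_less (2 * J) g g' & (\<forall>f\<in>simplex_points (2 * J) S. colex_less (2 * J) g f --> f = g' \<or> colex_less (2 * J) g' f)"
  using n by blast
  then show ?case
  by (intro post) (use fin in auto)
 qed auto
next
 case 2
 have gm: "g \<in> simplex_points (2 * J) S" and tot: "NA h vTot 0 = (\<Sum>l<2 * J. g l)"
  and gl: "!!l. l < 2 * J ==> NA h vG l = g l" and SJ: "NA h vS 0 = S" "NA h vJ 0 = J" and sb: "bst h"
  using s by (auto simp: net_state_def bst_def)
 have full: "\<not> (\<Sum>l<2 * J. g l) < S" using 2 s by (simp add: net_state_def)
 show ?case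
 proof (intro ht_seq ht_nst, goal_cases)
  case 2
  show ?case
  proof (rule ht_while[where I = "%h'. same {vPos} {} h h' & clk h' = clk h + 2 + 2 * NA h' vPos 0 & NA h' vPos 0 <= 2 * J &
  (\<forall>l<NA h' vPos 0. g l = 0)" and \<mu> = "%h'. 2 * J - NA h' vPos 0"], goal_cases)
  case (2 h')
  then have S': "same {vPos} {} h h'" by simp
  show ?case
  by (rule ht_nst) (use 2 gl SJ sameN[OF S', of vG] sameN[OF S', of vJ] in \<open>auto simp: less_Suc_eq\<close>)
  next
  case (3 h1)
  then have S1: "same {vPos} {} h h1" by simp
  define p where "p = NA h1 vPos 0"
  have v1: "NA h1 vG = NA h vG" "NA h1 vJ 0 = J" "NA h1 vTot 0 = (\<Sum>l<2 * J. g l)" "NA h1 vS 0 = S" "NA h1 vFin 0 = 0"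
  using SJ tot fin sameN[OF S1, of vG] sameN[OF S1, of vJ] sameN[OF S1, of vTot] sameN[OF S1, of vS] sameN[OF S1, of vFin] by auto
  have b1: "bst h1" by (rule bst_same[OF sb S1]) auto
  have z: "!!l. l < p ==> g l = 0" and p: "p <= 2 * J" "clk h1 = clk h + 2 + 2 * p" using 3 by (auto simp: p_def)
  have pg: "p < 2 * J ==> 0 < g p" using 3(2) v1 gl by (auto simp: p_def)
  show ?case
  proof (rule ht_cond, goal_cases)
  case 1
  then have sp: "Suc p < 2 * J" using v1 by (simp add: p_def)
  then have gp: "0 < g p" using pg by simp
  note nx = colex_next_carry[OF _ gm full z gp sp]
  define g' where "g' = g(p := 0, Suc p := Suc (g (Suc p)))"
  show ?case
  proof (intro ht_seq ht_nst, goal_cases)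
  case 4
  define h5 where "h5 = tick (nset vG (Suc p) (Suc (NA h vG (Suc p))) (tick (nset vG p 0 (tick (nset vTot 0 ((\<Sum>l<2 * J. g l) - g p + 1) (tick (tick h1)))))))"
  have n: "net_state h5 S g'"
  using b1 v1 gl sp nx(1,4)[OF gm] by (auto simp: net_state_def h5_def g'_def)
  have "\<forall>f\<in>simplex_points (2 * J) S. colex_less (2 * J) g f --> f = g' \<or> colex_less (2 * J) g' f"
  unfolding g'_def using nx(3) by blast
  moreover have "colex_less (2 * J) g g'" unfolding g'_def by (rule nx(2)[OF gm])
  ultimately have "\<exists>g'. net_state h5 S g' & colex_less (2 * J) g g' &
  (\<forall>f\<in>simplex_points (2 * J) S. colex_less (2 * J) g f --> f = g' \<or> colex_less (2 * J) g' f)"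
  using n by blast
  then have "Q h5"
  by (intro post) (use S1 v1 p in \<open>auto simp: h5_def same_def\<close>)
  moreover have "NA h vG p = g p" using gl sp by simp
  ultimately show ?case using v1 sp by (simp add: h5_def p_def)
  qed auto
  next
  case 2
  then have sp: "2 * J <= Suc p" using v1 by (simp add: p_def)
  have "\<not> colex_less (2 * J) g f" if f: "f \<in> simplex_points (2 * J) S" for f
  proof
  assume "colex_less (2 * J) g f"
  then obtain j where j: "j < 2 * J" "g j < f j" "\<forall>k. j < k --> k < 2 * J --> g k = f k" by (auto simp: colex_less_def)
  have "p < j" by (rule colex_above_zero_prefix[OF f full z j])
  then show False using sp j by simp
  qed
  then show ?case
  by (intro ht_nst post) (use S1 p in \<open>auto simp: same_def\<close>)
  qed
  qed auto
 qed auto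
qed

end

context net_search
begin

text \<open>Each coordinate is rounded down to a multiple of delta. As nrm < 4, the penalty is at
  most 4 J delta^2, which the upper bound on delta makes small. For the l1-norm, Cauchy-Schwarz is
  applied to coordinates whose squares sum to at most Se <= 8 m; with delta^2 > eps m/(16 kappa J)
  it is at most J (1 + sqrt(128 kappa/eps)) in units of delta, rounding included.\<close>

lemma net_point_exists:
 assumes zs: "fractional n q zs" and del: "0 < \<delta>" "4 * kap * real J * (\<delta> * \<delta>) <= eps * real m"
  and del2: "0 < J ==> eps * real m < 16 * kap * real J * (\<delta> * \<delta>)"
 shows "\<exists>g\<in>simplex_points (2 * J) (J * lam). near (gam \<delta> g) zs"
proof -
 define k where "k = (%l. \<lfloor>tc l zs / \<delta>\<rfloor>)"
 define g where "g = (%l. if l < J then nat (k l) else if l < 2 * J then nat (- k (l - J)) else 0)"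
 have gk: "gam \<delta> g l = \<delta> * real_of_int (k l)" if "l < J" for l
  using that by (simp add: gam_def g_def) (cases "0 <= k l"; simp)
 have near1: "(tc l zs - \<delta> * real_of_int (k l))\<^sup>2 <= \<delta> * \<delta>" for l
 proof -
  have "real_of_int (k l) <= tc l zs / \<delta>" "tc l zs / \<delta> < real_of_int (k l) + 1"
  unfolding k_def by linarith+
  then have "0 <= tc l zs - \<delta> * real_of_int (k l)" "tc l zs - \<delta> * real_of_int (k l) <= \<delta>"
  using del(1) by (simp_all add: field_simps)
  then show ?thesis unfolding power2_eq_square by (intro mult_mono) auto
 qed
 have "pen (gam \<delta> g) zs <= (\<Sum>l<J. 4 * (\<delta> * \<delta>))"
  unfolding pen_def
 proof (rule sum_mono)
  fix l assume "l \<in> {..<J}"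
  then have l: "l < J" by simp
  show "nrm l * (tc l zs - gam \<delta> g l)\<^sup>2 <= 4 * (\<delta> * \<delta>)"
  unfolding gk[OF l] using near1[of l] basis[OF l] by (intro mult_mono) auto
 qed
 then have "kap * pen (gam \<delta> g) zs <= kap * (4 * real J * (\<delta> * \<delta>))"
  using kap_pos by (intro mult_left_mono) auto
 also have "... <= eps * real m" using del(2) by (simp add: mult_ac)
 also have "... <= eps * Se" using Sm(1) eps by (intro mult_left_mono) (auto simp: Se_def)
 finally have nr: "near (gam \<delta> g) zs" using zs by (simp add: near_def)
 have "(\<Sum>l<2 * J. g l) = (\<Sum>l<J. g l) + (\<Sum>l<J. g (J + l))"
 proof -
  have "(\<Sum>l<2 * J. g l) = (\<Sum>l<J. g l) + (\<Sum>l\<in>{J..<2 * J}. g l)"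
  by (subst sum.union_disjoint[symmetric]) (auto intro!: sum.cong)
  also have "(\<Sum>l\<in>{J..<2 * J}. g l) = (\<Sum>l<J. g (J + l))"
  using sum.shift_bounds_nat_ivl[of g 0 J J] by (simp add: atLeast0LessThan add.commute mult_2)
  finally show ?thesis .
 qed
 also have "... = (\<Sum>l<J. nat \<bar>k l\<bar>)"
  unfolding sum.distrib[symmetric] by (intro sum.cong refl) (auto simp: g_def)
 finally have sg: "real (\<Sum>l<2 * J. g l) = (\<Sum>l<J. real_of_int \<bar>k l\<bar>)" by simp
 have kb: "real_of_int \<bar>k l\<bar> <= \<bar>tc l zs\<bar> / \<delta> + 1" for l
 proof -
  have "real_of_int (k l) <= tc l zs / \<delta>" "tc l zs / \<delta> < real_of_int (k l) + 1"
  unfolding k_def by linarith+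
  moreover have "\<bar>tc l zs\<bar> / \<delta> = \<bar>tc l zs / \<delta>\<bar>" using del(1) by simp
  ultimately show ?thesis by linarith
 qed
 have "(\<Sum>l<2 * J. g l) <= J * lam"
 proof (cases "J = 0")
  case False
  define A where "A = (\<Sum>l<J. \<bar>tc l zs\<bar>)"
  have A0: "0 <= A" by (simp add: A_def sum_nonneg)
  have "A\<^sup>2 <= ip J (%l. \<bar>tc l zs\<bar>) (%l. \<bar>tc l zs\<bar>) * ip J (%l. 1) (%l. 1)"
  using cauchy_schwarz_ip[of J "%l. \<bar>tc l zs\<bar>" "%l. 1"] by (simp add: A_def ip_def)
  also have "... = real J * (\<Sum>l<J. (tc l zs)\<^sup>2)" by (simp add: ip_def power2_eq_square)
  also have "(\<Sum>l<J. (tc l zs)\<^sup>2) <= (\<Sum>l<J. nrm l * (tc l zs)\<^sup>2)"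
  proof (rule sum_mono)
  fix l assume "l \<in> {..<J}"
  then have "1 * (tc l zs)\<^sup>2 <= nrm l * (tc l zs)\<^sup>2" using basis[of l] by (intro mult_right_mono) auto
  then show "(tc l zs)\<^sup>2 <= nrm l * (tc l zs)\<^sup>2" by simp
  qed
  also have "... <= Se" using bessel[of zs] Nz_fractional[OF zs] by linarith
  also have "... <= 8 * real m" using Sm(2) by (simp add: Se_def)
  finally have "A\<^sup>2 <= real J * (8 * real m)" by (simp add: mult_left_mono)
  then have "A\<^sup>2 * eps <= real J * 8 * (eps * real m)" using eps by (simp add: mult_ac mult_left_mono)
  also have "... <= real J * 8 * (16 * kap * real J * (\<delta> * \<delta>))" using del2 False by (intro mult_left_mono) auto
  finally have "(A / \<delta>)\<^sup>2 <= (real J)\<^sup>2 * (128 * kap / eps)"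
  using del(1) eps by (simp add: power2_eq_square field_simps)
  then have "sqrt ((A / \<delta>)\<^sup>2) <= sqrt ((real J)\<^sup>2 * (128 * kap / eps))" by (rule real_sqrt_le_mono)
  then have Ad: "A / \<delta> <= real J * sqrt (128 * kap / eps)"
  using A0 del(1) by (simp only: real_sqrt_mult[of "(real J)\<^sup>2"] real_sqrt_abs abs_of_nat)
  have "real (\<Sum>l<2 * J. g l) <= (\<Sum>l<J. \<bar>tc l zs\<bar> / \<delta> + 1)" unfolding sg by (intro sum_mono kb)
  also have "... = A / \<delta> + real J" by (simp add: A_def sum.distrib sum_divide_distrib)
  also have "... <= real J * (1 + sqrt (128 * kap / eps))" using Ad by (simp add: algebra_simps)
  also have "... <= real J * real lam" using lam by (intro mult_left_mono) auto
  finally show ?thesis by (simp only: of_nat_mult[symmetric] of_nat_le_iff)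
 qed simp
 then have "g \<in> simplex_points (2 * J) (J * lam)" by (auto simp: simplex_points_def g_def)
 with nr show ?thesis by blast
qed

definition net_prog :: prog where
 "net_prog =
  rset0 xDel (rv xM) ;;
  Loop (RLess (RMul (rv xEps) (rv xM)) (RMul (RMul (RMul (Rc 4) (rv xKap)) (RNat (nv vJ))) (RMul (rv xDel) (rv xDel))))
  (rset0 xDel (RDiv (rv xDel) (Rc 2))) ;;
  nset0 vS (NConst 0) ;;
  for_loop vL (nv vJ) (nset0 vS (NAdd (nv vS) (nv vLam))) ;;
  for_loop vL (NAdd (nv vJ) (nv vJ)) (nst vG (nv vL) (NConst 0)) ;;
  nset0 vTot (NConst 0) ;; nset0 vFin (NConst 0) ;;
  Loop (NLess (nv vFin) (NConst 1)) (process ;; next_prog)"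

text \<open>Halving from m stops at the first delta that is small enough, so twice that value was
  still too large; this gives the lower bound. For J > 0 the start value m itself fails, hence a
  halving has taken place.\<close>

lemma ht_delta:
 assumes s: "bst h" and jd: "4 * kap * real J * real m <= eps * 4 ^ jd"
  and post: "!!h' \<delta>. same {} {xDel} h h' ==> clk h' <= clk h + 2 * jd + 2 ==> RA h' xDel 0 = \<delta> ==> 0 < \<delta> ==>
  4 * kap * real J * (\<delta> * \<delta>) <= eps * real m ==> (0 < J ==> eps * real m < 16 * kap * real J * (\<delta> * \<delta>)) ==> Q h'"
 shows "ht (rset0 xDel (rv xM) ;;
  Loop (RLess (RMul (rv xEps) (rv xM)) (RMul (RMul (RMul (Rc 4) (rv xKap)) (RNat (nv vJ))) (RMul (rv xDel) (rv xDel))))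
  (rset0 xDel (RDiv (rv xDel) (Rc 2)))) h Q"
proof (intro ht_seq ht_rst, goal_cases)
 case 2
 define c where "c = 4 * kap * real J"
 have c0: "0 <= c" using kap_pos by (simp add: c_def)
 have m0: "0 < real m" using m1 by simp
 have cs: "RA h' xM 0 = real m" "RA h' xEps 0 = eps" "RA h' xKap 0 = kap" "NA h' vJ 0 = J" if "same {} {xDel} h h'" for h'
 proof -
  have "bst h'" by (rule bst_same[OF s that]) auto
  then show "RA h' xM 0 = real m" "RA h' xEps 0 = eps" "RA h' xKap 0 = kap" "NA h' vJ 0 = J"
  by (auto simp: bst_def cstR cM cEps cKap)
 qed
 have sq4: "(2::real) ^ j * 2 ^ j = 4 ^ j" for j by (simp add: power_mult_distrib[symmetric])
 have sq: "(real m / 2 ^ j) * (real m / 2 ^ j) = real m * real m / 4 ^ j" for j by (simp add: sq4)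
 show ?case
 proof (rule ht_while[where I = "%h'. same {} {xDel} h h' & (\<exists>j\<le>jd. RA h' xDel 0 = real m / 2 ^ j & clk h' = clk h + 1 + 2 * j &
  (0 < j --> eps * real m < 4 * (c * (RA h' xDel 0 * RA h' xDel 0))))" and \<mu> = "%h'. clk h + 2 * jd + 2 - clk h'"], goal_cases)
  case 1
  show ?case using cs[of h] by (auto intro!: exI[of _ 0])
 next
  case (2 h')
  then have S': "same {} {xDel} h h'" by simp
  from 2 obtain j where j: "j <= jd" "RA h' xDel 0 = real m / 2 ^ j" "clk h' = clk h + 1 + 2 * j" by auto
  have lt: "eps * real m < c * (real m * real m / 4 ^ j)" using 2(2) cs[OF S'] j(2) by (simp add: c_def sq4)
  have "j ~= jd"
  proof
  assume "j = jd"
  then have "eps * real m < c * real m * real m / 4 ^ jd" using lt by simp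
  also have "c * real m * real m / 4 ^ jd <= (eps * 4 ^ jd) * real m / 4 ^ jd"
  using jd m0 by (intro divide_right_mono mult_right_mono) (auto simp: c_def)
  finally show False by simp
  qed
  then have jl: "Suc j <= jd" using j(1) by simp
  have "eps * real m < 4 * (c * (real m / 2 ^ Suc j * (real m / 2 ^ Suc j)))" using lt unfolding sq by simp
  then show ?case using S' j jl by (intro ht_rst) (auto intro!: exI[of _ "Suc j"])
 next
  case (3 h')
  then have S': "same {} {xDel} h h'" by simp
  from 3 obtain j where j: "j <= jd" "RA h' xDel 0 = real m / 2 ^ j" "clk h' = clk h + 1 + 2 * j"
  "0 < j --> eps * real m < 4 * (c * (RA h' xDel 0 * RA h' xDel 0))" by auto
  have le: "c * (RA h' xDel 0 * RA h' xDel 0) <= eps * real m" using 3(2) cs[OF S'] by (simp add: c_def)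
  have "0 < j" if "0 < J"
  proof (rule ccontr)
  assume "\<not> 0 < j"
  then have "c * (real m * real m) <= eps * real m" using le j(2) by simp
  then have "c * real m * real m <= eps * real m" by (simp add: mult.assoc)
  then have "c * real m <= eps" using m0 by (simp only: mult_le_cancel_right_pos)
  moreover have "1 * 1 * 1 <= (4 * kap) * real J * real m" using kap_pos that m1 by (intro mult_mono) auto
  ultimately show False using eps1 by (simp add: c_def)
  qed
  then show ?case using S' j le m0 by (intro post[of _ "real m / 2 ^ j"]) (auto simp: c_def)
 qed
qed auto

abbreviation "npN == {vP, vR, vL, vI, vA, vBi, vFt, vLab, vBest, vG, vTot, vPos, vFin, vS}"
abbreviation "npR == {xAcc, xTt, yG, yZ, yGam, xVal, xBest, xDel}"

definition tNet :: "nat => nat" where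
 "tNet jd = 2 * jd + 9 * J + 20 + card (simplex_points (2 * J) (J * lam)) * (tProc + 4 * J + 10)"

text \<open>Invariant: for every net point before the current one, the recorded value already serves
  all fractional points near it (\<open>cov\<close>). The number of net points from the current one
  on is the measure and also pays for the time.\<close>

lemma ht_net_prog:
 assumes s: "bst h" and ok: "bestok h" and jd: "4 * kap * real J * real m <= eps * 4 ^ jd"
  and post: "!!h'. same npN npR h h' ==> clk h' <= clk h + tNet jd ==> bestok h' ==>
  (!!zs. fractional n q zs ==> obj zs - 10 * eps * Se <= RA h' xBest 0) ==> Q h'"
 shows "ht net_prog h Q"
proof -
 have assoc: "ht (P ;; P' ;; R) h Q" if "ht (P ;; P') h (%h2. ht R h2 Q)" for P P' R h Q
 proof -
  from that obtain t hh u h2 where e: "exec (P ;; P') (lay h) t (lay hh)" "clk hh = clk h + t"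
  "exec R (lay hh) u (lay h2)" "clk h2 = clk hh + u" "Q h2" unfolding ht_def by blast
  from e(1) obtain t1 s1 t2 where "exec P (lay h) t1 s1" "exec P' s1 t2 (lay hh)" "t = t1 + t2"
  by (cases rule: exec.cases) auto
  then have "exec (P ;; P' ;; R) (lay h) (t1 + (t2 + u)) (lay h2)" using e(3) by (intro exec.Then) auto
  then show ?thesis unfolding ht_def using e \<open>t = t1 + t2\<close> by (intro exI[of _ "t1 + (t2 + u)"] exI[of _ h2]) auto
 qed
 define S where "S = J * lam"
 define D where "D = 2 * J"
 define V where "V = simplex_points D S"
 have finV: "finite V" unfolding V_def by (rule simplex_points_card(1))
 show ?thesis unfolding net_prog_def
 proof (rule assoc, rule ht_delta[OF s jd], goal_cases)
  case (1 h1 \<delta>)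
  note h1 = this
  have s1: "bst h1" by (rule bst_same[OF s h1(1)]) auto
  have ok1: "bestok h1" using ok sameR[OF h1(1), of xBest] sameN[OF h1(1), of vBest] by (simp add: bestok_def)
  show ?case
  proof (intro ht_seq ht_nst, goal_cases)
  case 2
  define h2 where "h2 = tick (nset vS (nval (NConst 0) (lay h1)) (nval (NConst 0) (lay h1)) h1)"
  have h2: "bst h2" "same npN npR h1 h2" "NA h2 vS 0 = 0" "clk h2 = Suc (clk h1)" using s1 by (auto simp: h2_def)
  show ?case unfolding h2_def[symmetric]
  proof (rule ht_for[where n = J and I = "%k h'. same {vS, vL} {} h2 h' & NA h' vS 0 = k * lam & clk h' = clk h2 + 3 * k + 1"], goal_cases)
  case (3 k h')
  then have "bst h'" using bst_same[OF h2(1), of "{vS, vL}" "{}"] by auto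
  then show ?case by (simp add: bst_def)
  next
  case (4 k h')
  then have "bst h'" using bst_same[OF h2(1), of "{vS, vL}" "{}"] by auto
  then have "NA h' vLam 0 = lam" using cLam by (simp add: bst_def cstN)
  then show ?case using 4 by (intro ht_nst) auto
  next
  case (5 h3)
  then have S3: "same {vS, vL} {} h2 h3" and k3: "NA h3 vS 0 = S" "clk h3 = clk h2 + 3 * J + 1" by (auto simp: S_def)
  have s3: "bst (tick h3)" using bst_same[OF h2(1) S3] by auto
  show ?case
  proof (intro ht_seq, rule ht_for[where n = "2 * J" and I = "%k h'. same {vG, vL} {} (tick h3) h' &
  (\<forall>l<k. NA h' vG l = 0) & clk h' = clk h3 + 3 * k + 2"], goal_cases)
  case (3 k h')
  then have "bst h'" using bst_same[OF s3, of "{vG, vL}" "{}"] by auto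
  then show ?case by (simp add: bst_def)
  next
  case (4 k h')
  then show ?case by (intro ht_nst) (auto simp: less_Suc_eq)
  next
  case (5 h4)
  then have S4: "same {vG, vL} {} (tick h3) h4" by simp
  have s4: "bst h4" by (rule bst_same[OF s3 S4]) auto
  have v4: "NA h4 vS 0 = S" "!!l. l < 2 * J ==> NA h4 vG l = 0" "clk h4 = clk h3 + 3 * (2 * J) + 2"
  using k3 5 sameN[OF S4, of vS] by auto
  show ?case
  proof (intro ht_nst ht_seq, goal_cases)
  case 3
  define h5 where "h5 = tick (nset vFin 0 0 (tick (nset vTot 0 0 (tick h4))))"
  have n5: "net_state h5 S (%_. 0)" using s4 v4 by (auto simp: h5_def net_state_def simplex_points_def)
  have S5: "same npN npR h h5"
  proof -
  have "same npN npR h2 h3" by (rule same_weaken[OF S3]) auto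
  moreover have "same npN npR h3 h4" using same_weaken[OF S4, of npN npR] by auto
  moreover have "same npN npR h h1" by (rule same_weaken[OF h1(1)]) auto
  ultimately have "same npN npR h h4" using h2(2) same_trans by blast
  then show ?thesis by (simp add: h5_def)
  qed
  have x5: "RA h5 xDel 0 = \<delta>" "RA h5 xBest = RA h1 xBest" "NA h5 vBest = NA h1 vBest" "NA h5 vFin 0 = 0"
  using h1(3) sameR[OF S4, of xDel] sameR[OF S3, of xDel] sameR[OF S4, of xBest] sameR[OF S3, of xBest]
  sameN[OF S4, of vBest] sameN[OF S3, of vBest] by (auto simp: h5_def h2_def)
  have ok5: "bestok h5" using ok1 x5 by (simp add: bestok_def)
  have k5: "clk h5 <= clk h + 2 * jd + 9 * J + 12"
  using h1(2) h2(4) k3(2) v4(3) by (simp add: h5_def)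
  define tS where "tS = tProc + 4 * J + 10"
  define cov where "cov = (%(h'::hst) g. \<forall>zs. near (gam \<delta> g) zs --> obj zs - 10 * eps * Se <= RA h' xBest 0)"
  define A where "A = (%g. {f\<in>V. f = g \<or> colex_less D g f})"
  define tr where "tr = (%(h'::hst) l. if l < D then NA h' vG l else 0)"
  have gof: "tr h' = g" if "net_state h' S g" for h' g
  using that by (auto simp: tr_def net_state_def simplex_points_def D_def fun_eq_iff)
  have stepA: "card (A g') < card (A g)" if "g \<in> V" "colex_less D g g'" for g g'
  proof (rule psubset_card_mono)
  have "A g' \<subseteq> A g" using that colex_less_trans by (auto simp: A_def)
  moreover have "g \<in> A g" using that by (simp add: A_def)
  moreover have "g \<notin> A g'" using that colex_less_trans[of D g g' g] colex_less_irrefl[of D g] by (auto simp: A_def)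
  ultimately show "A g' \<subset> A g" by blast
  qed (use finV in \<open>simp add: A_def\<close>)
  define I where "I = (%h'. same npN npR h h' & bestok h' & RA h' xDel 0 = \<delta> &
  ((NA h' vFin 0 = 0 & (\<exists>g. net_state h' S g & clk h' + card (A g) * tS <= clk h5 + card V * tS &
  (\<forall>f\<in>V. colex_less D g f \<or> f = g \<or> cov h' f))) \<or>
  (NA h' vFin 0 = 1 & clk h' <= clk h5 + card V * tS & (\<forall>f\<in>V. cov h' f))))"
  \<comment> \<open>The enumeration starts at the zero point, the least in the order, so that no
    point is skipped.\<close>
  have min0: "f = (%_. 0) \<or> colex_less D (%_. 0) f" if f: "f \<in> V" for f
  proof (cases "\<exists>l<D. f l ~= 0")
  case True
  define j where "j = Max {l. l < D & f l ~= 0}"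
  have "j \<in> {l. l < D & f l ~= 0}" unfolding j_def by (rule Max_in) (use True in auto)
  moreover have "f l = 0" if "j < l" "l < D" for l
  proof (rule ccontr)
  assume "f l ~= 0"
  then have "l <= j" unfolding j_def using that by (intro Max_ge) auto
  then show False using that by simp
  qed
  ultimately have "colex_less D (%_. 0) f" unfolding colex_less_def by (intro exI[of _ j]) auto
  then show ?thesis ..
  next
  case False
  have "f = (%_. 0)" by (rule simplex_points_eqI[of _ D S]) (use f False in \<open>auto simp: V_def simplex_points_def\<close>)
  then show ?thesis ..
  qed
  have "ht (Loop (NLess (nv vFin) (NConst 1)) (process ;; next_prog)) h5 Q"
  proof (rule ht_while[where I = I and \<mu> = "%h'. if NA h' vFin 0 = 0 then Suc (card (A (tr h'))) else 0"], goal_cases)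
  case 1
  have "card (A (%_. 0)) <= card V" by (rule card_mono[OF finV]) (auto simp: A_def)
  then have "clk h5 + card (A (%_. 0)) * tS <= clk h5 + card V * tS" by simp
  then show ?case unfolding I_def using S5 ok5 x5 n5 min0 by (intro conjI disjI1 exI[of _ "%_. 0"]) auto
  next
  case (2 h6)
  then have S6: "same npN npR h h6" and ok6: "bestok h6" and d6: "RA h6 xDel 0 = \<delta>" and f6: "NA h6 vFin 0 = 0"
  by (auto simp: I_def)
  from 2 obtain g where g: "net_state h6 S g" "clk h6 + card (A g) * tS <= clk h5 + card V * tS"
  "\<forall>f\<in>V. colex_less D g f \<or> f = g \<or> cov h6 f" by (auto simp: I_def)
  have gV: "g \<in> V" using g(1) by (simp add: net_state_def V_def D_def)
  have s6: "bst (tick h6)" using g(1) by (simp add: net_state_def)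
  have ok6': "bestok (tick h6)" using ok6 by (simp add: bestok_def)
  have Gg: "near (gam \<delta> g) zs = near (gam \<delta> (NA h6 vG)) zs" for zs
  by (rule near_cong) (use g(1) in \<open>simp add: gam_def net_state_def\<close>)
  show ?case
  proof (rule ht_seq, rule ht_process[OF s6 ok6'], goal_cases)
  case (1 h7)
  note h7 = this
  have S7: "same npN npR h h7" by (rule same_trans[OF S6]) (use same_weaken[OF h7(1), of npN npR] in auto)
  have s7: "bst h7" by (rule bst_same[OF s6 h7(1)]) auto
  have n7: "net_state h7 S g" using g(1) s7 sameN[OF h7(1), of vS] sameN[OF h7(1), of vG] sameN[OF h7(1), of vTot]
  by (simp add: net_state_def)
  have f7: "NA h7 vFin 0 = 0" using f6 sameN[OF h7(1), of vFin] by simp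
  have d7: "RA h7 xDel 0 = \<delta>" using d6 sameR[OF h7(1), of xDel] by simp
  have cov7: "\<forall>f\<in>V. colex_less D g f \<or> cov h7 f"
  proof
  fix f assume f: "f \<in> V"
  consider "colex_less D g f" | "f = g" | "cov h6 f" using g(3) f by blast
  then show "colex_less D g f \<or> cov h7 f"
  proof cases
  case 2
  then have "cov h7 f" unfolding cov_def using h7(5) Gg d6 by simp
  then show ?thesis ..
  next
  case 3
  then have "cov h7 f" unfolding cov_def using h7(4) by fastforce
  then show ?thesis ..
  qed simp
  qed
  show ?case
  proof (rule ht_next_prog[OF n7 _ f7], goal_cases)
  case 1
  then show ?case by (simp add: S_def)
  next
  case (2 h8)
  note h8 = this
  have S8: "same npN npR h h8" by (rule same_trans[OF S7 same_weaken[OF h8(1)]]) auto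
  have ok8: "bestok h8" using h7(3) sameR[OF h8(1), of xBest] sameN[OF h8(1), of vBest] by (simp add: bestok_def)
  have d8: "RA h8 xDel 0 = \<delta>" using d7 sameR[OF h8(1), of xDel] by simp
  have cov8: "cov h8 f = cov h7 f" for f using sameR[OF h8(1), of xBest] by (simp add: cov_def)
  have k8: "clk h8 <= clk h6 + tS" using h7(2) h8(2) by (simp add: tS_def)
  show ?case
  proof (cases "NA h8 vFin 0 = 0")
  case True
  then obtain g' where g': "net_state h8 S g'" "colex_less D g g'"
  "\<forall>f\<in>V. colex_less D g f --> f = g' \<or> colex_less D g' f"
  using h8(3) by (auto simp: D_def V_def)
  have lessA: "card (A g') < card (A g)" by (rule stepA[OF gV g'(2)])
  then have "Suc (card (A g')) * tS <= card (A g) * tS" by (intro mult_le_mono1) simp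
  then have kI: "clk h8 + card (A g') * tS <= clk h5 + card V * tS" using k8 g(2) by simp
  have "\<forall>f\<in>V. colex_less D g' f \<or> f = g' \<or> cov h8 f" using cov7 cov8 g'(3) by blast
  then have "I h8" unfolding I_def using S8 ok8 d8 True g'(1) kI by blast
  then show ?thesis using lessA gof[OF g(1)] gof[OF g'(1)] f6 True by simp
  next
  case False
  then have F: "NA h8 vFin 0 = 1" "\<forall>f\<in>V. \<not> colex_less D g f" using h8(3) by (auto simp: D_def V_def)
  have "0 < card (A g)" using gV finV by (auto simp: A_def card_gt_0_iff)
  then have "1 * tS <= card (A g) * tS" by (intro mult_le_mono1) simp
  then have "clk h8 <= clk h5 + card V * tS" using k8 g(2) by linarith
  moreover have "\<forall>f\<in>V. cov h8 f" using cov7 cov8 F(2) by blast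
  ultimately have "I h8" unfolding I_def using S8 ok8 d8 F(1) by blast
  then show ?thesis using f6 F(1) by simp
  qed
  qed
  qed
  next
  case (3 h6)
  then have h6: "same npN npR h h6" "bestok h6" "clk h6 <= clk h5 + card V * tS" "\<forall>f\<in>V. cov h6 f"
  by (auto simp: I_def)
  show ?case
  proof (rule post, goal_cases)
  case (4 zs)
  obtain g where "g \<in> simplex_points (2 * J) (J * lam)" "near (gam \<delta> g) zs"
  using net_point_exists[OF 4 h1(4,5,6)] by blast
  then show ?case using h6(4) by (auto simp: cov_def V_def D_def S_def)
  next
  case 2
  show ?case using h6(3) k5 by (simp add: tNet_def V_def D_def S_def tS_def)
  qed (use h6 in \<open>auto simp: bestok_def\<close>)
  qed
  then show ?case by (simp add: h5_def)
  qed auto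
  qed auto
  qed (use h2 in auto)
  qed auto
 qed
qed

end

section \<open>Comparison with the threshold rank\<close>

lemma spectral_expansion:
 assumes co: "!!r s. r < d ==> s < d ==> (\<Sum>i<d. Q i r * Q i s) = (if r = s then 1 else 0)"
 shows "ip d v w = (\<Sum>i<d. ip d v (Q i) * ip d w (Q i))"
proof -
 have "(\<Sum>i<d. ip d v (Q i) * ip d w (Q i)) = (\<Sum>i<d. \<Sum>r<d. \<Sum>s<d. v r * w s * (Q i r * Q i s))"
  unfolding ip_def sum_product by (intro sum.cong refl) (simp add: mult_ac)
 also have "... = (\<Sum>r<d. \<Sum>s<d. v r * w s * (\<Sum>i<d. Q i r * Q i s))"
  by (subst sum.swap, rule sum.cong[OF refl], subst sum.swap) (simp add: sum_distrib_left)
 also have "... = (\<Sum>r<d. \<Sum>s<d. if s = r then v r * w s else 0)"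
  using co by (intro sum.cong refl) auto
 also have "... = ip d v w" by (simp add: ip_def)
 finally show ?thesis by simp
qed

lemma eigen_ip:
 assumes "sym_fun d A" "!!s. s < d ==> mv d A Q s = l * Q s"
 shows "ip d (mv d A v) Q = l * ip d v Q"
proof -
 have "ip d (mv d A v) Q = ip d v (mv d A Q)" by (simp add: ip_mv_swap[OF assms(1)])
 also have "... = ip d v (%s. l * Q s)" using assms(2) by (intro ip_cong) auto
 finally show ?thesis by (simp add: ip_scale_right)
qed

lemma kernel_combo:
 assumes "finite I" "card I < m"
 shows "\<exists>x. (\<exists>j<m. x j ~= 0) & (\<forall>i\<in>I. ip d (%r. \<Sum>j<m. x j * V j r) (Q i) = 0)"
proof -
 obtain f where f: "bij_betw f {..<card I} I" using assms(1) ex_bij_betw_nat_finite[of I] by (auto simp: atLeast0LessThan)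
 obtain x where x: "\<exists>j\<in>{..<m}. x j ~= 0" "\<forall>i<card I. (\<Sum>j\<in>{..<m}. x j * ip d (V j) (Q (f i))) = 0"
  using homogeneous_nontrivial_solution[of "{..<m}" "card I" "%i j. ip d (V j) (Q (f i))"] assms by auto
 have "ip d (%r. \<Sum>j<m. x j * V j r) (Q i) = 0" if i: "i \<in> I" for i
 proof -
  obtain k where "k < card I" "f k = i" using f i by (metis bij_betw_iff_bijections lessThan_iff)
  then show ?thesis using x(2) by (auto simp: ip_sum_left ip_scale_left)
 qed
 then show ?thesis using x(1) by (intro exI[of _ x]) auto
qed

text \<open>Courant-Fischer: if there were fewer than m eigenvalues of size at least eps, some
  nontrivial combination would be orthogonal to all their eigenvectors, and its form would lie
  strictly below eps |v|^2.\<close>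

lemma rank_ge_lower_bound:
 assumes s: "sym_fun d A"
  and dom: "!!x v. \<exists>j<m. x j ~= 0 ==> v = (%r. \<Sum>j<m. x j * V j r) ==> 0 < ip d v v & \<epsilon> * ip d v v <= ip d v (mv d A v)"
 shows "m <= rank_ge \<epsilon> (mat d d (%(r, c). A r c))"
proof (rule ccontr)
 assume n: "\<not> ?thesis"
 obtain Q l where on: "!!i j. i < d ==> j < d ==> ip d (Q i) (Q j) = (if i = j then 1 else 0)"
  and ev: "!!i s. i < d ==> s < d ==> mv d A (Q i) s = l i * Q i s"
  and co: "!!r s. r < d ==> s < d ==> (\<Sum>i<d. Q i r * Q i s) = (if r = s then 1 else 0)"
  by (rule spectral_decomposition[OF s]) (rule that)
 have se: "ip d v w = (\<Sum>i<d. ip d v (Q i) * ip d w (Q i))" for v w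
  by (rule spectral_expansion) (rule co)
 define I where "I = {i. i < d & \<epsilon> <= l i}"
 have "card I < m" using n rank_ge_spectral[OF s on ev co, of \<epsilon>] by (simp add: I_def)
 then obtain x where x: "\<exists>j<m. x j ~= 0" "\<forall>i\<in>I. ip d (%r. \<Sum>j<m. x j * V j r) (Q i) = 0"
  using kernel_combo[of I m d V Q] by (auto simp: I_def)
 define v where "v = (%r. \<Sum>j<m. x j * V j r)"
 define c where "c = (%i. ip d v (Q i))"
 have c0: "c i = 0" if "i < d" "\<epsilon> <= l i" for i using x(2) that by (simp add: I_def c_def v_def)
 have vv: "ip d v v = (\<Sum>i<d. (c i)\<^sup>2)" using se[of v v] by (simp add: c_def power2_eq_square)
 have eip: "ip d (mv d A v) (Q i) = l i * ip d v (Q i)" if "i < d" for i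
  by (rule eigen_ip[OF s]) (use ev that in auto)
 have vAv: "ip d v (mv d A v) = (\<Sum>i<d. l i * (c i)\<^sup>2)"
  unfolding se[of v "mv d A v"]
  by (intro sum.cong refl) (use eip in \<open>simp add: c_def power2_eq_square\<close>)
 have d0: "0 < ip d v v" and le: "\<epsilon> * ip d v v <= ip d v (mv d A v)" using dom[OF x(1) v_def] by auto
 obtain i where i: "i < d" "c i ~= 0" using d0 unfolding vv by (metis (no_types, lifting) lessThan_iff less_irrefl sum.neutral zero_power2)
 have "(\<Sum>i<d. l i * (c i)\<^sup>2) < (\<Sum>i<d. \<epsilon> * (c i)\<^sup>2)"
 proof (rule sum_strict_mono_ex1)
  show "\<forall>i\<in>{..<d}. l i * (c i)\<^sup>2 <= \<epsilon> * (c i)\<^sup>2"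
  proof
  fix i assume "i \<in> {..<d}"
  then show "l i * (c i)\<^sup>2 <= \<epsilon> * (c i)\<^sup>2" using c0[of i] by (cases "\<epsilon> <= l i") (auto intro!: mult_right_mono)
  qed
  show "\<exists>i\<in>{..<d}. l i * (c i)\<^sup>2 < \<epsilon> * (c i)\<^sup>2"
  using i c0[of i] by (intro bexI[of _ i]) (auto intro!: mult_strict_right_mono simp: not_le[symmetric])
 qed auto
 then show False using le vAv vv by (simp add: sum_distrib_left)
qed

lemma sop_pow_eigen:
 assumes "sym_fun d A" "!!s. s < d ==> mv d A Q s = l * Q s"
 shows "ip d ((sop d A ^^ k) v) Q = l ^ k * ip d v Q"
proof (induction k)
 case (Suc k)
 have "ip d ((sop d A ^^ Suc k) v) Q = ip d (mv d A ((sop d A ^^ k) v)) Q"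
  by (auto intro!: ip_cong simp: sop_less)
 then show ?case using eigen_ip[OF assms] Suc by simp
qed simp

context solver
begin

lemma mv_St: "r < d ==> mv d St v r = real (K\<^sup>2) * (mv d (scaled M e) v r + real q * v r)"
proof -
 assume r: "r < d"
 have "mv d St v r = (\<Sum>c<d. RA h0 yA r * (M r c * (RA h0 yA c * v c))) + real (K\<^sup>2) * (real q * v r)"
  unfolding St_def mv_shifted[OF r] cQK by (simp add: mv_def sum_distrib_left mult_ac)
 also have "(\<Sum>c<d. RA h0 yA r * (M r c * (RA h0 yA c * v c))) = real (K\<^sup>2) * mv d (scaled M e) v r"
  unfolding mv_def sum_distrib_left using r
  by (intro sum.cong refl) (simp add: aN aE scaled_def power2_eq_square)
 finally show ?thesis by (simp add: distrib_left)
qed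

lemma Mnn': "r < d ==> c < d ==> 0 <= M r c" using Mn by simp

lemma zero_row': "r < d ==> c < d ==> e r = 0 ==> M r c = 0"
proof -
 assume a: "r < d" "c < d" "e r = 0"
 have "M r c <= (\<Sum>c<d. M r c)" by (rule member_le_sum) (use a Mnn' in auto)
 then show ?thesis using rows'[OF a(1)] a Mnn'[OF a(1,2)] by simp
qed

text \<open>Two comparisons. A dominating family with more members than there are eigenvalues of at
  least eps of \<open>scaled M e\<close> would have a combination orthogonal to their eigenvectors,
  which \<open>St\<close>^T stretches by less than \<open>thof\<close> demands. And passing from e
  to the true square roots \<open>sd\<close> <= e can only raise the count: y mapped to (sd/e) y
  keeps the value of the form and does not increase the norm.\<close>

lemma dominating_le_rank:
 fixes mm :: nat and sd :: "nat => real"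
 assumes dm: "dominating mm V T"
  and sd: "!!r. r < d ==> 0 <= sd r" "!!r. r < d ==> sd r <= e r" "!!r. r < d ==> sd r = 0 ==> e r = 0"
 shows "mm <= rank_ge eps (mat d d (%(r, c). scaled M sd r c))"
proof -
 define H where "H = scaled M e"
 have T: "0 < T" using dm by (simp add: dominating_def)
 have sH: "sym_fun d H" using sM by (auto simp: H_def sym_fun_def scaled_def mult.commute)
 have sSt: "sym_fun d St" using sM by (auto simp: sym_fun_def St_def shifted_def)
 obtain Q l where on: "!!i j. i < d ==> j < d ==> ip d (Q i) (Q j) = (if i = j then 1 else 0)"
  and evv: "!!i s. i < d ==> s < d ==> mv d H (Q i) s = l i * Q i s"
  and co: "!!r s. r < d ==> s < d ==> (\<Sum>i<d. Q i r * Q i s) = (if r = s then 1 else 0)"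
  by (rule spectral_decomposition[OF sH]) (rule that)
 have se: "ip d v w = (\<Sum>i<d. ip d v (Q i) * ip d w (Q i))" for v w
  by (rule spectral_expansion) (rule co)
 \<comment> \<open>This makes \<open>\<mu> i\<close> nonnegative, so that its upper bound survives
   raising to the power 2 T.\<close>
 have lq: "- real q <= l i" if i: "i < d" for i
 proof -
  have "ip d (Q i) (mv d H (Q i)) = l i * ip d (Q i) (Q i)"
  unfolding ip_scale_right[symmetric] using evv[OF i] by (intro ip_cong) auto
  then show ?thesis using weighted_form_bound[OF sM Mnn' rows', of "Q i"] on[OF i i] by (simp add: H_def)
 qed
 define \<mu> where "\<mu> = (%i. real (K\<^sup>2) * (l i + real q))"
 have evS: "mv d St (Q i) s = \<mu> i * Q i s" if "i < d" "s < d" for i s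
  using mv_St[OF that(2), of "Q i"] evv[OF that] by (simp add: H_def \<mu>_def algebra_simps)
 define I where "I = {i. i < d & eps <= l i}"
 have finI: "finite I" by (simp add: I_def)
 obtain f where f: "bij_betw f {..<card I} I" using finI ex_bij_betw_nat_finite[of I] by (auto simp: atLeast0LessThan)
 have "mm <= card I"
 proof (rule ccontr)
  assume "\<not> mm <= card I"
  then obtain x where x: "\<exists>j<mm. x j ~= 0" "\<forall>i\<in>I. ip d (%r. \<Sum>j<mm. x j * V j r) (Q i) = 0"
  using kernel_combo[OF finI, of mm d V Q] by auto
  define v where "v = combo mm V x"
  define w where "w = (sop d St ^^ T) v"
  define c where "c = (%i. ip d v (Q i))"
  have c0: "c i = 0" if "i < d" "eps <= l i" for i using x(2) that by (simp add: I_def c_def v_def combo_def)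
  have pw: "0 < ip d w w" "thof T * ip d v v <= ip d w w"
  using dm x(1) by (auto simp: dominating_def Let_def v_def w_def)
  have wi: "ip d w (Q i) = \<mu> i ^ T * c i" if "i < d" for i
  unfolding w_def c_def by (rule sop_pow_eigen[OF sSt evS[OF that]])
  have pw2: "x ^ (2 * T) = x ^ T * x ^ T" for x :: real by (simp add: mult_2 power_add)
  have ww: "ip d w w = (\<Sum>i<d. \<mu> i ^ (2 * T) * (c i)\<^sup>2)"
  unfolding se[of w w] pw2
  by (intro sum.cong refl) (use wi in \<open>simp add: power2_eq_square mult_ac\<close>)
  have vv: "ip d v v = (\<Sum>i<d. (c i)\<^sup>2)" using se[of v v] by (simp add: c_def power2_eq_square)
  have mu: "\<mu> i ^ (2 * T) < thof T" if "i < d" "\<not> eps <= l i" for i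
  proof -
  have "0 <= \<mu> i" using lq[OF that(1)] by (simp add: \<mu>_def)
  moreover have "\<mu> i < real (K\<^sup>2) * (real q + eps)"
  unfolding \<mu>_def using that(2) K1 by (intro mult_strict_left_mono) auto
  ultimately show ?thesis unfolding thof_def using T by (intro power_strict_mono) auto
  qed
  obtain i where i: "i < d" "c i ~= 0" using pw(1) unfolding ww
  by (metis (no_types, lifting) lessThan_iff less_irrefl mult_zero_right sum.neutral zero_power2)
  have "(\<Sum>i<d. \<mu> i ^ (2 * T) * (c i)\<^sup>2) < (\<Sum>i<d. thof T * (c i)\<^sup>2)"
  proof (rule sum_strict_mono_ex1)
  show "\<forall>i\<in>{..<d}. \<mu> i ^ (2 * T) * (c i)\<^sup>2 <= thof T * (c i)\<^sup>2"
  proof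
  fix i assume "i \<in> {..<d}"
  then show "\<mu> i ^ (2 * T) * (c i)\<^sup>2 <= thof T * (c i)\<^sup>2"
  using c0[of i] mu[of i] by (cases "eps <= l i") (auto intro!: mult_right_mono)
  qed
  show "\<exists>i\<in>{..<d}. \<mu> i ^ (2 * T) * (c i)\<^sup>2 < thof T * (c i)\<^sup>2"
  using i c0[of i] mu[of i] by (intro bexI[of _ i]) (auto intro!: mult_strict_right_mono)
  qed auto
  then show False using pw(2) ww vv by (simp add: sum_distrib_left)
 qed
 also have "card I <= rank_ge eps (mat d d (%(r, c). scaled M sd r c))"
 proof (rule rank_ge_lower_bound)
  show "sym_fun d (scaled M sd)" using sM by (auto simp: sym_fun_def scaled_def mult.commute)
  fix x v assume x: "\<exists>j<card I. x j ~= 0" and v: "v = (%r. \<Sum>j<card I. x j * (sd r / e r * Q (f j) r))"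
  have fI: "f j < d" "eps <= l (f j)" if "j < card I" for j
  using f that by (auto simp: bij_betw_def I_def)
  have finj: "f j = f j' \<longleftrightarrow> j = j'" if "j < card I" "j' < card I" for j j'
  using f that by (auto simp: bij_betw_def inj_on_def)
  define y where "y = (%r. \<Sum>j<card I. x j * Q (f j) r)"
  have vy: "v r = sd r / e r * y r" for r by (simp add: v y_def sum_distrib_left mult_ac)
  have Hy: "mv d H y r = (\<Sum>j<card I. (x j * l (f j)) * Q (f j) r)" if "r < d" for r
  unfolding y_def mv_sum mv_scale using evv fI that by (intro sum.cong refl) (simp add: mult_ac)
  have onf: "ip d (Q (f j)) (Q (f j')) = (if j' = j then 1 else 0)" if "j < card I" "j' < card I" for j j'
  using on fI finj that by auto
  have "ip d y (mv d H y) = ip d y (%r. \<Sum>j<card I. (x j * l (f j)) * Q (f j) r)"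
  using Hy by (intro ip_cong) auto
  also have "... = (\<Sum>j<card I. \<Sum>j'<card I. x j' * (x j * l (f j)) * ip d (Q (f j')) (Q (f j)))"
  unfolding y_def ip_sum_left ip_sum_right ip_scale_left ip_scale_right by (subst sum.swap) (simp add: mult_ac sum_distrib_left)
  also have "... = (\<Sum>j<card I. \<Sum>j'<card I. if j' = j then l (f j) * (x j)\<^sup>2 else 0)"
  using onf by (intro sum.cong refl) (auto simp: power2_eq_square mult_ac)
  also have "... = (\<Sum>j<card I. l (f j) * (x j)\<^sup>2)" by (intro sum.cong refl sum_delta_const) auto
  finally have yHy: "ip d y (mv d H y) = (\<Sum>j<card I. l (f j) * (x j)\<^sup>2)" .
  have yy: "ip d y y = (\<Sum>j<card I. (x j)\<^sup>2)"
  unfolding y_def by (subst orthogonal_sum_norm) (use onf in auto)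
  have "eps * ip d y y <= ip d y (mv d H y)"
  unfolding yHy yy sum_distrib_left using fI by (intro sum_mono mult_right_mono) auto
  moreover have "0 < ip d y y"
  proof -
  obtain j0 where "j0 < card I" "x j0 ~= 0" using x by blast
  then show ?thesis unfolding yy by (intro sum_pos2[of _ j0]) auto
  qed
  moreover have "ip d v (mv d (scaled M sd) v) = ip d y (mv d H y)"
  proof -
  \<comment> \<open>Where e vanishes, so does the row of \<open>M\<close>; therefore the convention
    x / 0 = 0 does not disturb the identity.\<close>
  have "v r * (scaled M sd r c * v c) = y r * (H r c * y c)" if "r < d" "c < d" for r c
  using zero_row'[OF that] zero_row'[OF that(2,1)] sM that sd(3)[OF that(1)] sd(3)[OF that(2)]
  by (cases "sd r = 0"; cases "sd c = 0"; cases "e r = 0"; cases "e c = 0")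
  (auto simp: vy scaled_def H_def sym_fun_def field_simps)
  then show ?thesis unfolding ip_def mv_def sum_distrib_left by (intro sum.cong refl) auto
  qed
  moreover have "ip d v v <= ip d y y"
  unfolding ip_def
  proof (rule sum_mono)
  fix r assume "r \<in> {..<d}"
  then have "0 <= sd r" "sd r <= e r" using sd[of r] by auto
  then have "\<bar>sd r / e r\<bar> <= 1" by (auto simp: divide_le_eq_1)
  then have "(sd r / e r)\<^sup>2 <= 1" by (simp add: abs_square_le_1)
  then have "(sd r / e r)\<^sup>2 * (y r * y r) <= 1 * (y r * y r)" by (intro mult_right_mono) auto
  then show "v r * v r <= y r * y r" by (simp add: vy power2_eq_square mult_ac)
  qed
  ultimately have a: "0 < ip d v (mv d (scaled M sd) v)" "eps * ip d v v <= ip d v (mv d (scaled M sd) v)"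
  using eps mult_left_mono[of "ip d v v" "ip d y y" eps] by (smt (verit) mult_pos_pos)+
  have "ip d v v ~= 0"
  proof
  assume "ip d v v = 0"
  then have "\<forall>r<d. v r = 0" by (simp add: ip_self_zero_iff)
  then have "ip d v (mv d (scaled M sd) v) = 0" by (simp add: ip_def)
  with a show False by simp
  qed
  then show "0 < ip d v v & eps * ip d v v <= ip d v (mv d (scaled M sd) v)"
  using a ip_self_nonneg[of d v] by simp
 qed
 finally show ?thesis .
qed

end

section \<open>Reading the instance\<close>

text \<open>A loop rule on bare states, as the memory does not have the layout of \<open>lay\<close>
  before \<open>boot\<close> is done. All rounds cost the same number p of steps.\<close>

lemma exec_while:
 assumes "I (0::nat) s"
  and step: "!!k s. I k s ==> holds b s ==> \<exists>s'. exec P s p s' & I (Suc k) s' & k < N"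
  and fin: "!!k s. I k s ==> \<not> holds b s ==> Q k s"
 shows "\<exists>k s'. exec (Loop b P) s (k * (p + 1) + 1) s' & k <= N & Q k s'"
proof -
 have "k0 <= N ==> I k0 s ==> \<exists>k s'. exec (Loop b P) s (k * (p + 1) + 1) s' & k0 + k <= N & Q (k0 + k) s'" for k0 s
 proof (induction "N - k0" arbitrary: k0 s)
  case 0
  then have "\<not> holds b s" using step[of k0 s] by auto
  then show ?case using 0 fin exec.LoopFalse[of b s P] by (intro exI[of _ 0] exI[of _ s]) auto
 next
  case (Suc x)
  show ?case
  proof (cases "holds b s")
  case False
  then show ?thesis using Suc fin exec.LoopFalse[of b s P] by (intro exI[of _ 0] exI[of _ s]) auto
  next
  case True
  then obtain s1 where 1: "exec P s p s1" "I (Suc k0) s1" "k0 < N" using step Suc.prems by blast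
  have "\<exists>k s'. exec (Loop b P) s1 (k * (p + 1) + 1) s' & Suc k0 + k <= N & Q (Suc k0 + k) s'"
  by (rule Suc.hyps(1)) (use 1 Suc.hyps(2) in auto)
  then obtain k s' where 2: "exec (Loop b P) s1 (k * (p + 1) + 1) s'" "Suc k0 + k <= N" "Q (Suc k0 + k) s'" by blast
  have "exec (Loop b P) s (p + (k * (p + 1) + 1) + 1) s'" by (rule exec.LoopTrue[OF True 1(1) 2(1)])
  then have "exec (Loop b P) s (Suc k * (p + 1) + 1) s'" by (simp add: add_ac)
  with 2 show ?thesis by (intro exI[of _ "Suc k"] exI[of _ s']) (simp del: mult_Suc)
  qed
 qed
 from this[of 0 s] assms(1) show ?thesis by simp
qed

text \<open>Cell 0 of the natural-number memory becomes the base address of the working arrays; its input value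
 \<open>n\<close> and the counts \<open>m\<close>, \<open>q\<close> are first saved in the real memory.\<close>

definition boot :: prog where
 "boot = RStore (NConst xN) (RNat (NLoad (NConst 0))) ;; RStore (NConst xM) (RNat (NLoad (NConst 1))) ;;
  RStore (NConst xQ) (RNat (NLoad (NConst 2))) ;;
  RStore (NConst xLen) (RAdd (RAdd (Rc 3) (RAdd (RLoad (NConst xM)) (RLoad (NConst xM))))
  (RAdd (RMul (RLoad (NConst xM)) (RMul (RLoad (NConst xQ)) (RLoad (NConst xQ)))) (RLoad (NConst xN)))) ;;
  NStore (NConst 0) (NConst 0) ;;
  Loop (RLess (RNat (NLoad (NConst 0))) (RLoad (NConst xLen))) (NStore (NConst 0) (NAdd (NLoad (NConst 0)) (NConst 1)))"

text \<open>The summand n in the base address guarantees that at least n cells precede the working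
  arrays, so the assignment can be written over the input area without touching them. The clock
  starts at the cost of \<open>boot\<close>.\<close>

definition boot_state :: "nat => nat => nat => nat list => real => hst" where
 "boot_state n m q ins eps = (let B = 3 + 2 * m + m * q * q + n in
  \<lparr>bnd = B - 1, raw = (%a. if a < length ins then ins ! a else 0), NA = (%_ _. 0),
  RA = (%a i. if i ~= 0 then 0 else if a = xEps then eps else if a = xN then real n else if a = xM then real m
  else if a = xQ then real q else if a = xLen then real B else 0), clk = 2 * B + 6\<rparr>)"

lemma exec_boot:
 assumes ins: "ins = [n, m, q] @ xs" "length xs = 2 * m + m * q * q"
 shows "exec boot ((%a. if a < length ins then ins ! a else 0), (%a. if a = 0 then eps else 0))
  (clk (boot_state n m q ins eps)) (lay (boot_state n m q ins eps))"
proof -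
 define B where "B = 3 + 2 * m + m * q * q + n"
 define f where "f = (%a. if a < length ins then ins ! a else 0)"
 define g where "g = (%a::nat. if a = xEps then eps else if a = xN then real n else if a = xM then real m
  else if a = xQ then real q else if a = xLen then real B else 0)"
 have f: "f 0 = n" "f 1 = m" "f (Suc 0) = m" "f 2 = q" using ins by (auto simp: f_def nth_append)
 have seq: "exec (P ;; P') s (Suc t) s'" if "exec P s 1 s1" "exec P' s1 t s'" for P P' s s1 t s'
  using exec.Then[OF that] by simp
 have "\<exists>k s'. exec (Loop (RLess (RNat (NLoad (NConst 0))) (RLoad (NConst xLen))) (NStore (NConst 0) (NAdd (NLoad (NConst 0)) (NConst 1))))
  (f(0 := 0), g) (k * (1 + 1) + 1) s' & k <= B & (s' = (f(0 := k), g) & B <= k)"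
 proof (rule exec_while[where I = "%k s. s = (f(0 := k), g)"], goal_cases)
  case (2 k s)
  then have "exec (NStore (NConst 0) (NAdd (NLoad (NConst 0)) (NConst 1))) s 1 (f(0 := Suc k), g)"
  using exec.NStore[of "NConst 0" "NAdd (NLoad (NConst 0)) (NConst 1)" s] by simp
  moreover have "k < B" using 2 by (simp add: g_def)
  ultimately show ?case by blast
 next
  case (3 k s)
  then show ?case by (simp add: g_def)
 qed simp
 then have L: "exec (Loop (RLess (RNat (NLoad (NConst 0))) (RLoad (NConst xLen))) (NStore (NConst 0) (NAdd (NLoad (NConst 0)) (NConst 1))))
  (f(0 := 0), g) (2 * B + 1) (f(0 := B), g)" by (auto simp: mult_2 mult_2_right dest: le_antisym)
 define g0 where "g0 = (%a::nat. if a = 0 then eps else 0)"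
 have 1: "exec (RStore (NConst xN) (RNat (NLoad (NConst 0)))) (f, g0) 1 (f, g0(xN := real n))"
  using exec.RStore[of "NConst xN" "RNat (NLoad (NConst 0))" "(f, g0)"] f by simp
 have 2: "exec (RStore (NConst xM) (RNat (NLoad (NConst 1)))) (f, g0(xN := real n)) 1 (f, g0(xN := real n, xM := real m))"
  using exec.RStore[of "NConst xM" "RNat (NLoad (NConst 1))" "(f, g0(xN := real n))"] f by simp
 have 3: "exec (RStore (NConst xQ) (RNat (NLoad (NConst 2)))) (f, g0(xN := real n, xM := real m)) 1
  (f, g0(xN := real n, xM := real m, xQ := real q))"
  using exec.RStore[of "NConst xQ" "RNat (NLoad (NConst 2))" "(f, g0(xN := real n, xM := real m))"] f by simp
 have g: "g0(xN := real n, xM := real m, xQ := real q, xLen := real B) = g" by (auto simp: g_def g0_def fun_eq_iff)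
 have 4: "exec (RStore (NConst xLen) (RAdd (RAdd (Rc 3) (RAdd (RLoad (NConst xM)) (RLoad (NConst xM))))
  (RAdd (RMul (RLoad (NConst xM)) (RMul (RLoad (NConst xQ)) (RLoad (NConst xQ)))) (RLoad (NConst xN)))))
  (f, g0(xN := real n, xM := real m, xQ := real q)) 1 (f, g)"
  unfolding g[symmetric]
  using exec.RStore[of "NConst xLen" "RAdd (RAdd (Rc 3) (RAdd (RLoad (NConst xM)) (RLoad (NConst xM))))
  (RAdd (RMul (RLoad (NConst xM)) (RMul (RLoad (NConst xQ)) (RLoad (NConst xQ)))) (RLoad (NConst xN)))"
  "(f, g0(xN := real n, xM := real m, xQ := real q))"] by (simp add: B_def algebra_simps)
 have 5: "exec (NStore (NConst 0) (NConst 0)) (f, g) 1 (f(0 := 0), g)"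
  using exec.NStore[of "NConst 0" "NConst 0" "(f, g)"] by simp
 have E: "exec boot (f, g0) (Suc (Suc (Suc (Suc (Suc (2 * B + 1)))))) (f(0 := B), g)"
  unfolding boot_def by (rule seq[OF 1 seq[OF 2 seq[OF 3 seq[OF 4 seq[OF 5 L]]]]])
 have fin: "lay (boot_state n m q ins eps) = (f(0 := B), g)"
 proof -
  have B0: "0 < B" by (simp add: B_def)
  have len: "length ins <= B" using ins by (simp add: B_def)
  have "fst (lay (boot_state n m q ins eps)) = f(0 := B)"
  using B0 len unfolding lay_def boot_state_def B_def[symmetric] Let_def by (auto simp: f_def fun_eq_iff)
  moreover have "snd (lay (boot_state n m q ins eps)) a = g a" for a
  proof (cases "a < 64")
  case False
  then have "a div 64 ~= 0" by simp
  then show ?thesis using False unfolding lay_def boot_state_def B_def[symmetric] Let_def by (auto simp: g_def)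
  qed (simp add: lay_def boot_state_def g_def B_def Let_def)
  ultimately show ?thesis by (simp add: prod_eq_iff fun_eq_iff)
 qed
 have clk: "clk (boot_state n m q ins eps) = Suc (Suc (Suc (Suc (Suc (2 * B + 1)))))"
  by (simp add: boot_state_def B_def Let_def)
 show ?thesis using E unfolding fin clk f_def g0_def .
qed

definition rawset :: "nat => nat => hst => hst" where
 "rawset i x h = h\<lparr>raw := (raw h)(i := x)\<rparr>"

lemma rawset_access [simp]:
 "NA (rawset i x h) = NA h" "RA (rawset i x h) = RA h" "bnd (rawset i x h) = bnd h"
 "raw (rawset i x h) = (raw h)(i := x)" "clk (rawset i x h) = clk h"
 by (simp_all add: rawset_def)

lemma ht_raw_store:
 assumes a: "0 < nval i (lay h)" "nval i (lay h) <= bnd h"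
  and Q: "Q (tick (rawset (nval i (lay h)) (nval e (lay h)) h))"
 shows "ht (NStore i e) h Q"
proof -
 have "exec (NStore i e) (lay h) 1 (lay (tick (rawset (nval i (lay h)) (nval e (lay h)) h)))"
  unfolding lay_tick using exec.NStore[of i e "lay h"] a
  by (simp add: lay_def fun_upd_def) (auto simp: lay_def fun_eq_iff elim!: back_subst[of "%s. exec _ _ _ s"])
 with Q show ?thesis unfolding ht_def by (intro exI conjI) auto
qed

text \<open>Cell 0 is the pointer through which all arrays are read, so the label of vertex 0 is
  written last.\<close>

definition write_out :: prog where
 "write_out = nset0 vI (NConst 1) ;;
  Loop (NLess (nv vI) (nv vN)) (NStore (nv vI) (nld vBest (nv vI)) ;; nset0 vI (NAdd (nv vI) (NConst 1))) ;;
  NStore (NConst 0) (nld vBest (NConst 0))"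

lemma exec_output:
 assumes n: "NA h vN 0 = n" "1 <= n" "n <= Suc (bnd h)"
 shows "\<exists>t s. exec write_out (lay h) t s & t <= 3 * n + 5 & (\<forall>i<n. fst s i = NA h vBest i)"
proof -
 have "ht (nset0 vI (NConst 1) ;;
  Loop (NLess (nv vI) (nv vN)) (NStore (nv vI) (nld vBest (nv vI)) ;; nset0 vI (NAdd (nv vI) (NConst 1)))) h
  (%h'. NA h' vBest = NA h vBest & bnd h' = bnd h & (\<forall>i<n. 0 < i --> raw h' i = NA h vBest i) & clk h' <= clk h + 3 * n + 4)"
 proof (intro ht_seq ht_nst, goal_cases)
  case 2
  show ?case
  proof (rule ht_while[where I = "%h'. NA h' vBest = NA h vBest & NA h' vN = NA h vN & bnd h' = bnd h & 1 <= NA h' vI 0 & NA h' vI 0 <= n &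
  (\<forall>i<NA h' vI 0. 0 < i --> raw h' i = NA h vBest i) & clk h' <= clk h + 1 + 3 * NA h' vI 0" and \<mu> = "%h'. n - NA h' vI 0"], goal_cases)
  case (2 h')
  then show ?case using n
  by (intro ht_seq ht_raw_store ht_nst) (auto simp: less_Suc_eq)
  qed (use n in auto)
 qed auto
 then obtain t h' where e: "exec (nset0 vI (NConst 1) ;;
  Loop (NLess (nv vI) (nv vN)) (NStore (nv vI) (nld vBest (nv vI)) ;; nset0 vI (NAdd (nv vI) (NConst 1)))) (lay h) t (lay h')"
  "NA h' vBest = NA h vBest" "bnd h' = bnd h" "\<forall>i<n. 0 < i --> raw h' i = NA h vBest i" "clk h' <= clk h + 3 * n + 4" "clk h' = clk h + t"
  unfolding ht_def by auto
 from e(1) obtain t1 s1 t2 where t: "exec (nset0 vI (NConst 1)) (lay h) t1 s1" "exec (Loop (NLess (nv vI) (nv vN))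
  (NStore (nv vI) (nld vBest (nv vI)) ;; nset0 vI (NAdd (nv vI) (NConst 1)))) s1 t2 (lay h')" "t = t1 + t2"
  by (cases rule: exec.cases) auto
 have "exec (NStore (NConst 0) (nld vBest (NConst 0))) (lay h') 1 ((fst (lay h'))(0 := NA h vBest 0), snd (lay h'))"
  using exec.NStore[of "NConst 0" "nld vBest (NConst 0)" "lay h'"] e(2) by simp
 then have "exec write_out (lay h) (t1 + (t2 + 1)) ((fst (lay h'))(0 := NA h vBest 0), snd (lay h'))"
  unfolding write_out_def using t by (intro exec.Then) auto
 moreover have "((fst (lay h'))(0 := NA h vBest 0)) i = NA h vBest i" if "i < n" for i
  using that e(3,4) n by (cases "i = 0") (auto simp: lay_def)
 ultimately show ?thesis using e(5,6) t(3) by (intro exI[of _ "t1 + (t2 + 1)"] exI conjI) auto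
qed

text \<open>Rounding up by counting: a real can influence a natural number through comparisons
  only.\<close>

definition count_to :: "nat => rexp => prog" where
 "count_to v x = nset0 v (NConst 0) ;; Loop (RLess (RNat (nv v)) x) (nset0 v (NAdd (nv v) (NConst 1)))"

lemma ht_count_to:
 assumes v: "v < arrs" and X: "0 <= X" and val: "!!h'. same {v} {} h h' ==> rval x (lay h') = X"
  and post: "!!h' k. same {v} {} h h' ==> NA h' v 0 = k ==> X <= real k ==> real k < X + 1 ==> clk h' = clk h + 2 * k + 2 ==> Q h'"
 shows "ht (count_to v x) h Q"
 unfolding count_to_def
proof (intro ht_seq ht_nst, goal_cases)
 case 2
 show ?case
 proof (rule ht_while[where I = "%h'. same {v} {} h h' & real (NA h' v 0) < X + 1 & clk h' = clk h + 2 * NA h' v 0 + 1"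
  and \<mu> = "%h'. nat \<lceil>X\<rceil> - NA h' v 0"], goal_cases)
  case (2 h')
  then have "rval x (lay h') = X" by (intro val) simp
  then have lt: "real (NA h' v 0) < X" using 2 v by simp
  then have "NA h' v 0 < nat \<lceil>X\<rceil>" by linarith
  then show ?case using 2 v lt by (intro ht_nst) auto
 next
  case (3 h')
  then have "rval x (lay h') = X" by (intro val) simp
  then show ?case using 3 v by (intro post[of _ "NA h' v 0"]) auto
 qed (use v X in auto)
qed (use v in auto)

definition lg4 :: "nat => nat" where "lg4 g = (LEAST j. g <= 4 ^ j)"

lemma le_four_power: "g <= (4::nat) ^ g"
proof (induction g)
 case (Suc g)
 have "1 <= (4::nat) ^ g" by simp
 with Suc show ?case unfolding power_Suc by linarith
qed simp

lemma lg4_le: "g <= 4 ^ lg4 g" unfolding lg4_def by (rule LeastI) (rule le_four_power)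

lemma lg4_le_self: "lg4 g <= g" unfolding lg4_def by (rule Least_le) (rule le_four_power)

lemma lg4_less: "j < lg4 g ==> 4 ^ j < g"
 unfolding lg4_def using not_less_Least[of j "%j. g <= 4 ^ j"] by (simp add: not_le)

lemma lg4_upper: "0 < g ==> 4 ^ lg4 g <= 4 * g"
 using lg4_less[of "lg4 g - 1" g] by (cases "lg4 g") auto

text \<open>The substitute for a square root: the least power of two whose square reaches g; for g >
  0 the square is at most 4 g by \<open>lg4_upper\<close>.\<close>

definition sqrt_pow2 :: "rexp => prog" where
 "sqrt_pow2 x = rset0 xS (Rc 1) ;; Loop (RLess (RMul (rv xS) (rv xS)) x) (rset0 xS (RMul (rv xS) (Rc 2)))"

lemma ht_sqrt_pow2:
 assumes val: "!!h'. same {} {xS} h h' ==> rval x (lay h') = real g"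
  and post: "!!h'. same {} {xS} h h' ==> RA h' xS 0 = 2 ^ lg4 g ==> clk h' = clk h + 2 * lg4 g + 2 ==> Q h'"
 shows "ht (sqrt_pow2 x) h Q"
 unfolding sqrt_pow2_def
proof (intro ht_seq ht_rst, goal_cases)
 case 2
 have sq: "(2::real) ^ j * 2 ^ j < real g \<longleftrightarrow> 4 ^ j < g" for j
 proof -
  have "(2::real) ^ j * 2 ^ j = real (4 ^ j)" by (simp add: power_mult_distrib[symmetric])
  then show ?thesis by (metis of_nat_less_iff)
 qed
 define I where "I = (%j h'. same {} {xS} h h' & j <= lg4 g & RA h' xS 0 = 2 ^ j & clk h' = clk h + 2 * j + 1)"
 show ?case
 proof (rule ht_while[where I = "%h'. \<exists>j. I j h'" and \<mu> = "%h'. clk h + 2 * lg4 g + 1 - clk h'"], goal_cases)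
  case 1
  show ?case by (rule exI[of _ 0]) (simp add: I_def)
 next
  case (2 h')
  then obtain j where j: "I j h'" by blast
  then have "rval x (lay h') = real g" by (intro val) (simp add: I_def)
  then have "4 ^ j < g" using 2 j by (simp add: I_def sq)
  then have "\<not> lg4 g <= j" using lg4_le[of g] power_increasing[of "lg4 g" j "4::nat"] by linarith
  then have jl: "j < lg4 g" by simp
  have "I (Suc j) (tick (rset xS 0 (2 ^ j * 2) (tick h')))" using j jl by (simp add: I_def)
  then show ?case using j jl by (intro ht_rst conjI exI[of _ "Suc j"]) (auto simp: I_def)
 next
  case (3 h')
  then obtain j where j: "I j h'" by blast
  then have "rval x (lay h') = real g" by (intro val) (simp add: I_def)
  then have "\<not> 4 ^ j < g" using 3 j by (simp add: I_def sq)
  then have "\<not> j < lg4 g" using lg4_less[of j g] by blast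
  then have "j = lg4 g" using j by (simp add: I_def)
  then show ?case using j by (intro post) (auto simp: I_def)
 qed
qed auto

definition push :: "nat => nat => prog" where
 "push r c = nst vCol (nv vCnt) (nv c) ;; nst vNxt (nv vCnt) (nld vHead (nv r)) ;;
  nst vHead (nv r) (nv vCnt) ;; nset0 vCnt (NAdd (nv vCnt) (NConst 1))"

text \<open>\<open>S\<close> lists the matrix positions pushed so far, newest first, and each row
  list holds the columns of its row in that order. The bound on cell numbers keeps existing lists
  intact when the next free cell is written.\<close>

definition rep :: "hst => (nat \<times> nat) list => bool" where
 "rep h S \<longleftrightarrow> NA h vCnt 0 = Suc (length S) &
  (\<exists>rows. \<forall>r. chain (NA h vNxt) (NA h vHead r) (rows r) & (\<forall>p\<in>set (rows r). p < Suc (length S)) &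
  map (NA h vCol) (rows r) = map snd (filter (%x. fst x = r) S))"

lemma rep_cong: "rep h S ==> same X Y h h' ==> X \<inter> {vCol, vNxt, vHead, vCnt} = {} ==> rep h' S"
proof -
 assume a: "rep h S" "same X Y h h'" "X \<inter> {vCol, vNxt, vHead, vCnt} = {}"
 then have "NA h' vCol = NA h vCol" "NA h' vNxt = NA h vNxt" "NA h' vHead = NA h vHead" "NA h' vCnt = NA h vCnt"
  by (auto intro!: sameN[of X Y])
 with a(1) show "rep h' S" by (simp add: rep_def)
qed

lemma chain_cong: "chain f p xs ==> (!!x. x \<in> set xs ==> f x = g x) ==> chain g p xs"
 by (induction xs arbitrary: p) auto

lemma ht_push:
 assumes s: "rep h S" and rc: "NA h r 0 = r0" "NA h c 0 = c0"
  and v: "r < arrs" "c < arrs" "r \<notin> {vCol, vNxt, vHead, vCnt}" "c \<notin> {vCol, vNxt, vHead, vCnt}"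
  and post: "!!h'. same {vCol, vNxt, vHead, vCnt} {} h h' ==> clk h' = clk h + 4 ==> rep h' ((r0, c0) # S) ==> Q h'"
 shows "ht (push r c) h Q"
 unfolding push_def
proof (intro ht_seq ht_nst, goal_cases)
 case 5
 from s obtain rows where cnt: "NA h vCnt 0 = Suc (length S)"
  and rows: "!!r. chain (NA h vNxt) (NA h vHead r) (rows r)" "!!r p. p \<in> set (rows r) ==> p < Suc (length S)"
  "!!r. map (NA h vCol) (rows r) = map snd (filter (%x. fst x = r) S)"
  unfolding rep_def by blast
 define nx hd cl where "nx = (NA h vNxt)(Suc (length S) := NA h vHead r0)" and "hd = (NA h vHead)(r0 := Suc (length S))"
  and "cl = (NA h vCol)(Suc (length S) := c0)"
 define rows' where "rows' = rows(r0 := Suc (length S) # rows r0)"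
 have c1: "chain nx (NA h vHead r') (rows r')" for r'
  by (rule chain_cong[OF rows(1)]) (use rows(2)[of _ r'] in \<open>auto simp: nx_def\<close>)
 have m1: "map cl (rows r') = map snd (filter (%x. fst x = r') S)" for r'
 proof -
  have "map cl (rows r') = map (NA h vCol) (rows r')" using rows(2)[of _ r'] by (auto simp: cl_def)
  then show ?thesis using rows(3) by simp
 qed
 have "chain nx (hd r') (rows' r') & (\<forall>p\<in>set (rows' r'). p < Suc (length ((r0, c0) # S))) &
  map cl (rows' r') = map snd (filter (%x. fst x = r') ((r0, c0) # S))" for r'
 proof (cases "r' = r0")
  case True
  have "nx (Suc (length S)) = NA h vHead r0" by (simp add: nx_def)
  moreover have "cl (Suc (length S)) = c0" by (simp add: cl_def)
  ultimately show ?thesis using True c1[of r0] m1[of r0] rows(2)[of _ r0]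
  by (auto simp: rows'_def hd_def less_Suc_eq)
 next
  case False
  then show ?thesis using c1[of r'] m1[of r'] rows(2)[of _ r'] by (auto simp: rows'_def hd_def less_Suc_eq)
 qed
 then have "\<exists>rows'. \<forall>r'. chain nx (hd r') (rows' r') & (\<forall>p\<in>set (rows' r'). p < Suc (length ((r0, c0) # S))) &
  map cl (rows' r') = map snd (filter (%x. fst x = r') ((r0, c0) # S))" by blast
 then show ?case using rc v cnt unfolding nx_def hd_def cl_def
  by (intro post) (simp_all add: rep_def)
qed (use v in auto)

section \<open>Adjacency lists and weights from the input\<close>

locale csp_input =
 fixes h0 :: hst and n q m :: nat and ei ej tb :: "nat => nat" and eps :: real
 assumes r1: "raw h0 1 = m" and r2: "raw h0 2 = q"
  and re: "!!t. t < m ==> raw h0 (3 + 2 * t) = ei t & raw h0 (4 + 2 * t) = ej t"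
  and rt: "!!p. p < m * q * q ==> raw h0 (3 + 2 * m + p) = tb p"
  and bnd0: "bnd h0 = 2 + 2 * m + m * q * q + n"
  and NA0: "NA h0 = (%_ _. 0)"
  and RA0: "RA h0 xEps 0 = eps" "RA h0 xN 0 = real n" "RA h0 xM 0 = real m" "RA h0 xQ 0 = real q" "!!i. RA h0 yDeg i = 0"
  and ee: "!!t. t < m ==> ei t < n & ej t < n"
  and q0: "0 < q" and n0: "0 < n" and m0: "0 < m" and eps: "0 < eps"
begin

text \<open>Position p of the concatenated truth tables is (t q + alpha) q + beta for edge t and
  labels alpha, beta; this is the matrix position to which that table entry belongs.\<close>

definition pair :: "nat => nat \<times> nat" where
 "pair p = (ei (p div (q * q)) * q + (p div q) mod q, ej (p div (q * q)) * q + p mod q)"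

primrec pairs :: "nat => (nat \<times> nat) list" where
 "pairs 0 = []"
| "pairs (Suc p) = (if 0 < tb p then prod.swap (pair p) # pair p # pairs p else pairs p)"

lemma length_pairs: "length (pairs p) <= 2 * p"
 by (induction p) auto

definition degc :: "nat => nat => nat" where
 "degc t i = (\<Sum>t'<t. of_bool (ei t' = i) + of_bool (ej t' = i))"

lemma sum_degc: "(\<Sum>i<n. degc m i) = 2 * m"
proof -
 have "(\<Sum>i<n. degc m i) = (\<Sum>t<m. \<Sum>i<n. of_bool (ei t = i) + of_bool (ej t = i))"
  unfolding degc_def by (rule sum.swap)
 also have "... = (\<Sum>t<m. 2)"
 proof (rule sum.cong[OF refl])
  fix t assume "t \<in> {..<m}"
  then have t: "ei t < n" "ej t < n" using ee by auto
  have "(\<Sum>i<n. of_bool (ei t = i) + of_bool (ej t = i)) = (\<Sum>i<n. of_bool (ei t = i)) + (\<Sum>i<n. of_bool (ej t = i) :: nat)"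
  by (rule sum.distrib)
  then show "(\<Sum>i<n. of_bool (ei t = i) + of_bool (ej t = i)) = (2::nat)" using t by (simp add: of_bool_def)
 qed
 finally show ?thesis by simp
qed

definition load_counts :: prog where
 "load_counts = nset0 vM (rawld (NConst 1)) ;; nset0 vQ (rawld (NConst 2)) ;; nset0 vD (NConst 0) ;;
  for_loop vI (nv vN) (nst vRb (nv vI) (nv vD) ;; nset0 vD (NAdd (nv vD) (nv vQ)))"

definition cfg :: "hst => bool" where
 "cfg h \<longleftrightarrow> NA h vN 0 = n & NA h vM 0 = m & NA h vQ 0 = q & NA h vD 0 = n * q & (\<forall>i<n. NA h vRb i = i * q)"

lemma cfg_same: "cfg h ==> same X Y h h' ==> X \<inter> {vN, vM, vQ, vD, vRb} = {} ==> cfg h'"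
proof -
 assume a: "cfg h" "same X Y h h'" "X \<inter> {vN, vM, vQ, vD, vRb} = {}"
 then have "NA h' vN = NA h vN" "NA h' vM = NA h vM" "NA h' vQ = NA h vQ" "NA h' vD = NA h vD" "NA h' vRb = NA h vRb"
  by (auto intro!: sameN[of X Y])
 with a(1) show "cfg h'" by (simp add: cfg_def)
qed

lemma ht_load_counts:
 assumes S: "same X Y h0 h" and N: "NA h vN 0 = n"
  and post: "!!h'. same {vM, vQ, vD, vRb, vI} {} h h' ==> cfg h' ==> clk h' = clk h + 4 * n + 5 ==> Q h'"
 shows "ht load_counts h Q"
 unfolding load_counts_def
proof (intro ht_seq ht_nst, goal_cases)
 case 4
 have raw: "raw h 1 = m" "raw h (Suc 0) = m" "raw h 2 = q" using r1 r2 sameraw[OF S] by auto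
 have bnd: "2 <= bnd h" using bnd0 samebnd[OF S] by simp
 show ?case
 proof (rule ht_for[where n = n and I = "%k h'. same {vM, vQ, vD, vRb, vI} {} h h' & NA h' vM 0 = m & NA h' vQ 0 = q &
  NA h' vD 0 = k * q & (\<forall>i<k. NA h' vRb i = i * q) & clk h' = clk h + 4 * k + 4"], goal_cases)
  case 2
  then show ?case using raw bnd by simp
 next
  case (3 k h')
  then show ?case using N sameN[of "{vM, vQ, vD, vRb, vI}" "{}" h h' vN] by simp
 next
  case (4 k h')
  then show ?case by (intro ht_seq ht_nst) (auto simp: less_Suc_eq)
 next
  case (5 h')
  then show ?case using N sameN[of "{vM, vQ, vD, vRb, vI}" "{}" h h' vN] by (intro post) (auto simp: cfg_def)
 qed auto
qed auto

abbreviation "ltN == {vCol, vNxt, vHead, vCnt, vR, vP, vR2, vLo, vHi, vLen, vH, vT, vT1}"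

definition load_tables :: prog where
 "load_tables =
  nset0 vCnt (NConst 1) ;; nset0 vP (NConst 3) ;; nset0 vR2 (NAdd (NConst 3) (NAdd (nv vM) (nv vM))) ;;
  for_loop vR (nv vM)
  (nset0 vLo (rawld (nv vP)) ;; nset0 vHi (rawld (NAdd (nv vP) (NConst 1))) ;; nset0 vP (NAdd (nv vP) (NConst 2)) ;;
  rst yDeg (nv vLo) (RAdd (rld yDeg (nv vLo)) (Rc 1)) ;; rst yDeg (nv vHi) (RAdd (rld yDeg (nv vHi)) (Rc 1)) ;;
  for_loop vLen (nv vQ)
  (for_loop vH (nv vQ)
  (nset0 vT (NAdd (nld vRb (nv vLo)) (nv vLen)) ;; nset0 vT1 (NAdd (nld vRb (nv vHi)) (nv vH)) ;;
  Cond (NLess (NConst 0) (rawld (nv vR2))) (push vT vT1 ;; push vT1 vT) Skip ;;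
  nset0 vR2 (NAdd (nv vR2) (NConst 1)))))"

lemma linear_index:
 fixes t \<alpha> \<beta> :: nat
 assumes "\<alpha> < q" "\<beta> < q"
 shows "(t * q + \<alpha>) * q + \<beta> < (t + 1) * q * q" "((t * q + \<alpha>) * q + \<beta>) div (q * q) = t"
  "((t * q + \<alpha>) * q + \<beta>) div q mod q = \<alpha>" "((t * q + \<alpha>) * q + \<beta>) mod q = \<beta>"
proof -
 have a: "((t * q + \<alpha>) * q + \<beta>) div q = t * q + \<alpha>" using assms by simp
 have "((t * q + \<alpha>) * q + \<beta>) div (q * q) = ((t * q + \<alpha>) * q + \<beta>) div q div q" by (simp only: div_mult2_eq)
 then show "((t * q + \<alpha>) * q + \<beta>) div (q * q) = t" using assms unfolding a by simp
 show "((t * q + \<alpha>) * q + \<beta>) div q mod q = \<alpha>" unfolding a using assms by simp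
 show "((t * q + \<alpha>) * q + \<beta>) mod q = \<beta>" using assms by simp
 have "t * q + \<alpha> + 1 <= (t + 1) * q" using assms by simp
 then have "(t * q + \<alpha> + 1) * q <= (t + 1) * q * q" by (rule mult_le_mono1)
 then show "(t * q + \<alpha>) * q + \<beta> < (t + 1) * q * q" using assms by (simp add: algebra_simps)
qed

lemma ht_table_entry:
 assumes s: "rep h (pairs p)" "cfg h" and ix: "p = (t * q + \<alpha>) * q + \<beta>" "\<alpha> < q" "\<beta> < q" "t < m"
  and v: "NA h vLo 0 = ei t" "NA h vHi 0 = ej t" "NA h vLen 0 = \<alpha>" "NA h vH 0 = \<beta>" "NA h vR2 0 = 3 + 2 * m + p"
  and S: "same X Y h0 h"
  and post: "!!h'. same {vCol, vNxt, vHead, vCnt, vT, vT1, vR2} {} h h' ==> clk h' <= clk h + 12 ==> rep h' (pairs (Suc p)) ==>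
  NA h' vR2 0 = 3 + 2 * m + Suc p ==> Q h'"
 shows "ht (nset0 vT (NAdd (nld vRb (nv vLo)) (nv vLen)) ;; nset0 vT1 (NAdd (nld vRb (nv vHi)) (nv vH)) ;;
  Cond (NLess (NConst 0) (rawld (nv vR2))) (push vT vT1 ;; push vT1 vT) Skip ;;
  nset0 vR2 (NAdd (nv vR2) (NConst 1))) h Q"
proof (intro ht_seq ht_nst, goal_cases)
 case 3
 have pm: "p < m * q * q"
 proof -
  have "(t + 1) * q * q <= m * q * q" using ix by (intro mult_le_mono1) simp
  then show ?thesis using linear_index(1)[OF ix(2,3), of t] ix(1) by linarith
 qed
 have raw: "raw h (3 + 2 * m + p) = tb p" using rt[OF pm] sameraw[OF S] by simp
 have bnd: "3 + 2 * m + p <= bnd h" using bnd0 samebnd[OF S] pm n0 by simp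
 have rb: "NA h vRb (ei t) = ei t * q" "NA h vRb (ej t) = ej t * q" using s(2) ee[OF ix(4)] by (auto simp: cfg_def)
 have pr: "pair p = (ei t * q + \<alpha>, ej t * q + \<beta>)"
  unfolding pair_def ix(1) linear_index[OF ix(2,3)] ..
 define h1 where "h1 = tick (nset vT1 0 (ej t * q + \<beta>) (tick (nset vT 0 (ei t * q + \<alpha>) h)))"
 have S1: "same {vCol, vNxt, vHead, vCnt, vT, vT1, vR2} {} h h1" by (simp add: h1_def)
 have r1: "rep (tick h1) (pairs p)" by (rule rep_cong[OF s(1), of "{vT, vT1}" "{}"]) (auto simp: h1_def)
 have c1: "clk h1 = clk h + 2" by (simp add: h1_def)
 have t1: "nval (rawld (nv vR2)) (lay h1) = tb p" using v raw bnd by (subst nval_rawld) (auto simp: h1_def)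
 have vv: "NA (tick h1) vT 0 = ei t * q + \<alpha>" "NA (tick h1) vT1 0 = ej t * q + \<beta>" by (simp_all add: h1_def)
 have g: "ht (Cond (NLess (NConst 0) (rawld (nv vR2))) (push vT vT1 ;; push vT1 vT) Skip) h1
  (%h'. ht (nset0 vR2 (NAdd (nv vR2) (NConst 1))) h' Q)"
 proof (rule ht_cond, goal_cases)
  case 1
  then have b: "0 < tb p" using t1 by simp
  show ?case
  proof (rule ht_seq, rule ht_push[OF r1 vv], goal_cases)
  case (5 h2)
  have v2: "NA h2 vT 0 = ei t * q + \<alpha>" "NA h2 vT1 0 = ej t * q + \<beta>" using vv sameN[OF 5(1)] by auto
  show ?case
  proof (rule ht_push[OF 5(3) v2(2) v2(1)], goal_cases)
  case (5 h3)
  note h3 = this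
  have S3: "same {vCol, vNxt, vHead, vCnt, vT, vT1, vR2} {} h h3"
  by (rule same_trans'[OF same_trans'[OF S1, of "{vCol, vNxt, vHead, vCnt}" "{}" h2] 5(1)]) (use \<open>same _ _ (tick h1) h2\<close> in auto)
  have "rep h3 (pairs (Suc p))" using h3(3) b pr by simp
  then have "rep (tick (nset vR2 0 x h3)) (pairs (Suc p))" for x
  by (rule rep_cong[of _ _ "{vR2}" "{}"]) auto
  moreover have "NA h3 vR2 0 = 3 + 2 * m + p"
  using v(5) sameN[OF h3(1), of vR2] sameN[OF \<open>same _ _ (tick h1) h2\<close>, of vR2] by (simp add: h1_def)
  ultimately show ?case using S3 h3(2) \<open>clk h2 = _\<close> c1 by (intro ht_nst post) auto
  qed auto
  qed auto
 next
  case 2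
  then have b: "tb p = 0" using t1 by simp
  have "rep (tick (tick h1)) (pairs (Suc p))" using b r1 rep_cong[OF r1, of "{}" "{}"] by simp
  then have "rep (tick (nset vR2 0 x (tick (tick h1)))) (pairs (Suc p))" for x
  by (rule rep_cong[of _ _ "{vR2}" "{}"]) auto
  moreover have "NA h1 vR2 0 = 3 + 2 * m + p" using v(5) by (simp add: h1_def)
  ultimately show ?case using S1 c1 by (intro ht_skip ht_nst post) auto
 qed
 then show ?case using v rb by (simp add: h1_def)
qed auto

end

lemma rep_simps [simp]:
 "rep (tick h) S = rep h S"
 "a \<notin> {vCol, vNxt, vHead, vCnt} ==> rep (nset a i x h) S = rep h S"
 "rep (rset a i y h) S = rep h S"
 by (auto simp: rep_def)

lemma lg4_square_le: "lg4 (g * g) <= g"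
proof -
 have "g <= 2 ^ g" using less_exp[of g] by simp
 then have "g * g <= 2 ^ g * 2 ^ g" by (intro mult_le_mono)
 also have "... = (4::nat) ^ g" by (simp add: power_mult_distrib[symmetric])
 finally show ?thesis unfolding lg4_def by (rule Least_le)
qed

context csp_input
begin

lemma cfg_simps [simp]:
 "cfg (tick h) = cfg h"
 "a \<notin> {vN, vM, vQ, vD, vRb} ==> cfg (nset a i x h) = cfg h"
 "cfg (rset a i y h) = cfg h"
 by (auto simp: cfg_def)

abbreviation "ltI == {vCol, vNxt, vHead, vCnt, vT, vT1, vR2, vH}"
abbreviation "ltM == {vCol, vNxt, vHead, vCnt, vT, vT1, vR2, vH, vLen}"

lemma ht_table_row:
 assumes s: "rep h (pairs ((t * q + \<alpha>) * q))" "cfg h" and ix: "\<alpha> < q" "t < m"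
  and v: "NA h vLo 0 = ei t" "NA h vHi 0 = ej t" "NA h vLen 0 = \<alpha>" "NA h vR2 0 = 3 + 2 * m + (t * q + \<alpha>) * q"
  and S: "same UNIV UNIV h0 h"
  and post: "!!h'. same ltI {} h h' ==> clk h' <= clk h + 14 * q + 2 ==> rep h' (pairs ((t * q + Suc \<alpha>) * q)) ==>
  NA h' vR2 0 = 3 + 2 * m + (t * q + Suc \<alpha>) * q ==> Q h'"
 shows "ht (for_loop vH (nv vQ)
  (nset0 vT (NAdd (nld vRb (nv vLo)) (nv vLen)) ;; nset0 vT1 (NAdd (nld vRb (nv vHi)) (nv vH)) ;;
  Cond (NLess (NConst 0) (rawld (nv vR2))) (push vT vT1 ;; push vT1 vT) Skip ;;
  nset0 vR2 (NAdd (nv vR2) (NConst 1)))) h Q"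
proof -
 define b0 where "b0 = (t * q + \<alpha>) * q"
 have b1: "(t * q + Suc \<alpha>) * q = b0 + q" by (simp add: b0_def algebra_simps)
 show ?thesis
 proof (rule ht_for[where n = q and I = "%k h'. same ltI {} h h' & clk h' <= clk h + 14 * k + 1 & rep h' (pairs (b0 + k)) &
  NA h' vR2 0 = 3 + 2 * m + (b0 + k)"], goal_cases)
  case 2
  then show ?case using s v by (simp add: b0_def)
 next
  case (3 k h')
  then have "cfg h'" using cfg_same[OF s(2), of ltI "{}" h'] by simp
  then show ?case by (simp add: cfg_def)
 next
  case (4 k h')
  then have S': "same ltI {} h (tick h')" by simp
  have c': "cfg (tick h')" using cfg_same[OF s(2) S'] by simp
  have U: "same UNIV UNIV h0 (tick h')" by (rule same_trans'[OF S S']) auto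
  have r': "rep (tick h') (pairs (b0 + k))" using 4 by simp
  show ?case
  proof (rule ht_table_entry[OF r' c' _ ix(1) _ ix(2) _ _ _ _ _ U, of k], goal_cases)
  case (8 h2)
  have "same ltI {} h h2" by (rule same_trans'[OF S' 8(1)]) auto
  then show ?case using 8 4 sameN[OF 8(1), of vH] by auto
  qed (use 4 v sameN[OF S'] in \<open>auto simp: b0_def\<close>)
 next
  case (5 h')
  have "rep h' (pairs ((t * q + Suc \<alpha>) * q))" "NA h' vR2 0 = 3 + 2 * m + (t * q + Suc \<alpha>) * q"
  unfolding b1 using 5 by auto
  then show ?case using 5 by (intro post) auto
 qed auto
qed

lemma ht_table:
 assumes s: "rep h (pairs (t * q * q))" "cfg h" and ix: "t < m"
  and v: "NA h vLo 0 = ei t" "NA h vHi 0 = ej t" "NA h vR2 0 = 3 + 2 * m + t * q * q"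
  and S: "same UNIV UNIV h0 h"
  and post: "!!h'. same ltM {} h h' ==> clk h' <= clk h + (14 * q + 4) * q + 2 ==> rep h' (pairs (Suc t * q * q)) ==>
  NA h' vR2 0 = 3 + 2 * m + Suc t * q * q ==> Q h'"
 shows "ht (for_loop vLen (nv vQ) (for_loop vH (nv vQ)
  (nset0 vT (NAdd (nld vRb (nv vLo)) (nv vLen)) ;; nset0 vT1 (NAdd (nld vRb (nv vHi)) (nv vH)) ;;
  Cond (NLess (NConst 0) (rawld (nv vR2))) (push vT vT1 ;; push vT1 vT) Skip ;;
  nset0 vR2 (NAdd (nv vR2) (NConst 1))))) h Q"
proof -
 have b1: "Suc t * q * q = (t * q + q) * q" by (simp add: algebra_simps)
 show ?thesis
 proof (rule ht_for[where n = q and I = "%k h'. same ltM {} h h' & clk h' <= clk h + (14 * q + 4) * k + 1 &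
  rep h' (pairs ((t * q + k) * q)) & NA h' vR2 0 = 3 + 2 * m + (t * q + k) * q"], goal_cases)
  case 2
  then show ?case using s v by simp
 next
  case (3 k h')
  then have "cfg h'" using cfg_same[OF s(2), of ltM "{}" h'] by simp
  then show ?case by (simp add: cfg_def)
 next
  case (4 k h')
  then have S': "same ltM {} h (tick h')" by simp
  have c': "cfg (tick h')" using cfg_same[OF s(2) S'] by simp
  have U: "same UNIV UNIV h0 (tick h')" by (rule same_trans'[OF S S']) auto
  have r': "rep (tick h') (pairs ((t * q + k) * q))" using 4 by simp
  show ?case
  proof (rule ht_table_row[OF r' c' _ ix _ _ _ _ U], goal_cases)
  case (6 h2)
  have "same ltM {} h h2" by (rule same_trans'[OF S' 6(1)]) auto
  then show ?case using 6 4 sameN[OF 6(1), of vLen] by (auto simp: algebra_simps)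
  qed (use 4 v sameN[OF S'] in auto)
 next
  case (5 h')
  then show ?case by (intro post) (auto simp: b1 algebra_simps)
 qed auto
qed

definition tTab :: nat where "tTab = m * ((14 * q + 4) * q + 9) + 5"

lemma degc_Suc: "degc (Suc t) i = degc t i + of_bool (ei t = i) + of_bool (ej t = i)"
 by (simp add: degc_def)

lemma ht_load_tables:
 assumes c: "cfg h" and S: "same (UNIV - {vHead}) (UNIV - {yDeg}) h0 h"
  and post: "!!h'. same ltN {yDeg} h h' ==> clk h' <= clk h + tTab ==> rep h' (pairs (m * q * q)) ==>
  (!!i. RA h' yDeg i = real (degc m i)) ==> Q h'"
 shows "ht load_tables h Q"
 unfolding load_tables_def
proof (intro ht_seq ht_nst, goal_cases)
 case 4
 define tE where "tE = (14 * q + 4) * q + 9"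
 have U: "same UNIV UNIV h0 h" using same_weaken[OF S] by auto
 have hd: "NA h vHead r = 0" for r using sameN[OF S, of vHead] NA0 by simp
 have dg: "RA h yDeg i = 0" for i using sameR[OF S, of yDeg] RA0 by simp
 have r0: "\<exists>rows. \<forall>r. chain nx 0 (rows r) & (\<forall>p\<in>set (rows r). p < Suc 0) & rows r = []" for nx
  by (rule exI[of _ "%_. []"]) simp
 show ?case
 proof (rule ht_for[where n = m and I = "%k h'. same ltN {yDeg} h h' & clk h' <= clk h + 4 + tE * k &
  rep h' (pairs (k * q * q)) & NA h' vP 0 = 3 + 2 * k & NA h' vR2 0 = 3 + 2 * m + k * q * q &
  (\<forall>i. RA h' yDeg i = real (degc k i))"], goal_cases)
  case 2
  then show ?case using c hd dg r0 by (simp add: cfg_def rep_def degc_def)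
 next
  case (3 k h')
  then have "cfg h'" using cfg_same[OF c, of ltN "{yDeg}" h'] by simp
  then show ?case by (simp add: cfg_def)
 next
  case (4 k h')
  then have S': "same ltN {yDeg} h h'" by simp
  have c': "cfg h'" using cfg_same[OF c S'] by simp
  have U': "same UNIV UNIV h0 h'" by (rule same_trans'[OF U S']) auto
  have raw: "raw h' (3 + 2 * k) = ei k" "raw h' (4 + 2 * k) = ej k" using re[OF 4(1)] sameraw[OF U'] by auto
  have bnd: "4 + 2 * k <= bnd h'" using bnd0 samebnd[OF U'] 4(1) n0 by simp
  show ?case
  proof (intro ht_seq ht_nst ht_rst, goal_cases)
  case 6
  have ne: "ei k = ej k ==> x + 1 + 1 = x + 2" for x :: real by simp
  define h2 where "h2 = tick (rset yDeg (ej k) (RA (rset yDeg (ei k) (RA h' yDeg (ei k) + 1) h') yDeg (ej k) + 1) (tick (rset yDeg (ei k) (RA h' yDeg (ei k) + 1) (tick (nset vP 0 (5 + 2 * k) (tick (nset vHi 0 (ej k) (tick (nset vLo 0 (ei k) (tick h'))))))))))"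
  have S2: "same ltN {yDeg} h h2" using S' by (simp add: h2_def)
  have U2: "same UNIV UNIV h0 h2" by (rule same_trans'[OF U S2]) auto
  have rp2: "rep h2 (pairs (k * q * q))" and c2: "cfg h2" using 4 c' by (simp_all add: h2_def)
  have dg2: "RA h2 yDeg i = real (degc (Suc k) i)" for i
  using 4 by (auto simp: h2_def degc_Suc)
  have v2: "NA h2 vLo 0 = ei k" "NA h2 vHi 0 = ej k" "NA h2 vR2 0 = 3 + 2 * m + k * q * q" "NA h2 vP 0 = 3 + 2 * Suc k"
  "NA h2 vR 0 = k" "clk h2 = clk h' + 6"
  using 4 by (simp_all add: h2_def)
  have "ht (for_loop vLen (nv vQ) (for_loop vH (nv vQ)
  (nset0 vT (NAdd (nld vRb (nv vLo)) (nv vLen)) ;; nset0 vT1 (NAdd (nld vRb (nv vHi)) (nv vH)) ;;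
  Cond (NLess (NConst 0) (rawld (nv vR2))) (push vT vT1 ;; push vT1 vT) Skip ;;
  nset0 vR2 (NAdd (nv vR2) (NConst 1))))) h2 (%h'. NA h' vR 0 = k & same ltN {yDeg} h (tick (nset vR 0 (Suc k) h')) &
  clk (tick (nset vR 0 (Suc k) h')) <= clk h + 4 + tE * Suc k &
  rep (tick (nset vR 0 (Suc k) h')) (pairs (Suc k * q * q)) & NA (tick (nset vR 0 (Suc k) h')) vP 0 = 3 + 2 * Suc k &
  NA (tick (nset vR 0 (Suc k) h')) vR2 0 = 3 + 2 * m + Suc k * q * q &
  (\<forall>i. RA (tick (nset vR 0 (Suc k) h')) yDeg i = real (degc (Suc k) i)))"
  proof (rule ht_table[OF rp2 c2 4(1) v2(1-3) U2], goal_cases)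
  case (1 h3)
  have "same ltN {yDeg} h h3" by (rule same_trans'[OF S2 1(1)]) auto
  then show ?case using 1 v2 4 dg2 sameN[OF 1(1)] sameR[OF 1(1)] by (auto simp: tE_def)
  qed
  then show ?case using raw bnd 4 by (simp add: h2_def)
  qed auto
 next
  case (5 h')
  then show ?case by (intro post) (auto simp: tTab_def tE_def algebra_simps)
 qed auto
qed auto

text \<open>\<open>Kn\<close> is a power of two and at least every \<open>evf i\<close>, so the
  quotient of \<open>Kn\<close> by a nonzero weight is a natural number; this makes
  \<open>St\<close> integral. An isolated vertex has weight 0.\<close>

definition evf :: "nat => real" where "evf i = (if degc m i = 0 then 0 else 2 ^ lg4 (degc m i))"
definition Kn :: nat where "Kn = 2 ^ lg4 ((2 * m) * (2 * m))"

definition weights :: prog where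
 "weights =
  sqrt_pow2 (RMul (RAdd (rv xM) (rv xM)) (RAdd (rv xM) (rv xM))) ;; rset0 xK (rv xS) ;;
  for_loop vI (nv vN)
  (Cond (RLess (Rc 0) (rld yDeg (nv vI))) (sqrt_pow2 (rld yDeg (nv vI))) (rset0 xS (Rc 0)) ;;
  vmap vR (nv vQ) yE (nld vRb (nv vI)) (rv xS) ;;
  vmap vR (nv vQ) yA (nld vRb (nv vI)) (RDiv (rv xK) (rv xS)))"

abbreviation "wtR == {xS, xK, yE, yA}"

lemma ht_weights:
 assumes c: "cfg h" and dg: "!!i. RA h yDeg i = real (degc m i)" and M: "RA h xM 0 = real m"
  and post: "!!h'. same {vI, vR} wtR h h' ==> clk h' <= clk h + 8 * m + n * (6 * q + 10) + 6 ==> RA h' xK 0 = real Kn ==>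
  (!!r. r < n * q ==> RA h' yE r = evf (r div q) & RA h' yA r = real Kn / evf (r div q)) ==> Q h'"
 shows "ht weights h Q"
 unfolding weights_def
proof (rule ht_seq, rule ht_sqrt_pow2[where g = "(2 * m) * (2 * m)"], goal_cases)
 case (1 h')
 then show ?case using M sameR[OF 1, of xM] by simp
next
 case (2 h1)
 show ?case
 proof (intro ht_seq ht_rst, goal_cases)
  case 2
  define h2 where "h2 = tick (rset xK 0 (real Kn) h1)"
  have S2: "same {vI, vR} wtR h h2" unfolding h2_def using same_weaken[OF \<open>same {} {xS} h h1\<close>, of "{vI, vR}" wtR] by simp
  have K2: "RA h2 xK 0 = real Kn" by (simp add: h2_def)
  have k2: "clk h2 <= clk h + 4 * m + 3" using \<open>clk h1 = _\<close> lg4_square_le[of "2 * m"] by (simp add: h2_def)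
  have "ht (for_loop vI (nv vN)
  (Cond (RLess (Rc 0) (rld yDeg (nv vI))) (sqrt_pow2 (rld yDeg (nv vI))) (rset0 xS (Rc 0)) ;;
  vmap vR (nv vQ) yE (nld vRb (nv vI)) (rv xS) ;;
  vmap vR (nv vQ) yA (nld vRb (nv vI)) (RDiv (rv xK) (rv xS)))) h2 Q"
  proof (rule ht_for[where n = n and I = "%k h'. same {vI, vR} wtR h h' & RA h' xK 0 = real Kn &
  clk h' <= clk h2 + 1 + (\<Sum>i<k. 2 * degc m i) + k * (6 * q + 10) &
  (\<forall>r<k * q. RA h' yE r = evf (r div q) & RA h' yA r = real Kn / evf (r div q))"], goal_cases)
  case 2
  then show ?case using S2 K2 by simp
  next
  case (3 k h')
  then have "cfg h'" using cfg_same[OF c, of "{vI, vR}" wtR h'] by simp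
  then show ?case by (simp add: cfg_def)
  next
  case (4 k h')
  note h' = this
  then have S': "same {vI, vR} wtR h h'" by simp
  have c': "cfg h'" using cfg_same[OF c S'] by simp
  have dg': "RA h' yDeg i = real (degc m i)" for i using dg sameR[OF S', of yDeg] by simp
  have rb: "NA h' vRb k = k * q" "NA h' vQ 0 = q" using c' 4(1) by (auto simp: cfg_def)
  show ?case
  proof (rule ht_seq)
  have "ht (Cond (RLess (Rc 0) (rld yDeg (nv vI))) (sqrt_pow2 (rld yDeg (nv vI))) (rset0 xS (Rc 0))) (tick h')
  (%h3. same {} {xS} h' h3 & RA h3 xS 0 = evf k & clk h3 <= clk h' + 2 * degc m k + 4)"
  proof (rule ht_cond, goal_cases)
  case 1
  then have g: "0 < degc m k" using h' dg' by simp
  show ?case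
  proof (rule ht_sqrt_pow2[where g = "degc m k"], goal_cases)
  case (1 h3)
  then show ?case using h' dg' sameN[OF 1, of vI] sameR[OF 1, of yDeg] by simp
  next
  case (2 h3)
  then show ?case using g lg4_le_self[of "degc m k"] by (simp add: evf_def)
  qed
  next
  case 2
  then have g: "degc m k = 0" using h' dg' by simp
  then show ?case by (intro ht_rst) (auto simp: evf_def)
  qed
  then show "ht (Cond (RLess (Rc 0) (rld yDeg (nv vI))) (sqrt_pow2 (rld yDeg (nv vI))) (rset0 xS (Rc 0))) (tick h')
  (%h3. ht (vmap vR (nv vQ) yE (nld vRb (nv vI)) (rv xS) ;;
  vmap vR (nv vQ) yA (nld vRb (nv vI)) (RDiv (rv xK) (rv xS))) h3 (%h'. NA h' vI 0 = k & same {vI, vR} wtR h (tick (nset vI 0 (Suc k) h')) &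
  RA (tick (nset vI 0 (Suc k) h')) xK 0 = real Kn &
  clk (tick (nset vI 0 (Suc k) h')) <= clk h2 + 1 + (\<Sum>i<Suc k. 2 * degc m i) + Suc k * (6 * q + 10) &
  (\<forall>r<Suc k * q. RA (tick (nset vI 0 (Suc k) h')) yE r = evf (r div q) & RA (tick (nset vI 0 (Suc k) h')) yA r = real Kn / evf (r div q))))"
  proof (rule ht_mono)
  fix h3 assume h3: "same {} {xS} h' h3 & RA h3 xS 0 = evf k & clk h3 <= clk h' + 2 * degc m k + 4"
  then have S3: "same {} {xS} h' h3" by simp
  show "ht (vmap vR (nv vQ) yE (nld vRb (nv vI)) (rv xS) ;;
  vmap vR (nv vQ) yA (nld vRb (nv vI)) (RDiv (rv xK) (rv xS))) h3 (%h'. NA h' vI 0 = k & same {vI, vR} wtR h (tick (nset vI 0 (Suc k) h')) &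
  RA (tick (nset vI 0 (Suc k) h')) xK 0 = real Kn &
  clk (tick (nset vI 0 (Suc k) h')) <= clk h2 + 1 + (\<Sum>i<Suc k. 2 * degc m i) + Suc k * (6 * q + 10) &
  (\<forall>r<Suc k * q. RA (tick (nset vI 0 (Suc k) h')) yE r = evf (r div q) & RA (tick (nset vI 0 (Suc k) h')) yA r = real Kn / evf (r div q)))"
  proof (rule ht_seq, rule ht_vmap[where n = q and ?b0.0 = "k * q" and f = "%_. evf k"], goal_cases)
  case (3 j h4)
  then show ?case using h' h3 rb sameN[OF S3] sameN[OF 3(2)] sameR[OF 3(2)] by auto
  next
  case (4 h4)
  note h4 = this
  have K4: "RA h4 xK 0 = real Kn" using h' sameR[OF S3, of xK] sameR[OF h4(1), of xK] by simp
  have X4: "RA h4 xS 0 = evf k" using h3 sameR[OF h4(1), of xS] by simp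
  have N4: "NA h4 vI 0 = k" "NA h4 vQ 0 = q" "NA h4 vRb k = k * q"
  using h' rb sameN[OF S3] sameN[OF h4(1)] by auto
  show ?case
  proof (rule ht_vmap[where n = q and ?b0.0 = "k * q" and f = "%_. real Kn / evf k"], goal_cases)
  case (3 j h5)
  then show ?case using N4 K4 X4 sameN[OF 3(2)] sameR[OF 3(2)] by auto
  next
  case (4 h5)
  note h5 = this
  have S5: "same {vI, vR} wtR h h5"
  by (rule same_trans'[OF same_trans'[OF same_trans'[OF S' S3] h4(1)] h5(1)]) auto
  have "RA h5 yE r = evf (r div q) & RA h5 yA r = real Kn / evf (r div q)" if r: "r < Suc k * q" for r
  proof (cases "r < k * q")
  case True
  then show ?thesis using h' h4(3) h5(3) sameR[OF S3] sameR[OF h5(1)] sameR[OF h4(1)] by auto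
  next
  case False
  have "r div q = k" by (rule div_nat_eqI) (use r False in \<open>auto simp: mult.commute\<close>)
  then show ?thesis using r False h4(3) h5(3) sameR[OF h5(1), of yE] by auto
  qed
  then show ?case using S5 N4 K4 h' h3 h4(2) h5(2) sameN[OF h5(1), of vI] sameR[OF h5(1), of xK] by simp
  qed auto
  qed auto
  qed
  qed
  next
  case (5 h')
  have "(\<Sum>i<n. 2 * degc m i) = 4 * m" using sum_degc by (simp add: sum_distrib_left[symmetric])
  then show ?case using 5 k2 by (intro post) (auto simp: algebra_simps)
  qed auto
  then show ?case using \<open>RA h1 xS 0 = _\<close> by (simp add: h2_def Kn_def)
 qed auto
qed

end

lemma lg4_mono: "g <= g' ==> lg4 g <= lg4 g'"
 unfolding lg4_def[of g] using lg4_le[of g'] by (intro Least_le) linarith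

context csp_input
begin

text \<open>The constants come from kappa <= 2 q^2/eps: then 1 + sqrt(128 kappa/eps) <= 17 q/eps,
  and 11 kappa (q + kappa)/eps^2 <= 11 * 2 * 3 q^4/eps^4.\<close>

definition prepare :: prog where
 "prepare = load_counts ;; load_tables ;; weights ;;
  rset0 xQK (RMul (rv xQ) (RMul (rv xK) (rv xK))) ;;
  rset0 xKap (RAdd (rv xQ) (RDiv (RMul (rv xQ) (rv xQ)) (rv xEps))) ;;
  rset0 xEta (RDiv (rv xEps) (RAdd (rv xQ) (rv xKap))) ;;
  count_to vLam (RDiv (RMul (Rc 17) (rv xQ)) (rv xEps)) ;;
  count_to vFW (RDiv (RMul (Rc 66) (RMul (RMul (rv xQ) (rv xQ)) (RMul (rv xQ) (rv xQ))))
  (RMul (RMul (rv xEps) (rv xEps)) (RMul (rv xEps) (rv xEps))))"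

abbreviation "stN == {vN, vM, vQ, vD, vRb, vI, vCol, vNxt, vHead, vCnt, vR, vP, vR2, vLo, vHi, vLen, vH, vT, vT1, vLam, vFW}"
abbreviation "stR == {yDeg, xS, xK, yE, yA, xQK, xKap, xEta}"

definition kp :: real where "kp = real q + (real q)\<^sup>2 / eps"

definition ready :: "hst => nat => nat => bool" where
 "ready h lam TF \<longleftrightarrow> same stN stR h0 h & cfg h & rep h (pairs (m * q * q)) & RA h xK 0 = real Kn &
  (\<forall>r<n * q. RA h yE r = evf (r div q) & RA h yA r = real Kn / evf (r div q)) &
  RA h xQK 0 = real (q * Kn\<^sup>2) & RA h xKap 0 = kp & RA h xEta 0 = eps / (real q + kp) &
  NA h vLam 0 = lam & NA h vFW 0 = TF & 17 * real q / eps <= real lam & real lam < 17 * real q / eps + 1 &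
  66 * real q ^ 4 / eps ^ 4 <= real TF & real TF < 66 * real q ^ 4 / eps ^ 4 + 1"

lemma ht_prepare:
 assumes S: "same {vN} {} h0 h" and N: "NA h vN 0 = n"
  and post: "!!h' lam TF. clk h' <= clk h + tTab + 8 * m + n * (6 * q + 14) + 2 * lam + 2 * TF + 18 ==> ready h' lam TF ==> Q h'"
 shows "ht prepare h Q"
 unfolding prepare_def
proof (rule ht_seq, rule ht_load_counts[OF S N], goal_cases)
 case (1 h1)
 note h1 = this
 have S1: "same stN stR h0 h1" by (rule same_trans'[OF same_weaken[OF S] h1(1)]) auto
 have S1': "same (UNIV - {vHead}) (UNIV - {yDeg}) h0 h1" by (rule same_trans'[OF same_weaken[OF S] h1(1)]) auto
 show ?case
 proof (rule ht_seq, rule ht_load_tables[OF h1(2) S1'], goal_cases)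
  case (1 h2)
  note h2 = this
  have S2: "same stN stR h0 h2" by (rule same_trans'[OF S1 h2(1)]) auto
  have c2: "cfg h2" by (rule cfg_same[OF h1(2) h2(1)]) auto
  have M2: "RA h2 xM 0 = real m" using sameR[OF S2, of xM] RA0 by simp
  show ?case
  proof (rule ht_seq, rule ht_weights[OF c2 h2(4) M2], goal_cases)
  case (1 h3)
  note h3 = this
  have S3: "same stN stR h0 h3" by (rule same_trans'[OF S2 h3(1)]) auto
  have c3: "cfg h3" by (rule cfg_same[OF c2 h3(1)]) auto
  have r3: "rep h3 (pairs (m * q * q))" by (rule rep_cong[OF h2(3) h3(1)]) auto
  have cs: "RA h3 xQ 0 = real q" "RA h3 xEps 0 = eps" using sameR[OF S3, of xQ] sameR[OF S3, of xEps] RA0 by auto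
  show ?case
  proof (intro ht_seq ht_rst, goal_cases)
  case 4
  define h4 where "h4 = tick (rset xEta 0 (eps / (real q + kp)) (tick (rset xKap 0 kp (tick (rset xQK 0 (real (q * Kn\<^sup>2)) h3)))))"
  have S4: "same stN stR h0 h4" using S3 by (simp add: h4_def)
  have c4: "cfg h4" "rep h4 (pairs (m * q * q))" using c3 r3 by (simp_all add: h4_def)
  have v4: "RA h4 xEps 0 = eps" "RA h4 xQ 0 = real q" "RA h4 xK 0 = real Kn"
  "!!r. r < n * q ==> RA h4 yE r = evf (r div q) & RA h4 yA r = real Kn / evf (r div q)"
  "RA h4 xQK 0 = real (q * Kn\<^sup>2)" "RA h4 xKap 0 = kp" "RA h4 xEta 0 = eps / (real q + kp)"
  using cs h3(3,4) by (auto simp: h4_def)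
  have k4: "clk h4 = clk h3 + 3" by (simp add: h4_def)
  have "ht (count_to vLam (RDiv (RMul (Rc 17) (rv xQ)) (rv xEps))) h4 (%h'. ht (
  count_to vFW (RDiv (RMul (Rc 66) (RMul (RMul (rv xQ) (rv xQ)) (RMul (rv xQ) (rv xQ))))
  (RMul (RMul (rv xEps) (rv xEps)) (RMul (rv xEps) (rv xEps))))) h' Q)"
  proof (rule ht_count_to[where X = "17 * real q / eps"], goal_cases)
  case (3 h')
  then show ?case using v4 sameR[OF 3, of xQ] sameR[OF 3, of xEps] by simp
  next
  case (4 h5 lam)
  note h5 = this
  show ?case
  proof (rule ht_count_to[where X = "66 * real q ^ 4 / eps ^ 4"], goal_cases)
  case (3 h')
  then show ?case using v4 sameR[OF 3, of xQ] sameR[OF 3, of xEps] sameR[OF h5(1), of xQ] sameR[OF h5(1), of xEps]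
  by (simp add: power4_eq_xxxx mult_ac)
  next
  case (4 h6 TF)
  note h6 = this
  have S56: "same {vLam, vFW} {} h4 h6"
  by (rule same_trans'[OF same_weaken[OF h5(1)] h6(1)]) auto
  have S6: "same stN stR h0 h6" by (rule same_trans'[OF S4 S56]) auto
  have RR: "RA h6 = RA h4" using sameR[OF S56] by auto
  show ?case
  proof (rule post)
  show "ready h6 lam TF"
  unfolding ready_def RR
  using S6 cfg_same[OF c4(1) S56] rep_cong[OF c4(2) S56] v4 h5(2,3,4) h6(2,3,4) sameN[OF h6(1), of vLam] by auto
  show "clk h6 <= clk h + tTab + 8 * m + n * (6 * q + 14) + 2 * lam + 2 * TF + 18"
  using h1(3) h2(2) h3(2) k4 h5(5) h6(5) by (simp add: algebra_simps)
  qed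
  qed (use eps in auto)
  qed (use eps in auto)
  then show ?case using cs h3(3) by (simp add: h4_def kp_def power2_eq_square mult_ac)
  qed auto
  qed
 qed
qed

definition Mq :: "nat => nat => nat" where "Mq r c = of_bool ((r, c) \<in> set (pairs (m * q * q)))"

lemma set_pairs: "set (pairs p) = {x. \<exists>p'<p. 0 < tb p' & (x = pair p' \<or> x = prod.swap (pair p'))}"
 by (induction p) (auto simp: less_Suc_eq)

lemma pair_components:
 "fst (pair p) div q = ei (p div (q * q))" "snd (pair p) div q = ej (p div (q * q))"
 "fst (pair p) mod q = p div q mod q" "snd (pair p) mod q = p mod q"
 using q0 by (simp_all add: pair_def)

lemma index_div: "p < m * q * q ==> p div (q * q) < m"
 using q0 by (simp add: less_mult_imp_div_less mult.assoc)

lemma index_decomp: "p = (p div (q * q) * q + p div q mod q) * q + p mod (q::nat)"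
proof -
 have "p div (q * q) * q + p div q mod q = p div q" by (simp add: div_mult2_eq)
 then show ?thesis by simp
qed

end

section \<open>The matrix of the label-extended graph\<close>

locale csp_graph = csp_input +
 assumes lt: "!!t. t < m ==> ei t < ej t"
  and inj: "!!t t'. t < m ==> t' < m ==> ei t = ei t' ==> ej t = ej t' ==> t = t'"
begin

lemma pair_inj: "p < m * q * q ==> p' < m * q * q ==> pair p = pair p' ==> p = p'"
proof -
 assume a: "p < m * q * q" "p' < m * q * q" "pair p = pair p'"
 have "p div (q * q) = p' div (q * q)"
  using inj[OF index_div[OF a(1)] index_div[OF a(2)]] pair_components(1,2)[of p] pair_components(1,2)[of p'] a(3) by simp
 moreover have "p div q mod q = p' div q mod q" "p mod q = p' mod q"
  using pair_components(3,4)[of p] pair_components(3,4)[of p'] a(3) by simp_all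
 ultimately show "p = p'" using index_decomp[of p] index_decomp[of p'] by simp
qed

lemma pair_swap: "p < m * q * q ==> p' < m * q * q ==> pair p ~= prod.swap (pair p')"
proof
 assume a: "p < m * q * q" "p' < m * q * q" "pair p = prod.swap (pair p')"
 have "ei (p div (q * q)) = ej (p' div (q * q))" "ej (p div (q * q)) = ei (p' div (q * q))"
  using pair_components(1,2)[of p] pair_components(1,2)[of p'] a(3) by simp_all
 then show False using lt[OF index_div[OF a(1)]] lt[OF index_div[OF a(2)]] by simp
qed

text \<open>Edges are distinct and satisfy i < j, so two table positions never yield the same matrix
  position, nor mirrored ones. Hence the row lists are free of repetitions and their sums are
  products with a 0/1 matrix.\<close>

lemma distinct_pairs: "p <= m * q * q ==> distinct (pairs p)"
proof (induction p)
 case (Suc p)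
 have "pair p \<notin> set (pairs p)" "prod.swap (pair p) \<notin> set (pairs p)"
 proof -
  show "pair p \<notin> set (pairs p)"
  proof
  assume "pair p \<in> set (pairs p)"
  then obtain p' where "p' < p" "pair p = pair p' \<or> pair p = prod.swap (pair p')"
  unfolding set_pairs by blast
  then show False using Suc.prems pair_inj[of p p'] pair_swap[of p p'] by auto
  qed
  show "prod.swap (pair p) \<notin> set (pairs p)"
  proof
  assume "prod.swap (pair p) \<in> set (pairs p)"
  then obtain p' where "p' < p" "prod.swap (pair p) = pair p' \<or> prod.swap (pair p) = prod.swap (pair p')"
  unfolding set_pairs by blast
  moreover from this have "pair p = pair p' \<or> pair p' = prod.swap (pair p)" by (metis swap_swap)
  ultimately show False using Suc.prems pair_inj[of p p'] pair_swap[of p' p] by auto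
  qed
 qed
 then show ?case using Suc pair_swap[of p p] by auto
qed simp

lemma pair_bounds: "p < m * q * q ==> fst (pair p) < n * q & snd (pair p) < n * q"
proof -
 assume "p < m * q * q"
 then have e: "ei (p div (q * q)) < n & ej (p div (q * q)) < n" by (intro ee index_div)
 have "i * q + \<alpha> < n * q" if "i < n" "\<alpha> < q" for i \<alpha>
 proof -
  have "Suc i * q <= n * q" using that by (intro mult_le_mono1) simp
  then show ?thesis using that by simp
 qed
 then show ?thesis using e q0 by (simp add: pair_def)
qed

lemma Mq_sym: "Mq r c = Mq c r"
 unfolding Mq_def set_pairs by (simp add: prod.swap_def prod_eq_iff) (metis fst_conv snd_conv)

lemma Mq_iff: "Mq r c = 1 \<longleftrightarrow> (\<exists>p<m * q * q. 0 < tb p & ((r, c) = pair p \<or> (c, r) = pair p))"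
 unfolding Mq_def set_pairs by (auto simp: prod.swap_def prod_eq_iff)

lemma Mq_cases: "Mq r c = 0 \<or> Mq r c = 1" by (simp add: Mq_def)

lemma Mq_noself: "\<alpha> < q ==> \<beta> < q ==> Mq (i * q + \<alpha>) (i * q + \<beta>) = 0"
proof (rule ccontr)
 assume a: "\<alpha> < q" "\<beta> < q" "Mq (i * q + \<alpha>) (i * q + \<beta>) ~= 0"
 then have "Mq (i * q + \<alpha>) (i * q + \<beta>) = 1" using Mq_cases[of "i * q + \<alpha>" "i * q + \<beta>"] by linarith
 then obtain p where p: "p < m * q * q" "(i * q + \<alpha>, i * q + \<beta>) = pair p \<or> (i * q + \<beta>, i * q + \<alpha>) = pair p"
  unfolding Mq_iff by blast
 have "fst (pair p) div q = i & snd (pair p) div q = i"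
  using p(2)
 proof
  assume e: "(i * q + \<alpha>, i * q + \<beta>) = pair p"
  show ?thesis unfolding e[symmetric] using a by simp
 next
  assume e: "(i * q + \<beta>, i * q + \<alpha>) = pair p"
  show ?thesis unfolding e[symmetric] using a by simp
 qed
 then have "ei (p div (q * q)) = i" "ej (p div (q * q)) = i" using pair_components(1,2)[of p] by auto
 then show False using lt[OF index_div[OF p(1)]] by simp
qed

text \<open>The entries of a row lie in the blocks of the neighbours of its vertex, q columns in
  each.\<close>

lemma Mq_row: "(\<Sum>c<n * q. Mq r c) <= q * degc m (r div q)"
proof -
 define i where "i = r div q"
 define nb where "nb = (%t. (if ei t = i then (%\<beta>. ej t * q + \<beta>) ` {..<q} else {}) \<union> (if ej t = i then (%\<beta>. ei t * q + \<beta>) ` {..<q} else {}))"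
 have "(\<Sum>c<n * q. Mq r c) = card {c. c < n * q & Mq r c = 1}"
 proof -
  have "(\<Sum>c<n * q. Mq r c) = (\<Sum>c<n * q. if Mq r c = 1 then 1 else 0)"
  by (intro sum.cong refl) (use Mq_cases in auto)
  also have "... = card ({..<n * q} \<inter> {c. Mq r c = 1})" by (simp add: sum.If_cases)
  also have "{..<n * q} \<inter> {c. Mq r c = 1} = {c. c < n * q & Mq r c = 1}" by auto
  finally show ?thesis .
 qed
 also have "... <= card (\<Union>t\<in>{..<m}. nb t)"
 proof (rule card_mono)
  show "{c. c < n * q & Mq r c = 1} \<subseteq> (\<Union>t\<in>{..<m}. nb t)"
  proof
  fix c assume "c \<in> {c. c < n * q & Mq r c = 1}"
  then obtain p where p: "p < m * q * q" "(r, c) = pair p \<or> (c, r) = pair p" unfolding Mq_iff by blast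
  have ci': "c \<in> (%\<beta>. c div q * q + \<beta>) ` {..<q}"
  by (rule image_eqI[of _ _ "c mod q"]) (use q0 in auto)
  have "c \<in> nb (p div (q * q))"
  using p(2)
  proof
  assume a: "(r, c) = pair p"
  have e: "ei (p div (q * q)) = i" "ej (p div (q * q)) = c div q"
  using pair_components(1,2)[of p] unfolding a[symmetric] by (auto simp: i_def)
  show ?thesis using e ci' unfolding nb_def by simp
  next
  assume a: "(c, r) = pair p"
  have e: "ej (p div (q * q)) = i" "ei (p div (q * q)) = c div q"
  using pair_components(1,2)[of p] unfolding a[symmetric] by (auto simp: i_def)
  show ?thesis using e ci' unfolding nb_def by simp
  qed
  then show "c \<in> (\<Union>t\<in>{..<m}. nb t)" using index_div[OF p(1)] by blast
  qed
 qed (auto simp: nb_def)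
 also have "... <= (\<Sum>t<m. card (nb t))" by (rule card_UN_le) simp
 also have "... <= (\<Sum>t<m. q * (of_bool (ei t = i) + of_bool (ej t = i)))"
 proof (rule sum_mono)
  fix t
  have ci: "card ((%\<beta>. x + \<beta>) ` {..<q}) = q" for x :: nat by (simp add: card_image)
  have "card (nb t) <= card (if ei t = i then (%\<beta>. ej t * q + \<beta>) ` {..<q} else {}) + card (if ej t = i then (%\<beta>. ei t * q + \<beta>) ` {..<q} else {})"
  unfolding nb_def by (rule card_Un_le)
  also have "... = q * (of_bool (ei t = i) + of_bool (ej t = i))" using ci by auto
  finally show "card (nb t) <= q * (of_bool (ei t = i) + of_bool (ej t = i))" .
 qed
 also have "... = q * degc m i" unfolding degc_def sum_distrib_left ..
 finally show ?thesis by (simp add: i_def)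
qed

lemma degc_le: "degc m i <= 2 * m"
proof -
 have "degc m i <= (\<Sum>t<m. 2)" unfolding degc_def by (intro sum_mono) auto
 then show ?thesis by simp
qed

lemma evf_square: "real (degc m i) <= (evf i)\<^sup>2" "(evf i)\<^sup>2 <= 4 * real (degc m i)" "0 <= evf i"
proof -
 have sq: "((2::real) ^ j)\<^sup>2 = real (4 ^ j)" for j
  by (simp add: power_mult_distrib[symmetric] power2_eq_square)
 show "real (degc m i) <= (evf i)\<^sup>2"
  using lg4_le[of "degc m i"] unfolding evf_def by (simp only: sq split: if_splits) (simp only: of_nat_le_iff, simp)
 have "real (4 ^ lg4 (degc m i)) <= real (4 * degc m i)" if "0 < degc m i"
  using lg4_upper[OF that] by (simp only: of_nat_le_iff)
 then show "(evf i)\<^sup>2 <= 4 * real (degc m i)"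
  unfolding evf_def by (cases "degc m i = 0") (simp_all only: sq if_True if_False, auto)
qed (simp add: evf_def)

text \<open>The degrees sum to 2 m, and each squared weight is between the degree and four times the
  degree.\<close>

lemma evf_sum: "real m <= (\<Sum>i<n. (evf i)\<^sup>2)" "(\<Sum>i<n. (evf i)\<^sup>2) <= 8 * real m"
proof -
 have s: "(\<Sum>i<n. real (degc m i)) = 2 * real m" using sum_degc by (metis of_nat_mult of_nat_numeral of_nat_sum)
 have "(\<Sum>i<n. real (degc m i)) <= (\<Sum>i<n. (evf i)\<^sup>2)" by (intro sum_mono evf_square)
 then show "real m <= (\<Sum>i<n. (evf i)\<^sup>2)" using s by simp
 have "(\<Sum>i<n. (evf i)\<^sup>2) <= (\<Sum>i<n. 4 * real (degc m i))" by (intro sum_mono evf_square)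
 then show "(\<Sum>i<n. (evf i)\<^sup>2) <= 8 * real m" using s by (simp add: sum_distrib_left[symmetric])
qed

definition aq :: "nat => nat" where
 "aq r = (if degc m (r div q) = 0 then 0 else 2 ^ (lg4 ((2 * m) * (2 * m)) - lg4 (degc m (r div q))))"

lemma aq: "real (aq r) = real Kn / evf (r div q)" "aq r <= Kn"
proof -
 have "degc m (r div q) <= (2 * m) * (2 * m)" using degc_le[of "r div q"] m0 by (intro order_trans[OF degc_le]) simp
 then have "lg4 (degc m (r div q)) <= lg4 ((2 * m) * (2 * m))" by (rule lg4_mono)
 then have "(2::real) ^ (lg4 ((2 * m) * (2 * m)) - lg4 (degc m (r div q))) = 2 ^ lg4 ((2 * m) * (2 * m)) / 2 ^ lg4 (degc m (r div q))"
  by (intro power_diff) auto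
 then show "real (aq r) = real Kn / evf (r div q)" unfolding aq_def Kn_def evf_def by simp
 show "aq r <= Kn" unfolding aq_def Kn_def by (auto intro!: power_increasing)
qed

lemma Kn: "1 <= Kn" "Kn <= 2 ^ (2 * m)"
 unfolding Kn_def using lg4_square_le[of "2 * m"] by (auto intro!: power_increasing)

lemma rep_rows:
 assumes "rep h (pairs (m * q * q))"
 obtains rows where "!!r. chain (NA h vNxt) (NA h vHead r) (rows r)"
  "!!r f. (\<Sum>p\<leftarrow>rows r. f (NA h vCol p)) = mv (n * q) (%r c. real (Mq r c)) f r"
  "(\<Sum>r<n * q. length (rows r)) <= 2 * (m * q * q)"
proof -
 define S where "S = pairs (m * q * q)"
 from assms obtain rows where ch: "!!r. chain (NA h vNxt) (NA h vHead r) (rows r)"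
  and mp: "!!r. map (NA h vCol) (rows r) = map snd (filter (%x. fst x = r) S)"
  unfolding rep_def S_def by blast
 have dS: "distinct S" unfolding S_def by (rule distinct_pairs) simp
 have bS: "fst x < n * q & snd x < n * q" if "x \<in> set S" for x
  using that pair_bounds unfolding S_def set_pairs by (auto simp: prod.swap_def)
 show thesis
 proof (rule that[OF ch])
  fix r and f :: "nat => real"
  have "(\<Sum>p\<leftarrow>rows r. f (NA h vCol p)) = sum_list (map f (map (NA h vCol) (rows r)))" by (simp add: comp_def)
  also have "... = (\<Sum>x\<leftarrow>filter (%x. fst x = r) S. f (snd x))" unfolding mp by (simp add: comp_def)
  also have "... = (\<Sum>x\<in>{x \<in> set S. fst x = r}. f (snd x))"
  using dS by (simp add: sum_list_distinct_conv_sum_set)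
  also have "... = (\<Sum>c\<in>{c. c < n * q & (r, c) \<in> set S}. f c)"
  by (rule sum.reindex_bij_witness[where i = "%c. (r, c)" and j = snd]) (use bS in auto)
  also have "... = (\<Sum>c<n * q. real (Mq r c) * f c)"
  by (rule sum.mono_neutral_cong_left) (auto simp: Mq_def S_def)
  finally show "(\<Sum>p\<leftarrow>rows r. f (NA h vCol p)) = mv (n * q) (%r c. real (Mq r c)) f r" by (simp add: mv_def)
 next
  have "length (rows r) = length (filter (%x. fst x = r) S)" for r using mp[of r] by (metis length_map)
  then have "(\<Sum>r<n * q. length (rows r)) = (\<Sum>r<n * q. length (filter (%x. fst x = r) S))" by simp
  also have "... <= length S"
  proof -
  have "(\<Sum>r<N. length (filter (%x. fst x = r) S)) = length (filter (%x. fst x < N) S)" for N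
  proof (induction S)
  case (Cons x S)
  have "(\<Sum>r<N. length (filter (%y. fst y = r) (x # S))) = (\<Sum>r<N. of_bool (fst x = r) + length (filter (%y. fst y = r) S))"
  by (intro sum.cong refl) auto
  also have "... = of_bool (fst x < N) + (\<Sum>r<N. length (filter (%y. fst y = r) S))"
  by (simp add: sum.distrib of_bool_def)
  finally show ?case using Cons by simp
  qed simp
  then show ?thesis by simp
  qed
  also have "... <= 2 * (m * q * q)" unfolding S_def by (rule length_pairs)
  finally show "(\<Sum>r<n * q. length (rows r)) <= 2 * (m * q * q)" .
 qed
qed

end

section \<open>Running time\<close>

text \<open>Bounds linear in V, the input size, and polynomial in W. Coefficients and exponents
  combine by fixed formulas, even under sums, so the bound of a long expression is computed by rule
  application without comparing exponents. A product may take the factor V only once, hence one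
  factor in \<open>bd_mult\<close> is bounded with V = 1.\<close>

definition bd :: "real => real => real => real => nat => bool" where
 "bd V W x a p \<longleftrightarrow> 1 <= V & 1 <= W & 0 <= x & 0 <= a & x <= a * V * W ^ p"

lemma bd_add: "bd V W x a p ==> bd V W y b r ==> bd V W (x + y) (a + b) (p + r)"
proof -
 assume h: "bd V W x a p" "bd V W y b r"
 have "x <= a * V * W ^ (p + r)"
  using h by (intro order_trans[OF _ mult_left_mono[OF power_increasing[of p "p + r" W], of "a * V"]]) (auto simp: bd_def)
 moreover have "y <= b * V * W ^ (p + r)"
  using h by (intro order_trans[OF _ mult_left_mono[OF power_increasing[of r "p + r" W], of "b * V"]]) (auto simp: bd_def)
 ultimately show ?thesis using h by (simp add: bd_def algebra_simps)
qed

lemma bd_mult: "bd 1 W x a p ==> bd V W y b r ==> bd V W (x * y) (a * b) (p + r)"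
proof -
 assume h: "bd 1 W x a p" "bd V W y b r"
 have "x * y <= (a * 1 * W ^ p) * (b * V * W ^ r)" using h by (intro mult_mono) (auto simp: bd_def)
 then show ?thesis using h by (simp add: bd_def power_add mult_ac)
qed

lemma bd_mult': "bd V W x a p ==> bd 1 W y b r ==> bd V W (x * y) (a * b) (p + r)"
 using bd_mult[of W y b r V x a p] by (simp add: mult_ac add_ac)

lemma bd_num: "1 <= V ==> 1 <= W ==> bd V W (numeral c) (numeral c) 0"
proof -
 assume "1 <= V" "1 <= W"
 moreover from this have "numeral c * 1 <= numeral c * V" by (intro mult_left_mono) auto
 ultimately show ?thesis by (simp add: bd_def)
qed

lemma bd_one: "1 <= V ==> 1 <= W ==> bd V W 1 1 0"
 by (simp add: bd_def)

lemma bd_atom: "1 <= V ==> 1 <= W ==> real x <= a * W ^ p ==> 0 <= a ==> bd V W (real x) a p"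
proof -
 assume h: "1 <= V" "1 <= W" "real x <= a * W ^ p" "0 <= a"
 then have "a * W ^ p * 1 <= a * W ^ p * V" by (intro mult_left_mono) auto
 then show ?thesis using h by (simp add: bd_def mult_ac)
qed

lemma bd_atomN: "1 <= V ==> 1 <= W ==> real x <= a * V * W ^ p ==> 0 <= a ==> bd V W (real x) a p"
 by (simp add: bd_def)

text \<open>Only n, m, d and nnz may grow with N; all other quantities are polynomial in W, with the
  degrees that \<open>parameters\<close> establishes.\<close>

definition size_ok :: "real => real => nat => nat => nat => nat => nat => nat => nat => nat => nat => nat => nat => nat => nat => nat => bool" where
 "size_ok N W n m q k J jm P w1 lg d nnz TF lam jd \<longleftrightarrow>
  1 <= N & 1 <= W & real n <= 1 * N * W ^ 0 & real m <= 1 * N * W ^ 0 & real q <= 1 * W ^ 1 & real k <= 1 * W ^ 1 & real J <= 1 * W ^ 1 &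
  real jm <= 48 * W ^ 5 & real P <= 48 * W ^ 5 & real w1 <= 18 * W ^ 2 & real lg <= 6 * W ^ 2 & real d <= 1 * N * W ^ 1 &
  real nnz <= 2 * N * W ^ 2 & real TF <= 67 * W ^ 8 & real lam <= 18 * W ^ 2 & real jd <= 34 * W ^ 5"

definition trace_time :: "nat => nat => nat => nat => nat" where
 "trace_time P w1 d nnz = (2 * P + 2) * ((3 * nnz + 16 * d + 16) + 2) + 6 * ((2 * P + 1) * w1) * (d + 1)"

definition search_time :: "nat => nat => nat => nat => nat => nat => nat => nat" where
 "search_time k jm P w1 lg d nnz = (k + 1) * ((5 * jm + 6 * d + 30 + trace_time P w1 d nnz + (k + 1) *
  ((lg + 1) * (2 * trace_time P w1 d nnz + 2 * lg + 20) +
  ((2 * P + 2) * ((3 * nnz + 16 * d + 16) + 2) + (Suc k + 8) * (3 * d + 6) + 2 * ((2 * P + 1) * w1) + 30) + trace_time P w1 d nnz + 5)) + 5) + 5"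

definition net_time :: "nat => nat => nat => nat => nat => nat => nat => nat => nat" where
 "net_time n q J d nnz TF jd C = 2 * jd + 9 * J + 20 + C *
  ((TF * ((3 * nnz + 9 * d + J * (6 * d + 9) + n * (4 * q + 6) + 20) + 2) + 3 * d + 3 * n + 10) +
  6 * nnz + n * (13 * q + 17) + 9 * d + 3 * J + 20 + 4 * J + 10)"

definition frame_time :: "nat => nat => nat => nat" where
 "frame_time n m q = (2 * (3 + 2 * m + m * (q * q) + n) + 6) + (2 * n + 2) + 2 + (3 * n + 5)"

definition prepare_time :: "nat => nat => nat => nat => nat => nat" where
 "prepare_time n m q lam TF = (m * ((14 * q + 4) * q + 9) + 5) + 8 * m + n * (6 * q + 14) + 2 * lam + 2 * TF + 18"

lemma total_time_bound:
 "\<exists>a p. \<forall>N W n m q k J jm P w1 lg d nnz TF lam jd C. size_ok N W n m q k J jm P w1 lg d nnz TF lam jd --> real C <= 1 * W ^ 10 -->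
  bd N W (real (frame_time n m q + prepare_time n m q lam TF + search_time k jm P w1 lg d nnz + net_time n q J d nnz TF jd C)) a p"
 \<comment> \<open>Both witnesses remain schematic and are assembled by the rules for
   \<open>bd\<close> along the structure of the time expression.\<close>
 apply (rule exI, rule exI)
 apply (intro allI impI)
 apply (unfold size_ok_def frame_time_def prepare_time_def search_time_def net_time_def trace_time_def
  of_nat_add of_nat_mult of_nat_numeral of_nat_1 of_nat_Suc)
 apply (elim conjE)
 apply (rule bd_add
  | (rule bd_mult', rule bd_atomN, assumption, assumption, assumption, rule zero_le_one zero_le_numeral)
  | rule bd_mult
  | (rule bd_num bd_one, assumption, assumption)
  | (rule bd_num bd_one, rule order_refl, assumption)
  | (rule bd_atomN, assumption, assumption, assumption, rule zero_le_one zero_le_numeral)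
  | (rule bd_atom, assumption, assumption, assumption, rule zero_le_one zero_le_numeral)
  | (rule bd_atom, rule order_refl, assumption, assumption, rule zero_le_one zero_le_numeral))+
 done

section \<open>Correctness\<close>

lemma concat_uniform:
 assumes "!!xs. xs \<in> set xss ==> length xs = L"
 shows "length (concat xss) = length xss * L"
  and "t < length xss ==> b < L ==> concat xss ! (t * L + b) = xss ! t ! b"
proof -
 show "length (concat xss) = length xss * L" using assms by (induction xss) auto
 show "t < length xss ==> b < L ==> concat xss ! (t * L + b) = xss ! t ! b"
  using assms
 proof (induction xss arbitrary: t)
  case (Cons xs xss)
  have l: "length xs = L" using Cons.prems by simp
  show ?case
  proof (cases t)
  case 0
  then show ?thesis using Cons.prems l by (simp add: nth_append)
  next
  case (Suc t')
  have "concat (xs # xss) ! (t * L + b) = concat xss ! (t' * L + b)"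
  using Suc l by (simp add: nth_append)
  then show ?thesis using Cons Suc by auto
  qed
 qed simp
qed

locale csp_problem =
 fixes n q :: nat and E :: "(nat \<times> nat) set" and \<phi> :: "nat => nat => nat => nat => bool" and es :: "(nat \<times> nat) list" and eps :: real
 assumes eps: "0 < eps" "eps < 1" and n1: "1 <= n" and q1: "1 <= q"
  and G: "simple_graph n E" and pred: "edge_predicates q E \<phi>" and es: "edge_listing E es"
begin

definition m :: nat where "m = length es"
definition ei :: "nat => nat" where "ei t = fst (es ! t)"
definition ej :: "nat => nat" where "ej t = snd (es ! t)"
definition tb :: "nat => nat" where
 "tb p = of_bool (\<phi> (ei (p div (q * q))) (ej (p div (q * q))) (p div q mod q) (p mod q))"
definition hb :: hst where "hb = boot_state n m q (input_list n q es \<phi>) eps"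

lemma m_card: "m = card (edges E)"
 using es unfolding m_def edge_listing_def by (metis distinct_card)

lemma edge: "t < m ==> (ei t, ej t) \<in> edges E"
 using es unfolding edge_listing_def m_def ei_def ej_def by (metis nth_mem prod.collapse)

lemma edge_props: "(i, j) \<in> edges E ==> (i, j) \<in> E & i < j & i < n & j < n"
 using G by (auto simp: edges_def simple_graph_def)

lemma edge_index: "(i, j) \<in> edges E ==> \<exists>t<m. ei t = i & ej t = j"
 using es unfolding edge_listing_def m_def ei_def ej_def by (metis fst_conv in_set_conv_nth snd_conv)

lemma tables: "input_list n q es \<phi> = [n, m, q] @ concat (map (%(i, j). [i, j]) es) @ concat (map (%(i, j).
  concat (map (%\<alpha>. map (%\<beta>. of_bool (\<phi> i j \<alpha> \<beta>)) [0..<q]) [0..<q])) es)"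
 by (simp add: input_list_def m_def)

lemma len_edges: "length (concat (map (%(i, j). [i, j]) es)) = 2 * m"
 by (subst concat_uniform(1)[where L = 2]) (auto simp: m_def)

lemma len_table: "length (concat (map (%\<alpha>. map (%\<beta>. of_bool (\<phi> i j \<alpha> \<beta>) :: nat) [0..<q]) [0..<q])) = q * q"
 by (subst concat_uniform(1)[where L = q]) auto

lemma len_tables: "length (concat (map (%(i, j).
  concat (map (%\<alpha>. map (%\<beta>. of_bool (\<phi> i j \<alpha> \<beta>) :: nat) [0..<q]) [0..<q])) es)) = m * (q * q)"
 by (subst concat_uniform(1)[where L = "q * q"]) (auto simp: m_def len_table simp del: length_concat)

lemma table_entry:
 assumes p: "p < m * q * q"
 shows "concat (map (%(i, j). concat (map (%\<alpha>. map (%\<beta>. of_bool (\<phi> i j \<alpha> \<beta>) :: nat) [0..<q]) [0..<q])) es) ! p = tb p"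
proof -
 define t where "t = p div (q * q)"
 have t: "t < m" using p q1 by (simp add: t_def less_mult_imp_div_less mult.assoc)
 have b: "p mod (q * q) < q * q" using q1 by simp
 have "concat (map (%(i, j). concat (map (%\<alpha>. map (%\<beta>. of_bool (\<phi> i j \<alpha> \<beta>) :: nat) [0..<q]) [0..<q])) es) ! (t * (q * q) + p mod (q * q))
  = map (%(i, j). concat (map (%\<alpha>. map (%\<beta>. of_bool (\<phi> i j \<alpha> \<beta>) :: nat) [0..<q]) [0..<q])) es ! t ! (p mod (q * q))"
  by (rule concat_uniform(2)) (use t b in \<open>auto simp: m_def len_table simp del: length_concat\<close>)
 also have "... = concat (map (%\<alpha>. map (%\<beta>. of_bool (\<phi> (ei t) (ej t) \<alpha> \<beta>) :: nat) [0..<q]) [0..<q]) ! (p mod (q * q))"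
  using t by (simp add: m_def ei_def ej_def case_prod_beta)
 finally have e1: "concat (map (%(i, j). concat (map (%\<alpha>. map (%\<beta>. of_bool (\<phi> i j \<alpha> \<beta>) :: nat) [0..<q]) [0..<q])) es) ! (t * (q * q) + p mod (q * q))
  = concat (map (%\<alpha>. map (%\<beta>. of_bool (\<phi> (ei t) (ej t) \<alpha> \<beta>) :: nat) [0..<q]) [0..<q]) ! (p mod (q * q))" .
 have ix: "p mod (q * q) = p div q mod q * q + p mod q" "t * (q * q) + p mod (q * q) = p"
  by (simp add: mod_mult2_eq, unfold t_def, rule div_mult_mod_eq)
 have "concat (map (%\<alpha>. map (%\<beta>. of_bool (\<phi> (ei t) (ej t) \<alpha> \<beta>) :: nat) [0..<q]) [0..<q]) ! (p div q mod q * q + p mod q)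
  = map (%\<alpha>. map (%\<beta>. of_bool (\<phi> (ei t) (ej t) \<alpha> \<beta>) :: nat) [0..<q]) [0..<q] ! (p div q mod q) ! (p mod q)"
  by (rule concat_uniform(2)) (use q1 in auto)
 also have "... = tb p" using q1 by (simp add: tb_def t_def)
 finally show ?thesis using e1 unfolding ix(2) unfolding ix(1) by simp
qed

lemma raw_hb:
 "raw hb 1 = m" "raw hb 2 = q" "t < m ==> raw hb (3 + 2 * t) = ei t & raw hb (4 + 2 * t) = ej t"
 "p < m * q * q ==> raw hb (3 + 2 * m + p) = tb p"
proof -
 define xs where "xs = concat (map (%(i, j). [i, j]) es)"
 define ys where "ys = concat (map (%(i, j). concat (map (%\<alpha>. map (%\<beta>. of_bool (\<phi> i j \<alpha> \<beta>) :: nat) [0..<q]) [0..<q])) es)"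
 have raw: "raw hb a = (if a < length ([n, m, q] @ xs @ ys) then ([n, m, q] @ xs @ ys) ! a else 0)" for a
  unfolding hb_def boot_state_def tables Let_def xs_def[symmetric] ys_def[symmetric] by simp
 have lx: "length xs = 2 * m" and ly: "length ys = m * (q * q)" by (simp_all only: xs_def ys_def len_edges len_tables)
 show "raw hb 1 = m" "raw hb 2 = q" unfolding raw by auto
 show "raw hb (3 + 2 * t) = ei t & raw hb (4 + 2 * t) = ej t" if t: "t < m"
 proof -
  have "xs ! (t * 2 + b) = map (%(i, j). [i, j]) es ! t ! b" if "b < 2" for b
  unfolding xs_def by (rule concat_uniform(2)) (use t that in \<open>auto simp: m_def\<close>)
  from this[of 0] this[of 1] have x: "xs ! (2 * t) = ei t" "xs ! Suc (2 * t) = ej t"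
  using t by (auto simp: m_def ei_def ej_def mult.commute case_prod_beta)
  have "([n, m, q] @ xs @ ys) ! (3 + a) = xs ! a" if "a < 2 * m" for a
  using that lx by (simp add: nth_append)
  from this[of "2 * t"] this[of "Suc (2 * t)"] x have y: "([n, m, q] @ xs @ ys) ! (3 + 2 * t) = ei t" "([n, m, q] @ xs @ ys) ! (4 + 2 * t) = ej t"
  using t by simp_all
  have "3 + 2 * t < length ([n, m, q] @ xs @ ys)" "4 + 2 * t < length ([n, m, q] @ xs @ ys)" using t lx by auto
  then show ?thesis unfolding raw y by simp
 qed
 show "raw hb (3 + 2 * m + p) = tb p" if p: "p < m * q * q"
 proof -
  have "([n, m, q] @ xs @ ys) ! (3 + (2 * m + p)) = ys ! p" using lx by (simp add: nth_append)
  also have "ys ! p = tb p" unfolding ys_def by (rule table_entry[OF p])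
  finally have y: "([n, m, q] @ xs @ ys) ! (3 + 2 * m + p) = tb p" by (simp add: add.assoc)
  have "3 + 2 * m + p < length ([n, m, q] @ xs @ ys)" using p lx ly by (simp add: mult.assoc)
  then show ?thesis unfolding raw y by simp
 qed
qed

lemma csp_graph: "0 < m ==> csp_graph hb n q m ei ej tb eps"
proof unfold_locales
 show "raw hb 1 = m" "raw hb 2 = q" by (rule raw_hb)+
 show "raw hb (3 + 2 * t) = ei t & raw hb (4 + 2 * t) = ej t" if "t < m" for t by (rule raw_hb(3)[OF that])
 show "raw hb (3 + 2 * m + p) = tb p" if "p < m * q * q" for p by (rule raw_hb(4)[OF that])
 show "bnd hb = 2 + 2 * m + m * q * q + n" "NA hb = (%_ _. 0)" "RA hb xEps 0 = eps" "RA hb xN 0 = real n" "RA hb xM 0 = real m"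
  "RA hb xQ 0 = real q" "!!i. RA hb yDeg i = 0" by (auto simp: hb_def boot_state_def Let_def)
 show "ei t < n & ej t < n" if "t < m" for t using edge_props[OF edge[OF that]] by simp
 show "0 < q" "0 < n" "0 < eps" using q1 n1 eps by auto
 show "ei t < ej t" if "t < m" for t using edge_props[OF edge[OF that]] by simp
 show "t = t'" if "t < m" "t' < m" "ei t = ei t'" "ej t = ej t'" for t t'
  using es that nth_eq_iff_index_eq[of es t t'] by (auto simp: edge_listing_def m_def ei_def ej_def prod_eq_iff)
qed

end

locale csp_nonempty = csp_problem + assumes m1: "0 < m"

sublocale csp_nonempty \<subseteq> csp_graph hb n q m ei ej tb eps
 by (rule csp_graph[OF m1])

context csp_nonempty
begin

abbreviation "d == n * q"

lemma E_sym: "(i, j) \<in> E ==> (j, i) \<in> E" using G by (auto simp: simple_graph_def dest: symD)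

lemma E_cases: "(i, j) \<in> E ==> (i, j) \<in> edges E \<or> (j, i) \<in> edges E"
 using G E_sym[of i j] by (cases "i < j"; cases "i = j") (auto simp: edges_def simple_graph_def irrefl_def)

lemma phi_sym: "(i, j) \<in> E ==> \<alpha> < q ==> \<beta> < q ==> \<phi> j i \<beta> \<alpha> = \<phi> i j \<alpha> \<beta>"
 using pred by (auto simp: edge_predicates_def)

lemma index_of: "t < m ==> \<alpha> < q ==> \<beta> < q ==> (t * q + \<alpha>) * q + \<beta> < m * q * q &
  pair ((t * q + \<alpha>) * q + \<beta>) = (ei t * q + \<alpha>, ej t * q + \<beta>) & tb ((t * q + \<alpha>) * q + \<beta>) = of_bool (\<phi> (ei t) (ej t) \<alpha> \<beta>)"
proof -
 assume a: "t < m" "\<alpha> < q" "\<beta> < q"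
 have "(t + 1) * q * q <= m * q * q" using a by (intro mult_le_mono1) simp
 then have "(t * q + \<alpha>) * q + \<beta> < m * q * q" using linear_index(1)[OF a(2,3), of t] by linarith
 then show ?thesis unfolding pair_def tb_def linear_index[OF a(2,3)] by simp
qed

text \<open>The input lists an edge once, with i < j; the mirrored matrix position is accounted for
  by the symmetry of the predicates.\<close>

lemma Mq_char: "Mq r c = of_bool ((r div q, c div q) \<in> E & \<phi> (r div q) (c div q) (r mod q) (c mod q))"
proof -
 have "Mq r c = 1 \<longleftrightarrow> (r div q, c div q) \<in> E & \<phi> (r div q) (c div q) (r mod q) (c mod q)"
 proof
  assume "Mq r c = 1"
  then obtain p where p: "p < m * q * q" "0 < tb p" "(r, c) = pair p \<or> (c, r) = pair p" unfolding Mq_iff by blast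
  have e: "(ei (p div (q * q)), ej (p div (q * q))) \<in> E" using edge_props[OF edge[OF index_div[OF p(1)]]] by simp
  have f: "\<phi> (ei (p div (q * q))) (ej (p div (q * q))) (p div q mod q) (p mod q)" using p(2) by (simp add: tb_def split: if_splits)
  show "(r div q, c div q) \<in> E & \<phi> (r div q) (c div q) (r mod q) (c mod q)"
  using p(3)
  proof
  assume a: "(r, c) = pair p"
  show ?thesis using e f pair_components[of p] unfolding a[symmetric] by simp
  next
  assume a: "(c, r) = pair p"
  show ?thesis using e f pair_components[of p] E_sym[OF e] phi_sym[OF e, of "p div q mod q" "p mod q"] q0 unfolding a[symmetric] by simp
  qed
 next
  assume a: "(r div q, c div q) \<in> E & \<phi> (r div q) (c div q) (r mod q) (c mod q)"
  have md: "r mod q < q" "c mod q < q" using q0 by auto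
  from a E_cases consider "(r div q, c div q) \<in> edges E" | "(c div q, r div q) \<in> edges E" by blast
  then show "Mq r c = 1"
  proof cases
  case 1
  then obtain t where t: "t < m" "ei t = r div q" "ej t = c div q" using edge_index by blast
  show ?thesis unfolding Mq_iff
  by (rule exI[of _ "(t * q + r mod q) * q + c mod q"]) (use index_of[OF t(1) md] a t in simp)
  next
  case 2
  then obtain t where t: "t < m" "ei t = c div q" "ej t = r div q" using edge_index by blast
  have "\<phi> (c div q) (r div q) (c mod q) (r mod q)" using a phi_sym[of "r div q" "c div q"] md by blast
  then show ?thesis unfolding Mq_iff
  by (intro exI[of _ "(t * q + c mod q) * q + r mod q"]) (use index_of[OF t(1) md(2,1)] t in simp)
  qed
 qed
 then show ?thesis using Mq_cases[of r c] by auto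
qed

lemma sum_edges: "(\<Sum>t<m. F (ei t) (ej t)) = (\<Sum>(i, j)\<in>edges E. F i j)"
proof -
 have "bij_betw ((!) es) {..<m} (edges E)"
  using es unfolding edge_listing_def m_def by (metis bij_betw_nth)
 then have "(\<Sum>e\<in>edges E. F (fst e) (snd e)) = (\<Sum>t<m. F (fst (es ! t)) (snd (es ! t)))"
  by (rule sum.reindex_bij_betw[symmetric])
 then show ?thesis by (simp add: ei_def ej_def case_prod_beta)
qed

lemma finE: "finite E" "finite (edges E)"
proof -
 show "finite E" using G finite_subset[of E "{..<n} \<times> {..<n}"] by (auto simp: simple_graph_def)
 then show "finite (edges E)" by (rule finite_subset[rotated]) (auto simp: edges_def)
qed

lemma sum_E: "(\<Sum>(i, j)\<in>E. F i j) = (\<Sum>(i, j)\<in>edges E. F i j + F j (i::nat) :: 'a::comm_monoid_add)"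
proof -
 have "E = edges E \<union> prod.swap ` edges E" using E_cases E_sym by (force simp: edges_def)
 moreover have "edges E \<inter> prod.swap ` edges E = {}" by (auto simp: edges_def)
 ultimately have "(\<Sum>(i, j)\<in>E. F i j) = (\<Sum>(i, j)\<in>edges E. F i j) + (\<Sum>(i, j)\<in>prod.swap ` edges E. F i j)"
  using finE(2) by (metis (no_types, lifting) finite_imageI sum.union_disjoint)
 also have "(\<Sum>(i, j)\<in>prod.swap ` edges E. F i j) = (\<Sum>(i, j)\<in>edges E. F j i)"
  by (subst sum.reindex) (auto simp: case_prod_beta)
 finally show ?thesis by (simp add: sum.distrib case_prod_beta)
qed

lemma degree: "vertex_degree E i = degc m i"
proof -
 have "vertex_degree E i = card {e \<in> E. fst e = i}"
  unfolding vertex_degree_def by (rule bij_betw_same_card[of "%j. (i, j)"]) (auto simp: bij_betw_def inj_on_def)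
 also have "... = (\<Sum>e\<in>E. of_bool (fst e = i))" using finE(1) by (simp add: of_bool_def sum.If_cases Int_def)
 also have "... = (\<Sum>(i', j)\<in>E. of_bool (i' = i))" by (simp add: case_prod_beta)
 also have "... = (\<Sum>(i', j)\<in>edges E. of_bool (i' = i) + of_bool (j = i))" by (rule sum_E)
 also have "... = degc m i" unfolding degc_def sum_edges[symmetric] ..
 finally show ?thesis .
qed

definition sd :: "nat => real" where "sd r = sqrt (real (degc m (r div q)))"

text \<open>The threshold rank refers to the true square roots \<open>sd\<close> of the degrees, not
  to the weights of the algorithm; at isolated vertices both sides use 1 / 0 = 0.\<close>

lemma normalized_eq: "normalized_label_extended n q E \<phi> = mat d d (%(r, c). scaled (%r c. real (Mq r c)) sd r c)"
proof -
 define S where "S = diag_inv_sqrt (kronecker (degree_mat n E) (1\<^sub>m q))"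
 define L where "L = label_extended n q E \<phi>"
 have Sd: "dim_row S = d" "dim_col S = d" by (simp_all add: S_def diag_inv_sqrt_def kronecker_def degree_mat_def)
 have Ld: "dim_row L = d" "dim_col L = d" by (simp_all add: L_def label_extended_def)
 have S: "S $$ (a, b) = (if a = b then 1 / sd a else 0)" if "a < d" "b < d" for a b
  using that q0 by (simp add: S_def diag_inv_sqrt_def kronecker_def degree_mat_def sd_def degree less_mult_imp_div_less)
 have L: "L $$ (a, b) = real (Mq a b)" if "a < d" "b < d" for a b
  using that by (simp add: L_def label_extended_def Mq_char)
 have SL: "(S * L) $$ (a, b) = real (Mq a b) / sd a" if "a < d" "b < d" for a b
 proof -
  have "(S * L) $$ (a, b) = (\<Sum>c = 0..<d. S $$ (a, c) * L $$ (c, b))"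
  using that Sd Ld by (simp add: scalar_prod_def)
  also have "... = (\<Sum>c = 0..<d. if c = a then real (Mq a b) / sd a else 0)"
  using that by (intro sum.cong refl) (auto simp: S L)
  finally show ?thesis using that by simp
 qed
 have SLS: "(S * L * S) $$ (a, b) = real (Mq a b) / sd a / sd b" if "a < d" "b < d" for a b
 proof -
  have "(S * L * S) $$ (a, b) = (\<Sum>c = 0..<d. (S * L) $$ (a, c) * S $$ (c, b))"
  using that Sd Ld by (simp add: scalar_prod_def)
  also have "... = (\<Sum>c = 0..<d. if c = b then real (Mq a b) / sd a / sd b else 0)"
  using that by (intro sum.cong refl) (auto simp: S SL)
  finally show ?thesis using that by simp
 qed
 have "normalized_label_extended n q E \<phi> = S * L * S"
  by (simp add: normalized_label_extended_def S_def L_def Let_def)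
 then show ?thesis using SLS Sd Ld by (intro eq_matI) (auto simp: scaled_def)
qed

text \<open>The quadratic form meets every edge in both orientations, hence the factor 2.\<close>

lemma csp_value_form:
 assumes x: "!!i. i < n ==> x i < q"
 shows "ip d (label_vec q x) (mv d (%r c. real (Mq r c)) (label_vec q x)) = 2 * real (csp_value E \<phi> x)"
proof -
 have blk: "(\<Sum>r<d. F r * label_vec q x r) = (\<Sum>i<n. F (i * q + x i))" for F :: "nat => real"
 proof -
  have "(\<Sum>r<d. F r * label_vec q x r) = (\<Sum>i<n. \<Sum>\<alpha><q. F (i * q + \<alpha>) * label_vec q x (i * q + \<alpha>))"
  proof -
  have "(\<Sum>i<n. sum (%r. F r * label_vec q x r) {i * q..<i * q + q}) = (\<Sum>r<n * q. F r * label_vec q x r)"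
  by (rule sum.nat_group)
  moreover have "sum (%r. F r * label_vec q x r) {i * q..<i * q + q} = (\<Sum>\<alpha><q. F (i * q + \<alpha>) * label_vec q x (i * q + \<alpha>))" for i
  by (rule sum.reindex_bij_witness[where i = "%\<alpha>. i * q + \<alpha>" and j = "%r. r - i * q"]) auto
  ultimately show ?thesis by simp
  qed
  also have "... = (\<Sum>i<n. F (i * q + x i))" using x by (intro sum.cong refl label_vec_sum) auto
  finally show ?thesis .
 qed
 have dv: "(i * q + x i) div q = i" if "i < n" for i using x[OF that] by simp
 define M' where "M' = (%r c. real (Mq r c))"
 have "ip d (label_vec q x) (mv d M' (label_vec q x)) = (\<Sum>r<d. mv d M' (label_vec q x) r * label_vec q x r)"
  by (simp add: ip_def mult.commute)
 also have "... = (\<Sum>i<n. \<Sum>j<n. M' (i * q + x i) (j * q + x j))" unfolding blk mv_def ..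
 also have "... = (\<Sum>i<n. \<Sum>j<n. if (i, j) \<in> E then of_bool (\<phi> i j (x i) (x j)) else 0)"
  by (intro sum.cong refl) (auto simp: M'_def Mq_char dv x)
 also have "... = (\<Sum>(i, j)\<in>{..<n} \<times> {..<n}. if (i, j) \<in> E then of_bool (\<phi> i j (x i) (x j)) else 0)"
  by (simp add: sum.cartesian_product)
 also have "... = (\<Sum>(i, j)\<in>E. of_bool (\<phi> i j (x i) (x j)))"
  by (rule sum.mono_neutral_cong_right) (use G in \<open>auto simp: simple_graph_def\<close>)
 also have "... = (\<Sum>(i, j)\<in>edges E. of_bool (\<phi> i j (x i) (x j)) + of_bool (\<phi> j i (x j) (x i)))"
  by (rule sum_E)
 also have "... = (\<Sum>(i, j)\<in>edges E. 2 * of_bool (\<phi> i j (x i) (x j)))"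
  using edge_props phi_sym x by (intro sum.cong refl) auto
 also have "... = 2 * real (csp_value E \<phi> x)"
  by (simp add: csp_value_def case_prod_beta sum_distrib_left)
 finally show ?thesis by (simp add: M'_def)
qed

text \<open>Every predicate is satisfiable, so each edge contributes a nonzero entry, and entries of
  different edges are different.\<close>

lemma sum_Mq: "real m <= (\<Sum>r<d. \<Sum>c<d. real (Mq r c))"
proof -
 have "\<forall>t. \<exists>p. t < m --> p < m * q * q & 0 < tb p & p div (q * q) = t"
 proof
  fix t
  show "\<exists>p. t < m --> p < m * q * q & 0 < tb p & p div (q * q) = t"
  proof (cases "t < m")
  case True
  then obtain \<alpha> \<beta> where ab: "\<alpha> < q" "\<beta> < q" "\<phi> (ei t) (ej t) \<alpha> \<beta>"
  using pred edge_props[OF edge[OF True]] unfolding edge_predicates_def by blast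
  show ?thesis
  by (rule exI[of _ "(t * q + \<alpha>) * q + \<beta>"]) (use index_of[OF True ab(1,2)] linear_index(2)[OF ab(1,2), of t] ab in simp)
  qed simp
 qed
 then obtain pt where pt: "!!t. t < m ==> pt t < m * q * q & 0 < tb (pt t) & pt t div (q * q) = t" by metis
 have inj: "inj_on (%t. pair (pt t)) {..<m}"
 proof (rule inj_onI)
  fix t t' assume a: "t \<in> {..<m}" "t' \<in> {..<m}" "pair (pt t) = pair (pt t')"
  then have "pt t = pt t'" using pt pair_inj[of "pt t" "pt t'"] by auto
  then show "t = t'" using pt a by (metis lessThan_iff)
 qed
 have "(%t. pair (pt t)) ` {..<m} \<subseteq> ({..<d} \<times> {..<d}) \<inter> {x. Mq (fst x) (snd x) = 1}"
 proof (rule image_subsetI)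
  fix t assume "t \<in> {..<m}"
  then have p: "pt t < m * q * q" "0 < tb (pt t)" using pt by auto
  have "Mq (fst (pair (pt t))) (snd (pair (pt t))) = 1" unfolding Mq_iff using p by auto
  then show "pair (pt t) \<in> ({..<d} \<times> {..<d}) \<inter> {x. Mq (fst x) (snd x) = 1}"
  using pair_bounds[OF p(1)] by (auto simp: mem_Times_iff)
 qed
 then have "card ((%t. pair (pt t)) ` {..<m}) <= card (({..<d} \<times> {..<d}) \<inter> {x. Mq (fst x) (snd x) = 1})"
  by (rule card_mono[rotated]) simp
 then have "m <= card (({..<d} \<times> {..<d}) \<inter> {x. Mq (fst x) (snd x) = 1})" using card_image[OF inj] by simp
 then have "real m <= (\<Sum>x\<in>({..<d} \<times> {..<d}) \<inter> {x. Mq (fst x) (snd x) = 1}. 1)" by simp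
 also have "... = (\<Sum>x\<in>({..<d} \<times> {..<d}) \<inter> {x. Mq (fst x) (snd x) = 1}. real (Mq (fst x) (snd x)))"
  by (intro sum.cong refl) auto
 also have "... <= (\<Sum>x\<in>{..<d} \<times> {..<d}. real (Mq (fst x) (snd x)))" by (rule sum_mono2) auto
 also have "... = (\<Sum>r<d. \<Sum>c<d. real (Mq r c))" by (simp add: sum.cartesian_product case_prod_beta)
 finally show ?thesis .
qed

end

section \<open>Parameters and their sizes\<close>

text \<open>The least exponent works: the power below it misses Y. The bound on the exponent uses ln
  2 >= 1/2.\<close>

lemma power2_between:
 fixes Y :: real
 assumes "1 <= Y"
 shows "\<exists>w. Y <= 2 ^ w & 2 ^ w <= 2 * Y & real w <= 2 * ln (2 * Y)"
proof -
 define w where "w = (LEAST w. Y <= 2 ^ w)"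
 obtain w0 where "Y < 2 ^ w0" using real_arch_pow[of 2 Y] by auto
 then have "Y <= 2 ^ w0" by simp
 then have w: "Y <= 2 ^ w" unfolding w_def by (rule LeastI)
 have u: "2 ^ w <= 2 * Y"
 proof (cases w)
  case (Suc w')
  then have "\<not> Y <= 2 ^ w'" using not_less_Least[of w' "%w. Y <= 2 ^ w"] by (simp add: w_def)
  then show ?thesis using Suc by simp
 qed (use assms in simp)
 have "ln (2 ^ w) <= ln (2 * Y)" using u assms by (subst ln_le_cancel_iff) auto
 then have "real w * ln 2 <= ln (2 * Y)" by (simp add: ln_realpow)
 moreover have "real w * (1 / 2) <= real w * ln 2" using ln_ge_iff[of 2 "1 / 2"] exp_half_le2 by (intro mult_left_mono) auto
 ultimately show ?thesis using w u by (intro exI[of _ w]) auto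
qed

context csp_nonempty
begin

abbreviation "nz == 2 * (m * q * q)"
abbreviation "Mr == %r c. real (Mq r c)"

lemma eps01: "0 < eps" "eps < 1"
 using csp_problem_axioms by (auto simp: csp_problem_def)

lemma kp_bounds: "kp <= 2 * (real q)\<^sup>2 / eps" "real q <= (real q)\<^sup>2 / eps" "0 <= kp"
proof -
 have "real q * 1 <= (real q)\<^sup>2" using q1 by (simp add: power2_eq_square)
 also have "(real q)\<^sup>2 * eps <= (real q)\<^sup>2 * 1" using eps01 by (intro mult_left_mono) auto
 then have "(real q)\<^sup>2 <= (real q)\<^sup>2 / eps" using eps by (simp add: le_divide_eq)
 finally show a: "real q <= (real q)\<^sup>2 / eps" by simp
 then show "kp <= 2 * (real q)\<^sup>2 / eps" by (simp add: kp_def)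
 show "0 <= kp" using eps by (simp add: kp_def)
qed

lemma solver_ready:
 fixes rows :: "nat => nat list"
 assumes rd: "ready h lam TF" and ch: "!!r. chain (NA h vNxt) (NA h vHead r) (rows r)"
  and rw: "!!r f. (\<Sum>p\<leftarrow>rows r. f (NA h vCol p)) = mv d Mr f r"
  and nn: "(\<Sum>r<d. length (rows r)) <= nz"
  and w1: "Kn\<^sup>2 * (d + q) <= 2 ^ w1" "d + 1 <= 2 ^ w1"
 shows "solver h n q d nz Mr rows aq Mq Kn w1 eps (%r. evf (r div q)) evf lam TF m kp"
proof -
 from rd have S: "same stN stR hb h" and cf: "cfg h" and yEA: "!!r. r < d ==> RA h yE r = evf (r div q) & RA h yA r = real Kn / evf (r div q)"
  and v: "RA h xK 0 = real Kn" "RA h xQK 0 = real (q * Kn\<^sup>2)" "RA h xKap 0 = kp" "RA h xEta 0 = eps / (real q + kp)"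
  "NA h vLam 0 = lam" "NA h vFW 0 = TF" and l: "17 * real q / eps <= real lam" and t: "66 * real q ^ 4 / eps ^ 4 <= real TF"
  unfolding ready_def by blast+
 have c: "NA h vN 0 = n" "NA h vQ 0 = q" "NA h vD 0 = d" "!!i. i < n ==> NA h vRb i = i * q" using cf by (auto simp: cfg_def)
 have R: "RA h xEps 0 = eps" "RA h xQ 0 = real q" "RA h xM 0 = real m"
  using sameR[OF S, of xEps] sameR[OF S, of xQ] sameR[OF S, of xM] RA0 by auto
 show ?thesis
 proof unfold_locales
  show "NA h vN 0 = n" "NA h vQ 0 = q" "NA h vD 0 = d" "!!i. i < n ==> NA h vRb i = i * q" by (fact c)+
  show "d = n * q" ..
  show "!!r. r < d ==> chain (NA h vNxt) (NA h vHead r) (rows r)" by (rule ch)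
  show "!!r f. r < d ==> (\<Sum>p\<leftarrow>rows r. f (NA h vCol p)) = mv d Mr f r" by (rule rw)
  show "(\<Sum>r<d. length (rows r)) <= nz" by (rule nn)
  show "!!r. r < d ==> RA h yA r = real (aq r)" using yEA aq(1) by simp
  show "!!r. r < d ==> aq r <= Kn" by (rule aq(2))
  show "!!r c. r < d ==> c < d ==> real (Mq r c) = real (Mq r c)" ..
  show "!!r c. r < d ==> c < d ==> Mq r c <= 1" by (simp add: Mq_def)
  show "RA h xEps 0 = eps" "RA h xQ 0 = real q" "RA h xM 0 = real m" by (fact R)+
  show "0 < eps" "0 < q" "0 < n" "eps < 1" using eps01 q1 n1 by auto
  show "RA h xK 0 = real Kn" "RA h xQK 0 = real (q * Kn\<^sup>2)" "RA h xKap 0 = kp" "RA h xEta 0 = eps / (real q + kp)"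
  "NA h vLam 0 = lam" "NA h vFW 0 = TF" by (fact v)+
  show "1 <= Kn" by (rule Kn)
  show "sym_fun d Mr" by (simp add: sym_fun_def Mq_sym)
  show "Kn\<^sup>2 * (d + q) <= 2 ^ w1" "d + 1 <= 2 ^ w1" by (fact w1)+
  show "!!r. r < d ==> RA h yE r = evf (r div q)" using yEA by simp
  show "!!r. r < d ==> evf (r div q) = evf (r div q)" ..
  show "!!r. r < d ==> real (aq r) = real Kn / evf (r div q)" by (rule aq(1))
  show "(\<Sum>c<d. real (Mq r c)) <= real q * (evf (r div q))\<^sup>2" if "r < d" for r
  proof -
  have "real (\<Sum>c<d. Mq r c) <= real (q * degc m (r div q))" using Mq_row[of r] by (simp only: of_nat_le_iff)
  also have "... <= real q * (evf (r div q))\<^sup>2" using evf_square(1)[of "r div q"] by (simp add: mult_left_mono)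
  finally show ?thesis by simp
  qed
  show "!!i \<alpha> \<beta>. i < n ==> \<alpha> < q ==> \<beta> < q ==> real (Mq (i * q + \<alpha>) (i * q + \<beta>)) = 0" using Mq_noself by simp
  show "kp = real q + (real q)\<^sup>2 / eps" by (rule kp_def)
  have "kp * (real q + kp) <= (2 * (real q)\<^sup>2 / eps) * (3 * (real q)\<^sup>2 / eps)"
  using kp_bounds eps by (intro mult_mono) auto
  then have "11 * (kp * (real q + kp)) / eps\<^sup>2 <= 11 * ((2 * (real q)\<^sup>2 / eps) * (3 * (real q)\<^sup>2 / eps)) / eps\<^sup>2"
  by (intro divide_right_mono mult_left_mono) auto
  also have "... = 66 * real q ^ 4 / eps ^ 4" by (simp add: power2_eq_square power4_eq_xxxx)
  finally show "11 * kp * (real q + kp) / eps\<^sup>2 <= real TF" using t by (simp add: mult.assoc)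
  have "128 * kp / eps <= 128 * (2 * (real q)\<^sup>2 / eps) / eps" using kp_bounds eps by (intro divide_right_mono mult_left_mono) auto
  also have "... = (16 * real q / eps)\<^sup>2" by (simp add: power2_eq_square)
  finally have "sqrt (128 * kp / eps) <= 16 * real q / eps" using eps by (intro real_le_lsqrt) auto
  moreover have "1 <= real q / eps" using q1 eps01 by (simp add: le_divide_eq)
  ultimately show "1 + sqrt (128 * kp / eps) <= real lam" using l by simp
  show "1 <= m" using m1 by simp
  show "real m <= (\<Sum>i<n. (evf i)\<^sup>2)" "(\<Sum>i<n. (evf i)\<^sup>2) <= 8 * real m" by (rule evf_sum)+
 qed
qed

definition kk :: nat where "kk = rank_ge eps (normalized_label_extended n q E \<phi>)"

lemma sd_props: "0 <= sd r" "sd r <= evf (r div q)" "sd r = 0 ==> evf (r div q) = 0"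
proof -
 show "0 <= sd r" by (simp add: sd_def)
 show "sd r <= evf (r div q)" unfolding sd_def using evf_square by (intro real_le_lsqrt) auto
 show "sd r = 0 ==> evf (r div q) = 0" by (simp add: sd_def evf_def)
qed

text \<open>The vector \<open>sd\<close> has squared norm 2 q m and form value equal to the sum of
  all entries, which is at least m; so its Rayleigh quotient is at least 1/(2q) >= eps. A rank of at
  least 1 is what allows (1/eps)^k to absorb fixed powers of 1/eps.\<close>

lemma kk_pos:
 assumes g: "4 * eps * (real q)\<^sup>2 < 1"
 shows "1 <= kk"
 unfolding kk_def normalized_eq
proof (rule rank_ge_lower_bound[where V = "%_. sd"])
 show "sym_fun d (scaled Mr sd)" by (simp add: sym_fun_def scaled_def Mq_sym mult.commute)
 fix x :: "nat => real" and v assume x: "\<exists>j<1. x j ~= 0" and v: "v = (%r. \<Sum>j<1. x j * sd r)"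
 have vr: "v r = x 0 * sd r" for r by (simp add: v)
 have x0: "0 < (x 0)\<^sup>2" using x by simp
 have z: "real (Mq r c) = 0" if "r < d" "c < d" "sd r = 0" for r c
 proof -
  have "Mq r c <= (\<Sum>c<d. Mq r c)" by (rule member_le_sum) (use that in auto)
  also have "... <= q * degc m (r div q)" by (rule Mq_row)
  finally show ?thesis using that(3) by (simp add: sd_def)
 qed
 have t: "sd r * (real (Mq r c) / (sd r * sd c) * sd c) = real (Mq r c)" if "r < d" "c < d" for r c
  using z[OF that] z[OF that(2,1)] by (cases "sd r = 0"; cases "sd c = 0") (auto simp: Mq_sym[of r c])
 have "ip d v (mv d (scaled Mr sd) v) = (\<Sum>r<d. \<Sum>c<d. (x 0)\<^sup>2 * (sd r * (real (Mq r c) / (sd r * sd c) * sd c)))"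
  unfolding ip_def mv_def sum_distrib_left scaled_def vr by (intro sum.cong refl) (simp add: power2_eq_square)
 also have "... = (x 0)\<^sup>2 * (\<Sum>r<d. \<Sum>c<d. real (Mq r c))"
  unfolding sum_distrib_left by (intro sum.cong refl) (simp only: lessThan_iff t)
 finally have A: "ip d v (mv d (scaled Mr sd) v) = (x 0)\<^sup>2 * (\<Sum>r<d. \<Sum>c<d. real (Mq r c))" .
 have "(\<Sum>r<d. real (degc m (r div q))) = (\<Sum>i<n. \<Sum>r\<in>{i * q..<i * q + q}. real (degc m (r div q)))"
  by (rule sum.nat_group[symmetric])
 also have "... = (\<Sum>i<n. \<Sum>r\<in>{i * q..<i * q + q}. real (degc m i))"
 proof (intro sum.cong refl)
  fix i r assume "r \<in> {i * q..<i * q + q}"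
  then have "r div q = i" by (intro div_nat_eqI) (auto simp: mult.commute)
  then show "real (degc m (r div q)) = real (degc m i)" by simp
 qed
 also have "... = real q * real (\<Sum>i<n. degc m i)" by (simp add: sum_distrib_left)
 finally have dg: "(\<Sum>r<d. real (degc m (r div q))) = real q * (2 * real m)" unfolding sum_degc by simp
 have "ip d v v = (x 0)\<^sup>2 * (\<Sum>r<d. real (degc m (r div q)))"
  unfolding ip_def vr sum_distrib_left by (intro sum.cong refl) (simp add: sd_def power2_eq_square)
 then have B: "ip d v v = (x 0)\<^sup>2 * (real q * (2 * real m))" unfolding dg .
 have "real q * 1 <= (real q)\<^sup>2" using q1 by (simp add: power2_eq_square)
 then have "eps * real q <= eps * (real q)\<^sup>2" using eps by (intro mult_left_mono) auto
 then have "2 * (eps * real q) <= 1" using g by simp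
 then have "2 * (eps * real q) * real m <= 1 * real m" by (intro mult_right_mono) auto
 also have "... <= (\<Sum>r<d. \<Sum>c<d. real (Mq r c))" using sum_Mq by simp
 finally have "(x 0)\<^sup>2 * (2 * (eps * real q) * real m) <= (x 0)\<^sup>2 * (\<Sum>r<d. \<Sum>c<d. real (Mq r c))"
  using x0 by (intro mult_left_mono) auto
 moreover have "0 < ip d v v" unfolding B using x0 q1 m1 by simp
 ultimately show "0 < ip d v v & eps * ip d v v <= ip d v (mv d (scaled Mr sd) v)"
  unfolding A B by (simp add: mult_ac)
qed

text \<open>80 eps m comes from 10 eps Se and Se <= 8 m. As the form is twice the number of
  satisfied constraints, the loss in the latter is 40 eps m.\<close>

lemma ht_main:
 assumes rd: "ready h lam TF" and best: "NA h vBest = (%_. 0)" "RA h xBest 0 = 0"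
  and w1: "Kn\<^sup>2 * (d + q) <= 2 ^ w1" "d + 1 <= 2 ^ w1"
  and jm: "(24 * real d) ^ (kk + 2) <= ((real q + 2 * eps) / (real q + eps)) ^ (2 * 2 ^ jm)" and lg: "d <= 2 ^ lg"
  and jd: "!!J. J <= kk ==> 4 * kp * real J * real m <= eps * 4 ^ jd"
 shows "ht (engine.search ;; net_search.net_prog) h (%h'. NA h' vN 0 = n & bnd h' = bnd h & (\<forall>i<n. NA h' vBest i < q) &
  (\<forall>zs. fractional n q zs --> ip d zs (mv d Mr zs) - 80 * eps * real m <= 2 * real (csp_value E \<phi> (NA h' vBest))) &
  (\<exists>J C. J <= kk & real C <= (3 * (real lam + 2)) ^ (2 * J) &
  clk h' <= clk h + search_time kk jm (2 ^ jm) w1 lg d nz + net_time n q J d nz TF jd C))"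
proof -
 have "rep h (pairs (m * q * q))" using rd by (simp add: ready_def)
 then obtain rows where rows: "!!r. chain (NA h vNxt) (NA h vHead r) (rows r)"
  "!!r f. (\<Sum>p\<leftarrow>rows r. f (NA h vCol p)) = mv d Mr f r" "(\<Sum>r<d. length (rows r)) <= nz"
  using rep_rows[of h thesis] by blast
 interpret s: solver h n q d nz Mr rows aq Mq Kn w1 eps "%r. evf (r div q)" evf lam TF m kp
  by (rule solver_ready[OF rd rows w1])
 have c0: "s.cst h" by (simp add: s.cst_def)
 show ?thesis
 proof (rule ht_seq, rule s.ht_search[OF c0, where kk = kk and jm = jm and lg = lg], goal_cases)
  case 1
  show ?case using jm by (simp only: s.rho_def)
 next
  case 2
  show ?case by (rule lg)
 next
  case (3 mm V T)
  show ?case unfolding kk_def normalized_eq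
  by (rule s.dominating_le_rank[OF 3]) (use sd_props in auto)
 next
  case (4 h' J b nrm)
  note h' = this
  have bf: "NA h' vJ 0 = J" "!!l. l < J ==> NA h' vBB l = l * d" "!!l r. l < J ==> r < d ==> RA h' yB (l * d + r) = b l r"
  "!!l. l < J ==> RA h' yNrm l = nrm l" "!!l. l < J ==> 1 <= nrm l & nrm l < 4 & nrm l = ip d (b l) (b l)"
  "!!l l'. l < J ==> l' < J ==> l ~= l' ==> ip d (b l) (b l') = 0"
  "!!v. (!!l. l < J ==> ip d v (b l) = 0) ==> ip d v (mv d s.St v) <= real (Kn\<^sup>2) * (real q + 2 * eps) * ip d v v"
  using h'(4) unfolding s.basis_found_def by blast+
  interpret ns: net_search h n q d nz Mr rows aq Mq Kn w1 eps "%r. evf (r div q)" evf lam TF m kp J b nrm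
  by unfold_locales (fact bf)+
  have c': "s.cst h'" by (rule s.cst_same[OF c0 h'(1)]) auto
  have b': "ns.bst h'" unfolding ns.bst_def using c' bf(1-4) by simp
  have "NA h' vBest = (%_. 0)" "RA h' xBest 0 = 0" using best sameN[OF h'(1), of vBest] sameR[OF h'(1), of xBest] by simp_all
  then have ok: "ns.bestok h'" unfolding ns.bestok_def ns.obj_def using csp_value_form[of "%_. 0"] q1 by simp
  show ?case
  proof (rule ns.ht_net_prog[OF b' ok, where jd = jd], goal_cases)
  case 1
  show ?case by (rule jd[OF h'(3)])
  next
  case (2 h2)
  note h2 = this
  have ob: "\<forall>i<n. NA h2 vBest i < q" "RA h2 xBest 0 <= 2 * real (csp_value E \<phi> (NA h2 vBest))"
  using h2(3) csp_value_form[of "NA h2 vBest"] by (auto simp: ns.bestok_def ns.obj_def)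
  have "ns.Se <= 8 * real m" unfolding ns.Se_def by (rule evf_sum)
  then have Se: "10 * eps * ns.Se <= 80 * eps * real m" using eps by (simp add: mult.assoc)
  have "ip d zs (mv d Mr zs) - 80 * eps * real m <= 2 * real (csp_value E \<phi> (NA h2 vBest))" if "fractional n q zs" for zs
  using h2(4)[OF that] ob(2) Se unfolding ns.obj_def by linarith
  moreover have "NA h2 vN 0 = n" using sameN[OF h2(1), of vN] sameN[OF h'(1), of vN] s.cN by simp
  moreover have "bnd h2 = bnd h" using samebnd[OF h2(1)] samebnd[OF h'(1)] by simp
  moreover have "clk h2 <= clk h + search_time kk jm (2 ^ jm) w1 lg d nz + net_time n q J d nz TF jd (card (simplex_points (2 * J) (J * lam)))"
  using h2(2) h'(2) unfolding search_time_def trace_time_def net_time_def ns.tNet_def ns.tProc_def ns.tFW_def ns.tFWs_def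
  s.tAttM_def s.tIterM_def s.tTrM_def s.tM_def by (simp add: add_ac)
  moreover have "real (card (simplex_points (2 * J) (J * lam))) <= (3 * (real lam + 2)) ^ (2 * J)"
  by (rule simplex_points_card_le)
  ultimately show ?case using ob(1) h'(3) by blast
  qed
 qed
qed

end

text \<open>Only N has to enter logarithmically, so the other factor is treated by the crude ln y <=
  y - 1.\<close>

lemma ln_bound:
 fixes x N y :: real
 assumes "0 < x" "1 <= N" "1 <= y" "x <= 2 ^ c * N ^ a * y ^ b"
 shows "ln x <= real c + real a * ln N + real b * (y - 1)"
proof -
 have N0: "0 < N" "0 < y" using assms by linarith+
 have p: "(0::real) < 2 ^ c" "0 < N ^ a" "0 < y ^ b" using assms by auto
 have "ln x <= ln (2 ^ c * N ^ a * y ^ b)" using assms p by (subst ln_le_cancel_iff) auto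
 also have "... = real c * ln 2 + real a * ln N + real b * ln y"
  using p N0 by (simp add: ln_mult ln_realpow)
 also have "... <= real c * 1 + real a * ln N + real b * (y - 1)"
  using assms ln_le_minus_one[of y] ln_le_minus_one[of "2::real"] by (intro add_mono mult_left_mono) auto
 finally show ?thesis by simp
qed

context csp_nonempty
begin

definition Nn :: real where "Nn = real (n + m)"
definition Wn :: real where "Wn = real q * (1 + ln Nn) * (1 / eps) ^ kk"

text \<open>\<open>Wn\<close> dominates q, 1 + ln N, 1/eps and k + 1 at once: z = 1/eps is at least
  4 q^2 and k >= 1, so z <= z^k and k + 1 <= 2^k <= z^k.\<close>

lemma parameters:
 assumes g: "4 * eps * (real q)\<^sup>2 < 1" and lam: "real lam < 17 * real q / eps + 1" and TF: "real TF < 66 * real q ^ 4 / eps ^ 4 + 1"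
 obtains jm w1 lg jd where "Kn\<^sup>2 * (d + q) <= 2 ^ w1" "d + 1 <= 2 ^ w1"
  "(24 * real d) ^ (kk + 2) <= ((real q + 2 * eps) / (real q + eps)) ^ (2 * 2 ^ jm)" "d <= 2 ^ lg"
  "!!J. J <= kk ==> 4 * kp * real J * real m <= eps * 4 ^ jd"
  "!!J. J <= kk ==> size_ok Nn Wn n m q kk J jm (2 ^ jm) w1 lg d nz TF lam jd"
  "!!J. J <= kk ==> (3 * (real lam + 2)) ^ (2 * J) <= 1 * Wn ^ 10"
proof -
 define z where "z = 1 / eps"
 define Lg where "Lg = 1 + ln Nn"
 define Q where "Q = real q"
 define k where "k = real kk"
 have k1: "1 <= k" using kk_pos[OF g] by (simp add: k_def)
 have Q1: "1 <= Q" using q1 by (simp add: Q_def)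
 have N2: "1 <= Nn" "real n <= Nn" "real m <= Nn" using n1 by (auto simp: Nn_def)
 have L1: "1 <= Lg" using N2 by (simp add: Lg_def)
 have zq: "4 * Q\<^sup>2 <= z" using g eps by (simp add: z_def Q_def le_divide_eq mult_ac less_imp_le)
 have QQ: "Q <= Q\<^sup>2" using Q1 by (simp add: power2_eq_square)
 have z4: "4 <= z" "Q <= z" using zq QQ Q1 by auto
 have zk1: "z <= z ^ kk" using kk_pos[OF g] z4 by (intro self_le_power) auto
 have W: "Wn = Q * Lg * z ^ kk" by (simp add: Wn_def Q_def Lg_def z_def)
 have zk: "1 <= z ^ kk" using z4 zk1 by linarith
 have QL: "1 <= Q * Lg" using mult_mono[OF Q1 L1] Q1 by simp
 have WQL: "Q * Lg <= Wn" unfolding W using mult_left_mono[OF zk, of "Q * Lg"] QL by simp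
 have Wz: "z ^ kk <= Wn" unfolding W using mult_right_mono[OF QL, of "z ^ kk"] zk by simp
 have "Q * 1 <= Q * Lg" using Q1 L1 by (intro mult_left_mono) auto
 then have WQ: "Q <= Wn" using WQL by linarith
 have "1 * Lg <= Q * Lg" using Q1 L1 by (intro mult_right_mono) auto
 then have WL: "Lg <= Wn" using WQL by linarith
 have Wz1: "z <= Wn" using zk1 Wz by linarith
 have W1: "1 <= Wn" using QL WQL by linarith
 have kW: "k + 1 <= Wn"
 proof -
  have "real (kk + 1) <= real (2 ^ kk)" using less_exp[of kk] by (simp only: of_nat_le_iff)
  also have "... <= z ^ kk" using z4 by (simp add: power_mono)
  finally show ?thesis using Wz by (simp add: k_def)
 qed
 have Wp: "Wn ^ a <= Wn ^ b" if "a <= b" for a b using that W1 by (rule power_increasing)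
 have LQ: "Lg + Q <= 1 + Q * Lg" using mult_nonneg_nonneg[of "Q - 1" "Lg - 1"] Q1 L1 by (simp add: algebra_simps)
 have dN: "real d <= Nn * Q" using N2 Q1 by (simp add: Q_def mult_right_mono)
 have d1: "1 <= real d" using n1 q1 by (simp add: Suc_le_eq flip: of_nat_mult)

 \<comment> \<open>With x = eps/(q + eps) <= 1/4 one has ln rho = ln(1 + x) >= x/2 >= eps/(4 q), so
   a unit of T contributes at least eps/(2 q) to the logarithm of the gap, and T >= Y outweighs (k +
   2) ln(24 d).\<close>
 define Y where "Y = 2 * Q * (k + 2) * ln (24 * real d) * z"
 have ln24: "1 <= ln (24 * real d)"
 proof -
  have "exp 1 <= 24 * real d" using exp_le d1 by linarith
  then show ?thesis using d1 by (subst ln_ge_iff) auto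
 qed
 have ln24': "ln (24 * real d) <= 6 * Wn"
 proof -
  have "ln (24 * real d) <= real 5 + real 1 * ln Nn + real 1 * (Q - 1)"
  proof (rule ln_bound)
  have "2 ^ 5 * Nn ^ 1 * Q ^ 1 = 32 * (Nn * Q)" by simp
  then show "24 * real d <= 2 ^ 5 * Nn ^ 1 * Q ^ 1" using dN d1 by linarith
  qed (use d1 N2 Q1 in linarith)+
  also have "... = Lg + Q + 3" by (simp add: Lg_def)
  finally show ?thesis using LQ WQL W1 by linarith
 qed
 have Y1: "1 <= Y"
 proof -
  have "1 * 1 * 1 * 1 <= (2 * Q) * (k + 2) * ln (24 * real d) * z" using Q1 k1 ln24 z4 by (intro mult_mono) auto
  then show ?thesis by (simp add: Y_def)
 qed
 obtain jm where jm: "Y <= 2 ^ jm" "2 ^ jm <= 2 * Y" using power2_between[OF Y1] by blast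
 have P: "2 ^ jm <= 48 * Wn ^ 4"
 proof -
  have "Y <= (2 * Wn) * (2 * Wn) * (6 * Wn) * Wn"
  unfolding Y_def using Q1 k1 ln24 ln24' z4 WQ kW Wz1 W1 by (intro mult_mono) auto
  also have "... = 24 * Wn ^ 4" by (simp add: power4_eq_xxxx)
  finally show ?thesis using jm by simp
 qed
 have c3: "(24 * real d) ^ (kk + 2) <= ((Q + 2 * eps) / (Q + eps)) ^ (2 * 2 ^ jm)"
 proof -
  define x where "x = eps / (Q + eps)"
  have R: "(Q + 2 * eps) / (Q + eps) = 1 + x" using Q1 eps by (simp add: x_def field_simps)
  have "eps <= 1 / 4"
  using z4 eps by (simp add: z_def field_simps)
  moreover have "x <= eps" using Q1 eps by (simp add: x_def divide_le_eq mult_le_cancel_left1)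
  moreover have x0: "0 <= x" using Q1 eps by (simp add: x_def)
  ultimately have xq: "x <= 1 / 4" "0 <= x" by auto
  have "x * x <= x * (1 / 4)" using xq by (intro mult_left_mono) auto
  then have "x / 2 <= x - x\<^sup>2" using xq by (simp add: power2_eq_square)
  also have "... <= ln (1 + x)" using xq by (intro ln_one_plus_pos_lower_bound) auto
  finally have lx: "x / 2 <= ln (1 + x)" .
  have "eps / (2 * Q) <= x" unfolding x_def using Q1 eps01 by (intro divide_left_mono) auto
  then have lr: "eps / (4 * Q) <= ln (1 + x)" using lx by simp
  have "ln ((24 * real d) ^ (kk + 2)) = (k + 2) * ln (24 * real d)"
  using d1 by (subst ln_realpow) (auto simp: k_def)
  also have "... = 2 * Y * (eps / (4 * Q))" using Q1 eps by (simp add: Y_def z_def)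
  also have "... <= 2 * 2 ^ jm * ln (1 + x)" using jm Y1 lr Q1 eps by (intro mult_mono) auto
  also have "... = ln ((1 + x) ^ (2 * 2 ^ jm))" using xq by (subst ln_realpow) auto
  finally have l: "ln ((24 * real d) ^ (kk + 2)) <= ln ((1 + x) ^ (2 * 2 ^ jm))" .
  have "0 < (24 * real d) ^ (kk + 2)" by (rule zero_less_power) (use d1 in linarith)
  moreover have "0 < (1 + x) ^ (2 * 2 ^ jm)" by (rule zero_less_power) (use xq in linarith)
  ultimately show ?thesis unfolding R using l ln_le_cancel_iff by blast
 qed

 \<comment> \<open>The product of 16 N^2, which bounds Kn^2, and 2 N q, which bounds d + q.\<close>
 define D where "D = 32 * Nn ^ 3 * Q"
 have ND: "Nn <= Nn ^ 3" "Nn ^ 2 <= Nn ^ 3" using N2 power_increasing[of 1 3 Nn] power_increasing[of 2 3 Nn] by auto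
 have D1: "1 <= D" unfolding D_def using mult_mono[of 1 "32 * Nn ^ 3" 1 Q] ND N2 Q1 by simp
 obtain w1 where w1: "D <= 2 ^ w1" "real w1 <= 2 * ln (2 * D)" using power2_between[OF D1] by blast
 have w1b: "real w1 <= 18 * Wn ^ 2"
 proof -
  have "ln (2 * D) <= real 6 + real 3 * ln Nn + real 1 * (Q - 1)"
  by (rule ln_bound) (use D1 N2 Q1 in \<open>auto simp: D_def\<close>)
  also have "... = 3 * Lg + Q + 2" by (simp add: Lg_def)
  also have "... <= 9 * Wn" using LQ WQL W1 WL by linarith
  finally have "real w1 <= 18 * Wn ^ 1" using w1 by simp
  then show ?thesis using Wp[of 1 2] by linarith
 qed
 have Kn2: "real (Kn\<^sup>2 * (d + q)) <= D"
 proof -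
  define gg where "gg = (2 * m) * (2 * m)"
  have "Kn\<^sup>2 = 4 ^ lg4 gg" by (simp add: Kn_def gg_def power2_eq_square power_mult_distrib[symmetric])
  also have "... <= 4 * gg" by (rule lg4_upper) (use m1 in \<open>simp add: gg_def\<close>)
  finally have "real (Kn\<^sup>2) <= real (16 * m\<^sup>2)" unfolding of_nat_le_iff by (simp add: gg_def power2_eq_square)
  also have "... <= 16 * Nn\<^sup>2" using N2 by simp
  finally have a: "real (Kn\<^sup>2) <= 16 * Nn\<^sup>2" .
  have "Q * 1 <= Q * Nn" using N2 Q1 by (intro mult_left_mono) auto
  then have "real (d + q) <= 2 * (Nn * Q)" using dN by (simp add: Q_def mult.commute)
  then have "real (Kn\<^sup>2) * real (d + q) <= (16 * Nn\<^sup>2) * (2 * (Nn * Q))" using a N2 by (intro mult_mono) auto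
  also have "... = D" by (simp add: D_def power2_eq_square power3_eq_cube)
  finally show ?thesis by (simp only: of_nat_mult)
 qed
 have dD: "real (d + 1) <= D"
 proof -
  have "real (d + 1) <= 2 * (Nn * Q)" using dN d1 by simp
  also have "... <= 32 * (Nn ^ 3 * Q)" using ND N2 Q1 by (intro mult_mono) auto
  finally show ?thesis by (simp add: D_def)
 qed
 have c1: "Kn\<^sup>2 * (d + q) <= 2 ^ w1" "d + 1 <= 2 ^ w1"
 proof -
  have "real (Kn\<^sup>2 * (d + q)) <= real (2 ^ w1)" using Kn2 w1 by simp
  then show "Kn\<^sup>2 * (d + q) <= 2 ^ w1" by (simp only: of_nat_le_iff)
  have "real (d + 1) <= real (2 ^ w1)" using dD w1 by simp
  then show "d + 1 <= 2 ^ w1" by (simp only: of_nat_le_iff)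
 qed

 obtain lg where lg: "real d <= 2 ^ lg" "real lg <= 2 * ln (2 * real d)" using power2_between[OF d1] by blast
 have lgb: "real lg <= 6 * Wn ^ 2"
 proof -
  have "ln (2 * real d) <= real 1 + real 1 * ln Nn + real 1 * (Q - 1)"
  proof (rule ln_bound)
  have "2 ^ 1 * Nn ^ 1 * Q ^ 1 = 2 * (Nn * Q)" by simp
  then show "2 * real d <= 2 ^ 1 * Nn ^ 1 * Q ^ 1" using dN by linarith
  qed (use d1 N2 Q1 in linarith)+
  also have "... = Lg + Q - 1" by (simp add: Lg_def)
  also have "... <= 3 * Wn" using LQ WQL W1 by linarith
  finally have "real lg <= 6 * Wn ^ 1" using lg by simp
  then show ?thesis using Wp[of 1 2] by linarith
 qed
 have c4: "d <= 2 ^ lg"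
 proof -
  have "real d <= real (2 ^ lg)" using lg by simp
  then show ?thesis by (simp only: of_nat_le_iff)
 qed

 \<comment> \<open>Chosen to give 4 kappa k m <= eps Z m when kappa <= 2 q^2/eps; so 2^jd >= Z m
   leaves enough halvings for delta.\<close>
 define Z where "Z = 8 * Q\<^sup>2 * z\<^sup>2 * k"
 have Z1: "1 <= Z"
 proof -
  have "1 * 1 * 1 * 1 <= 8 * Q\<^sup>2 * z\<^sup>2 * k" using Q1 z4 k1 by (intro mult_mono) auto
  then show ?thesis by (simp add: Z_def)
 qed
 have mr: "1 <= real m" using m1 by simp
 have Zm1: "1 <= Z * real m" using mult_mono[OF Z1 mr] Z1 by simp
 obtain jd where jd: "Z * real m <= 2 ^ jd" "real jd <= 2 * ln (2 * (Z * real m))" using power2_between[OF Zm1] by blast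
 have jdb: "real jd <= 34 * Wn ^ 5"
 proof -
  have "ln (2 * (Z * real m)) = ln (2 * Z) + ln (real m)" using Z1 mr by (subst mult.assoc[symmetric], subst ln_mult) auto
  also have "... <= 2 * Z + ln Nn" using ln_le_minus_one[of "2 * Z"] Z1 mr N2 by (intro add_mono) auto
  also have "Z <= 8 * Wn\<^sup>2 * Wn\<^sup>2 * Wn" unfolding Z_def using Q1 z4 k1 WQ Wz1 kW W1 by (intro mult_mono power_mono) auto
  also have "8 * Wn\<^sup>2 * Wn\<^sup>2 * Wn = 8 * Wn ^ 5" by (simp add: eval_nat_numeral)
  finally have "ln (2 * (Z * real m)) <= 2 * (8 * Wn ^ 5) + ln Nn" by simp
  moreover have "ln Nn <= Wn ^ 1" using WL by (simp add: Lg_def)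
  ultimately show ?thesis using jd Wp[of 1 5] by linarith
 qed
 have c5: "4 * kp * real J * real m <= eps * 4 ^ jd" if J: "J <= kk" for J
 proof -
  have "(2::real) ^ jd <= 4 ^ jd" by (rule power_mono) auto
  then have "eps * (Z * real m) <= eps * 4 ^ jd" using jd eps by (intro mult_left_mono) auto
  moreover have "4 * kp * real J * real m <= 4 * (2 * Q\<^sup>2 / eps) * k * real m"
  using kp_bounds J eps by (intro mult_mono) (auto simp: Q_def k_def)
  moreover have "4 * (2 * Q\<^sup>2 / eps) * k * real m = eps * (Z * real m)"
  using eps by (simp add: Z_def z_def power2_eq_square)
  ultimately show ?thesis by linarith
 qed

 have lamz: "real lam <= 17 * (Q * z) + 1" using lam by (simp add: Q_def z_def)
 have Qz: "1 <= Q * z" using mult_mono[OF Q1, of 1 z] z4 Q1 by simp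
 have QzW: "Q * z <= Wn ^ 2" unfolding power2_eq_square using WQ Wz1 Q1 z4 W1 by (intro mult_mono) auto
 have lamb: "real lam <= 18 * Wn ^ 2" using lamz Qz QzW by linarith
 have TFb: "real TF <= 67 * Wn ^ 8"
 proof -
  have "(Q * z) ^ 4 <= (Wn ^ 2) ^ 4" using QzW Qz by (intro power_mono) auto
  then have "(Q * z) ^ 4 <= Wn ^ 8" by (simp flip: power_mult)
  moreover have "real TF <= 66 * (Q * z) ^ 4 + 1" using TF by (simp add: Q_def z_def power_divide)
  moreover have "1 <= Wn ^ 8" using W1 by simp
  ultimately show ?thesis by linarith
 qed
 \<comment> \<open>By q <= z and z >= 4, 3 (lam + 2) <= 60 q z <= z^5 for z = 1/eps; with J <= k the
   net has at most (z^k)^10 points, which is (1/eps)^O(k).\<close>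
 have cd: "(3 * (real lam + 2)) ^ (2 * J) <= 1 * Wn ^ 10" if J: "J <= kk" for J
 proof -
  have "3 * (l + 2) <= 60 * t" if "l <= 17 * t + 1" "1 <= t" for l t :: real using that by argo
  from this[OF lamz Qz] have "3 * (real lam + 2) <= 60 * (Q * z)" .
  also have "... <= z ^ 3 * (z * z)"
  proof (rule mult_mono)
  have "(4::real) ^ 3 <= z ^ 3" using z4 by (intro power_mono) auto
  then show "60 <= z ^ 3" by simp
  show "Q * z <= z * z" using z4 by (intro mult_right_mono) auto
  qed (use Qz z4 in auto)
  also have "... = z ^ 5" by (simp add: eval_nat_numeral)
  finally have "(3 * (real lam + 2)) ^ (2 * J) <= (z ^ 5) ^ (2 * J)" by (intro power_mono) auto
  also have "... = z ^ (10 * J)" by (simp flip: power_mult)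
  also have "... <= z ^ (10 * kk)" using J z4 by (intro power_increasing) auto
  also have "... = (z ^ kk) ^ 10" by (simp add: mult.commute flip: power_mult)
  also have "... <= Wn ^ 10" using Wz zk by (intro power_mono) auto
  finally show ?thesis by simp
 qed
 have so: "size_ok Nn Wn n m q kk J jm (2 ^ jm) w1 lg d nz TF lam jd" if J: "J <= kk" for J
 proof -
  have p: "real jm <= 48 * Wn ^ 5" "real (2 ^ jm) <= 48 * Wn ^ 5"
  proof -
  show a: "real (2 ^ jm) <= 48 * Wn ^ 5" using P Wp[of 4 5] by simp
  have "real jm <= real (2 ^ jm)" using less_exp[of jm] by (simp only: of_nat_le_iff)
  then show "real jm <= 48 * Wn ^ 5" using a by linarith
  qed
  have J': "real J <= Wn" using J kW by (simp add: k_def)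
  have dW: "real d <= Nn * Wn" using dN mult_left_mono[OF WQ, of Nn] N2 by linarith
  have "real m * (Q * Q) <= Nn * (Wn * Wn)" using N2 WQ Q1 W1 by (intro mult_mono) auto
  then have nb: "real nz <= 2 * Nn * Wn ^ 2" by (simp add: Q_def power2_eq_square mult_ac)
  show ?thesis unfolding size_ok_def
  using N2 W1 WQ kW J' dW nb p w1b lgb TFb lamb jdb by (simp add: Q_def k_def)
 qed
 show thesis by (rule that[OF c1 c3[unfolded Q_def] c4 c5 so cd])
qed

end

section \<open>The whole program\<close>

text \<open>The test sorts out the cases in which every assignment is good enough: no edges, or 4
  eps q^2 >= 1. There the zeros initially in \<open>vBest\<close> are the answer.\<close>

definition solve :: prog where
 "solve = boot ;; (count_to vN (rv xN) ;;
  Cond (TAnd (RLess (Rc 0) (rv xM)) (RLess (RMul (RMul (Rc 4) (rv xEps)) (RMul (rv xQ) (rv xQ))) (Rc 1)))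
  (csp_input.prepare ;; engine.search ;; net_search.net_prog) Skip) ;; write_out"

definition total_time :: "nat => nat => nat => nat => nat => nat => nat => nat => nat => nat => nat => nat => nat => nat => nat => nat" where
 "total_time n m q k J jm P w1 lg d nnz TF lam jd C =
  frame_time n m q + prepare_time n m q lam TF + search_time k jm P w1 lg d nnz + net_time n q J d nnz TF jd C"

context csp_problem
begin

definition answered :: "real => (nat => nat) => bool" where
 "answered c x \<longleftrightarrow> (\<forall>i<n. x i < q) & real (csp_opt n q E \<phi>) - c * eps * real q ^ 2 * real m <= real (csp_value E \<phi> x)"

lemma csp_opt_attained: "\<exists>x\<in>assignments n q. csp_opt n q E \<phi> = csp_value E \<phi> x"
proof -
 have "finite (assignments n q)" unfolding assignments_def by (intro finite_PiE) auto
 moreover have "(\<lambda>i\<in>{..<n}. 0) \<in> assignments n q" using q1 by (auto simp: assignments_def)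
 ultimately have "csp_opt n q E \<phi> \<in> csp_value E \<phi> ` assignments n q"
  unfolding csp_opt_def by (intro Max_in) auto
 then show ?thesis by blast
qed

lemma csp_value_le: "csp_value E \<phi> x <= m"
proof -
 have "csp_value E \<phi> x <= (\<Sum>e\<in>edges E. 1)" unfolding csp_value_def by (intro sum_mono) auto
 then show ?thesis by (simp add: m_card)
qed

text \<open>The permitted error is at least m, and the optimum is at most m.\<close>

lemma answered_trivial:
 assumes "m = 0 \<or> 1 <= 4 * eps * (real q)\<^sup>2" "4 <= c" "!!i. i < n ==> x i < q"
 shows "answered c x"
proof -
 have "real m <= 4 * eps * real q ^ 2 * real m" using assms(1) mult_right_mono[of 1 "4 * eps * (real q)\<^sup>2" "real m"] by auto
 also have "... <= c * eps * real q ^ 2 * real m" using assms(2) eps by (intro mult_right_mono) auto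
 finally have "real m <= c * eps * real q ^ 2 * real m" .
 moreover obtain y where "csp_opt n q E \<phi> = csp_value E \<phi> y" using csp_opt_attained by blast
 then have "real (csp_opt n q E \<phi>) <= real m" using csp_value_le[of y] by simp
 ultimately show ?thesis using assms(3) by (simp add: answered_def)
qed

lemma ht_count_n:
 assumes "!!h'. same {vN} {} hb h' ==> NA h' vN 0 = n ==> clk h' = clk hb + 2 * n + 2 ==> Q h'"
 shows "ht (count_to vN (rv xN)) hb Q"
proof (rule ht_count_to[where X = "real n"], goal_cases)
 case (3 h')
 then show ?case using sameR[OF 3, of xN] by (simp add: hb_def boot_state_def Let_def)
next
 case (4 h' k)
 then have "k = n" by linarith
 then show ?case using 4 by (intro assms) auto
qed auto

lemma solve_exec:
 assumes mid: "ht (count_to vN (rv xN) ;;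
  Cond (TAnd (RLess (Rc 0) (rv xM)) (RLess (RMul (RMul (Rc 4) (rv xEps)) (RMul (rv xQ) (rv xQ))) (Rc 1)))
  (csp_input.prepare ;; engine.search ;; net_search.net_prog) Skip) hb
  (%h'. NA h' vN 0 = n & bnd h' = bnd hb & answered c (NA h' vBest) & real (clk h' + 3 * n + 5) <= T)"
 shows "\<exists>t s. exec solve (input_state n q es \<phi> eps) t s & real t <= T & answered c (fst s)"
proof -
 from mid obtain t h' where e: "exec (count_to vN (rv xN) ;;
  Cond (TAnd (RLess (Rc 0) (rv xM)) (RLess (RMul (RMul (Rc 4) (rv xEps)) (RMul (rv xQ) (rv xQ))) (Rc 1)))
  (csp_input.prepare ;; engine.search ;; net_search.net_prog) Skip) (lay hb) t (lay h')" "clk h' = clk hb + t"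
  and h': "NA h' vN 0 = n" "bnd h' = bnd hb" "answered c (NA h' vBest)" "real (clk h' + 3 * n + 5) <= T"
  unfolding ht_def by blast
 have b: "n <= Suc (bnd h')" unfolding h'(2) by (simp add: hb_def boot_state_def Let_def)
 obtain u s where w: "exec write_out (lay h') u s" "u <= 3 * n + 5" "\<forall>i<n. fst s i = NA h' vBest i"
  using exec_output[OF h'(1) n1 b] by blast
 have "exec boot (input_state n q es \<phi> eps) (clk hb) (lay hb)"
  unfolding input_state_def hb_def
  by (rule exec_boot[OF tables]) (unfold length_append len_edges len_tables, simp)
 then have "exec solve (input_state n q es \<phi> eps) (clk hb + (t + u)) s"
  unfolding solve_def using e(1) w(1) by (intro exec.Then)
 moreover have "real (clk hb + (t + u)) <= T" using e(2) w(2) h'(4) by simp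
 moreover have "answered c (fst s)"
 proof -
  have "csp_value E \<phi> (fst s) = csp_value E \<phi> (NA h' vBest)"
  unfolding csp_value_def using w(3) edge_props by (intro sum.cong refl) auto
  then show ?thesis using h'(3) w(3) by (simp add: answered_def)
 qed
 ultimately show ?thesis by blast
qed

lemma hb_consts: "RA hb xM 0 = real m" "RA hb xEps 0 = eps" "RA hb xQ 0 = real q" "NA hb = (%_ _. 0)" "RA hb xBest 0 = 0"
 "clk hb = 2 * (3 + 2 * m + m * (q * q) + n) + 6"
 by (simp_all add: hb_def boot_state_def Let_def)

lemma solve_trivial:
 assumes tr: "m = 0 \<or> 1 <= 4 * eps * (real q)\<^sup>2" and c: "4 <= c"
 shows "\<exists>t s. exec solve (input_state n q es \<phi> eps) t s & real t <= real (frame_time n m q) & answered c (fst s)"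
proof (rule solve_exec, rule ht_seq, rule ht_count_n, goal_cases)
 case (1 h)
 have R: "RA h = RA hb" using sameR[OF 1(1)] by auto
 have vB: "NA h vBest = (%_. 0)" using sameN[OF 1(1), of vBest] hb_consts by simp
 show ?case
 proof (rule ht_cond, goal_cases)
  case 1
  then show ?case using tr by (auto simp: R hb_consts power2_eq_square mult_ac)
 next
  case 2
  have "answered c (%_. 0)" by (rule answered_trivial[OF tr c]) (use q1 in auto)
  then show ?case using 1 vB samebnd[OF \<open>same _ _ hb h\<close>] hb_consts
  by (intro ht_skip) (simp add: frame_time_def)
 qed
qed

end

context csp_nonempty
begin

lemma solve_nontrivial:
 assumes g: "4 * eps * (real q)\<^sup>2 < 1" and c: "40 <= c"
  and tb: "!!N W n m q k J jm P w1 lg d nnz TF lam jd C. size_ok N W n m q k J jm P w1 lg d nnz TF lam jd ==> real C <= 1 * W ^ 10 ==>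
  bd N W (real (total_time n m q k J jm P w1 lg d nnz TF lam jd C)) a p"
 shows "\<exists>t s. exec solve (input_state n q es \<phi> eps) t s & real t <= a * Nn * Wn ^ p & answered c (fst s)"
proof (rule solve_exec, rule ht_seq, rule ht_count_n, goal_cases)
 case (1 h)
 note h1 = this
 have R: "RA h = RA hb" using sameR[OF 1(1)] by auto
 show ?case
 proof (rule ht_cond, goal_cases)
  case 2
  then show ?case using g m1 by (auto simp: R hb_consts power2_eq_square mult_ac)
 next
  case 1
  show ?case
  proof (rule ht_seq, rule ht_prepare, goal_cases)
  case 1
  show ?case using h1(1) by simp
  next
  case 2
  show ?case using h1(2) by simp
  next
  case (3 h2 lam TF)
  note h2 = this
  have S2: "same stN stR hb h2" using h2(2) by (simp add: ready_def)
  have best: "NA h2 vBest = (%_. 0)" "RA h2 xBest 0 = 0"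
  using sameN[OF S2, of vBest] sameR[OF S2, of xBest] hb_consts by auto
  have lt: "real lam < 17 * real q / eps + 1" "real TF < 66 * real q ^ 4 / eps ^ 4 + 1" using h2(2) by (auto simp: ready_def)
  obtain jm w1 lg jd where pr: "Kn\<^sup>2 * (d + q) <= 2 ^ w1" "d + 1 <= 2 ^ w1"
  "(24 * real d) ^ (kk + 2) <= ((real q + 2 * eps) / (real q + eps)) ^ (2 * 2 ^ jm)" "d <= 2 ^ lg"
  "!!J. J <= kk ==> 4 * kp * real J * real m <= eps * 4 ^ jd"
  "!!J. J <= kk ==> size_ok Nn Wn n m q kk J jm (2 ^ jm) w1 lg d nz TF lam jd"
  "!!J. J <= kk ==> (3 * (real lam + 2)) ^ (2 * J) <= 1 * Wn ^ 10" by (rule parameters[OF g lt]) (rule that)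
  show ?case
  proof (rule ht_mono[OF ht_main[OF h2(2) best pr(1,2,3,4,5)]], goal_cases)
  case (2 h3)
  then have v: "NA h3 vN 0 = n" "bnd h3 = bnd h2" "\<forall>i<n. NA h3 vBest i < q"
  "!!zs. fractional n q zs ==> ip d zs (mv d Mr zs) - 80 * eps * real m <= 2 * real (csp_value E \<phi> (NA h3 vBest))"
  and ex: "\<exists>J C. J <= kk & real C <= (3 * (real lam + 2)) ^ (2 * J) &
  clk h3 <= clk h2 + search_time kk jm (2 ^ jm) w1 lg d nz + net_time n q J d nz TF jd C" by auto
  from ex obtain J C where JC: "J <= kk" "real C <= (3 * (real lam + 2)) ^ (2 * J)"
  "clk h3 <= clk h2 + search_time kk jm (2 ^ jm) w1 lg d nz + net_time n q J d nz TF jd C" by blast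
  have "bd Nn Wn (real (total_time n m q kk J jm (2 ^ jm) w1 lg d nz TF lam jd C)) a p"
  by (rule tb[OF pr(6)[OF JC(1)]]) (use JC(2) pr(7)[OF JC(1)] in linarith)
  then have tt: "real (total_time n m q kk J jm (2 ^ jm) w1 lg d nz TF lam jd C) <= a * Nn * Wn ^ p" by (simp add: bd_def)
  have "clk h3 + 3 * n + 5 <= total_time n m q kk J jm (2 ^ jm) w1 lg d nz TF lam jd C"
  using JC(3) h2(1) h1(3) hb_consts(6) by (simp add: total_time_def frame_time_def prepare_time_def tTab_def)
  then have time: "real (clk h3 + 3 * n + 5) <= a * Nn * Wn ^ p" using tt by (meson of_nat_le_iff order_trans)
  obtain y where y: "y \<in> assignments n q" "csp_opt n q E \<phi> = csp_value E \<phi> y" using csp_opt_attained by blast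
  have yq: "!!i. i < n ==> y i < q" using y(1) by (auto simp: assignments_def)
  have fr: "fractional n q (label_vec q y)"
  using label_vec_sum[of y _ q "%_. 1"] yq by (auto simp: fractional_def label_vec_def)
  have cf: "ip d (label_vec q y) (mv d Mr (label_vec q y)) = 2 * real (csp_value E \<phi> y)"
  by (rule csp_value_form) (rule yq)
  from v(4)[OF fr] cf
  have "real (csp_opt n q E \<phi>) - 40 * eps * real m <= real (csp_value E \<phi> (NA h3 vBest))"
  unfolding y(2) by (simp add: algebra_simps)
  moreover have "40 * eps * real m <= c * eps * real q ^ 2 * real m"
  proof -
  have "40 * 1 <= c * real q ^ 2" using c q1 by (intro mult_mono) auto
  then have "40 * (eps * real m) <= (c * real q ^ 2) * (eps * real m)" using eps by (intro mult_right_mono) auto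
  then show ?thesis by (simp add: mult_ac)
  qed
  ultimately have "answered c (NA h3 vBest)" using v(3) by (simp add: answered_def)
  then show ?case using v(1,2) time samebnd[OF S2] by simp
  qed
  qed
 qed
qed

end

theorem theorem3p3:
 shows "\<exists>(P :: prog) (C :: real) (c :: nat).
  \<forall>(n :: nat) (q :: nat) (E :: (nat \<times> nat) set)
  (\<phi> :: nat \<Rightarrow> nat \<Rightarrow> nat \<Rightarrow> nat \<Rightarrow> bool) (es :: (nat \<times> nat) list) (\<epsilon> :: real).
  0 < \<epsilon> \<and> \<epsilon> < 1 \<and> 1 \<le> n \<and> 1 \<le> q \<and>
  simple_graph n E \<and> edge_predicates q E \<phi> \<and> edge_listing E es \<longrightarrow>
  (let m = card (edges E);
  k = rank_ge \<epsilon> (normalized_label_extended n q E \<phi>)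
  in \<exists>t s. exec P (input_state n q es \<phi> \<epsilon>) t s \<and>
  real t \<le> C * (real (n + m) * (1 + ln (real (n + m))) ^ c)
  * (1 / \<epsilon>) ^ (c * k) * real q ^ c \<and>
  output_assignment n s \<in> assignments n q \<and>
  real (csp_value E \<phi> (output_assignment n s))
  \<ge> real (csp_opt n q E \<phi>) - C * \<epsilon> * real q ^ 2 * real m)"
proof -
 obtain a p where tb: "!!N W n m q k J jm P w1 lg d nnz TF lam jd C. size_ok N W n m q k J jm P w1 lg d nnz TF lam jd ==> real C <= 1 * W ^ 10 ==>
  bd N W (real (total_time n m q k J jm P w1 lg d nnz TF lam jd C)) a p"
  using total_time_bound unfolding total_time_def by metis
 \<comment> \<open>The summand 100 covers the constants of the trivial case and the error constants
   4 and 40. The exponent has to be at least 2 because reading the tables costs of order m q^2 even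
   then.\<close>
 define C where "C = \<bar>a\<bar> + 100"
 define c where "c = p + 2"
 show ?thesis
 proof (rule exI[of _ solve], rule exI[of _ C], rule exI[of _ c], intro allI impI, elim conjE)
  fix n q E \<phi> and es :: "(nat \<times> nat) list" and \<epsilon> :: real
  assume as: "0 < \<epsilon>" "\<epsilon> < 1" "1 <= n" "1 <= q" "simple_graph n E" "edge_predicates q E \<phi>" "edge_listing E es"
  interpret cp: csp_problem n q E \<phi> es \<epsilon> by unfold_locales (fact as)+
  define k where "k = rank_ge \<epsilon> (normalized_label_extended n q E \<phi>)"
  define N where "N = real (n + cp.m)"
  define L where "L = 1 + ln N"
  define z where "z = 1 / \<epsilon>"
  have N1: "1 <= N" using as by (simp add: N_def)
  have L1: "1 <= L" using N1 by (simp add: L_def)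
  have z1: "1 <= z" using as by (simp add: z_def)
  have q1: "1 <= real q" using as by simp
  have pos: "1 <= L ^ c" "1 <= z ^ (c * k)" using L1 z1 by (auto intro: one_le_power)
  have "\<exists>t s. exec solve (input_state n q es \<phi> \<epsilon>) t s & real t <= C * (N * L ^ c) * z ^ (c * k) * real q ^ c & cp.answered C (fst s)"
  proof (cases "cp.m = 0 \<or> 1 <= 4 * \<epsilon> * (real q)\<^sup>2")
  case True
  have "4 <= C" by (simp add: C_def)
  from cp.solve_trivial[OF True this] obtain t s where ts: "exec solve (input_state n q es \<phi> \<epsilon>) t s"
  "real t <= real (frame_time n cp.m q)" "cp.answered C (fst s)" by blast
  have "real (frame_time n cp.m q) <= 100 * (N * (real q)\<^sup>2)"
  proof -
  have q2: "1 <= (real q)\<^sup>2" using q1 by (rule one_le_power)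
  have nm: "real n <= N" "real cp.m <= N" by (auto simp: N_def)
  have "real cp.m * (real q)\<^sup>2 <= N * (real q)\<^sup>2" using nm by (intro mult_right_mono) auto
  moreover have "N * 1 <= N * (real q)\<^sup>2" using q2 N1 by (intro mult_left_mono) auto
  moreover have "real (frame_time n cp.m q) = 21 + 4 * real cp.m + 2 * (real cp.m * (real q)\<^sup>2) + 7 * real n"
  by (simp add: frame_time_def power2_eq_square)
  ultimately show ?thesis using nm N1 by linarith
  qed
  also have "... <= C * ((N * L ^ c) * z ^ (c * k) * real q ^ c)"
  proof (rule mult_mono)
  have "N * 1 * 1 * (real q)\<^sup>2 <= N * L ^ c * z ^ (c * k) * real q ^ c"
  using pos N1 q1 by (intro mult_mono power_increasing) (auto simp: c_def)
  then show "N * (real q)\<^sup>2 <= (N * L ^ c) * z ^ (c * k) * real q ^ c" by simp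
  qed (use N1 in \<open>auto simp: C_def\<close>)
  finally show ?thesis using ts by (intro exI[of _ t] exI[of _ s]) (simp add: mult.assoc)
  next
  case False
  interpret cn: csp_nonempty n q E \<phi> es \<epsilon> by unfold_locales (use False in simp)
  have g: "4 * \<epsilon> * (real q)\<^sup>2 < 1" using False by simp
  have "40 <= C" by (simp add: C_def)
  from cn.solve_nontrivial[OF g this tb] obtain t s where ts: "exec solve (input_state n q es \<phi> \<epsilon>) t s"
  "real t <= a * cn.Nn * cn.Wn ^ p" "cp.answered C (fst s)" by blast
  have W: "cn.Wn ^ p = L ^ p * z ^ (p * k) * real q ^ p"
  by (simp add: cn.Wn_def cn.Nn_def cn.kk_def L_def N_def z_def k_def power_mult_distrib power_mult mult_ac flip: power_mult)
  have "a * cn.Nn * cn.Wn ^ p = a * (N * L ^ p * z ^ (p * k) * real q ^ p)" unfolding W by (simp add: cn.Nn_def N_def)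
  also have "... <= C * (N * L ^ c * z ^ (c * k) * real q ^ c)"
  proof (rule mult_mono)
  show "N * L ^ p * z ^ (p * k) * real q ^ p <= N * L ^ c * z ^ (c * k) * real q ^ c"
  using N1 L1 z1 q1 by (intro mult_mono power_increasing) (auto simp: c_def)
  qed (use N1 L1 z1 in \<open>auto simp: C_def\<close>)
  finally show ?thesis using ts by (intro exI[of _ t] exI[of _ s]) (simp add: mult.assoc)
  qed
  then obtain t s where ts: "exec solve (input_state n q es \<phi> \<epsilon>) t s" "real t <= C * (N * L ^ c) * z ^ (c * k) * real q ^ c"
  "cp.answered C (fst s)" by blast
  have x: "output_assignment n s \<in> assignments n q"
  using ts(3) by (auto simp: cp.answered_def output_assignment_def assignments_def)
  have "csp_value E \<phi> (output_assignment n s) = csp_value E \<phi> (fst s)"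
  unfolding csp_value_def output_assignment_def using cp.edge_props by (intro sum.cong refl) auto
  then show "let m = card (edges E); k = rank_ge \<epsilon> (normalized_label_extended n q E \<phi>)
  in \<exists>t s. exec solve (input_state n q es \<phi> \<epsilon>) t s &
  real t <= C * (real (n + m) * (1 + ln (real (n + m))) ^ c)
  * (1 / \<epsilon>) ^ (c * k) * real q ^ c &
  output_assignment n s \<in> assignments n q &
  real (csp_value E \<phi> (output_assignment n s))
  \<ge> real (csp_opt n q E \<phi>) - C * \<epsilon> * real q ^ 2 * real m"
  unfolding Let_def cp.m_card[symmetric] k_def[symmetric] using ts x
  by (intro exI[of _ t] exI[of _ s]) (simp add: cp.answered_def N_def L_def z_def)
 qed
qed

end
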